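(* For every constant $\varepsilon>0$ there is an algorithm for the strip packing problem (without rotations) that runs in pseudo-polynomial time, i.e. in time $(nN)^{O(1)}$ where $N=\max\{w_{\max},h_{\max}\}$ (the exponent may depend on $\varepsilon$), and always outputs a feasible packing of height at most $(\frac{4}{3}+\varepsilon)\cdot OPT$.
   Context: Strip packing: the input is an integer $W\in\mathbb{N}$ and a set $\mathcal{R}=\{R_1,\dots,R_n\}$ of rectangles, $R_i$ having integer width $w_i\le W$ and integer height $h_i$. A packing assigns to each $R_i$ a point $(x_i,y_i)\in\mathbb{N}\times\mathbb{N}$ with $0\le x_i\le W-w_i$, meaning $R_i$ occupies $[x_i,x_i+w_i]\times[y_i,y_i+h_i]$; it is feasible if the interiors of the placed rectangles are pairwise disjoint. Rectangles may not be rotated. The height of the packing is $\max_i (y_i+h_i)$, and $OPT$ denotes the minimum height of a feasible packing. $w_{\max}=\max_i w_i$, $h_{\max}=\max_i h_i$. *)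

theory Defs
  imports Complex_Main
begin

text \<open>An instance is a strip width W and a list of rectangles (w_i, h_i) with
positive integer dimensions and w_i \<le> W.  A packing assigns to rectangle i
(for i < n) its lower-left corner (x_i, y_i) in the nonnegative integer grid.\<close>

type_synonym rect = "nat \<times> nat"
type_synonym packing = "nat \<Rightarrow> nat \<times> nat"

definition valid_instance :: "nat \<Rightarrow> rect list \<Rightarrow> bool" where
  "valid_instance W rs \<longleftrightarrow> (\<forall>r\<in>set rs. 0 < fst r \<and> 0 < snd r \<and> fst r \<le> W)"

definition placed_interior :: "nat \<times> nat \<Rightarrow> rect \<Rightarrow> (real \<times> real) set" where
  "placed_interior pos r = {(a, b). real (fst pos) < a \<and> a < real (fst pos) + real (fst r)
                              \<and> real (snd pos) < b \<and> b < real (snd pos) + real (snd r)}"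

definition feasible_packing :: "nat \<Rightarrow> rect list \<Rightarrow> packing \<Rightarrow> bool" where
  "feasible_packing W rs p \<longleftrightarrow>
     (\<forall>i < length rs. fst (p i) + fst (rs ! i) \<le> W) \<and>
     (\<forall>i < length rs. \<forall>j < length rs. i \<noteq> j \<longrightarrow>
        placed_interior (p i) (rs ! i) \<inter> placed_interior (p j) (rs ! j) = {})"

definition packing_height :: "rect list \<Rightarrow> packing \<Rightarrow> nat" where
  "packing_height rs p = Max (insert 0 {snd (p i) + snd (rs ! i) | i. i < length rs})"

definition OPT :: "nat \<Rightarrow> rect list \<Rightarrow> nat" where
  "OPT W rs = (LEAST H. \<exists>p. feasible_packing W rs p \<and> packing_height rs p = H)"

definition Nmax :: "rect list \<Rightarrow> nat" where
  "Nmax rs = max (Max (insert 0 (fst ` set rs))) (Max (insert 0 (snd ` set rs)))"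

datatype instr =
    Const nat nat
  | Add nat nat nat
  | Sub nat nat nat
  | Load nat nat
  | Store nat nat
  | Jz nat nat

type_synonym config = "nat \<times> (nat \<Rightarrow> nat)"

fun exec :: "instr \<Rightarrow> config \<Rightarrow> config" where
  "exec (Const r c) (pc, m) = (Suc pc, m(r := c))"
| "exec (Add r a b) (pc, m) = (Suc pc, m(r := m a + m b))"
| "exec (Sub r a b) (pc, m) = (Suc pc, m(r := m a - m b))"
| "exec (Load r a) (pc, m) = (Suc pc, m(r := m (m a)))"
| "exec (Store a b) (pc, m) = (Suc pc, m(m a := m b))"
| "exec (Jz r l) (pc, m) = (if m r = 0 then (l, m) else (Suc pc, m))"

definition halted :: "instr list \<Rightarrow> config \<Rightarrow> bool" where
  "halted prog c \<longleftrightarrow> length prog \<le> fst c"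

definition step :: "instr list \<Rightarrow> config \<Rightarrow> config" where
  "step prog c = (if halted prog c then c else exec (prog ! fst c) c)"

definition run :: "instr list \<Rightarrow> nat \<Rightarrow> config \<Rightarrow> config" where
  "run prog t c = (step prog ^^ t) c"

definition input_mem :: "nat \<Rightarrow> rect list \<Rightarrow> nat \<Rightarrow> nat" where
  "input_mem W rs a =
     (if a = 0 then W else if a = 1 then length rs
      else if a - 2 < 2 * length rs then
        (if even (a - 2) then fst (rs ! ((a - 2) div 2)) else snd (rs ! ((a - 2) div 2)))
      else 0)"

definition decode_packing :: "(nat \<Rightarrow> nat) \<Rightarrow> packing" where
  "decode_packing m i = (m (2 + 2 * i), m (3 + 2 * i))"

end

theory Submission
  imports Defs
begin

text \<open>A packing of height \<open>H\<close> is rearranged, within height \<open>(4/3 + 15 e) H\<close>, into boundedly many boxes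
 that are filled shelf by shelf in the order of decreasing heights. The items are classified by two
 thresholds for the heights and two for the widths, chosen so that the items in between have small
 total area. The strip is divided into \<open>3 m\<^sub>3\<close> layers and what starts in the upper two thirds is shifted
 up by a third of the height. In each vertical slab between the big items the narrow items are then
 permuted column by column so that boundedly many containers suffice, the shift compensates the area
 that gets lost, and the remaining free boxes take the small items. The wide flat items are repacked
 by linear grouping. Since the boxes may be assumed to be integral, a dynamic program whose states,
 the fill levels of all boxes, are coded as numbers with a fixed number of digits finds such a packing.\<close>

text \<open>A tall item, one higher than a third, contains one of two fixed layers, so at most two
  tall items share a column. The shift leaves the lower one free to stand on the bottom of an
  obstacle-free zone and the upper one free to hang from its top. The gaps in between are few and
  have total width at most that of the strip. Shelves of items of at most a third waste at most a
  third of the height in these gaps, which is what the shift has gained; the terms in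
  \<open>e\<close> pay for all other losses. The delicate choice is the width threshold
  \<open>nv\<close>. Slicing loses items of width up to \<open>nv\<close> in every box, and the
  number of boxes grows with the number of big items, which itself depends on \<open>nv\<close>.
  Along a sequence of thresholds that at least halves, \<open>nv\<close> times the number of big
  items has a bounded sum, so one of boundedly many thresholds works. Only the number of boxes, a
  function of \<open>e\<close>, enters the program; the thresholds occur in the existence proof
  alone. The strip width need not be polynomial and is cut down to \<open>n * Nmax\<close>.\<close>

notation (input) iff (infixr "<->" 25)

type_synonym box = "real * real * real * real"

fun bint :: "box => (real * real) set" where "bint (x, y, d, g) = {x<..<x+d} \<times> {y<..<y+g}"

fun dims :: "box => real * real" where "dims (x, y, d, g) = (d, g)"

declare bint.simps [simp del]

abbreviation bdj :: "box list => bool" where "bdj == sorted_wrt (%b c. bint b Int bint c = {})"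

abbreviation ar :: "(real * real) list => real" where "ar Fs == SUM dg<-Fs. fst dg * snd dg"

abbreviation wdt :: "(real * real) list => real" where "wdt Fs == SUM dg<-Fs. fst dg"

abbreviation pdj :: "'a set list => bool" where "pdj == sorted_wrt (%S T. S Int T = {})"

abbreviation nnb :: "box => bool" where "nnb b == 0 <= fst (dims b) & 0 <= snd (dims b)"

section \<open>Shelves, boxes and layouts with free boxes\<close>

locale items =
 fixes ord :: "nat list" and w h :: "nat => nat"
 assumes ord_distinct: "distinct ord" and ord_sorted: "sorted_wrt (%i j. h j <= h i) ord" and w_pos: "i : set ord ==> 0 < w i"
 and h_pos: "i : set ord ==> 0 < h i"
begin

abbreviation "rw i == real (w i)"
abbreviation "rh i == real (h i)"

abbreviation hts :: "nat set => real" where "hts A == SUM i:A. real (h i)"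

abbreviation wds :: "nat set => real" where "wds A == SUM i:A. real (w i)"

definition sl :: "nat set => nat list" where "sl A = filter (%i. i : A) ord"

definition area :: "nat set => real" where "area A = (SUM i:A. rw i * rh i)"

text \<open>A chunk is a shelf. As \<open>ord\<close> is sorted by decreasing heights, the head of a
  chunk is its highest item, so the heights of the heads are the shelf heights.\<close>

definition chunked :: "nat list list => real => real => bool" where "chunked cs D G <-> (ALL c:set cs. c ~= [] & (SUM i<-c. rw i) <= D) &
 (SUM c<-cs. rh (hd c)) <= G"

text \<open>The items have to fill the shelves in the global order \<open>ord\<close>. This is what
  later allows one pass over \<open>ord\<close> to fill all boxes simultaneously.\<close>

definition shelfable :: "nat set => real => real => bool" where "shelfable A D G <-> A <= set ord & (EX cs. concat cs = sl A & chunked cs D G)"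

abbreviation shelfb :: "nat set => box => bool" where "shelfb A b == shelfable A (fst (dims b)) (snd (dims b))"

lemma set_sl: "A <= set ord ==> set (sl A) = A" by (auto simp: sl_def)

lemma distinct_sl: "distinct (sl A)" by (simp add: sl_def ord_distinct)

lemma sorted_sl: "sorted_wrt (%i j. h j <= h i) (sl A)" unfolding sl_def using ord_sorted by (rule sorted_wrt_filter)

lemma sum_list_sl: "A <= set ord ==> (SUM i<-sl A. f i) = sum f A" by (metis distinct_sl set_sl sum_list_distinct_conv_sum_set)

lemma sl_prefix:
 assumes "sl A = ys @ zs" shows "sl (set ys) = ys" "sl (set zs) = zs" "set ys Int set zs = {}"
proof -
 have d: "distinct (ys @ zs)" using assms distinct_sl by metis
 thus "set ys Int set zs = {}" by simp
 have sub: "set ys <= A" "set zs <= A" using arg_cong[OF assms, of set] by (auto simp: sl_def)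
 have "sl (set ys) = filter (%i. i : set ys) (sl A)" unfolding sl_def filter_filter using sub by (intro filter_cong) auto
 also have "... = ys" unfolding assms using d by (auto simp: filter_empty_conv intro!: filter_True)
 finally show "sl (set ys) = ys" .
 have "sl (set zs) = filter (%i. i : set zs) (sl A)" unfolding sl_def filter_filter using sub by (intro filter_cong) auto
 also have "... = zs" unfolding assms using d by (auto simp: filter_empty_conv intro!: filter_True)
 finally show "sl (set zs) = zs" .
qed

lemma shelfable_row:
 assumes "A <= set ord" "wds A <= D" "!!i. i : A ==> rh i <= G" "0 <= G" shows "shelfable A D G"
proof (cases "A = {}")
 case True
 thus ?thesis using assms by (auto simp: shelfable_def chunked_def sl_def intro!: exI[of _ "[]"])
next
 case False
 hence "sl A ~= []" using set_sl[OF assms(1)] by auto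
 hence "hd (sl A) : A" using set_sl[OF assms(1)] hd_in_set by blast
 with `sl A ~= []` show ?thesis using assms by (auto simp: shelfable_def chunked_def sum_list_sl intro!: exI[of _ "[sl A]"])
qed

lemma shelfable_stack:
 assumes "A <= set ord" "hts A <= G" "!!i. i : A ==> rw i <= D" shows "shelfable A D G"
proof -
 have "concat (map (%i. [i]) (sl A)) = sl A" by simp
 moreover have "chunked (map (%i. [i]) (sl A)) D G" using assms set_sl[OF assms(1)] by (auto simp: chunked_def o_def sum_list_sl)
 ultimately show ?thesis using assms(1) unfolding shelfable_def by blast
qed

lemma shelfable_empty: "0 <= G ==> shelfable {} D G" by (auto simp: shelfable_def chunked_def sl_def intro!: exI[of _ "[]"])

lemma longest_prefix:
 assumes "xs ~= []" "rw (hd xs) <= D" shows "EX c zs. xs = c @ zs & c ~= [] & (SUM i<-c. rw i) <= D &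
 (zs = [] | D < (SUM i<-c. rw i) + rw (hd zs))" using assms
proof (induct xs arbitrary: D)
 case (Cons x xs)
 show ?case
 proof (cases "xs = [] | D < rw x + rw (hd xs)")
 case True
 thus ?thesis using Cons by (intro exI[of _ "[x]"] exI[of _ xs]) auto
 next
 case False
 hence "xs ~= []" "rw (hd xs) <= D - rw x" by auto
 from Cons.hyps[OF this] obtain c zs where "xs = c @ zs" "c ~= []" "(SUM i<-c. rw i) <= D - rw x"
 "zs = [] | D - rw x < (SUM i<-c. rw i) + rw (hd zs)" by blast
 thus ?thesis by (intro exI[of _ "x # c"] exI[of _ zs]) auto
 qed
qed simp

text \<open>Next-fit decreasing height: a shelf is as wide as \<open>D - u\<close>, and its items are at least as
 high as the next shelf, so that only the first shelf height is lost.\<close>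

lemma nfdh_list:
 assumes "sorted_wrt (%i j. h j <= h i) xs" "!!i. i : set xs ==> rw i <= u" "u <= D" "0 <= G" shows "EX cs zs. xs = concat cs @ zs & chunked cs D G &
 (zs = [] | (D - u) * (G - rh (hd xs)) <= (SUM i<-concat cs. rw i * rh i))" using assms
proof (induct "length xs" arbitrary: xs G rule: less_induct)
 case less
 show ?case
 proof (cases "xs = [] | G < rh (hd xs)")
 case True
 thus ?thesis using less.prems by (intro exI[of _ "[]"] exI[of _ xs]) (auto simp: chunked_def mult_nonneg_nonpos)
 next
 case False
 hence ne: "xs ~= []" and hG: "rh (hd xs) <= G" by auto
 have "rw (hd xs) <= D" using less.prems ne by (meson hd_in_set order_trans)
 from longest_prefix[OF ne this] obtain c zs where c: "xs = c @ zs" "c ~= []"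
 "(SUM i<-c. rw i) <= D" "zs = [] | D < (SUM i<-c. rw i) + rw (hd zs)" by blast
 have hdc: "hd xs = hd c" using c by simp
 show ?thesis
 proof (cases "zs = []")
 case True
 thus ?thesis using c hG hdc by (intro exI[of _ "[c]"] exI[of _ "[]"]) (auto simp: chunked_def)
 next
 case False
 have "length zs < length xs" using c by simp
 moreover have "sorted_wrt (%i j. h j <= h i) zs" using less.prems(1) c by (simp add: sorted_wrt_append)
 moreover have "!!i. i : set zs ==> rw i <= u" using less.prems(2) c by simp
 ultimately obtain cs vs where v: "zs = concat cs @ vs" "chunked cs D (G - rh (hd xs))"
 "vs = [] | (D - u) * (G - rh (hd xs) - rh (hd zs)) <= (SUM i<-concat cs. rw i * rh i)"
 using less.hyps[of zs "G - rh (hd xs)"] less.prems(3) hG by auto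
 have "rw (hd zs) <= u" using less.prems(2) c False by simp
 hence cw: "D - u <= (SUM i<-c. rw i)" using c(4) False by simp
 have hz: "!!i. i : set c ==> h (hd zs) <= h i" using less.prems(1) c False by (simp add: sorted_wrt_append)
 have "(D - u) * rh (hd zs) <= (SUM i<-c. rw i) * rh (hd zs)" using cw by (intro mult_right_mono) auto
 also have "... = (SUM i<-c. rw i * rh (hd zs))" by (simp add: sum_list_mult_const)
 also have "... <= (SUM i<-c. rw i * rh i)" using hz by (intro sum_list_mono mult_left_mono) auto
 finally have ca: "(D - u) * rh (hd zs) <= (SUM i<-c. rw i * rh i)" .
 have "vs = [] | (D - u) * (G - rh (hd xs)) <= (SUM i<-concat (c # cs). rw i * rh i)" using v(3) ca by (auto simp: algebra_simps)
 moreover have "chunked (c # cs) D G" using v(2) c hdc by (auto simp: chunked_def)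
 ultimately show ?thesis using c(1) v(1) by (intro exI[of _ "c # cs"] exI[of _ vs]) auto
 qed
 qed
qed

text \<open>The area that next-fit is sure to use in a box if items of width at most
  \<open>u\<close> and height at most \<open>v\<close> are left over: each shelf misses at most the
  width \<open>u\<close>, and one height \<open>v\<close> is lost.\<close>

definition cap :: "real => real => real * real => real" where "cap u v dg = max 0 (fst dg - u) * max 0 (snd dg - v)"

lemma cap_le:
 assumes "0 <= a" "(D - u) * (G - v') <= a" "v' <= v" "u <= D" shows "cap u v (D, G) <= a"
proof (cases "v <= G")
 case True
 have "(D - u) * (G - v) <= (D - u) * (G - v')" using assms by (intro mult_left_mono) auto
 thus ?thesis using True assms by (simp add: cap_def)
qed (use assms in "simp add: cap_def")

lemma nfdh:
 assumes "A <= set ord" "!!i. i : A ==> rw i <= u" "!!i. i : A ==> rh i <= v" "0 <= G"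
 shows "EX B C. A = B Un C & B Int C = {} & shelfable B D G & (C = {} | cap u v (D, G) <= area B)"
\<comment> \<open>If \<open>D < u\<close>, the guaranteed area is 0 and the box may stay
  empty.\<close>
proof (cases "u <= D & A ~= {}")
 case False
 thus ?thesis using assms(4) by (intro exI[of _ "{}"] exI[of _ A]) (auto simp: shelfable_empty cap_def area_def)
next
 case True
 have "EX cs zs. sl A = concat cs @ zs & chunked cs D G &
 (zs = [] | (D - u) * (G - rh (hd (sl A))) <= (SUM i<-concat cs. rw i * rh i))"
 using assms sorted_sl True set_sl[OF assms(1)] by (intro nfdh_list) auto
 then obtain cs zs where
 z: "sl A = concat cs @ zs" "chunked cs D G" "zs = [] | (D - u) * (G - rh (hd (sl A))) <= (SUM i<-concat cs. rw i * rh i)" by blast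
 let ?B = "set (concat cs)" and ?C = "set zs"
 have A: "A = ?B Un ?C" using z(1) set_sl[OF assms(1)] by (metis set_append)
 have s: "sl ?B = concat cs" "?B Int ?C = {}" using sl_prefix[OF z(1)] by auto
 have Bo: "?B <= set ord" using A assms(1) by auto
 have "shelfable ?B D G" unfolding shelfable_def using s(1) z(2) Bo by auto
 moreover have "?C = {} | cap u v (D, G) <= area ?B"
 proof (cases "zs = []")
 case False
 have ar: "(SUM i<-concat cs. rw i * rh i) = area ?B" unfolding area_def by (metis sum_list_sl[OF Bo] s(1))
 have "0 <= area ?B" unfolding area_def by (intro sum_nonneg) simp
 moreover have "sl A ~= []" using True set_sl[OF assms(1)] by fastforce
 hence "hd (sl A) : A" using set_sl[OF assms(1)] hd_in_set by blast
 hence "rh (hd (sl A)) <= v" using assms by auto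
 moreover have "(D - u) * (G - rh (hd (sl A))) <= area ?B" using z(3) False ar by metis
 ultimately show ?thesis using cap_le True by blast
 qed simp
 ultimately show ?thesis using A s(2) by (intro exI[of _ ?B] exI[of _ ?C] conjI) assumption+
qed

text \<open>Of the free boxes only the dimensions are visible in \<open>F\<close>; all later
  fillings need no more, and the positions stay under the existential quantifier. The boxes are
  open, so common borders are harmless.\<close>

definition lay :: "nat => nat set => (real * real) list => (real * real) set => bool" where
 "lay k A F R <-> (EX (cs :: (box * nat set) list) fb. length cs + length fb <= k &
 bdj (map fst cs @ fb) &
 (ALL b:set (map fst cs @ fb). bint b <= R & nnb b) &
 A = \<Union>(snd ` set cs) & pdj (map snd cs) &
 (ALL (b, S):set cs. shelfb S b) & F = map dims fb)"

text \<open>Equality of all sums instead of an equation between lists, since a union over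
  \<open>J\<close> comes without an order.\<close>

abbreviation joins :: "(real * real) list => 'a set => ('a => (real * real) list) => bool" where
 "joins Fs J F == (ALL f :: _ => real. sum_list (map f Fs) = (SUM j:J. sum_list (map f (F j)))) & set Fs = (UN j:J. set (F j))"

lemma layE [consumes 1, case_names L]:
 assumes "lay k A F R"
 obtains cs fb where "length cs + length fb <= k" "bdj (map fst cs @ fb)"
 "ALL b:set (map fst cs @ fb). bint b <= R & nnb b" "A = \<Union>(snd ` set cs)" "pdj (map snd cs)" "ALL (b, S):set cs. shelfb S b" "F = map dims fb"
 using assms unfolding lay_def by (elim exE conjE) (rule that; assumption)

lemma lay_mono:
 assumes "lay k A F R" "k <= k'" "R <= R'" shows "lay k' A F R'" using assms(1)
proof (cases rule: layE)
 case (L cs fb)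
 thus ?thesis unfolding lay_def using assms(2,3) by (intro exI[of _ cs] exI[of _ fb]) auto
qed

lemma lay_empty: "lay 0 {} [] R" unfolding lay_def by (intro exI[of _ "[]"]) auto

lemma lay_items:
 assumes "shelfable A d g" "0 <= d" "0 <= g" "bint (x, y, d, g) <= R" shows "lay 1 A [] R" unfolding lay_def using assms
 by (intro exI[of _ "[((x,y,d,g),A)]"] exI[of _ "[]"]) auto

lemma lay_free:
 assumes "0 <= d" "0 <= g" "bint (x, y, d, g) <= R" shows "lay 1 {} [(d, g)] R" unfolding lay_def using assms
 by (intro exI[of _ "[]"] exI[of _ "[(x,y,d,g)]"]) auto

lemma lay_dims: "lay k A F R ==> dg : set F ==> 0 <= fst dg & 0 <= snd dg" unfolding lay_def by (elim exE conjE) auto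

lemma lay_len: "lay k A F R ==> length F <= k" unfolding lay_def by auto

lemma lay_Un:
 assumes "lay k A F R" "lay k' A' F' R'" "A Int A' = {}" "R Int R' = {}" shows "lay (k + k') (A Un A') (F @ F') (R Un R')" using assms(1)
proof (cases rule: layE)
 case 1: (L cs fb)
 show ?thesis using assms(2)
 proof (cases rule: layE)
 case 2: (L cs' fb')
 have x: "bint b Int bint c = {}" "bint c Int bint b = {}"
 if "b : set (map fst cs @ fb)" "c : set (map fst cs' @ fb')" for b c using 1(3) 2(3) assms(4) that by blast+
 have y: "S Int S' = {}" if "S : set (map snd cs)" "S' : set (map snd cs')" for S S' using that 1(4) 2(4) assms(3) by auto
 have "bdj (map fst (cs @ cs') @ fb @ fb')" using 1(2) 2(2) x unfolding map_append sorted_wrt_append set_append by blast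
 moreover have "pdj (map snd (cs @ cs'))" using 1(5) 2(5) y by (auto simp: sorted_wrt_append)
 moreover have "ALL b:set (map fst (cs @ cs') @ fb @ fb'). bint b <= R Un R' & nnb b" using 1(3) 2(3) by auto
 ultimately show ?thesis unfolding lay_def using 1 2 by (intro exI[of _ "cs @ cs'"] exI[of _ "fb @ fb'"]) auto
 qed
qed

lemma lay_UN:
 assumes "finite J" "!!j. j : J ==> lay (k j) (A j) (F j) (R j)" "!!i j. i : J ==> j : J ==> i ~= j ==> A i Int A j = {} & R i Int R j = {}"
 shows "EX Fs. lay (sum k J) (UN j:J. A j) Fs (UN j:J. R j) &
 joins Fs J F" using assms
proof (induct J rule: finite_induct)
 case empty
 thus ?case using lay_empty by (intro exI[of _ "[]"]) auto
next
 case (insert j J)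
 have "EX Fs. lay (sum k J) (UN j:J. A j) Fs (UN j:J. R j) &
 joins Fs J F" using insert.prems by (intro insert.hyps) auto
 then obtain Fs where Fs: "lay (sum k J) (UN j:J. A j) Fs (UN j:J. R j)"
 "ALL f :: _ => real. sum_list (map f Fs) = (SUM j:J. sum_list (map f (F j)))" "set Fs = (UN j:J. set (F j))" by blast
 have "A j Int A i = {} & R j Int R i = {}" if "i : J" for i using insert.prems(2)[of j i] insert.hyps(2) that by auto
 hence "A j Int (UN j:J. A j) = {}" "R j Int (UN j:J. R j) = {}" by auto
 from lay_Un[OF insert.prems(1)[of j] Fs(1) this] show ?case using insert.hyps Fs(2,3) by (intro exI[of _ "F j @ Fs"]) auto
qed

lemma lay_fill1:
 assumes "lay k A ((d, g) # F) R" "shelfable B d g" "A Int B = {}" shows "lay k (A Un B) F R" using assms(1)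
proof (cases rule: layE)
 case 1: (L cs fb)
 then obtain b fb' where b: "fb = b # fb'" "dims b = (d, g)" "F = map dims fb'" by auto
 have "S Int B = {}" if "S : set (map snd cs)" for S using that 1(4) assms(3) by auto
 hence "pdj (map snd (cs @ [(b, B)]))" using 1(5) by (auto simp: sorted_wrt_append)
 thus ?thesis unfolding lay_def using 1 b assms(2) by (intro exI[of _ "cs @ [(b, B)]"] exI[of _ fb']) (auto simp: sorted_wrt_append)
qed

lemma area_Un: "B Un C <= set ord ==> B Int C = {} ==> area (B Un C) = area B + area C"
 unfolding area_def by (rule sum.union_disjoint) (auto intro: finite_subset)

lemma area_pos: "A <= set ord ==> A ~= {} ==> 0 < area A"
 unfolding area_def using w_pos h_pos by (intro sum_pos) (auto intro: finite_subset simp: subset_iff)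

text \<open>The boxes are filled one after the other. Whenever items are left over, the box has
  taken at least the area \<open>cap\<close>, so the area inequality passes on to the remaining
  items and boxes.\<close>

lemma lay_fill:
 assumes "lay k A (F @ F') R" "B <= set ord" "A Int B = {}" "!!i. i : B ==> rw i <= u" "!!i. i : B ==> rh i <= v" "area B <= (SUM dg<-F. cap u v dg)"
 shows "lay k (A Un B) F' R" using assms
proof (induct F arbitrary: A B)
 case Nil
 hence "B = {}" using area_pos[of B] by (cases "B = {}") auto
 thus ?case using Nil by simp
next
 case (Cons dg F)
 obtain d g where dg: "dg = (d, g)" by force
 have "0 <= g" using lay_dims[OF Cons.prems(1)] dg by force
 from nfdh[OF Cons.prems(2,4,5) this] obtain B1 C where BC: "B = B1 Un C" "B1 Int C = {}"
 "shelfable B1 d g" "C = {} | cap u v (d, g) <= area B1" by metis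
 have "A Int B1 = {}" using Cons.prems(3) BC by auto
 with Cons.prems(1) have L: "lay k (A Un B1) (F @ F') R" using lay_fill1 BC(3) dg by simp
 have "area C <= (SUM dg<-F. cap u v dg)"
 proof (cases "C = {}")
 case True
 have "0 <= (SUM dg<-F. cap u v dg)" by (intro sum_list_nonneg) (auto simp: cap_def)
 thus ?thesis using True by (simp add: area_def)
 next
 case False
 thus ?thesis using BC(4) Cons.prems(6) area_Un[of B1 C] BC(1,2) Cons.prems(2) dg by simp
 qed
 hence "lay k ((A Un B1) Un C) F' R" using L Cons.prems BC by (intro Cons.hyps) auto
 thus ?case using BC(1) by (simp add: Un_assoc)
qed

text \<open>The free box is cut horizontally: its lower part of height \<open>e\<close> becomes a
  box of items, its upper part keeps the place in the list. Most of the proof restores pairwise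
  disjointness.\<close>

lemma lay_split1:
 assumes "lay k A (F @ (d, g) # F') R" "0 <= e" "e <= g" "shelfable B d e" "A Int B = {}" shows "lay (k + 1) (A Un B) (F @ (d, g - e) # F') R"
 using assms(1)
proof (cases rule: layE)
 case 1: (L cs fb)
 then obtain f1 b f2 where b: "fb = f1 @ b # f2" "F = map dims f1" "dims b = (d, g)" "F' = map dims f2"
 by (auto simp: append_eq_map_conv Cons_eq_map_conv)
 obtain x y where xy: "b = (x, y, d, g)" using b(3) by (cases b) auto
 obtain b1 b2 where bb: "bint b1 <= bint b" "bint b2 <= bint b" "bint b1 Int bint b2 = {}" "dims b1 = (d, e)" "dims b2 = (d, g - e)"
 proof
 show "bint (x, y, d, e) <= bint b" "bint (x, y + e, d, g - e) <= bint b" using assms(2,3) xy by (auto simp: bint.simps)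
 show "bint (x, y, d, e) Int bint (x, y + e, d, g - e) = {}" by (auto simp: bint.simps)
 qed simp_all
 have dis: "bdj (map fst cs)" "bdj f1" "bdj f2" "!!c c'. c : set (map fst cs) ==> c' : set f1 Un {b} Un set f2 ==> bint c Int bint c' = {}"
 "!!c. c : set f1 ==> bint c Int bint b = {}" "!!c. c : set f2 ==> bint b Int bint c = {}"
 "!!c c'. c : set f1 ==> c' : set f2 ==> bint c Int bint c' = {}"
 proof -
 have D: "bdj (map fst cs)" "bdj (f1 @ b # f2)" "ALL c:set (map fst cs). ALL c':set (f1 @ b # f2). bint c Int bint c' = {}"
 using 1(2) unfolding b(1) sorted_wrt_append by blast+
 have E: "bdj f1" "bdj (b # f2)" "ALL c:set f1. ALL c':set (b # f2). bint c Int bint c' = {}" using D(2) unfolding sorted_wrt_append by blast+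
 show "bdj (map fst cs)" "bdj f1" "bdj f2" using D(1) E(1,2) by simp_all
 show "bint c Int bint c' = {}" if "c : set (map fst cs)" "c' : set f1 Un {b} Un set f2" for c c' using D(3) that by fastforce
 show "bint c Int bint b = {}" if "c : set f1" for c using E(3) that by simp
 show "bint b Int bint c = {}" if "c : set f2" for c using E(2) that by simp
 show "bint c Int bint c' = {}" if "c : set f1" "c' : set f2" for c c' using E(3) that by simp
 qed
 have "bdj (map fst (cs @ [(b1, B)]) @ f1 @ b2 # f2)"
 proof -
 have "bint c Int bint b1 = {}" "bint c Int bint b2 = {}" if "c : set (map fst cs)" for c using bb(1,2) dis(4)[OF that, of b] by blast+
 moreover have "bint c Int bint b2 = {}" "bint b1 Int bint c = {}" if "c : set f1" for c using bb(1,2) dis(5)[OF that] by blast+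
 moreover have "bint b1 Int bint c = {}" "bint b2 Int bint c = {}" if "c : set f2" for c using bb(1,2) dis(6)[OF that] by blast+
 moreover have "ALL c:set (map fst cs). ALL c':set f1 Un set f2. bint c Int bint c' = {}" using dis(4) by simp
 moreover have "ALL c:set f1. ALL c':set f2. bint c Int bint c' = {}" using dis(7) by simp
 ultimately show ?thesis using bb(3) dis(1,2,3) by (simp add: sorted_wrt_append ball_Un)
 qed
 moreover have "ALL c:set (map fst (cs @ [(b1, B)]) @ f1 @ b2 # f2). bint c <= R & nnb c"
 proof -
 have "bint b <= R" "0 <= d" using 1(3) b(3) unfolding b(1) by auto
 moreover have "bint c <= R & nnb c" if "c : set (map fst cs) Un set f1 Un set f2" for c using 1(3) that unfolding b(1) by simp
 ultimately show ?thesis using bb assms(2,3) by (simp add: ball_Un) (metis order_trans)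
 qed
 moreover have "!!S. S : set (map snd cs) ==> S Int B = {}" using 1(4) assms(5) by auto
 hence "pdj (map snd (cs @ [(b1, B)]))" using 1(5) by (simp add: sorted_wrt_append)
 moreover have "length (cs @ [(b1, B)]) + length (f1 @ b2 # f2) <= k + 1" using 1(1) unfolding b(1) by simp
 moreover have "A Un B = \<Union>(snd ` set (cs @ [(b1, B)]))" using 1(4) by auto
 moreover have "ALL (b, S):set (cs @ [(b1, B)]). shelfb S b" using 1(6) assms(4) bb(4) by simp
 moreover have "F @ (d, g - e) # F' = map dims (f1 @ b2 # f2)" using b bb(5) by simp
 ultimately show ?thesis unfolding lay_def by (intro exI[of _ "cs @ [(b1, B)]"] exI[of _ "f1 @ b2 # f2"] conjI)
qed

text \<open>Variant of \<open>lay_fill\<close> that uses only the height \<open>e dg\<close> of a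
  free box and keeps the rest free, at the price of one more box each.\<close>

lemma lay_fill_split:
 assumes "lay k A (P @ F) R" "B <= set ord" "A Int B = {}" "!!i. i : B ==> rw i <= u" "!!i. i : B ==> rh i <= v"
 "!!dg. dg : set F ==> 0 <= e dg & e dg <= snd dg" "area B <= (SUM dg<-F. cap u v (fst dg, e dg))"
 shows "lay (k + length F) (A Un B) (P @ map (%dg. (fst dg, snd dg - e dg)) F) R" using assms
proof (induct F arbitrary: A B P k)
 case Nil
 hence "B = {}" using area_pos[of B] by (cases "B = {}") auto
 thus ?case using Nil by simp
next
 case (Cons dg F)
 obtain d g where dg: "dg = (d, g)" by force
 have e: "0 <= e dg" "e dg <= g" using Cons.prems(6)[of dg] dg by auto
 from nfdh[OF Cons.prems(2,4,5) e(1)] obtain B1 C where BC: "B = B1 Un C" "B1 Int C = {}"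
 "shelfable B1 d (e dg)" "C = {} | cap u v (d, e dg) <= area B1" by metis
 have "A Int B1 = {}" using Cons.prems(3) BC by auto
 with Cons.prems(1) have L: "lay (k + 1) (A Un B1) ((P @ [(d, g - e dg)]) @ F) R" using lay_split1[of k A P d g F R "e dg" B1] BC(3) dg e by simp
 have "area C <= (SUM dg<-F. cap u v (fst dg, e dg))"
 proof (cases "C = {}")
 case True
 have "0 <= (SUM dg<-F. cap u v (fst dg, e dg))" by (intro sum_list_nonneg) (auto simp: cap_def)
 thus ?thesis using True by (simp add: area_def)
 next
 case False
 thus ?thesis using BC(4) Cons.prems(7) area_Un[of B1 C] BC(1,2) Cons.prems(2) dg by simp
 qed
 hence "lay ((k + 1) + length F) ((A Un B1) Un C) ((P @ [(d, g - e dg)]) @ map (%dg. (fst dg, snd dg - e dg)) F) R"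
 using L Cons.prems BC by (intro Cons.hyps) auto
 thus ?case using BC(1) dg by (simp add: Un_assoc)
qed

end

section \<open>Intervals, bins and groups\<close>

text \<open>The intervals of lengths \<open>f k\<close> are laid side by side. Columns, rows or
  slots of the same kind are made adjacent in this way.\<close>

lemma bucket:
 fixes f :: "'k => nat"
 assumes "finite K" shows "EX st. (ALL k:K. st k + f k <= sum f K) &
 (ALL k:K. ALL k':K. k ~= k' --> st k + f k <= st k' | st k' + f k' <= st k)" using assms
proof (induct K rule: finite_induct)
 case (insert k K)
 then obtain st where st: "ALL k:K. st k + f k <= sum f K" "ALL k:K. ALL k':K. k ~= k' --> st k + f k <= st k' | st k' + f k' <= st k" by blast
 show ?case using st insert.hyps by (intro exI[of _ "st(k := sum f K)"]) auto
qed simp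

lemma max_subset:
 fixes l :: "'a => real"
 assumes "finite A" "!!i. i : A ==> 0 <= l i & l i <= u" "0 <= c" shows "EX S<=A. sum l S <= c & (S = A | c - u <= sum l S)" using assms
proof (induct A rule: finite_induct)
 case (insert a A)
 then obtain S where S: "S <= A" "sum l S <= c" "S = A | c - u <= sum l S" by auto
 show ?case
 proof (cases "S = A & sum l A + l a <= c")
 case True
 thus ?thesis using insert.hyps by (intro exI[of _ "insert a A"]) auto
 next
 case False
 hence "c - u <= sum l S" using S insert.prems(1)[of a] by auto
 thus ?thesis using S by (intro exI[of _ S]) auto
 qed
qed simp

text \<open>A bin either takes everything that is left or is filled up to a rest of at most
  \<open>u\<close>. Hence the leftovers exceed the true excess by at most \<open>u\<close> per
  bin.\<close>

lemma bins:
 fixes l :: "'a => real" and c :: "'b => real"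
 assumes "finite Bn" "finite A" "!!i. i : A ==> 0 <= l i & l i <= u" "!!b. b : Bn ==> 0 <= c b" "0 <= u"
 shows "EX S L. A = (UN b:Bn. S b) Un L & (ALL b:Bn. sum l (S b) <= c b & S b Int L = {}) &
 (ALL b:Bn. ALL b':Bn. b ~= b' --> S b Int S b' = {}) &
 sum l L <= max 0 (sum l A - sum c Bn) + real (card Bn) * u" using assms(1,2,3,4)
proof (induct Bn arbitrary: A rule: finite_induct)
 case empty
 hence "0 <= sum l A" by (intro sum_nonneg) auto
 thus ?case using empty by (intro exI[of _ "%_. {}"] exI[of _ A]) auto
next
 case (insert b Bn)
 from max_subset[OF insert.prems(1), of l u "c b"] insert.prems obtain S0 where
 S0: "S0 <= A" "sum l S0 <= c b" "S0 = A | c b - u <= sum l S0" by auto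
 have fin: "finite (A - S0)" using insert.prems by auto
 have "EX S L. A - S0 = (UN b:Bn. S b) Un L & (ALL b:Bn. sum l (S b) <= c b & S b Int L = {}) &
 (ALL b:Bn. ALL b':Bn. b ~= b' --> S b Int S b' = {}) &
 sum l L <= max 0 (sum l (A - S0) - sum c Bn) + real (card Bn) * u" using insert.prems fin by (intro insert.hyps(3)) auto
 then obtain S L where S: "A - S0 = (UN b:Bn. S b) Un L" "ALL b:Bn. sum l (S b) <= c b & S b Int L = {}"
 "ALL b:Bn. ALL b':Bn. b ~= b' --> S b Int S b' = {}" "sum l L <= max 0 (sum l (A - S0) - sum c Bn) + real (card Bn) * u" by blast
 have d: "sum l (A - S0) = sum l A - sum l S0" using S0 insert.prems by (simp add: sum_diff)
 have cB: "0 <= sum c Bn" using insert.prems by (intro sum_nonneg) auto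
 have "max 0 (sum l (A - S0) - sum c Bn) <= max 0 (sum l A - sum c (insert b Bn)) + u"
 proof (cases "S0 = A")
 case True
 thus ?thesis using cB assms(5) d by simp
 next
 case False
 thus ?thesis using S0(3) d assms(5) insert.hyps(1,2) by (auto simp: max_def)
 qed
 hence "sum l L <= max 0 (sum l A - sum c (insert b Bn)) + real (card (insert b Bn)) * u"
 proof -
 have "real (card (insert b Bn)) * u = real (card Bn) * u + u" using insert.hyps(1,2) by (simp add: algebra_simps)
 thus ?thesis using S(4) `max 0 _ <= _` by linarith
 qed
 moreover have "A = (UN b':insert b Bn. (S(b := S0)) b') Un L" using S(1) S0(1) insert.hyps(2) by auto
 moreover have "S b' Int S0 = {}" if "b' : Bn" for b' using S(1) that by blast
 moreover have "L Int S0 = {}" using S(1) by blast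
 moreover have "ALL b':insert b Bn. sum l ((S(b := S0)) b') <= c b' & (S(b := S0)) b' Int L = {}"
 using S(2) S0(2) insert.hyps(2) calculation(4) by (simp add: Int_commute)
 moreover have "ALL b1:insert b Bn. ALL b2:insert b Bn. b1 ~= b2 --> (S(b := S0)) b1 Int (S(b := S0)) b2 = {}"
 using S(3) insert.hyps(2) calculation(3) by (simp add: Int_commute)
 ultimately show ?case by (intro exI[of _ "S(b := S0)"] exI[of _ L] conjI) assumption+
qed

text \<open>The elementary intervals between neighbouring points of \<open>Q\<close>.\<close>

definition cuts :: "nat set => (nat * nat) set" where "cuts Q = {(x, y). x : Q & y : Q & x < y & (ALL z:Q. ~ (x < z & z < y))}"

lemma cuts_subset: "cuts Q <= Q \<times> Q" by (auto simp: cuts_def)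

lemma finite_cuts: "finite Q ==> finite (cuts Q)" using cuts_subset finite_subset by blast

lemma cuts_cover:
 assumes "finite Q" "p : Q" "q : Q" "p <= c" "c < q" shows "EX (x, y):cuts Q. x <= c & c < y"
proof -
 let ?x = "Max {z:Q. z <= c}" and ?y = "Min {z:Q. c < z}"
 have x: "?x : {z:Q. z <= c}" using assms by (intro Max_in) auto
 have y: "?y : {z:Q. c < z}" using assms by (intro Min_in) auto
 have "~ (?x < z & z < ?y)" if "z : Q" for z
 proof (cases "z <= c")
 case True
 hence "z <= ?x" using that assms(1) by (intro Max_ge) auto
 thus ?thesis by simp
 next
 case False
 hence "?y <= z" using that assms(1) by (intro Min_le) auto
 thus ?thesis by simp
 qed
 hence "(?x, ?y) : cuts Q" using x y by (auto simp: cuts_def)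
 thus ?thesis using x y by blast
qed

lemma cuts_disjoint:
 assumes "(x, y) : cuts Q" "(x', y') : cuts Q" "(x, y) ~= (x', y')" shows "y <= x' | y' <= x"
proof (rule ccontr)
 assume a: "~ ?thesis"
 hence "x = x'" using assms(1,2) unfolding cuts_def by (auto simp: not_le) (metis linorder_neqE_nat)
 moreover hence "y = y'" using assms(1,2) unfolding cuts_def by auto (metis linorder_neqE_nat)
 ultimately show False using assms(3) by simp
qed

lemma card_cuts: "finite Q ==> card (cuts Q) <= card Q"
proof -
 assume f: "finite Q"
 have "inj_on fst (cuts Q)"
 proof (rule inj_onI, rule ccontr)
 fix a b assume a: "a : cuts Q" "b : cuts Q" "fst a = fst b" "a ~= b"
 have "fst a < snd a" "fst b < snd b" using a by (auto simp: cuts_def)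
 thus False using cuts_disjoint[of "fst a" "snd a" Q "fst b" "snd b"] a by (cases a; cases b) auto
 qed
 moreover have "fst ` cuts Q <= Q" by (auto simp: cuts_def)
 ultimately show ?thesis using f card_inj_on_le by blast
qed

lemma cuts_side:
 assumes "(x, y) : cuts Q" "z : Q" shows "z <= x | y <= z" using assms by (auto simp: cuts_def)

lemma sum_cuts:
 assumes "finite Q" "Q <= {p..q}" "p : Q" "q : Q" shows "(SUM c=p..<q. f c) = (SUM (x, y):cuts Q. SUM c=x..<y. f c)"
proof -
 have "{p..<q} = (UN xy:cuts Q. {fst xy..<snd xy})"
 proof (intro equalityI subsetI)
 fix c assume "c : {p..<q}"
 thus "c : (UN xy:cuts Q. {fst xy..<snd xy})" using cuts_cover[OF assms(1,3,4), of c] by force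
 next
 fix c assume "c : (UN xy:cuts Q. {fst xy..<snd xy})"
 thus "c : {p..<q}" using assms(2) cuts_subset[of Q] by fastforce
 qed
 moreover have "ALL i:cuts Q. ALL j:cuts Q. i ~= j --> {fst i..<snd i} Int {fst j..<snd j} = {}" using cuts_disjoint by fastforce
 ultimately show ?thesis using finite_cuts[OF assms(1)] by (simp add: sum.UNION_disjoint case_prod_unfold)
qed

lemma pigeonhole_avg:
 fixes f :: "nat => real"
 assumes "0 < J" "sum f {..<J} <= A" shows "EX j<J. f j <= A / real J"
proof (rule ccontr)
 assume "~ ?thesis"
 hence "(SUM j<J. A / real J) < sum f {..<J}" using assms(1) by (intro sum_strict_mono) auto
 thus False using assms by simp
qed

text \<open>The narrowest item is removed as long as the height stays at least \<open>th\<close>;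
  the first removal that fails shows that the overshoot is at most \<open>eh\<close>.\<close>

lemma top_subset:
 fixes h :: "'a => real" and w :: "'a => nat"
 assumes "finite A" "!!i. i : A ==> h i <= eh" "th <= sum h A"
 shows "EX A1<=A. (ALL i:A1. ALL j:A - A1. w j <= w i) & th <= sum h A1 & (A1 = {} | sum h A1 <= th + eh)" using assms
proof (induct "card A" arbitrary: A rule: less_induct)
 case less
 show ?case
 proof (cases "A = {}")
 case True
 thus ?thesis using less.prems by auto
 next
 case False
 obtain a where a: "a : A" "ALL i:A. w a <= w i" using False less.prems(1) by (metis arg_min_if_finite(1) arg_min_least)
 show ?thesis
 proof (cases "th <= sum h (A - {a})")
 case True
 have "card (A - {a}) < card A" using a less.prems(1) by (meson card_Diff1_less)
 then obtain A1 where "A1 <= A - {a}" "ALL i:A1. ALL j:(A - {a}) - A1. w j <= w i" "th <= sum h A1" "A1 = {} | sum h A1 <= th + eh"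
 using less.hyps[of "A - {a}"] less.prems True by auto
 thus ?thesis using a by (intro exI[of _ A1]) blast
 next
 case False
 hence "sum h A <= th + eh" using a less.prems by (simp add: sum_diff1) (smt (verit) less.prems(2) a(1))
 thus ?thesis using less.prems by (intro exI[of _ A]) auto
 qed
 qed
qed

text \<open>Linear grouping: the widest items of total height about \<open>th\<close> are split off
  repeatedly. All groups but the last reach \<open>th\<close> and none exceeds
  \<open>th + eh\<close>, whence the third claim, by which a group almost fits into the places of
  the next wider one.\<close>

lemma grouping:
 fixes h :: "'a => real" and w :: "'a => nat"
 assumes "finite A" "!!i. i : A ==> 0 <= h i & h i <= eh" "0 < th" "0 <= eh" shows "EX kp. (ALL i:A. ALL j:A. kp i < kp j --> w j <= w i) &
 (ALL k. sum h {i:A. kp i = k} <= th + eh) &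
 (ALL k. sum h {i:A. kp i = Suc k} <= sum h {i:A. kp i = k} + eh) &
 (ALL i:A. real (kp i) * th <= sum h A)" using assms(1,2)
proof (induct "card A" arbitrary: A rule: less_induct)
 case less
 show ?case
 proof (cases "sum h A < th")
 case True
 have "0 <= sum h A" using less.prems by (intro sum_nonneg) auto
 moreover have "sum h {i:A. (0::nat) = k} <= th + eh" "0 <= sum h {i:A. (0::nat) = k} + eh" for k
 using True assms(3,4) calculation by (cases "k = 0"; simp)+
 ultimately show ?thesis using assms(3,4) by (intro exI[of _ "%_. 0"]) auto
 next
 case False
 then obtain A1 where A1: "A1 <= A" "ALL i:A1. ALL j:A - A1. w j <= w i" "th <= sum h A1" "A1 = {} | sum h A1 <= th + eh"
 using top_subset[OF less.prems(1), of h eh th w] less.prems(2) by (meson not_less)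
 have ne: "A1 ~= {}" using A1(3) assms(3) by auto
 have "card (A - A1) < card A" using A1(1) ne less.prems(1) by (intro psubset_card_mono) auto
 hence "EX kp. (ALL i:A - A1. ALL j:A - A1. kp i < kp j --> w j <= w i) &
 (ALL k. sum h {i:A - A1. kp i = k} <= th + eh) &
 (ALL k. sum h {i:A - A1. kp i = Suc k} <= sum h {i:A - A1. kp i = k} + eh) &
 (ALL i:A - A1. real (kp i) * th <= sum h (A - A1))" using less.prems by (intro less.hyps) auto
 then obtain kp where k: "ALL i:A - A1. ALL j:A - A1. kp i < kp j --> w j <= w i" "ALL k. sum h {i:A - A1. kp i = k} <= th + eh"
 "ALL k. sum h {i:A - A1. kp i = Suc k} <= sum h {i:A - A1. kp i = k} + eh" "ALL i:A - A1. real (kp i) * th <= sum h (A - A1)" by blast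
 let ?k = "%i. if i : A1 then 0 else Suc (kp i)"
 have e0: "{i:A. ?k i = 0} = A1" using A1(1) by auto
 have eS: "{i:A. ?k i = Suc k} = {i:A - A1. kp i = k}" for k by auto
 have d: "sum h (A - A1) = sum h A - sum h A1" using A1(1) less.prems(1) by (simp add: sum_diff)
 have "ALL k. sum h {i:A. ?k i = k} <= th + eh"
 proof
 fix k0 show "sum h {i:A. ?k i = k0} <= th + eh"
 proof (cases k0)
 case 0
 thus ?thesis using e0 A1(4) ne by simp
 next
 case (Suc n)
 show ?thesis unfolding Suc eS using k(2) by blast
 qed
 qed
 moreover have "ALL k. sum h {i:A. ?k i = Suc k} <= sum h {i:A. ?k i = k} + eh"
 proof
 fix k0
 show "sum h {i:A. ?k i = Suc k0} <= sum h {i:A. ?k i = k0} + eh"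
 proof (cases k0)
 case 0
 have "sum h {i:A - A1. kp i = 0} <= th + eh" using k(2) by blast
 thus ?thesis unfolding eS 0 e0 using A1(3) by linarith
 next
 case (Suc n)
 show ?thesis unfolding Suc eS using k(3) by blast
 qed
 qed
 moreover have "ALL i:A. real (?k i) * th <= sum h A"
 proof
 fix i assume i: "i : A"
 have "0 <= sum h A" using less.prems by (intro sum_nonneg) auto
 thus "real (?k i) * th <= sum h A" using k(4)[rule_format, of i] i d A1(3) by (auto simp: algebra_simps)
 qed
 moreover have "ALL i:A. ALL j:A. ?k i < ?k j --> w j <= w i" using k(1) A1(2) by auto
 ultimately show ?thesis by (intro exI[of _ ?k] conjI)
 qed
qed

lemma card_fibers: "finite Z ==> (SUM t:f ` Z. card {x:Z. f x = t}) = card Z" using sum.image_gen[of Z "%_. 1::nat" f] by simp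

lemma bint_djx: "x + d <= x' | x' + d' <= x ==> bint (x, y, d, g) Int bint (x', y', d', g') = {}" by (auto simp: bint.simps)

lemma bint_djy: "y + g <= y' | y' + g' <= y ==> bint (x, y, d, g) Int bint (x', y', d', g') = {}" by (auto simp: bint.simps)

context items
begin

lemma lay_boxes:
 assumes "finite J" "!!j. j : J ==> shelfb (S j) (bx j) & nnb (bx j)"
 "!!i j. i : J ==> j : J ==> i ~= j ==> S i Int S j = {} & bint (bx i) Int bint (bx j) = {}"
 shows "lay (card J) (UN j:J. S j) [] (UN j:J. bint (bx j))"
proof -
 have "lay 1 (S j) [] (bint (bx j))" if "j : J" for j using assms(2)[OF that] by (cases "bx j") (auto simp del: One_nat_def intro!: lay_items)
 from lay_UN[OF assms(1) this assms(3)] show ?thesis by force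
qed

abbreviation lists_dims :: "(real * real) list => 'a set => ('a => box) => bool" where
 "lists_dims Fs J b == (ALL f :: _ => real. sum_list (map f Fs) = (SUM j:J. f (dims (b j)))) & set Fs = (%j. dims (b j)) ` J"

lemma lay_frees:
 assumes "finite J" "!!j. j : J ==> nnb (bx j)" "!!i j. i : J ==> j : J ==> i ~= j ==> bint (bx i) Int bint (bx j) = {}"
 shows "EX Fs. lay (card J) {} Fs (UN j:J. bint (bx j)) &
 lists_dims Fs J bx"
proof -
 have "lay 1 {} [dims (bx j)] (bint (bx j))" if "j : J" for j using assms(2)[OF that] by (cases "bx j") (auto simp del: One_nat_def intro!: lay_free)
 from lay_UN[OF assms(1) this, of "%j. j"] assms(3) show ?thesis by force
qed

section \<open>Sorting the columns of a slab\<close>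

text \<open>The summands count the boxes of tall items, of sliced items and of free cells. There are
  at most \<open>(m+1)^2\<close> layer ranges and \<open>2^((m+1)^2)\<close> sets of them.\<close>

definition part_count :: "nat => nat" where "part_count m = (m+1)^2 + 2^((m+1)^2) * 2^((m+1)^2) * (m+1)^2 + 2^((m+1)^2) * 2^((m+1)^2) * m"

text \<open>Permuting the columns of a vertical slab so that columns with the same layer pattern become
 adjacent. The single row \<open>T\<close> of tall items is kept exactly; items of \<open>V\<close> are sliced and refilled,
 losing one item per bin.\<close>

lemma part:
 fixes X a b :: "nat => nat" and g off u :: real
 assumes g: "0 < g" and u: "0 <= u" and Lay: "Lay <= {..<m}" and zz: "z0 <= z1" and TV: "T <= set ord" "V <= set ord" "T Int V = {}"
 and it: "!!i. i : T Un V ==> z0 <= X i & X i + w i <= z1 & a i < b i & {a i..<b i} <= Lay & rh i <= real (b i - a i) * g"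
 and wu: "!!i. i : V ==> rw i <= u" and dj: "!!i j. i : T Un V ==> j : T Un V ==> i ~= j ==>
 X i + w i <= X j | X j + w j <= X i | b i <= a j | b j <= a i"
 and djT: "!!i j. i : T ==> j : T ==> i ~= j ==> X i + w i <= X j | X j + w j <= X i"
 defines "Fc == {(x, k). z0 <= x & x < z1 & k : Lay & (ALL i:T Un V. ~ (X i <= x & x < X i + w i & a i <= k & k < b i))}"
 shows "EX L Fs. L <= V & wds L <= real (part_count m) * u &
 lay (part_count m) (T Un V - L) Fs
 (UN (a', b'):{(a', b'). a' < b' & {a'..<b'} <= Lay}. {real z0<..<real z1} \<times> {real a' * g + off<..<real b' * g + off}) &
 ar Fs = g * real (card Fc) & wdt Fs = real (card Fc) & (ALL dg:set Fs. snd dg <= g)"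
proof -
 let ?q = "(m+1)^2"
 define Z where "Z = {z0..<z1}"
 \<comment> \<open>The class of an item is its range of layers. A column is described by the classes
   of the tall items and of the other items that it meets.\<close>
 define cl where "cl i = (a i, b i)" for i
 define ta where "ta x = cl ` {i:T. X i <= x & x < X i + w i}" for x
 define P where "P x = cl ` {i:V. X i <= x & x < X i + w i}" for x
 define f1 where "f1 t = card {x:Z. ta x = t}" for t
 define f2 where "f2 t p = card {x:Z. ta x = t & P x = p}" for t p
 define K1 where "K1 = ta ` Z"
 define K2 where "K2 t = P ` {x:Z. ta x = t}" for t
 let ?Z = "%tp. {x:Z. ta x = fst tp & P x = snd tp}" and ?f = "%tp. f2 (fst tp) (snd tp)"
 have finZ: "finite Z" by (simp add: Z_def)
 have finTV: "finite T" "finite V" using TV by (auto intro: finite_subset)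
 have s1: "sum f1 K1 = z1 - z0" unfolding f1_def K1_def using card_fibers[OF finZ, of ta] by (simp add: Z_def)
 have s2: "sum (f2 t) (K2 t) = f1 t" for t using card_fibers[of "{x:Z. ta x = t}" P] finZ unfolding f2_def K2_def f1_def by (simp add: conj_assoc)
 have finK: "finite K1" "finite (K2 t)" for t using finZ by (auto simp: K1_def K2_def)
 \<comment> \<open>Columns are sorted by the tall pattern and only within it by the other pattern.
   In this order all columns of one tall class form one undivided block.\<close>
 obtain st1 where st1: "ALL k:K1. st1 k + f1 k <= z1 - z0" "ALL k:K1. ALL k':K1. k ~= k' --> st1 k + f1 k <= st1 k' | st1 k' + f1 k' <= st1 k"
 using bucket[OF finK(1), of f1] s1 by auto
 have "ALL t. EX st. (ALL k:K2 t. st k + f2 t k <= f1 t) &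
 (ALL k:K2 t. ALL k':K2 t. k ~= k' --> st k + f2 t k <= st k' | st k' + f2 t k' <= st k)"
 proof
 fix t
 show "EX st. (ALL k:K2 t. st k + f2 t k <= f1 t) &
 (ALL k:K2 t. ALL k':K2 t. k ~= k' --> st k + f2 t k <= st k' | st k' + f2 t k' <= st k)"
 using bucket[OF finK(2)[of t], of "f2 t"] unfolding s2[of t] by simp
 qed
 then obtain st2 where st2: "!!t k. k : K2 t ==> st2 t k + f2 t k <= f1 t"
 "!!t k k'. k : K2 t ==> k' : K2 t ==> k ~= k' ==> st2 t k + f2 t k <= st2 t k' | st2 t k' + f2 t k' <= st2 t k" by metis
 define s where "s t p = z0 + st1 t + st2 t p" for t p
 let ?s = "%tp. s (fst tp) (snd tp)"
 have in1: "z0 + st1 t + f1 t <= z1" if "t : K1" for t using st1(1) that zz by auto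
 have in2: "z0 + st1 t <= s t p" "s t p + f2 t p <= z0 + st1 t + f1 t" if "p : K2 t" for t p using st2(1)[OF that] by (auto simp: s_def)
 have sep1: "z0 + st1 t + f1 t <= z0 + st1 t' | z0 + st1 t' + f1 t' <= z0 + st1 t"
 if "t : K1" "t' : K1" "t ~= t'" for t t' using st1(2) that by fastforce
 have sep2: "s t p + f2 t p <= s t' p' | s t' p' + f2 t' p' <= s t p"
 if "t : K1" "t' : K1" "p : K2 t" "p' : K2 t'" "(t, p) ~= (t', p')" for t t' p p'
 proof (cases "t = t'")
 case True
 thus ?thesis using st2(2)[of p t p'] that by (auto simp: s_def)
 next
 case False
 thus ?thesis using sep1[OF that(1,2)] in2[OF that(3)] in2[OF that(4)] by linarith
 qed
 have wit: "EX x:Z. ta x = t & P x = p" if "p : K2 t" for t p using that by (auto simp: K2_def)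
 have cldj: "snd c <= fst c' | snd c' <= fst c" if "t : K1" "p : K2 t" "c : t Un p" "c' : t Un p" "c ~= c'" for t p c c'
 proof -
 obtain x where x: "x : Z" "ta x = t" "P x = p" using wit[OF `p : K2 t`] by blast
 have "EX i:T Un V. X i <= x & x < X i + w i & cl i = c" "EX i:T Un V. X i <= x & x < X i + w i & cl i = c'"
 using that(3,4) x by (auto simp: ta_def P_def)
 then obtain i j where ij: "i : T Un V" "X i <= x" "x < X i + w i" "cl i = c" "j : T Un V" "X j <= x" "x < X j + w j" "cl j = c'" by blast
 hence "i ~= j" using that(5) by auto
 from dj[OF ij(1,5) this] show ?thesis using ij by (auto simp: cl_def)
 qed
 have clT: "fst c < snd c & {fst c..<snd c} <= Lay & snd c <= m" if "c : cl ` (T Un V)" for c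
 proof -
 obtain i where i: "i : T Un V" "c = cl i" using \<open>c : cl ` (T Un V)\<close> by blast
 have "b i - 1 : {a i..<b i}" using it[OF i(1)] by auto
 hence "b i - 1 < m" using it[OF i(1)] Lay by blast
 thus ?thesis using it[OF i(1)] i(2) by (auto simp: cl_def)
 qed
 have Ksub: "t <= cl ` T" "p <= cl ` V" if "t : K1" "p : K2 t" for t p using that by (auto simp: K1_def K2_def ta_def P_def)
 define U where "U = {..m} \<times> {..m}"
 have cU: "c : U" if "c : cl ` (T Un V)" for c using clT[OF that] by (auto simp: U_def mem_Times_iff)
 have cardU: "card U = ?q" "finite U" by (auto simp: U_def power2_eq_square)
 have K1U: "K1 <= Pow U" and K2U: "t : K1 ==> K2 t <= Pow U" for t using cU by (auto simp: K1_def K2_def ta_def P_def)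
 define KK where "KK = (SIGMA t:K1. K2 t)"
 have finKK: "finite KK" using finK by (auto simp: KK_def)
 have "KK <= Pow U \<times> Pow U" using K1U K2U by (auto simp: KK_def)
 hence "card KK <= card (Pow U \<times> Pow U)" using cardU by (intro card_mono) auto
 hence cardKK: "card KK <= 2^?q * 2^?q" using cardU by (simp add: card_Pow card_cartesian_product)
 \<comment> \<open>Boxes of tall items: the block of the class \<open>c\<close> is wide enough for
   all its items, so nothing of \<open>T\<close> is lost.\<close>
 define JA where "JA = cl ` T"
 define bA where "bA c = (real (z0 + st1 {c}), real (fst c) * g + off, real (f1 {c}), real (snd c - fst c) * g)" for c
 define SA where "SA c = {i:T. cl i = c}" for c
 have tauT: "ta x = {cl i}" if "i : T" "X i <= x" "x < X i + w i" for i x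
 proof -
 have "{j:T. X j <= x & x < X j + w j} = {i}"
 proof (intro equalityI subsetI)
 fix j assume j: "j : {j:T. X j <= x & x < X j + w j}"
 show "j : {i}" using djT[of i j] j that by (cases "i = j") auto
 qed (use that in auto)
 thus ?thesis by (simp add: ta_def)
 qed
 have Zi: "x : Z" if "i : T Un V" "X i <= x" "x < X i + w i" for i x using it[OF that(1)] that(2,3) unfolding Z_def by simp
 have K1T: "{cl i} : K1" if "i : T" for i
 proof -
 have "0 < w i" using w_pos TV that by auto
 hence "X i : Z" "ta (X i) = {cl i}" using Zi[of i "X i"] tauT[of i "X i"] that by auto
 thus ?thesis unfolding K1_def by (metis image_eqI)
 qed
 have wA: "(SUM i:SA c. w i) <= f1 {c}" for c
 proof -
 have "(SUM i:SA c. w i) = card (UN i:SA c. {X i..<X i + w i})" using finTV djT unfolding SA_def by (subst card_UN_disjoint) (auto, fastforce)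
 also have "... <= f1 {c}" unfolding f1_def
 proof (rule card_mono)
 show "(UN i:SA c. {X i..<X i + w i}) <= {x:Z. ta x = {c}}" using tauT Zi by (fastforce simp: SA_def)
 qed (use finZ in auto)
 finally show ?thesis .
 qed
 have hcl: "rh i <= real (snd (cl i) - fst (cl i)) * g" if "i : T Un V" for i using it[OF that] unfolding cl_def fst_conv snd_conv by blast
 have LA: "lay (card JA) (UN c:JA. SA c) [] (UN c:JA. bint (bA c))"
 proof (rule lay_boxes)
 show "finite JA" using finTV by (simp add: JA_def)
 fix c assume c: "c : JA"
 have "wds (SA c) <= real (f1 {c})" using wA[of c] by (metis of_nat_mono of_nat_sum)
 moreover have "!!i. i : SA c ==> rh i <= real (snd c - fst c) * g" using hcl by (auto simp: SA_def)
 ultimately show "shelfb (SA c) (bA c) & nnb (bA c)" using TV g by (auto simp: bA_def SA_def intro!: shelfable_row)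
 next
 fix c c' assume c: "c : JA" "c' : JA" "c ~= c'"
 hence "z0 + st1 {c} + f1 {c} <= z0 + st1 {c'} | z0 + st1 {c'} + f1 {c'} <= z0 + st1 {c}" using K1T by (intro sep1) (auto simp: JA_def)
 hence "bint (bA c) Int bint (bA c') = {}" unfolding bA_def by (intro bint_djx) linarith
 thus "SA c Int SA c' = {} & bint (bA c) Int bint (bA c') = {}" using c by (auto simp: SA_def)
 qed
 \<comment> \<open>Boxes of sliced items: one for each block of columns and each class occurring in
   its pattern.\<close>
 define JB where "JB = {(tp, c). tp : KK & c : snd tp}"
 define bB where "bB j = (real (?s (fst j)), real (fst (snd j)) * g + off,
 real (?f (fst j)), real (snd (snd j) - fst (snd j)) * g)" for j :: "((nat * nat) set * (nat * nat) set) * nat * nat"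
 have JBsub: "JB <= KK \<times> (cl ` V)"
 proof
 fix j assume "j : JB"
 hence "fst (fst j) : K1" "snd (fst j) : K2 (fst (fst j))" "snd j : snd (fst j)" "fst j : KK" by (auto simp: JB_def KK_def)
 thus "j : KK \<times> (cl ` V)" using Ksub(2)[of "fst (fst j)" "snd (fst j)"] by (auto simp: mem_Times_iff)
 qed
 have finJB: "finite JB" using JBsub finKK finTV by (meson finite_SigmaI finite_imageI finite_subset)
 have clV: "cl ` V <= U" using cU by auto
 have cardclV: "card (cl ` V) <= ?q" using clV cardU by (metis card_mono)
 have "card JB <= card (KK \<times> (cl ` V))" using JBsub finKK finTV by (intro card_mono) auto
 also have "... = card KK * card (cl ` V)" by (simp add: card_cartesian_product)
 finally have cardJB: "card JB <= 2^?q * 2^?q * ?q" using cardKK cardclV by (meson mult_le_mono order_trans)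
 let ?J = "%c. {j:JB. snd j = c}"
 define Q where "Q c S L <-> {i:V. cl i = c} = (UN j:?J c. S j) Un L &
 (ALL j:?J c. (wds (S j)) <= fst (dims (bB j)) & S j Int L = {}) &
 (ALL j:?J c. ALL j':?J c. j ~= j' --> S j Int S j' = {}) &
 (wds L) <= real (card (?J c)) * u" for c S L
 have "EX S L. Q c S L" for c
 proof -
 let ?A = "{i:V. cl i = c}" and ?B = "?J c"
 \<comment> \<open>Items of one class are disjoint horizontally, so their total width is at most the
   number of columns meeting the class, which is the total width of its boxes. Hence
   \<open>bins\<close> loses only one item width per box.\<close>
 have "(SUM i:?A. w i) = card (UN i:?A. {X i..<X i + w i})"
 proof (subst card_UN_disjoint)
 show "ALL i:?A. ALL j:?A. i ~= j --> {X i..<X i + w i} Int {X j..<X j + w j} = {}"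
 proof (intro ballI impI)
 fix i j assume ij: "i : ?A" "j : ?A" "i ~= j"
 hence "a i = a j" "b i = b j" "a i < b i" using it[of i] by (auto simp: cl_def)
 hence "X i + w i <= X j | X j + w j <= X i" using dj[of i j] ij by auto
 thus "{X i..<X i + w i} Int {X j..<X j + w j} = {}" by auto
 qed
 qed (use finTV in auto)
 also have "... <= card {x:Z. c : P x}"
 proof (rule card_mono)
 show "(UN i:?A. {X i..<X i + w i}) <= {x:Z. c : P x}" using Zi by (fastforce simp: P_def)
 qed (use finZ in auto)
 also have "{x:Z. c : P x} = (UN j:?B. ?Z (fst j))"
 proof (intro equalityI subsetI)
 fix x assume "x : {x:Z. c : P x}"
 hence "((ta x, P x), c) : ?B" "x : Z" by (auto simp: JB_def KK_def K1_def K2_def)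
 thus "x : (UN j:?B. ?Z (fst j))" by (intro UN_I[of "((ta x, P x), c)"]) auto
 qed (auto simp: JB_def)
 also have "card ... = (SUM j:?B. ?f (fst j))" unfolding f2_def using finJB finZ by (subst card_UN_disjoint) (auto simp: prod_eq_iff)
 finally have "real (SUM i:?A. w i) <= real (SUM j:?B. ?f (fst j))" by (rule of_nat_mono)
 hence le: "wds ?A <= (SUM j:?B. fst (dims (bB j)))" by (simp add: bB_def)
 have "EX S L. ?A = (UN b:?B. S b) Un L & (ALL b:?B. (wds (S b)) <= fst (dims (bB b)) & S b Int L = {}) &
 (ALL b:?B. ALL b':?B. b ~= b' --> S b Int S b' = {}) &
 (wds L) <= max 0 (wds ?A - (SUM b:?B. fst (dims (bB b)))) + real (card ?B) * u" using finJB finTV wu u by (intro bins) (auto simp: bB_def)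
 thus "EX S L. Q c S L" unfolding Q_def using le by (simp add: max_absorb1)
 qed
 then obtain S' L' where SLQ: "!!c. Q c (S' c) (L' c)" by metis
 have SL: "{i:V. cl i = c} = (UN j:?J c. S' c j) Un L' c" "j : JB ==> snd j = c ==> wds (S' c j) <= fst (dims (bB j)) & S' c j Int L' c = {}"
 "j : JB ==> snd j = c ==> j' : JB ==> snd j' = c ==> j ~= j' ==> S' c j Int S' c j' = {}" "wds (L' c) <= real (card (?J c)) * u" for c j j'
 proof -
 note q = SLQ[of c, unfolded Q_def]
 show "{i:V. cl i = c} = (UN j:?J c. S' c j) Un L' c" using q by (elim conjE)
 show "wds (L' c) <= real (card (?J c)) * u" using q by (elim conjE)
 have q2: "ALL j:?J c. (wds (S' c j)) <= fst (dims (bB j)) & S' c j Int L' c = {}" using q by (elim conjE)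
 have q3: "ALL j:?J c. ALL j':?J c. j ~= j' --> S' c j Int S' c j' = {}" using q by (elim conjE)
 show "j : JB ==> snd j = c ==> wds (S' c j) <= fst (dims (bB j)) & S' c j Int L' c = {}" by (rule q2[rule_format]) simp
 show "j : JB ==> snd j = c ==> j' : JB ==> snd j' = c ==> j ~= j' ==> S' c j Int S' c j' = {}" by (rule q3[rule_format]) simp_all
 qed
 define SB where "SB j = S' (snd j) j" for j
 define L where "L = (UN c:cl ` V. L' c)"
 have L'V: "L' c <= {i:V. cl i = c}" for c using SL(1)[of c] by blast
 have SBV: "SB j <= {i:V. cl i = snd j}" if "j : JB" for j using SL(1)[of "snd j"] that unfolding SB_def by blast
 have LV: "L <= V" unfolding L_def using L'V by (intro UN_least) blast
 have VL: "(UN j:JB. SB j) = V - L"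
 proof (intro equalityI subsetI)
 fix i assume "i : (UN j:JB. SB j)"
 then obtain j where j: "j : JB" "i : SB j" by blast
 have "i ~: L' (snd j)" using SL(2)[OF j(1) refl] j(2) by (auto simp: SB_def)
 moreover have "i ~: L' c" if "c ~= snd j" for c using L'V[of c] SBV[OF j(1)] j(2) that by blast
 ultimately have "i ~: L" unfolding L_def by (metis UN_E)
 thus "i : V - L" using SBV[OF j(1)] j(2) by blast
 next
 fix i assume i: "i : V - L"
 hence "i ~: L' (cl i)" by (auto simp: L_def)
 moreover have "i : {i':V. cl i' = cl i}" using i by simp
 ultimately obtain j where "j : JB" "snd j = cl i" "i : S' (cl i) j" using SL(1)[of "cl i"] by blast
 thus "i : (UN j:JB. SB j)" by (metis SB_def UN_I)
 qed
 have Lw: "wds L <= real (part_count m) * u"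
 proof -
 have "wds L = (SUM c:cl ` V. SUM i:L' c. rw i)" unfolding L_def
 proof (rule sum.UNION_disjoint)
 show "finite (cl ` V)" using finTV by simp
 show "ALL i:cl ` V. finite (L' i)" using finTV(2) L'V by (metis (no_types, lifting) finite_subset mem_Collect_eq subsetI subset_trans)
 show "ALL i:cl ` V. ALL j:cl ` V. i ~= j --> L' i Int L' j = {}"
 proof (intro ballI impI)
 fix c c' :: "nat * nat" assume "c ~= c'"
 thus "L' c Int L' c' = {}" using L'V[of c] L'V[of c'] by blast
 qed
 qed
 also have "... <= (SUM c:cl ` V. real (card (?J c)) * u)" by (intro sum_mono SL(4))
 also have "... = real (SUM c:cl ` V. card (?J c)) * u" by (simp add: sum_distrib_right)
 also have "(SUM c:cl ` V. card (?J c)) = card (UN c:cl ` V. ?J c)" using finTV finJB by (subst card_UN_disjoint) auto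
 also have "real ... * u <= real (part_count m) * u"
 proof -
 have "card (UN c:cl ` V. ?J c) <= card JB" using finJB by (intro card_mono) auto
 also have "... <= part_count m" using cardJB unfolding part_count_def by linarith
 finally show ?thesis using u by (intro mult_right_mono) auto
 qed
 finally show ?thesis .
 qed
 have clB: "snd j : cl ` (T Un V)" if "j : JB" for j using JBsub that by auto
 have LB: "lay (card JB) (UN j:JB. SB j) [] (UN j:JB. bint (bB j))"
 proof (rule lay_boxes)
 fix j assume j: "j : JB"
 have "wds (SB j) <= fst (dims (bB j))" using SL(2)[OF j refl] by (simp add: SB_def)
 moreover have "!!i. i : SB j ==> rh i <= real (snd (snd j) - fst (snd j)) * g" using hcl SBV[OF j] by fastforce
 ultimately show "shelfb (SB j) (bB j) & nnb (bB j)" using TV SBV[OF j] g by (auto simp: bB_def intro!: shelfable_row)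
 next
 fix j j' assume j: "j : JB" "j' : JB" "j ~= j'"
 have "bint (bB j) Int bint (bB j') = {}"
 proof (cases "fst j = fst j'")
 case True
 hence "snd j ~= snd j'" using j by (auto simp: prod_eq_iff)
 hence "snd (snd j) <= fst (snd j') | snd (snd j') <= fst (snd j)"
 using cldj[of "fst (fst j)" "snd (fst j)" "snd j" "snd j'"] j True by (auto simp: JB_def KK_def)
 moreover have "fst (snd j) < snd (snd j)" "fst (snd j') < snd (snd j')" using clT clB j by auto
 ultimately show ?thesis unfolding bB_def using g by (intro bint_djy) (auto simp: of_nat_diff algebra_simps mult_right_mono)
 next
 case False
 hence "?s (fst j) + ?f (fst j) <= ?s (fst j') |
 ?s (fst j') + ?f (fst j') <= ?s (fst j)" using j by (intro sep2) (auto simp: JB_def KK_def prod_eq_iff)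
 thus ?thesis unfolding bB_def by (intro bint_djx) linarith
 qed
 moreover have "SB j Int SB j' = {}"
 proof (cases "snd j = snd j'")
 case True
 thus ?thesis using SL(3)[OF j(1) refl j(2)] j(3) by (auto simp: SB_def)
 next
 case False
 have "x ~: SB j'" if x: "x : SB j" for x using subsetD[OF SBV[OF j(1)] x] subsetD[OF SBV[OF j(2)], of x] False by auto
 thus ?thesis by (simp add: disjoint_iff)
 qed
 ultimately show "SB j Int SB j' = {} & bint (bB j) Int bint (bB j') = {}" by simp
 qed (rule finJB)
 \<comment> \<open>Free boxes: one layer high, over a block of columns whose pattern leaves the
   layer uncovered. Together they have as many cells as \<open>Fc\<close>.\<close>
 define JC where "JC = {(tp, k). tp : KK & k : Lay & (ALL c:fst tp Un snd tp. ~ (fst c <= k & k < snd c))}"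
 define bC where "bC j = (real (?s (fst j)), real (snd j) * g + off,
 real (?f (fst j)), g)" for j :: "((nat * nat) set * (nat * nat) set) * nat"
 have JCsub: "JC <= KK \<times> {..<m}" using Lay by (auto simp: JC_def)
 have finJC: "finite JC" using JCsub finKK by (meson finite_SigmaI finite_lessThan finite_subset)
 have "card JC <= card (KK \<times> {..<m})" using JCsub finKK by (intro card_mono) auto
 also have "... = card KK * m" by (simp add: card_cartesian_product)
 finally have cardJC: "card JC <= 2^?q * 2^?q * m" using cardKK by (meson mult_le_mono order_trans order_refl)
 have "EX Fs. lay (card JC) {} Fs (UN j:JC. bint (bC j)) &
 lists_dims Fs JC bC"
 proof (rule lay_frees[OF finJC])
 fix j j' assume j: "j : JC" "j' : JC" "j ~= j'"
 show "bint (bC j) Int bint (bC j') = {}"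
 proof (cases "fst j = fst j'")
 case True
 hence "snd j + 1 <= snd j' | snd j' + 1 <= snd j" using j by (cases j; cases j') auto
 hence "real (snd j + 1) * g <= real (snd j') * g | real (snd j' + 1) * g <= real (snd j) * g" using g by (auto simp: mult_right_mono)
 thus ?thesis unfolding bC_def by (intro bint_djy) (auto simp: algebra_simps)
 next
 case False
 hence "?s (fst j) + ?f (fst j) <= ?s (fst j') |
 ?s (fst j') + ?f (fst j') <= ?s (fst j)" using j by (intro sep2) (auto simp: JC_def KK_def prod_eq_iff)
 thus ?thesis unfolding bC_def by (intro bint_djx) linarith
 qed
 qed (use g in "auto simp: bC_def")
 then obtain Fs where Fs: "lay (card JC) {} Fs (UN j:JC. bint (bC j))"
 "!!f :: _ => real. sum_list (map f Fs) = (SUM j:JC. f (dims (bC j)))" "set Fs = (%j. dims (bC j)) ` JC" by blast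
 have Fcard: "card Fc = (SUM j:JC. ?f (fst j))"
 proof -
 have cov: "(ALL i:T Un V. ~ (X i <= x & x < X i + w i & a i <= k & k < b i)) <->
 (ALL c:ta x Un P x. ~ (fst c <= k & k < snd c))" for x k by (auto simp: ta_def P_def cl_def ball_Un)
 have "Fc = (UN j:JC. (%x. (x, snd j)) ` (?Z (fst j)))"
 proof (intro equalityI subsetI)
 fix y assume "y : Fc"
 then obtain x k where y: "y = (x, k)" "x : Z" "k : Lay" "ALL c:ta x Un P x. ~ (fst c <= k & k < snd c)" unfolding Fc_def Z_def using cov by auto
 hence "((ta x, P x), k) : JC" by (auto simp: JC_def KK_def K1_def K2_def)
 thus "y : (UN j:JC. (%x. (x, snd j)) ` (?Z (fst j)))" using y by force
 next
 fix y assume "y : (UN j:JC. (%x. (x, snd j)) ` (?Z (fst j)))"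
 thus "y : Fc" unfolding Fc_def using cov by (auto simp: JC_def Z_def)
 qed
 also have "card ... = (SUM j:JC. card ((%x. (x, snd j)) ` (?Z (fst j))))" using finJC finZ by (intro card_UN_disjoint) (auto simp: prod_eq_iff)
 also have "... = (SUM j:JC. ?f (fst j))" unfolding f2_def by (intro sum.cong refl card_image) (auto intro: inj_onI)
 finally show ?thesis .
 qed
 have FsA: "ar Fs = g * real (card Fc)" "wdt Fs = real (card Fc)" unfolding Fs(2) Fcard by (simp_all add: bC_def sum_distrib_left mult.commute)
 have Fsg: "ALL dg:set Fs. snd dg <= g" unfolding Fs(3) by (auto simp: bC_def)
 have AB: "bint (bA c) Int bint (bB j) = {}" if "c : JA" "j : JB" for c j
 proof (cases "fst (fst j) = {c}")
 case True
 have "c ~= snd j --> snd c <= fst (snd j) | snd (snd j) <= fst c"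
 using cldj[of "{c}" "snd (fst j)" c "snd j"] that True by (auto simp: JB_def KK_def)
 moreover have "c ~= snd j"
 proof
 assume e: "c = snd j"
 obtain x where x: "x : Z" "ta x = {c}" "P x = snd (fst j)" using wit[of "snd (fst j)" "{c}"] `j : JB` True by (auto simp: JB_def KK_def)
 have "c : ta x" "c : P x" using x e that by (auto simp: JB_def)
 then obtain i j where "i : T" "X i <= x" "x < X i + w i" "cl i = c" "j : V" "X j <= x" "x < X j + w j" "cl j = c" unfolding ta_def P_def by auto
 moreover from this have "i ~= j" using TV(3) by blast
 ultimately show False using dj[of i j] it[of i] by (auto simp: cl_def)
 qed
 moreover have "fst c < snd c" "fst (snd j) < snd (snd j)" using clT[of c] clT[OF clB[OF that(2)]] that by (auto simp: JA_def)
 ultimately show ?thesis unfolding bA_def bB_def using g by (intro bint_djy) (auto simp: of_nat_diff algebra_simps mult_right_mono)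
 next
 case False
 have m: "{c} : K1" "fst (fst j) : K1" "snd (fst j) : K2 (fst (fst j))" using that K1T by (auto simp: JA_def JB_def KK_def)
 have "z0 + st1 {c} + f1 {c} <= ?s (fst j) |
 ?s (fst j) + ?f (fst j) <= z0 + st1 {c}" using sep1[OF m(1,2) False[symmetric]] in2[OF m(3)] by linarith
 thus ?thesis unfolding bA_def bB_def by (intro bint_djx) linarith
 qed
 have ABC: "(bint (bA c)) Int bint (bC j) = {}" if "c : JA" "j : JC" for c j
 proof (cases "fst (fst j) = {c}")
 case True
 hence "~ (fst c <= snd j & snd j < snd c)" using that by (auto simp: JC_def)
 moreover have "fst c < snd c" using clT[of c] that by (auto simp: JA_def)
 ultimately have "real (snd c) * g <= real (snd j) * g | real (snd j + 1) * g <= real (fst c) * g" using g by (auto simp: mult_right_mono)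
 thus ?thesis unfolding bA_def bC_def using `fst c < snd c` by (intro bint_djy) (auto simp: of_nat_diff algebra_simps)
 next
 case False
 have m: "{c} : K1" "fst (fst j) : K1" "snd (fst j) : K2 (fst (fst j))" using that K1T by (auto simp: JA_def JC_def KK_def)
 have "z0 + st1 {c} + f1 {c} <= ?s (fst j) |
 ?s (fst j) + ?f (fst j) <= z0 + st1 {c}" using sep1[OF m(1,2) False[symmetric]] in2[OF m(3)] by linarith
 thus ?thesis unfolding bA_def bC_def by (intro bint_djx) linarith
 qed
 have BC: "(bint (bB i)) Int bint (bC j) = {}" if "i : JB" "j : JC" for i j
 proof (cases "fst i = fst j")
 case True
 have "snd i : fst (fst j) Un snd (fst j)" using that(1) True by (auto simp: JB_def)
 moreover have "ALL c:fst (fst j) Un snd (fst j). ~ (fst c <= snd j & snd j < snd c)" using that(2) by (simp add: JC_def case_prod_unfold)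
 ultimately have "~ (fst (snd i) <= snd j & snd j < snd (snd i))" by blast
 moreover have l: "fst (snd i) < snd (snd i)" using clT[OF clB[OF that(1)]] by simp
 ultimately have "real (snd (snd i)) * g <= real (snd j) * g | real (snd j + 1) * g <= real (fst (snd i)) * g"
 using g by (auto simp: mult_right_mono)
 thus ?thesis unfolding bB_def bC_def using l by (intro bint_djy) (auto simp: of_nat_diff algebra_simps)
 next
 case False
 hence "?s (fst i) + ?f (fst i) <= ?s (fst j) |
 ?s (fst j) + ?f (fst j) <= ?s (fst i)" using that by (intro sep2) (auto simp: JC_def JB_def KK_def prod_eq_iff)
 thus ?thesis unfolding bB_def bC_def by (intro bint_djx) linarith
 qed
 let ?R = "UN (a', b'):{(a', b'). a' < b' & {a'..<b'} <= Lay}. {real z0<..<real z1} \<times> {real a' * g + off<..<real b' * g + off}"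
 have Rsub: "bint (real x, real a' * g + off, real d, real (b' - a') * g) <= ?R"
 if "z0 <= x" "x + d <= z1" "a' < b'" "{a'..<b'} <= Lay" for x d a' b'
 proof -
 have "bint (real x, real a' * g + off, real d, real (b' - a') * g) <= {real z0<..<real z1} \<times> {real a' * g + off<..<real b' * g + off}"
 using that by (auto simp: bint.simps of_nat_diff algebra_simps)
 thus ?thesis using that by blast
 qed
 have SAT: "(UN c:JA. SA c) = T" by (auto simp: JA_def SA_def)
 have "lay (card JA + card JB + card JC) ((UN c:JA. SA c) Un (UN j:JB. SB j) Un {}) (([] @ []) @ Fs)
 ((UN c:JA. bint (bA c)) Un (UN j:JB. bint (bB j)) Un (UN j:JC. bint (bC j)))"
 proof (intro lay_Un LA LB Fs(1))
 show "(UN c:JA. SA c) Int (UN j:JB. SB j) = {}" unfolding SAT VL using TV by auto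
 show "(UN c:JA. bint (bA c)) Int (UN j:JB. bint (bB j)) = {}" using AB by blast
 show "((UN c:JA. bint (bA c)) Un (UN j:JB. bint (bB j))) Int (UN j:JC. bint (bC j)) = {}" using ABC BC by blast
 qed simp
 moreover have "(UN c:JA. SA c) Un (UN j:JB. SB j) Un {} = T Un V - L" unfolding SAT VL using TV LV by auto
 moreover have "card JA + card JB + card JC <= part_count m"
 proof -
 have "card JA <= ?q" unfolding JA_def using cU cardU by (metis (no_types, lifting) Un_upper1 card_mono image_mono image_subset_iff subset_trans)
 thus ?thesis using cardJB cardJC unfolding part_count_def by linarith
 qed
 moreover have "(UN c:JA. bint (bA c)) Un (UN j:JB. bint (bB j)) Un (UN j:JC. bint (bC j)) <= ?R"
 proof -
 have "bint (bA c) <= ?R" if "c : JA" for c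
 proof -
 have "c : cl ` (T Un V)" using that unfolding JA_def by blast
 hence "fst c < snd c & {fst c..<snd c} <= Lay" using clT[of c] by simp
 moreover have "{c} : K1" using K1T that unfolding JA_def by blast
 ultimately show ?thesis unfolding bA_def using in1 by (intro Rsub) auto
 qed
 moreover have "bint (bB j) <= ?R" if "j : JB" for j
 proof -
 have "fst (fst j) : K1" "snd (fst j) : K2 (fst (fst j))" using that by (auto simp: JB_def KK_def)
 thus ?thesis unfolding bB_def using in1[of "fst (fst j)"] in2[of "snd (fst j)" "fst (fst j)"] clT[OF clB[OF that]] by (intro Rsub) auto
 qed
 moreover have "bint (bC j) <= ?R" if "j : JC" for j
 proof -
 have "fst (fst j) : K1" "snd (fst j) : K2 (fst (fst j))" "snd j : Lay" using that by (auto simp: JC_def KK_def)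
 thus ?thesis unfolding bC_def using in1[of "fst (fst j)"] in2[of "snd (fst j)" "fst (fst j)"]
 Rsub[of "?s (fst j)" "?f (fst j)" "snd j" "snd j + 1"] by (auto simp: atLeastLessThanSuc)
 qed
 ultimately show ?thesis by (intro Un_least UN_least)
 qed
 ultimately have "lay (part_count m) (T Un V - L) Fs ?R" by (metis (no_types, lifting) append_Nil lay_mono)
 thus ?thesis using LV Lw FsA Fsg by blast
qed

end

lemma sum_intervals:
 fixes X w :: "nat => nat"
 assumes "finite S" "S ~= {}" "!!i. i : S ==> A <= X i & X i + w i <= B" "!!i j. i : S ==> j : S ==> i ~= j ==> X i + w i <= X j | X j + w j <= X i"
 shows "A + sum w S <= B"
proof -
 have "sum w S = card (UN i:S. {X i..<X i + w i})"
 proof (subst card_UN_disjoint)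
 show "ALL i:S. ALL j:S. i ~= j --> {X i..<X i + w i} Int {X j..<X j + w j} = {}" using assms(4) by fastforce
 qed (use assms(1) in auto)
 also have "... <= card {A..<B}" using assms(3) by (intro card_mono) (auto, fastforce+)
 finally show ?thesis using assms(2,3) by (metis (no_types, lifting) Nat.le_diff_conv2 add.commute all_not_in_conv card_atLeastLessThan le_add1 order_trans)
qed

section \<open>The strip in layers, the shift and the slabs\<close>

text \<open>Horizontally everything is integral, vertically it is measured in layers of height
  \<open>g\<close>. \<open>Ob\<close> consists of rectangles of columns and layers that have to be
  kept clear, \<open>Tl\<close> of the narrow items with more than \<open>m3\<close> layers and
  \<open>Vv\<close> of narrow items of height at most \<open>m3 * g\<close>.\<close>

locale matrix = items ord w h for ord w h +
 fixes m3 W u :: nat and g sh :: real and X a b :: "nat => nat" and Ob :: "(nat * nat * nat * nat) set" and Tl Vv :: "nat set"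
 assumes g: "0 < g" and m3: "0 < m3" and sh: "real m3 * g <= sh" and W: "0 < W" and finOb: "finite Ob"
 and Ob: "(l, r, c, d) : Ob ==> l < r & r <= W & c < d & d <= 3 * m3"
 and ObOb: "(l, r, c, d) : Ob ==> (l', r', c', d') : Ob ==> (l, r, c, d) ~= (l', r', c', d') ==>
 r <= l' | r' <= l | d <= c' | d' <= c" and TV: "Tl <= set ord" "Vv <= set ord" "Tl Int Vv = {}"
 and it: "i : Tl Un Vv ==> X i + w i <= W & a i < b i & b i <= 3 * m3 &
 real (h i) <= real (b i - a i) * g & w i <= u" and dj: "i : Tl Un Vv ==> j : Tl Un Vv ==> i ~= j ==>
 X i + w i <= X j | X j + w j <= X i | b i <= a j | b j <= a i"
 and djO: "i : Tl Un Vv ==> (l, r, c, d) : Ob ==> X i + w i <= l | r <= X i | b i <= c | d <= a i" and tall: "i : Tl ==> m3 < b i - a i"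
 and short: "i : Vv ==> real (h i) <= real m3 * g"
begin

abbreviation "rW == real W"
abbreviation m :: nat where "m == 3 * m3"
abbreviation Ht :: real where "Ht == real m * g + sh"
abbreviation pc :: nat where "pc == part_count m"
abbreviation xiv :: "nat => nat set" where "xiv i == {X i..<X i + w i}"

lemma sh_pos: "0 < sh" using sh g m3 by (meson less_le_trans mult_pos_pos of_nat_0_less_iff)

lemma w_pos': "i : Tl Un Vv ==> 0 < w i" using TV w_pos by blast

lemma finTV: "finite Tl" "finite Vv" using TV by (auto intro: finite_subset)

text \<open>A tall item with \<open>lt\<close> contains the layer \<open>m3\<close>, a tall item
  that is not \<open>isLow\<close> contains the layer \<open>2 * m3\<close>, and one with
  \<open>isMid\<close> contains both.\<close>

definition lt :: "nat => bool" where "lt i <-> a i < m3"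
definition isLow :: "nat => bool" where "isLow i <-> a i < m3 & b i <= 2 * m3"
definition isMid :: "nat => bool" where "isMid i <-> a i < m3 & 2 * m3 < b i"

text \<open>Both items contain the layer \<open>m3\<close>.\<close>

lemma xd_lt:
 assumes "i : Tl" "j : Tl" "i ~= j" "lt i" "lt j" shows "X i + w i <= X j | X j + w j <= X i"
 using dj[of i j] assms tall[of i] tall[of j] by (auto simp: lt_def)

text \<open>Both items contain the layer \<open>2 * m3\<close>: they end above it, and having more
  than \<open>m3\<close> of at most \<open>3 * m3\<close> layers they start below it.\<close>

lemma xd_nl:
 assumes "i : Tl" "j : Tl" "i ~= j" "~ isLow i" "~ isLow j" shows "X i + w i <= X j | X j + w j <= X i"
 using dj[of i j] assms tall[of i] tall[of j] it[of i] it[of j] by (auto simp: isLow_def)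

text \<open>Things starting in the upper two thirds of the strip are shifted up by \<open>sh\<close>.\<close>

definition rbox :: "nat * nat * nat * nat => box" where
 "rbox = (%(l, r, c, d). (real l, real c * g + (if c < m3 then 0 else sh), real (r - l), real (d - c) * g))"

definition ibox :: "nat => box" where "ibox i = rbox (X i, X i + w i, a i, b i)"

text \<open>The shift is monotone in the starting layer, so what lies above stays above.\<close>

lemma rbox_disjoint:
 assumes "r <= l' | r' <= l | d <= c' | d' <= c" "l < r" "l' < r'" "c < d" "c' < d'"
 shows "bint (rbox (l, r, c, d)) Int bint (rbox (l', r', c', d')) = {}"
proof -
 consider "r <= l' | r' <= l" | "d <= c'" | "d' <= c" using assms(1) by blast
 thus ?thesis
 proof cases
 case 1
 thus ?thesis using assms(2,3) unfolding rbox_def by (auto intro!: bint_djx simp: of_nat_diff)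
 next
 case 2
 hence "real d * g <= real c' * g" using g by simp
 thus ?thesis using 2 assms(4) sh_pos unfolding rbox_def by (auto intro!: bint_djy simp: of_nat_diff algebra_simps)
 next
 case 3
 hence "real d' * g <= real c * g" using g by simp
 thus ?thesis using 3 assms(5) sh_pos unfolding rbox_def by (auto intro!: bint_djy simp: of_nat_diff algebra_simps)
 qed
qed

definition bps :: "nat set" where "bps = insert 0 (insert W (UN (l, r, c, d):Ob. {l, r}))"

definition Sl :: "(nat * nat) set" where "Sl = cuts bps"

lemma fin_bps: "finite bps" using finOb by (auto simp: bps_def)

lemma bps_sub: "bps <= {0..W}" using Ob unfolding bps_def by (fastforce simp: less_imp_le)

lemma bps_ends: "0 : bps" "W : bps" by (auto simp: bps_def)

lemma fin_Sl: "finite Sl" unfolding Sl_def by (rule finite_cuts[OF fin_bps])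

lemma Sl_D: "(p, q) : Sl ==> p < q & q <= W" using bps_sub cuts_subset[of bps] by (fastforce simp: Sl_def cuts_def)

definition mv :: "nat => nat => nat => bool" where "mv p q i <-> p <= X i & X i + w i <= q"

text \<open>Tall items contained in no slab cross a breakpoint. There are few of them; they keep
  their places, up to the shift, and are treated as solid.\<close>

definition fx :: "nat set" where "fx = {i:Tl. ALL (p, q):Sl. ~ mv p q i}"

definition Solid :: "(real * real) set" where "Solid = (UN o':Ob. bint (rbox o')) Un (UN i:fx. bint (ibox i))"

abbreviation room :: "nat => nat => real set => (real * real) set" where "room p q S == {real p<..<real q} \<times> S - Solid"
abbreviation strip :: "(real * real) set" where "strip == {0<..<rW} \<times> {0<..<Ht} - (UN o':Ob. bint (rbox o'))"
abbreviation "Tmv p q == {i:Tl. mv p q i}"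
abbreviation "Vmv p q == {i:Vv. mv p q i}"

lemma fx_sub: "fx <= Tl" by (auto simp: fx_def)

lemma fx_notmv: "i : fx ==> (p, q) : Sl ==> ~ mv p q i" by (auto simp: fx_def)

definition obc :: "nat => nat => (nat * nat * nat * nat) set" where "obc p q = {(l, r, c, d). (l, r, c, d) : Ob & l <= p & q <= r}"

text \<open>The top of the highest obstacle over the slab that starts in the lower third, and dually
  in \<open>shi\<close> the bottom of the lowest obstacle that starts higher; the bottom and the top
  of the strip are the defaults. No obstacle over the slab lies between the two, and it is this zone
  that grows by \<open>sh\<close>.\<close>

definition slo :: "nat => nat => nat" where "slo p q = Max (insert 0 ((%(l, r, c, d). d) ` {(l, r, c, d). (l, r, c, d) : obc p q & c < m3}))"

definition shi :: "nat => nat => nat" where "shi p q = Min (insert m ((%(l, r, c, d). c) ` {(l, r, c, d). (l, r, c, d) : obc p q & m3 <= c}))"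

end

locale slab = matrix +
 fixes p q :: nat
 assumes J: "(p, q) : Sl"
begin

abbreviation "s == slo p q"
abbreviation "c == shi p q"

lemma pq: "p < q" "q <= W" using Sl_D[OF J] by auto

lemma obc_sub: "obc p q <= Ob" by (auto simp: obc_def)

lemma fin_obc: "finite (obc p q)" using obc_sub finOb finite_subset by blast

text \<open>The ends of every obstacle are breakpoints, and no breakpoint lies inside the
  slab.\<close>

lemma ob_side:
 assumes "(l, r, c', d) : Ob" "(l, r, c', d) ~: obc p q" shows "r <= p | q <= l"
proof -
 have "l : bps" "r : bps" using assms(1) by (auto simp: bps_def)
 hence "l <= p | q <= l" "r <= p | q <= r" using J cuts_side unfolding Sl_def by blast+
 thus ?thesis using assms by (auto simp: obc_def)
qed

lemma fin_lows: "finite {(l, r, c, d). (l, r, c, d) : obc p q & c < m3}" using fin_obc by (rule rev_finite_subset) auto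

lemma fin_highs: "finite {(l, r, c, d). (l, r, c, d) : obc p q & m3 <= c}" using fin_obc by (rule rev_finite_subset) auto

lemma s_ge: "(l, r, c', d) : obc p q ==> c' < m3 ==> d <= s" unfolding slo_def using fin_lows by (intro Max_ge) force+

lemma c_le: "(l, r, c', d) : obc p q ==> m3 <= c' ==> c <= c'" unfolding shi_def using fin_highs by (intro Min_le) force+

lemma s_cases: "s = 0 | (EX l r c' d. (l, r, c', d) : obc p q & c' < m3 & s = d)"
proof -
 have "s : insert 0 ((%(l, r, c, d). d) ` {(l, r, c, d). (l, r, c, d) : obc p q & c < m3})" unfolding slo_def using fin_lows by (intro Max_in) auto
 thus ?thesis by auto
qed

lemma c_cases: "c = m | (EX l r c' d. (l, r, c', d) : obc p q & m3 <= c' & c = c')"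
proof -
 have "c : insert m ((%(l, r, c, d). c) ` {(l, r, c, d). (l, r, c, d) : obc p q & m3 <= c})" unfolding shi_def using fin_highs by (intro Min_in) auto
 thus ?thesis by auto
qed

lemma c_ge: "m3 <= c" using c_cases by auto

lemma c_le_m: "c <= m" unfolding shi_def using fin_highs by (intro Min_le) auto

text \<open>The two extremal obstacles share the columns of the slab, so they lie one above the
  other, in the order of their starting layers.\<close>

lemma s_le_c: "s <= c"
proof (cases "s = 0 | c = m")
 case True
 thus ?thesis using s_cases Ob obc_sub by fastforce
next
 case False
 then obtain l r c1 d l' r' c2 d' where o: "(l, r, c1, d) : obc p q" "c1 < m3" "s = d"
 "(l', r', c2, d') : obc p q" "m3 <= c2" "c = c2" using s_cases c_cases by blast
 have *: "l <= p" "q <= r" "l' <= p" "q <= r'" using o(1,4) by (auto simp: obc_def)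
 have o1: "(l, r, c1, d) : Ob" and o2: "(l', r', c2, d') : Ob" using o(1,4) obc_sub by blast+
 have "c1 ~= c2" using o(2,5) by simp
 hence "r <= l' | r' <= l | d <= c2 | d' <= c1" using ObOb[OF o1 o2] by simp
 thus ?thesis using * pq o Ob[OF o2] by linarith
qed

lemma obc_split:
 assumes "(l, r, c', d) : obc p q" shows "d <= s & c' < m3 | c <= c' & m3 <= c'" using s_ge[OF assms] c_le[OF assms] by (meson not_le)

lemma item_ob:
 assumes "i : Tl Un Vv" "X i < q" "p < X i + w i" "(l, r, c', d) : obc p q" shows "b i <= c' | d <= a i"
 using djO[OF assms(1), of l r c' d] assms by (auto simp: obc_def)

lemma item_s:
 assumes "i : Tl Un Vv" "X i < q" "p < X i + w i" shows "b i <= s | s <= a i"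
proof (cases "s = 0")
 case False
 then obtain l r c' d where o: "(l, r, c', d) : obc p q" "c' < m3" "s = d" using s_cases by auto
 have "c' < d" using Ob obc_sub o(1) by blast
 thus ?thesis using item_ob[OF assms o(1)] o(3) by linarith
qed simp

lemma item_c:
 assumes "i : Tl Un Vv" "X i < q" "p < X i + w i" shows "b i <= c | c <= a i"
proof (cases "c = m")
 case True
 thus ?thesis using it[OF assms(1)] by simp
next
 case False
 then obtain l r c' d where o: "(l, r, c', d) : obc p q" "m3 <= c'" "c = c'" using c_cases by auto
 have "c' < d" using Ob obc_sub o(1) by blast
 thus ?thesis using item_ob[OF assms o(1)] o(3) by linarith
qed

text \<open>Below the obstacle that ends at \<open>s\<close> there are fewer than \<open>m3\<close>
  layers, too few for a tall item.\<close>

lemma tall_s: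
 assumes "i : Tl" "X i < q" "p < X i + w i" shows "s <= a i"
proof (cases "s = 0")
 case False
 then obtain l r c' d where o: "(l, r, c', d) : obc p q" "c' < m3" "s = d" using s_cases by auto
 thus ?thesis using item_ob[of i l r c' d] assms tall[OF assms(1)] by auto
qed simp

lemma tall_c:
 assumes "i : Tl" "X i < q" "p < X i + w i" "lt i" shows "b i <= c"
proof (cases "c = m")
 case True
 thus ?thesis using it[of i] assms(1) by simp
next
 case False
 then obtain l r c' d where o: "(l, r, c', d) : obc p q" "m3 <= c'" "c = c'" using c_cases by auto
 have "c' < d" using Ob obc_sub o(1) by blast
 thus ?thesis using item_ob[of i l r c' d] assms o by (auto simp: lt_def)
qed

text \<open>Fixed items protrude into the slab from both sides. Between \<open>pl\<close> and
  \<open>ql\<close> no fixed item through the layer \<open>m3\<close> is met, between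
  \<open>ph\<close> and \<open>qh\<close> none through \<open>2 * m3\<close>. The movable items
  through the same layer are disjoint from these horizontally, so they already lie in this
  range.\<close>

definition pl :: nat where "pl = Max (insert p ((%i. X i + w i) ` {i:fx. lt i & X i < p}))"
definition ql :: nat where "ql = Min (insert q (X ` {i:fx. lt i & q < X i + w i}))"
definition ph :: nat where "ph = Max (insert p ((%i. X i + w i) ` {i:fx. ~ isLow i & X i < p}))"
definition qh :: nat where "qh = Min (insert q (X ` {i:fx. ~ isLow i & q < X i + w i}))"

lemma fin_fx: "finite fx" using fx_sub finTV finite_subset by blast

lemma pl_ge: "p <= pl" "p <= ph" unfolding pl_def ph_def using fin_fx by (auto intro!: Max_ge)
lemma ql_le: "ql <= q" "qh <= q" unfolding ql_def qh_def using fin_fx by (auto intro!: Min_le)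

lemma pl_le: "pl <= p + u" "ph <= p + u"
proof -
 have "X i + w i <= p + u" if "i : fx" "X i < p" for i using it[of i] fx_sub that by fastforce
 thus "pl <= p + u" "ph <= p + u" unfolding pl_def ph_def using fin_fx by auto
qed

lemma ql_ge: "q <= ql + u" "q <= qh + u"
proof -
 have "q - u <= X i" if "i : fx" "q < X i + w i" for i using it[of i] fx_sub that by fastforce
 hence "q - u <= ql" "q - u <= qh" unfolding ql_def qh_def using fin_fx by auto
 thus "q <= ql + u" "q <= qh + u" by auto
qed

lemma fx_out_l:
 assumes "f : fx" "lt f" shows "X f + w f <= pl | ql <= X f"
proof (cases "X f < p")
 case True
 hence "X f + w f <= pl" unfolding pl_def using fin_fx assms by (intro Max_ge) auto
 thus ?thesis by simp
next
 case False
 hence "q < X f + w f" using fx_notmv[OF assms(1) J] by (auto simp: mv_def)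
 hence "ql <= X f" unfolding ql_def using fin_fx assms by (intro Min_le) auto
 thus ?thesis by simp
qed

lemma fx_out_h:
 assumes "f : fx" "~ isLow f" shows "X f + w f <= ph | qh <= X f"
proof (cases "X f < p")
 case True
 hence "X f + w f <= ph" unfolding ph_def using fin_fx assms by (intro Max_ge) auto
 thus ?thesis by simp
next
 case False
 hence "q < X f + w f" using fx_notmv[OF assms(1) J] by (auto simp: mv_def)
 hence "qh <= X f" unfolding qh_def using fin_fx assms by (intro Min_le) auto
 thus ?thesis by simp
qed

lemma mv_in_l:
 assumes "i : Tl" "mv p q i" "lt i" shows "pl <= X i & X i + w i <= ql"
proof -
 have x: "X i + w i <= X f | X f + w f <= X i" if "f : fx" "lt f" for f using xd_lt[of i f] assms that fx_sub fx_notmv[OF that(1) J] by auto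
 have wi: "0 < w i" using w_pos' assms(1) by auto
 have "pl <= X i" unfolding pl_def using fin_fx x assms(2) wi by (fastforce simp: mv_def)
 moreover have "X i + w i <= ql" unfolding ql_def using fin_fx x assms(2) wi by (fastforce simp: mv_def)
 ultimately show ?thesis by simp
qed

lemma mv_in_h:
 assumes "i : Tl" "mv p q i" "~ isLow i" shows "ph <= X i & X i + w i <= qh"
proof -
 have x: "X i + w i <= X f | X f + w f <= X i" if "f : fx" "~ isLow f" for f using xd_nl[of i f] assms that fx_sub fx_notmv[OF that(1) J] by auto
 have wi: "0 < w i" using w_pos' assms(1) by auto
 have "ph <= X i" unfolding ph_def using fin_fx x assms(2) wi by (fastforce simp: mv_def)
 moreover have "X i + w i <= qh" unfolding qh_def using fin_fx x assms(2) wi by (fastforce simp: mv_def)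
 ultimately show ?thesis by simp
qed

lemma solid_l:
 \<comment> \<open>below the middle zone only the obstacles covering the slab matter\<close>
 assumes "p <= x" "x + d <= q" "!!l r c' d'. (l, r, c', d') : obc p q ==>
 bint (real x, y, real d, e) Int bint (rbox (l, r, c', d')) = {}"
 "!!f. f : fx ==> X f < q ==> p < X f + w f ==> bint (real x, y, real d, e) Int bint (ibox f) = {}"
 shows "bint (real x, y, real d, e) Int Solid = {}"
proof -
 have "bint (real x, y, real d, e) Int bint (rbox o') = {}" if o: "o' : Ob" for o'
 proof (cases "o' : obc p q")
 case True
 thus ?thesis using assms(3) by (cases o') auto
 next
 case False
 obtain l r c' d' where o': "o' = (l, r, c', d')" by (cases o') auto
 hence "r <= p | q <= l" "l < r" using ob_side[of l r c' d'] o False Ob[of l r c' d'] by auto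
 thus ?thesis using assms(1,2) unfolding o' rbox_def by (auto intro!: bint_djx simp: of_nat_diff)
 qed
 moreover have "bint (real x, y, real d, e) Int bint (ibox f) = {}" if f: "f : fx" for f
 proof (cases "X f < q & p < X f + w f")
 case True
 thus ?thesis using assms(4)[OF f] by simp
 next
 case False
 thus ?thesis using assms(1,2) unfolding ibox_def rbox_def by (auto intro!: bint_djx)
 qed
 ultimately show ?thesis unfolding Solid_def by blast
qed

end

context matrix
begin

definition Free :: "(nat * nat) set" where "Free = {(x, k). x < W & k < m & (ALL (l, r, c, d):Ob. ~ (l <= x & x < r & c <= k & k < d)) &
 (ALL i:Tl Un Vv. ~ (X i <= x & x < X i + w i & a i <= k & k < b i))}"

abbreviation "Fcol p q == {(x, k):Free. p <= x & x < q}"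

lemma fin_Free: "finite Free" by (rule finite_subset[of _ "{..<W} \<times> {..<m}"]) (auto simp: Free_def)

end

section \<open>The zones below \<open>s\<close> and above \<open>c\<close>\<close>

context slab
begin

definition blk :: "nat => bool" where "blk k <-> (EX (l, r, c', d):obc p q. c' <= k & k < d)"

abbreviation "Fge == {(x, k):Free. p <= x & x < q & c <= k}"
abbreviation "Flt == {(x, k):Free. p <= x & x < q & k < s}"
abbreviation "Fmid == {(x, k):Free. p <= x & x < q & s <= k & k < c}"

lemma item_blk:
 assumes "i : Tl Un Vv" "X i < q" "p < X i + w i" "a i <= k" "k < b i" shows "~ blk k"
 using item_ob[OF assms(1-3)] assms(4,5) by (fastforce simp: blk_def)

lemma not_blk_range:
 assumes "{a'..<b'} <= {k. ~ blk k}" "a' < b'" "(l, r, c', d) : obc p q" shows "b' <= c' | d <= a'"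
proof (rule ccontr)
 assume n: "~ ?thesis"
 have "c' < d" using Ob obc_sub assms(3) by blast
 hence "max a' c' : {a'..<b'}" "c' <= max a' c'" "max a' c' < d" using n assms(2) by auto
 moreover have "blk (max a' c')" if "c' <= max a' c'" "max a' c' < d" unfolding blk_def using assms(3) that by (intro bexI[of _ "(l, r, c', d)"]) auto
 ultimately show False using assms(1) by blast
qed

lemma Free_blk: "(x, k) : Free ==> p <= x ==> x < q ==> ~ blk k" using obc_sub by (fastforce simp: Free_def blk_def obc_def)

definition Vlow where "Vlow = {i:Vv. mv p q i & b i <= s}"
definition Vhigh where "Vhigh = {i:Vv. mv p q i & c <= a i & ph <= X i & X i + w i <= qh}"
definition Thigh where "Thigh = {i:Tl. mv p q i & c <= a i}"
definition Tmid where "Tmid = {i:Tl. mv p q i & b i <= c}"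

lemma mv_slab: "i : Tl Un Vv ==> mv p q i ==> X i < q & p < X i + w i" using w_pos' by (fastforce simp: mv_def)

text \<open>No tall item reaches below \<open>s\<close>, so the whole width of the slab is
  available, and \<open>part\<close> applies without tall items and without shift.\<close>

lemma slab_low:
 "EX L Fs. L <= Vlow & wds L <= real (pc) * real u &
 lay (pc) (Vlow - L) Fs (room p q {0<..<real s * g}) &
 g * real (card (Flt)) <= ar Fs &
 wdt Fs <= real m * real (q - p) & (ALL dg:set Fs. snd dg <= g)"
proof -
 let ?Lay = "{k. k < s & ~ blk k}"
 let ?Fc = "{(x, k). p <= x & x < q & k : ?Lay & (ALL i:{} Un Vlow. ~ (X i <= x & x < X i + w i & a i <= k & k < b i))}"
 let ?R = "UN (a', b'):{(a', b'). a' < b' & {a'..<b'} <= ?Lay}. {real p<..<real q} \<times> {real a' * g + 0<..<real b' * g + 0}"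
 have sm: "s <= m" using s_le_c c_le_m by simp
 have "EX L Fs. L <= Vlow & wds L <= real (pc) * real u &
 lay (pc) ({} Un Vlow - L) Fs ?R &
 ar Fs = g * real (card ?Fc) & wdt Fs = real (card ?Fc) & (ALL dg:set Fs. snd dg <= g)"
 proof (rule part)
 show "?Lay <= {..<m}" using sm by auto
 show "Vlow <= set ord" using TV by (auto simp: Vlow_def)
 fix i assume i: "i : {} Un Vlow"
 hence i': "i : Tl Un Vv" "mv p q i" "b i <= s" by (auto simp: Vlow_def)
 have "~ blk k" if "k : {a i..<b i}" for k using item_blk[OF i'(1)] mv_slab[OF i'(1,2)] that by auto
 thus "p <= X i & X i + w i <= q & a i < b i & {a i..<b i} <= ?Lay & rh i <= real (b i - a i) * g" using it[OF i'(1)] i'(2,3) by (auto simp: mv_def)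
 next
 fix i j assume "i : {} Un Vlow" "j : {} Un Vlow" "i ~= j"
 thus "X i + w i <= X j | X j + w j <= X i | b i <= a j | b j <= a i" using dj[of i j] by (auto simp: Vlow_def)
 next
 fix i assume "i : Vlow" thus "rw i <= real u" using it[of i] by (auto simp: Vlow_def)
 qed (use g pq in auto)
 then obtain L Fs where L: "L <= Vlow" "wds L <= real (pc) * real u" "lay (pc) (Vlow - L) Fs ?R" "ar Fs = g * real (card ?Fc)"
 "wdt Fs = real (card ?Fc)" "ALL dg:set Fs. snd dg <= g" by auto
 have sub: "?R <= room p q {0<..<real s * g}"
 proof
 fix z assume "z : ?R"
 then obtain a' b' where ab: "a' < b'" "{a'..<b'} <= ?Lay" "z : {real p<..<real q} \<times> {real a' * g<..<real b' * g}" by auto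
 have "b' - 1 : {a'..<b'}" using ab(1) by auto
 hence bs: "b' <= s" using ab(2) by auto
 let ?B = "bint (real p, real a' * g, real (q - p), real (b' - a') * g)"
 have zb: "z : ?B" using ab pq by (auto simp: bint.simps of_nat_diff algebra_simps)
 have "?B Int Solid = {}"
 proof (rule solid_l)
 fix l r c' d assume o: "(l, r, c', d) : obc p q"
 have "c' < d" using Ob obc_sub o by blast
 have "b' <= c' | d <= a'" using not_blk_range[of a' b', OF _ ab(1) o] ab(2) by auto
 hence "real b' * g <= real c' * g | real d * g <= real a' * g & c' < m3" using obc_split[OF o] bs s_le_c ab(1) `c' < d` g by auto
 thus "?B Int bint (rbox (l, r, c', d)) = {}" unfolding rbox_def prod.case using ab(1) `c' < d` sh_pos
 by (intro bint_djy) (auto simp: of_nat_diff algebra_simps)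
 next
 fix f assume f: "f : fx" "X f < q" "p < X f + w f"
 hence "s <= a f" using tall_s fx_sub by blast
 hence "real b' * g <= real (a f) * g" using bs g by auto
 thus "?B Int bint (ibox f) = {}" unfolding ibox_def rbox_def prod.case using ab(1) sh_pos
 by (intro bint_djy) (auto simp: of_nat_diff algebra_simps)
 qed (use pq in auto)
 moreover have "0 <= real a' * g" "real b' * g <= real s * g" using bs g by auto
 ultimately show "z : room p q {0<..<real s * g}" using zb ab(3) by auto
 qed
 have fF: "finite ?Fc" by (rule finite_subset[of _ "{p..<q} \<times> {..<m}"]) (use sm in auto)
 have "Flt <= ?Fc" using Free_blk by (auto simp: Free_def Vlow_def)
 hence "card (Flt) <= card ?Fc" using fF by (rule card_mono[rotated])
 hence 1: "g * real (card (Flt)) <= g * real (card ?Fc)" using g by simp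
 have "card ?Fc <= card ({p..<q} \<times> {..<m})" using sm by (intro card_mono) auto
 hence "card ?Fc <= m * (q - p)" by (simp add: card_cartesian_product mult.commute)
 hence "real (card ?Fc) <= real (m * (q - p))" by (rule of_nat_mono)
 hence 2: "real (card ?Fc) <= real m * real (q - p)" by (simp only: of_nat_mult)
 show ?thesis
 proof (intro exI[of _ L] exI[of _ Fs] conjI)
 show "lay (pc) (Vlow - L) Fs (room p q {0<..<real s * g})" using lay_mono[OF L(3) order_refl sub] .
 show "g * real (card (Flt)) <= ar Fs" unfolding L(4) using 1 .
 show "wdt Fs <= real m * real (q - p)" unfolding L(5) using 2 .
 qed (use L in blast)+
qed

text \<open>The tall items above \<open>c\<close> all contain the layer \<open>2 * m3\<close>, so no
  two of them share a column, as \<open>part\<close> demands. The columns outside \<open>ph\<close>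
  to \<open>qh\<close> are given up; there are at most \<open>2 * u\<close> of them.\<close>

lemma slab_high:
 "EX L Fs. L <= Vhigh & wds L <= real (pc) * real u &
 lay (pc) (Thigh Un Vhigh - L) Fs (room p q {real c * g + sh<..<Ht}) &
 g * real (card (Fge)) - g * real (2 * u * m) <= ar Fs &
 wdt Fs <= real m * real (q - p) & (ALL dg:set Fs. snd dg <= g)"
proof (cases "ph < qh")
 \<comment> \<open>The fixed items leave no column. Then the slab has width at most
   \<open>2 * u\<close> and its upper free cells are written off altogether.\<close>
 case False
 have e: "Thigh = {}" "Vhigh = {}"
 proof -
 have "i ~: Thigh" for i using mv_in_h[of i] w_pos'[of i] False c_ge by (auto simp: Thigh_def isLow_def)
 thus "Thigh = {}" by auto
 have "i ~: Vhigh" for i using w_pos'[of i] False by (auto simp: Vhigh_def)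
 thus "Vhigh = {}" by auto
 qed
 have "q - p <= 2 * u" using False pl_le ql_ge by linarith
 have "card (Fge) <= card ({p..<q} \<times> {..<m})" by (intro card_mono) (auto simp: Free_def)
 also have "... = (q - p) * m" by (simp add: card_cartesian_product)
 also have "... <= 2 * u * m" using `q - p <= 2 * u` by (rule mult_le_mono1)
 finally have 0: "real (card (Fge)) <= real (2 * u * m)" by (rule of_nat_mono)
 have "g * real (card (Fge)) <= g * real (2 * u * m)" using g by (intro mult_left_mono[OF 0]) simp
 thus ?thesis unfolding e using lay_mono[OF lay_empty] by (intro exI[of _ "{}"] exI[of _ "[]"]) auto
next
 case True
 let ?Lay = "{k. c <= k & k < m & ~ blk k}"
 let ?Fc = "{(x, k). ph <= x & x < qh & k : ?Lay & (ALL i:Thigh Un Vhigh. ~ (X i <= x & x < X i + w i & a i <= k & k < b i))}"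
 let ?R = "UN (a', b'):{(a', b'). a' < b' & {a'..<b'} <= ?Lay}. {real ph<..<real qh} \<times> {real a' * g + sh<..<real b' * g + sh}"
 have TH: "i : Tl" "mv p q i" "~ isLow i" "ph <= X i & X i + w i <= qh" if "i : Thigh" for i
 using that mv_in_h[of i] c_ge by (auto simp: Thigh_def isLow_def)
 have "EX L Fs. L <= Vhigh & wds L <= real (pc) * real u &
 lay (pc) (Thigh Un Vhigh - L) Fs ?R &
 ar Fs = g * real (card ?Fc) & wdt Fs = real (card ?Fc) & (ALL dg:set Fs. snd dg <= g)"
 proof (rule part)
 show "?Lay <= {..<m}" by auto
 show "Vhigh <= set ord" "Thigh <= set ord" "Thigh Int Vhigh = {}" using TV by (auto simp: Vhigh_def Thigh_def)
 fix i assume i: "i : Thigh Un Vhigh"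
 hence i': "i : Tl Un Vv" "mv p q i" "c <= a i" "ph <= X i & X i + w i <= qh" using TH(4)[of i] by (auto simp: Vhigh_def Thigh_def)
 have "~ blk k" if "k : {a i..<b i}" for k using item_blk[OF i'(1)] mv_slab[OF i'(1,2)] that by auto
 thus "ph <= X i & X i + w i <= qh & a i < b i & {a i..<b i} <= ?Lay & rh i <= real (b i - a i) * g" using it[OF i'(1)] i'(3,4) by auto
 next
 fix i j assume "i : Thigh Un Vhigh" "j : Thigh Un Vhigh" "i ~= j"
 thus "X i + w i <= X j | X j + w j <= X i | b i <= a j | b j <= a i" using dj[of i j] by (auto simp: Vhigh_def Thigh_def)
 next
 fix i j assume "i : Thigh" "j : Thigh" "i ~= j"
 thus "X i + w i <= X j | X j + w j <= X i" using xd_nl[of i j] TH by blast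
 next
 fix i assume "i : Vhigh" thus "rw i <= real u" using it[of i] by (auto simp: Vhigh_def)
 qed (use g True in auto)
 then obtain L Fs where L: "L <= Vhigh" "wds L <= real (pc) * real u" "lay (pc) (Thigh Un Vhigh - L) Fs ?R" "ar Fs = g * real (card ?Fc)"
 "wdt Fs = real (card ?Fc)" "ALL dg:set Fs. snd dg <= g" by blast
 have sub: "?R <= room p q {real c * g + sh<..<Ht}"
 proof
 fix z assume "z : ?R"
 then obtain a' b' where ab: "a' < b'" "{a'..<b'} <= ?Lay" "z : {real ph<..<real qh} \<times> {real a' * g + sh<..<real b' * g + sh}" by auto
 have "b' - 1 : {a'..<b'}" "a' : {a'..<b'}" using ab(1) by auto
 hence "b' - 1 : ?Lay" "a' : ?Lay" using ab(2) by blast+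
 hence bs: "b' <= m" "c <= a'" by auto
 let ?B = "bint (real ph, real a' * g + sh, real (qh - ph), real (b' - a') * g)"
 have zb: "z : ?B" using ab True by (auto simp: bint.simps of_nat_diff algebra_simps)
 have "?B Int Solid = {}"
 proof (rule solid_l)
 fix l r c' d assume o: "(l, r, c', d) : obc p q"
 have cd: "c' < d" using Ob obc_sub o by blast
 have "b' <= c' | d <= a'" using not_blk_range[of a' b', OF _ ab(1) o] ab(2) by auto
 hence "(real b' * g <= real c' * g & m3 <= c') | real d * g <= real a' * g" using obc_split[OF o] bs s_le_c ab(1) cd g by auto
 thus "?B Int bint (rbox (l, r, c', d)) = {}" unfolding rbox_def prod.case using ab(1) cd sh_pos
 by (intro bint_djy) (auto simp: of_nat_diff algebra_simps)
 next
 fix f assume f: "f : fx" "X f < q" "p < X f + w f"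
 show "?B Int bint (ibox f) = {}"
 proof (cases "lt f")
 case lf: True
 hence "b f <= a'" using tall_c[of f] f fx_sub bs by fastforce
 hence "real (b f) * g <= real a' * g" using g by auto
 thus ?thesis unfolding ibox_def rbox_def prod.case using ab(1) sh_pos lf it[of f] fx_sub f
 by (intro bint_djy) (auto simp: of_nat_diff algebra_simps lt_def)
 next
 case False
 hence "X f + w f <= ph | qh <= X f" using fx_out_h[OF f(1)] by (auto simp: lt_def isLow_def)
 thus ?thesis unfolding ibox_def rbox_def prod.case using True by (intro bint_djx) (auto simp: of_nat_diff)
 qed
 qed (use pl_ge ql_le True in auto)
 moreover have "real c * g <= real a' * g" "real b' * g <= real m * g" using bs g by (auto simp del: of_nat_mult)
 moreover have "real p <= real ph" "real qh <= real q" using pl_ge ql_le by auto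
 ultimately show "z : room p q {real c * g + sh<..<Ht}" using zb ab(3) by auto
 qed
 have fF: "finite ?Fc" by (rule finite_subset[of _ "{ph..<qh} \<times> {..<m}"]) auto
 let ?E = "{p..<p+u} Un {q-u..<q}"
 have "Fge <= ?Fc Un (?E \<times> {..<m})"
 proof
 fix z assume z: "z : Fge"
 then obtain x k where xk: "z = (x, k)" "(x, k) : Free" "p <= x" "x < q" "c <= k" by auto
 hence km: "k < m" "~ blk k" using Free_blk by (auto simp: Free_def)
 have nc: "ALL i:Thigh Un Vhigh. ~ (X i <= x & x < X i + w i & a i <= k & k < b i)" using xk(2) by (auto simp: Free_def Thigh_def Vhigh_def)
 show "z : ?Fc Un (?E \<times> {..<m})" using xk km nc pl_le ql_ge by (cases "ph <= x & x < qh") auto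
 qed
 hence "card (Fge) <= card (?Fc Un (?E \<times> {..<m}))" using fF by (intro card_mono) auto
 also have "... <= card ?Fc + card (?E \<times> {..<m})" by (rule card_Un_le)
 also have "card (?E \<times> {..<m}) = card ?E * m" by (simp add: card_cartesian_product)
 also have "card ?E <= 2 * u" using card_Un_le[of "{p..<p+u}" "{q-u..<q}"] by simp
 finally have "card (Fge) <= card ?Fc + 2 * u * m" by simp
 hence "real (card (Fge)) <= real (card ?Fc + 2 * u * m)" by (rule of_nat_mono)
 hence 0: "real (card (Fge)) <= real (card ?Fc) + real (2 * u * m)" by (simp only: of_nat_add)
 have 1: "g * real (card (Fge)) <= g * real (card ?Fc) + g * real (2 * u * m)" using mult_left_mono[OF 0, of g] g by (simp add: algebra_simps)
 have "card ?Fc <= card ({p..<q} \<times> {..<m})" using pl_ge ql_le by (intro card_mono) auto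
 hence "card ?Fc <= m * (q - p)" by (simp add: card_cartesian_product mult.commute)
 hence "real (card ?Fc) <= real (m * (q - p))" by (rule of_nat_mono)
 hence 2: "real (card ?Fc) <= real m * real (q - p)" by (simp only: of_nat_mult)
 show ?thesis
 proof (intro exI[of _ L] exI[of _ Fs] conjI)
 show "lay (pc) (Thigh Un Vhigh - L) Fs (room p q {real c * g + sh<..<Ht})" using lay_mono[OF L(3) order_refl sub] .
 show "g * real (card (Fge)) - g * real (2 * u * m) <= ar Fs" unfolding L(4) using 1 by linarith
 show "wdt Fs <= real m * real (q - p)" unfolding L(5) using 2 .
 qed (use L in blast)+
qed

end

section \<open>The middle zone: standing and hanging tall items\<close>

context slab
begin

text \<open>Items through both distinguished layers share no column with any other item of
  \<open>Tmid\<close>, so they can be pushed together into one block that begins at the leftmost of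
  them, \<open>sg\<close>.\<close>

definition Mv where "Mv = {i:Tmid. isMid i}"
definition sg :: nat where "sg = Min (insert q (X ` Mv))"
definition wM :: nat where "wM = sum w Mv"

text \<open>Low items left and right of \<open>sg\<close>, the block itself, and upper items left
  and right of \<open>sg\<close>.\<close>

definition Sk :: "nat => nat set" where "Sk k = (if k = 0 then {i:Tmid. isLow i & X i < sg} else if k = 1 then {i:Tmid. isLow i & sg <= X i}
 else if k = 2 then Mv else if k = 3 then {i:Tmid. ~ lt i & X i < sg} else {i:Tmid. ~ lt i & sg <= X i})"

text \<open>The left groups are packed against the left border of their range, the right groups
  directly behind the block.\<close>

definition base :: "nat => nat" where "base k = (if k = 0 then pl else if k = 2 then sg else if k = 3 then ph else sg + wM)"

definition tt :: "nat => nat" where "tt i = b i - a i"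
abbreviation "Skt kt == {i:Sk (fst kt). tt i = snd kt}"

definition fk :: "nat => nat => nat" where "fk k t = sum w {i:Sk k. tt i = t}"

lemma finTmid: "finite Tmid" using finTV by (auto simp: Tmid_def)
lemma finSk: "finite (Sk k)" using finTmid by (auto simp: Sk_def Mv_def)
lemma Sk_sub: "Sk k <= Tmid" by (auto simp: Sk_def Mv_def)

lemma Tmid_D: "i : Tmid ==> i : Tl & mv p q i & b i <= c & s <= a i & a i < b i & X i + w i <= q & p <= X i & 0 < w i"
 using tall_s[of i] mv_slab[of i] it[of i] w_pos'[of i] by (auto simp: Tmid_def mv_def)

lemma sg_cases: "sg = q & Mv = {} | (EX i:Mv. sg = X i)"
proof -
 have "finite Mv" using finTmid by (auto simp: Mv_def)
 hence "sg : insert q (X ` Mv)" unfolding sg_def by (intro Min_in) auto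
 moreover have "sg < q" if "Mv ~= {}"
 proof -
 obtain i where "i : Mv" using `Mv ~= {}` by blast
 hence "sg <= X i" "X i < q" using `finite Mv` Tmid_D[of i] unfolding sg_def by (auto intro!: Min_le simp: Mv_def)
 thus ?thesis by simp
 qed
 ultimately show ?thesis by (cases "Mv = {}") auto
qed

lemma sg_le: "i : Mv ==> sg <= X i" unfolding sg_def using finTmid by (intro Min_le) (auto simp: Mv_def)

lemma xd_Mv:
 assumes "i : Mv" "j : Tmid" "i ~= j" shows "X i + w i <= X j | X j + w j <= X i"
proof (cases "lt j")
 case True
 thus ?thesis using xd_lt[of i j] assms Tmid_D by (auto simp: Mv_def isMid_def lt_def)
next
 case False
 thus ?thesis using xd_nl[of i j] assms Tmid_D by (auto simp: Mv_def isMid_def isLow_def lt_def)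
qed

lemma left_of_sg:
 assumes "i : Tmid" "X i < sg" shows "X i + w i <= sg"
proof (cases "Mv = {}")
 case True
 thus ?thesis using sg_cases Tmid_D[OF assms(1)] by auto
next
 case False
 then obtain j where j: "j : Mv" "sg = X j" using sg_cases by blast
 hence "j ~= i" "0 < w j" using assms(2) Tmid_D[of j] by (auto simp: Mv_def)
 thus ?thesis using xd_Mv[OF j(1) assms(1)] j assms(2) by auto
qed

lemma Mv_lim:
 assumes "Mv ~= {}" shows "pl <= sg & ph <= sg & sg + wM <= ql & sg + wM <= qh"
proof -
 have b: "pl <= X i & X i + w i <= ql & ph <= X i & X i + w i <= qh" if "i : Mv" for i
 using mv_in_l[of i] mv_in_h[of i] that Tmid_D[of i] by (auto simp: Mv_def isMid_def isLow_def lt_def)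
 have fin: "finite Mv" using finTmid by (auto simp: Mv_def)
 have xd: "X i + w i <= X j | X j + w j <= X i" if "i : Mv" "j : Mv" "i ~= j" for i j using xd_Mv[OF that(1) _ that(3)] that(2) by (auto simp: Mv_def)
 have "sg + sum w Mv <= min ql qh" by (rule sum_intervals[OF fin assms, where X = X]) (use b sg_le xd in auto)
 thus ?thesis using sg_cases assms b by (auto simp: wM_def)
qed

text \<open>The items of \<open>Mv\<close> and of \<open>S\<close> are disjoint intervals between
  \<open>sg\<close> and \<open>B\<close>; hence there is room for the whole block followed by all of
  \<open>S\<close>. Since \<open>S\<close> is nonempty, \<open>sg\<close> is not the default value
  \<open>q\<close>, which gives \<open>Mv ~= {}\<close>.\<close>

lemma right_of_sg:
 assumes "S <= {i:Tmid. ~ isMid i & sg <= X i}" "S ~= {}" "!!i. i : S ==> X i + w i <= B" "!!i. i : Mv ==> X i + w i <= B"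
 "!!i j. i : S ==> j : S ==> i ~= j ==> X i + w i <= X j | X j + w j <= X i" shows "Mv ~= {} & sg + wM + sum w S <= B"
proof -
 obtain i where i: "i : S" using assms(2) by blast
 hence "sg < q" using assms(1) Tmid_D[of i] by fastforce
 hence ne: "Mv ~= {}" using sg_cases by auto
 have fin: "finite Mv" "finite S" using finTmid assms(1) by (auto simp: Mv_def intro: finite_subset)
 have d: "Mv Int S = {}" using assms(1) by (auto simp: Mv_def)
 have "sg + sum w (Mv Un S) <= B"
 proof (rule sum_intervals[where X = X])
 fix i j assume ij: "i : Mv Un S" "j : Mv Un S" "i ~= j"
 thus "X i + w i <= X j | X j + w j <= X i" using assms(5)[of i j] xd_Mv[of i j] xd_Mv[of j i] assms(1) by (auto simp: Mv_def)
 qed (use fin ne assms sg_le in auto)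
 thus ?thesis using ne d fin by (simp add: sum.union_disjoint wM_def)
qed

lemma xd_Sk:
 assumes "i : Sk k" "j : Sk k" "i ~= j" shows "X i + w i <= X j | X j + w j <= X i"
proof (cases "k = 2")
 case True
 thus ?thesis using assms xd_Mv Sk_sub by (auto simp: Sk_def Mv_def)
next
 case False
 consider "lt i & lt j" | "~ isLow i & ~ isLow j" using assms False by (auto simp: Sk_def isLow_def lt_def split: if_splits)
 thus ?thesis using xd_lt[of i j] xd_nl[of i j] assms Sk_sub Tmid_D by (metis subsetD)
qed

lemma base_lim:
 assumes "Sk k ~= {}" "k < 5" shows "(k : {0, 1, 2} --> pl <= base k & base k + sum w (Sk k) <= ql) &
 (k : {2, 3, 4} --> ph <= base k & base k + sum w (Sk k) <= qh) &
 (k : {0, 3} --> base k + sum w (Sk k) <= sg) & (k : {1, 4} --> base k = sg + wM) &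
 (k = 2 --> base k = sg & base k + sum w (Sk k) = sg + wM)"
proof -
 have lo: "pl <= X i & X i + w i <= ql" if "i : Tmid" "lt i" for i using mv_in_l[of i] Tmid_D[of i] that by auto
 have hi: "ph <= X i & X i + w i <= qh" if "i : Tmid" "~ isLow i" for i using mv_in_h[of i] Tmid_D[of i] that by auto
 have ll: "isLow i ==> lt i" "~ lt i ==> ~ isLow i" "isMid i ==> ~ isLow i" "isMid i ==> lt i" for i by (auto simp: isLow_def lt_def isMid_def)
 consider "k = 0" | "k = 1" | "k = 2" | "k = 3" | "k = 4" using assms(2) by linarith
 thus ?thesis
 proof cases
 case 1
 have S: "Sk k = {i:Tmid. isLow i & X i < sg}" using 1 by (simp add: Sk_def)
 have "pl + sum w (Sk k) <= min sg ql" by (rule sum_intervals[OF finSk assms(1) _ xd_Sk]) (use S lo ll left_of_sg in auto)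
 thus ?thesis using 1 by (simp add: base_def)
 next
 case 2
 have S: "Sk k = {i:Tmid. isLow i & sg <= X i}" using 2 by (simp add: Sk_def)
 have "Mv ~= {} & sg + wM + sum w (Sk k) <= ql" by (rule right_of_sg[OF _ assms(1) _ _ xd_Sk]) (use S lo ll in "auto simp: Mv_def")
 thus ?thesis using 2 Mv_lim by (simp add: base_def)
 next
 case 3
 have "Mv ~= {}" using assms 3 by (simp add: Sk_def)
 thus ?thesis using 3 Mv_lim by (simp add: base_def Sk_def wM_def)
 next
 case 4
 have S: "Sk k = {i:Tmid. ~ lt i & X i < sg}" using 4 by (simp add: Sk_def)
 have "ph + sum w (Sk k) <= min sg qh" by (rule sum_intervals[OF finSk assms(1) _ xd_Sk]) (use S hi ll left_of_sg in auto)
 thus ?thesis using 4 by (simp add: base_def)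
 next
 case 5
 have S: "Sk k = {i:Tmid. ~ lt i & sg <= X i}" using 5 by (simp add: Sk_def)
 have "Mv ~= {} & sg + wM + sum w (Sk k) <= qh" by (rule right_of_sg[OF _ assms(1) _ _ xd_Sk]) (use S hi ll in "auto simp: Mv_def")
 thus ?thesis using 5 Mv_lim by (simp add: base_def)
 qed
qed

lemma Tmid_Sk: "(UN k:{..<5}. Sk k) = Tmid"
proof (intro equalityI subsetI)
 fix i assume i: "i : Tmid"
 have "isLow i | isMid i | ~ lt i" by (auto simp: isLow_def isMid_def lt_def)
 thus "i : (UN k:{..<5}. Sk k)" using i by (cases "X i < sg") (auto simp: Sk_def Mv_def lessThan_Suc numeral_eq_Suc)
qed (use Sk_sub in auto)

lemma Sk_disjoint: "k < 5 ==> k' < 5 ==> k ~= k' ==> Sk k Int Sk k' = {}" by (auto simp: Sk_def Mv_def isLow_def isMid_def lt_def split: if_splits)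

text \<open>Items of one group with the same number of layers share a container.\<close>

definition KT :: "(nat * nat) set" where "KT = {(k, t). k < 5 & (EX i:Sk k. tt i = t)}"

lemma tt_le: "i : Tmid ==> tt i <= m" using Tmid_D[of i] c_le_m by (auto simp: tt_def)

lemma KT_sub: "KT <= {..<5} \<times> {..m}" using tt_le Sk_sub by (auto simp: KT_def)
lemma fin_KT: "finite KT" using KT_sub by (rule finite_subset) auto
lemma card_KT: "card KT <= 5 * (m + 1)" using card_mono[OF _ KT_sub] by (simp add: card_cartesian_product)

lemma KT_y:
 assumes "(k, t) : KT" shows "(k < 3 --> s + t <= c) & (k < 2 --> s + t <= 2 * m3) & (3 <= k --> s + t <= c & m3 + t <= c)"
proof -
 obtain i where i: "i : Sk k" "tt i = t" "k < 5" using assms by (auto simp: KT_def)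
 have "i : Tmid" using i Sk_sub by blast
 thus ?thesis using i Tmid_D[of i] by (auto simp: tt_def Sk_def isLow_def lt_def split: if_splits)
qed

lemma ex_bucket: "EX st. ALL k. (ALL t:{..m}. st k t + fk k t <= sum w (Sk k)) &
 (ALL t:{..m}. ALL t':{..m}. t ~= t' --> st k t + fk k t <= st k t' | st k t' + fk k t' <= st k t)"
proof -
 have "EX st. (ALL t:{..m}. st t + fk k t <= sum w (Sk k)) &
 (ALL t:{..m}. ALL t':{..m}. t ~= t' --> st t + fk k t <= st t' | st t' + fk k t' <= st t)" for k
 proof -
 have "sum (fk k) {..m} = sum w (Sk k)" unfolding fk_def by (rule sum.group[OF finSk]) (use tt_le Sk_sub in auto)
 thus ?thesis using bucket[of "{..m}" "fk k"] by simp
 qed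
 thus ?thesis by metis
qed

definition st :: "nat => nat => nat" where "st = (SOME st. ALL k. (ALL t:{..m}. st k t + fk k t <= sum w (Sk k)) &
 (ALL t:{..m}. ALL t':{..m}. t ~= t' --> st k t + fk k t <= st k t' | st k t' + fk k t' <= st k t))"

lemma st: "t <= m ==> st k t + fk k t <= sum w (Sk k)"
 "t <= m ==> t' <= m ==> t ~= t' ==> st k t + fk k t <= st k t' | st k t' + fk k t' <= st k t"
 using someI_ex[OF ex_bucket] unfolding st_def[symmetric] by auto

definition x0 :: "nat => nat => nat" where "x0 k t = base k + st k t"
text \<open>The low items and the block stand on the bottom of the zone, the upper items hang from
  its shifted top.\<close>

definition y0 :: "nat => nat => real" where "y0 k t = (if k < 3 then real s * g else real c * g + sh - real t * g)"
definition cbx :: "nat * nat => box" where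
 "cbx kt = (real (x0 (fst kt) (snd kt)), y0 (fst kt) (snd kt), real (fk (fst kt) (snd kt)), real (snd kt) * g)"

lemma KT_x:
 assumes "(k, t) : KT" shows "k < 5" "t <= m" "base k <= x0 k t" "x0 k t + fk k t <= base k + sum w (Sk k)" "Sk k ~= {}" "0 < fk k t"
proof -
 show k: "k < 5" "t <= m" using assms KT_sub by auto
 show "base k <= x0 k t" "x0 k t + fk k t <= base k + sum w (Sk k)" using st(1)[OF k(2), of k] by (auto simp: x0_def)
 obtain i where i: "i : Sk k" "tt i = t" using assms by (auto simp: KT_def)
 thus "Sk k ~= {}" by auto
 have "w i <= fk k t" unfolding fk_def using i finSk by (intro member_le_sum) auto
 moreover have "0 < w i" using i Sk_sub Tmid_D by blast
 ultimately show "0 < fk k t" by simp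
qed

lemma KT_lim:
 assumes "(k, t) : KT" shows "k < 3 ==> pl <= x0 k t & x0 k t + fk k t <= ql" "2 <= k ==> ph <= x0 k t & x0 k t + fk k t <= qh"
 using KT_x[OF assms] base_lim[of k] by (auto simp: less_Suc_eq numeral_eq_Suc)

lemma KT_slab: "(k, t) : KT ==> p <= x0 k t & x0 k t + fk k t <= q" using KT_lim[of k t] pl_ge ql_le KT_x(1)[of k t] by (cases "k < 3") fastforce+

text \<open>Containers of the lower row and of the upper row are separated by the height \<open>2 * m3 * g\<close>,
 except for the middle items, which are alone in their columns.\<close>

lemma KT_sep:
 assumes "(k, t) : KT" "(k', t') : KT" "(k, t) ~= (k', t')" "k <= k'"
 shows "x0 k t + fk k t <= x0 k' t' | x0 k' t' + fk k' t' <= x0 k t | k < 2 & 3 <= k'"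
proof (cases "k = k'")
 case True
 thus ?thesis using st(2)[of t t' k] KT_x(2)[OF assms(1)] KT_x(2)[OF assms(2)] assms(3) by (auto simp: x0_def)
next
 case False
 note x = KT_x[OF assms(1)] and x' = KT_x[OF assms(2)]
 note bl = base_lim[OF x(5) x(1)] and bl' = base_lim[OF x'(5) x'(1)]
 have "k < k'" using False assms(4) by simp
 then consider "k = 0" "k' = 1 | k' = 2" | "k = 1" "k' = 2" | "k = 2" "k' = 3" | "k = 2" "k' = 4"
 | "k = 3" "k' = 4" | "k < 2 & 3 <= k'" using x'(1) by linarith
 thus ?thesis
 proof cases
 case 1
 have "x0 k t + fk k t <= sg" using x(4) bl 1(1) by simp
 moreover have "sg <= x0 k' t'" using x'(3) bl' 1(2) by (elim disjE) simp_all
 ultimately show ?thesis by simp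
 next
 case 2
 have "sg + wM <= x0 k t" using x(3) bl 2(1) by simp
 moreover have "x0 k' t' + fk k' t' <= sg + wM" using x'(4) bl' 2(2) by simp
 ultimately show ?thesis by simp
 next
 case 3
 have "sg <= x0 k t" using x(3) bl 3(1) by simp
 moreover have "x0 k' t' + fk k' t' <= sg" using x'(4) bl' 3(2) by simp
 ultimately show ?thesis by simp
 next
 case 4
 have "x0 k t + fk k t <= sg + wM" using x(4) bl 4(1) by simp
 moreover have "sg + wM <= x0 k' t'" using x'(3) bl' 4(2) by simp
 ultimately show ?thesis by simp
 next
 case 5
 have "x0 k t + fk k t <= sg" using x(4) bl 5(1) by simp
 moreover have "sg <= x0 k' t'" using x'(3) bl' 5(2) by simp
 ultimately show ?thesis by simp
 qed simp
qed

text \<open>Pushed down to \<open>s\<close>, a low item still ends by the layer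
  \<open>2 * m3\<close>; pushed up to \<open>c\<close>, an upper item still starts at
  \<open>m3\<close> or above, and the shift adds at least \<open>m3 * g\<close>.\<close>

lemma cbx_y_disjoint:
 assumes "k < 2" "3 <= k'" "(k, t) : KT" "(k', t') : KT" shows "y0 k t + real t * g <= y0 k' t'"
proof -
 have "real (s + t) * g <= real (2 * m3) * g" "real (m3 + t') * g <= real c * g"
 using KT_y[OF assms(3)] KT_y[OF assms(4)] assms g by (auto simp del: of_nat_add of_nat_mult)
 thus ?thesis using assms sh by (auto simp: y0_def algebra_simps)
qed

lemma cbx_disjoint:
 assumes "kt : KT" "kt' : KT" "kt ~= kt'" shows "bint (cbx kt) Int bint (cbx kt') = {}"
proof -
 obtain k t k' t' where e: "kt = (k, t)" "kt' = (k', t')" by (cases kt; cases kt') auto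
 consider "x0 k t + fk k t <= x0 k' t' | x0 k' t' + fk k' t' <= x0 k t" | "k < 2 & 3 <= k'" | "k' < 2 & 3 <= k"
 using KT_sep[of k t k' t'] KT_sep[of k' t' k t] assms e by (cases "k <= k'") auto
 thus ?thesis
 proof cases
 case 1
 thus ?thesis unfolding e cbx_def by (intro bint_djx) auto
 next
 case 2
 thus ?thesis using cbx_y_disjoint[of k k' t t'] assms unfolding e cbx_def by (intro bint_djy) auto
 next
 case 3
 thus ?thesis using cbx_y_disjoint[of k' k t' t] assms unfolding e cbx_def by (intro bint_djy) auto
 qed
qed

lemma y0_range:
 assumes "(k, t) : KT" shows "real s * g <= y0 k t" "y0 k t + real t * g <= real c * g + sh"
proof -
 have "real (s + t) * g <= real c * g" using KT_y[OF assms] g by (cases "k < 3") (auto simp del: of_nat_add)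
 thus "real s * g <= y0 k t" "y0 k t + real t * g <= real c * g + sh" using sh_pos by (auto simp: y0_def algebra_simps)
qed

lemma mid_obc:
 assumes "(l, r, c', d) : obc p q" "real s * g <= y" "y + e <= real c * g + sh" shows "bint (x, y, dd, e) Int bint (rbox (l, r, c', d)) = {}"
proof -
 have cd: "c' < d" using Ob obc_sub assms(1) by blast
 have "(real d * g <= real s * g & c' < m3) | (real c * g <= real c' * g & m3 <= c')" using obc_split[OF assms(1)] g by auto
 thus ?thesis unfolding rbox_def prod.case using assms(2,3) cd by (intro bint_djy) (auto simp: of_nat_diff algebra_simps)
qed

lemma cbx_sub:
 assumes "kt : KT" shows "bint (cbx kt) <= room p q {real s * g<..<real c * g + sh}"
proof -
 obtain k t where e: "kt = (k, t)" by (cases kt) auto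
 note kt = assms[unfolded e]
 have x: "p <= x0 k t" "x0 k t + fk k t <= q" using KT_slab[OF kt] by auto
 have "bint (real (x0 k t), y0 k t, real (fk k t), real t * g) Int Solid = {}"
 proof (rule solid_l[OF x])
 fix f assume f: "f : fx" "X f < q" "p < X f + w f"
 have fT: "f : Tl" using f fx_sub by auto
 show "bint (real (x0 k t), y0 k t, real (fk k t), real t * g) Int bint (ibox f) = {}"
 proof (cases "k < 3 & lt f | 2 <= k & ~ isLow f")
 case True
 hence "x0 k t + fk k t <= X f | X f + w f <= x0 k t" using fx_out_l[OF f(1)] fx_out_h[OF f(1)] KT_lim[OF kt] by fastforce
 thus ?thesis unfolding ibox_def rbox_def prod.case by (intro bint_djx) (auto simp: of_nat_diff)
 next
 case False
 then consider "k < 2" "~ lt f" | "3 <= k" "isLow f" by (auto simp: isLow_def lt_def)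
 thus ?thesis
 proof cases
 case 1
 hence "real (s + t) * g <= real (2 * m3) * g" "real m3 * g <= real (a f) * g"
 using KT_y[OF kt] g by (auto simp: lt_def simp del: of_nat_add of_nat_mult)
 thus ?thesis unfolding ibox_def rbox_def prod.case using 1 sh by (intro bint_djy) (auto simp: y0_def lt_def algebra_simps)
 next
 case 2
 hence "real (b f) * g <= real (2 * m3) * g" "real (m3 + t) * g <= real c * g"
 using KT_y[OF kt] g by (auto simp: isLow_def simp del: of_nat_add of_nat_mult)
 thus ?thesis unfolding ibox_def rbox_def prod.case using 2 sh it[of f] fT
 by (intro bint_djy) (auto simp: y0_def isLow_def algebra_simps of_nat_diff)
 qed
 qed
 qed (use mid_obc y0_range[OF kt] in blast)
 moreover have "bint (real (x0 k t), y0 k t, real (fk k t), real t * g) <= {real p<..<real q} \<times> {real s * g<..<real c * g + sh}"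
 proof -
 have "real p <= real (x0 k t)" "real (x0 k t) + real (fk k t) <= real q" using x by linarith+
 thus ?thesis using y0_range[OF kt] by (auto simp: bint.simps)
 qed
 ultimately show ?thesis unfolding e cbx_def fst_conv snd_conv by blast
qed

lemma lay_Tmid:
 "lay (5 * (m + 1)) Tmid [] (UN kt:KT. bint (cbx kt))"
proof -
 have "lay (card KT) (UN kt:KT. Skt kt) [] (UN kt:KT. bint (cbx kt))"
 proof (rule lay_boxes[OF fin_KT])
 fix kt assume kt: "kt : KT"
 have "shelfable (Skt kt) (real (fk (fst kt) (snd kt))) (real (snd kt) * g)"
 proof (rule shelfable_row)
 show "Skt kt <= set ord" using Sk_sub Tmid_D TV by fastforce
 show "wds (Skt kt) <= real (fk (fst kt) (snd kt))" by (simp add: fk_def)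
 fix i assume "i : Skt kt"
 thus "rh i <= real (snd kt) * g" using it[of i] Sk_sub Tmid_D[of i] by (auto simp: tt_def)
 qed (use g in auto)
 thus "shelfable (Skt kt) (fst (dims (cbx kt))) (snd (dims (cbx kt))) &
 nnb (cbx kt)" using g by (simp add: cbx_def)
 next
 fix kt kt' assume *: "kt : KT" "kt' : KT" "kt ~= kt'"
 have "Skt kt Int Skt kt' = {}" using Sk_disjoint[of "fst kt" "fst kt'"] * KT_sub by (cases kt; cases kt'; cases "fst kt = fst kt'") auto
 thus "Skt kt Int Skt kt' = {} & bint (cbx kt) Int bint (cbx kt') = {}" using cbx_disjoint[OF *] by simp
 qed
 moreover have "(UN kt:KT. Skt kt) = Tmid" unfolding Tmid_Sk[symmetric] by (auto simp: KT_def)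
 ultimately have "lay (card KT) Tmid [] (UN kt:KT. bint (cbx kt))" by simp
 thus ?thesis using lay_mono card_KT by blast
qed

definition P1 where "P1 = max pl ph"
definition Q1 where "Q1 = min ql qh"
text \<open>The places where a container begins or ends. Between neighbouring ones a container
  covers all columns or none, so one gap opens between the standing and the hanging
  containers.\<close>

definition Qs :: "nat set" where
 "Qs = {P1, Q1} Un ((%kt. x0 (fst kt) (snd kt)) ` KT Un (%kt. x0 (fst kt) (snd kt) + fk (fst kt) (snd kt)) ` KT) Int {P1..Q1}"

definition cov :: "nat => nat => (nat * nat) set" where "cov x y = {(k, t):KT. x0 k t <= x & y <= x0 k t + fk k t}"

abbreviation "covl x y == {(k, t):cov x y. k < 3}"
abbreviation "covh x y == {(k, t):cov x y. 3 <= k}"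

definition lob :: "nat => nat => real" where "lob x y = Max (insert (real s * g) ((%(k, t). real s * g + real t * g) ` (covl x y)))"
definition hib :: "nat => nat => real" where "hib x y = Min (insert (real c * g + sh) ((%(k, t). real c * g + sh - real t * g) ` (covh x y)))"
definition bbx :: "nat * nat => box" where
 "bbx xy = (real (fst xy), lob (fst xy) (snd xy), real (snd xy - fst xy), hib (fst xy) (snd xy) - lob (fst xy) (snd xy))"

lemma fin_cov: "finite (cov x y)" by (rule finite_subset[OF _ fin_KT]) (auto simp: cov_def)

lemma fin_Qs: "finite Qs" using fin_KT by (auto simp: Qs_def)

lemma card_Qs: "card Qs <= 10 * (m + 1) + 2"
proof -
 have "card Qs <= card {P1, Q1} + card ((%kt. x0 (fst kt) (snd kt)) ` KT Un (%kt. x0 (fst kt) (snd kt) + fk (fst kt) (snd kt)) ` KT)"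
 unfolding Qs_def using fin_KT by (intro order_trans[OF card_Un_le] add_mono card_mono) auto
 also have "... <= 2 + (card KT + card KT)"
 using fin_KT by (intro add_mono order_trans[OF card_Un_le] card_image_le) (auto intro: order_trans[OF card_insert_le_m1])
 finally show ?thesis using card_KT by linarith
qed

text \<open>The critical case is a standing and a hanging container over the same columns. By
  \<open>KT_sep\<close> the standing one does not belong to the block, so the shift keeps the two
  apart.\<close>

lemma lob_le_hib:
 assumes "x < y" shows "lob x y <= hib x y"
proof -
 have f: "finite (covl x y)" "finite (covh x y)" using fin_cov by (auto intro: finite_subset[of _ "cov x y"])
 have 0: "real s * g <= real c * g" using s_le_c g by auto
 have 1: "real s * g + real t * g <= real c * g + sh" if "(k, t) : cov x y" "k < 3" for k t
 using y0_range(2)[of k t] that by (auto simp: cov_def y0_def)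
 have 2: "real s * g <= real c * g + sh - real t * g" if "(k, t) : cov x y" "3 <= k" for k t
 using y0_range(1)[of k t] that by (auto simp: cov_def y0_def)
 have 3: "real s * g + real t * g <= real c * g + sh - real t' * g"
 if "(k, t) : cov x y" "(k', t') : cov x y" "k < 3" "3 <= k'" for k t k' t'
 proof -
 have kt: "(k, t) : KT" "(k', t') : KT" using that by (auto simp: cov_def)
 have "k < 2 & 3 <= k'" using KT_sep[OF kt] that assms by (auto simp: cov_def)
 thus ?thesis using cbx_y_disjoint[of k k' t t'] kt by (auto simp: y0_def)
 qed
 have "lob x y : insert (real s * g) ((%(k, t). real s * g + real t * g) ` (covl x y))" unfolding lob_def using f by (intro Max_in) auto
 hence A: "lob x y = real s * g | (EX k t. (k, t) : cov x y & k < 3 & lob x y = real s * g + real t * g)" by auto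
 have "hib x y : insert (real c * g + sh) ((%(k, t). real c * g + sh - real t * g) ` (covh x y))" unfolding hib_def using f by (intro Min_in) auto
 hence B: "hib x y = real c * g + sh | (EX k t. (k, t) : cov x y & 3 <= k & hib x y = real c * g + sh - real t * g)" by auto
 show ?thesis
 proof (cases "lob x y = real s * g")
 case True
 thus ?thesis using B 0 2 sh_pos by fastforce
 next
 case False
 then obtain k t where kt: "(k, t) : cov x y" "k < 3" "lob x y = real s * g + real t * g" using A by blast
 thus ?thesis using B 1[OF kt(1,2)] 3[OF kt(1) _ kt(2)] by fastforce
 qed
qed

lemma lob_ge: "real s * g <= lob x y" unfolding lob_def using fin_cov by (intro Max_ge) (auto intro: finite_subset[of _ "cov x y"])
lemma hib_le: "hib x y <= real c * g + sh" unfolding hib_def using fin_cov by (intro Min_le) (auto intro: finite_subset[of _ "cov x y"])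

lemma lob_cov: "(k, t) : cov x y ==> k < 3 ==> y0 k t + real t * g <= lob x y"
 unfolding lob_def y0_def using fin_cov by (intro Max_ge) (auto intro: finite_subset[of _ "cov x y"])
lemma hib_cov: "(k, t) : cov x y ==> 3 <= k ==> hib x y <= y0 k t"
 unfolding hib_def y0_def using fin_cov by (intro Min_le) (auto intro: finite_subset[of _ "cov x y"])

text \<open>The maxima in \<open>lob\<close> and \<open>hib\<close> are replaced by sums over all
  covering containers, because these sums add up to areas.\<close>

lemma gap_ge: "real c * g + sh - real s * g - (SUM (k, t):cov x y. real t * g) <= hib x y - lob x y"
proof -
 have f: "finite (covl x y)" "finite (covh x y)" using fin_cov by (auto intro: finite_subset[of _ "cov x y"])
 have n: "0 <= (SUM (k, t):A. real t * g)" for A using g by (intro sum_nonneg) auto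
 have l: "lob x y <= real s * g + (SUM (k, t):covl x y. real t * g)"
 proof -
 have "real t * g <= (SUM (k, t):covl x y. real t * g)" if "(k, t) : covl x y" for k t
 using member_le_sum[OF that _ f(1), of "%(k, t). real t * g"] g by auto
 thus ?thesis unfolding lob_def using f n by auto
 qed
 have u: "real c * g + sh - (SUM (k, t):covh x y. real t * g) <= hib x y"
 proof -
 have "real t * g <= (SUM (k, t):covh x y. real t * g)" if "(k, t) : covh x y" for k t
 using member_le_sum[OF that _ f(2), of "%(k, t). real t * g"] g by auto
 thus ?thesis unfolding hib_def using f n by auto
 qed
 have "(SUM (k, t):cov x y. real t * g) = (SUM (k, t):covl x y. real t * g) + (SUM (k, t):covh x y. real t * g)"
 using f by (subst sum.union_disjoint[symmetric]) (auto intro!: sum.cong)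
 thus ?thesis using l u by linarith
qed

end

section \<open>The area of the gaps\<close>

context matrix
begin

definition cells :: "nat => (nat * nat) set" where "cells i = xiv i \<times> {a i..<b i}"

lemma card_cells: "card (cells i) = w i * (b i - a i)" by (simp add: cells_def card_cartesian_product)

lemma cells_disjoint: "i : Tl Un Vv ==> j : Tl Un Vv ==> i ~= j ==> cells i Int cells j = {}" using dj[of i j] by (auto simp: cells_def)

lemma sum_cells:
 assumes "S <= Tl Un Vv" shows "(SUM i:S. w i * (b i - a i)) = card (UN i:S. cells i)"
proof -
 have "finite S" using assms finTV finite_subset by blast
 moreover have "ALL i:S. finite (cells i)" by (simp add: cells_def)
 moreover have "ALL i:S. ALL j:S. i ~= j --> cells i Int cells j = {}" using cells_disjoint assms by blast
 ultimately show ?thesis by (subst card_UN_disjoint) (auto simp: card_cells)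
qed

lemma sum_cells_le:
 assumes "S <= Tl Un Vv" "finite C" "!!i. i : S ==> xiv i <= C" shows "(SUM i:S. w i * (b i - a i)) <= card C * m"
proof -
 have "(UN i:S. cells i) <= C \<times> {..<m}" using assms it by (fastforce simp: cells_def)
 hence "card (UN i:S. cells i) <= card (C \<times> {..<m})" using assms(2) by (intro card_mono) auto
 thus ?thesis unfolding sum_cells[OF assms(1)] by (simp add: card_cartesian_product)
qed

end

context slab
begin

lemma Qs_sub: "P1 < Q1 ==> Qs <= {P1..Q1}" by (auto simp: Qs_def)

lemma cuts_Qs_D:
 assumes "P1 < Q1" "(x, y) : cuts Qs" shows "P1 <= x" "x < y" "y <= Q1" using cuts_subset[of Qs] assms Qs_sub[OF assms(1)] by (auto simp: cuts_def)

lemma cuts_Qs_KT: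
 assumes "P1 < Q1" "(x, y) : cuts Qs" "(k, t) : KT" shows "(k, t) : cov x y | y <= x0 k t | x0 k t + fk k t <= x"
proof -
 note d = cuts_Qs_D[OF assms(1,2)]
 have side: "z <= x | y <= z" if "z = x0 k t | z = x0 k t + fk k t" for z
 proof (cases "P1 <= z & z <= Q1")
 case True
 hence "z : Qs" using that assms(3) unfolding Qs_def by force
 thus ?thesis using cuts_side[OF assms(2)] by blast
 next
 case False
 thus ?thesis using d by auto
 qed
 thus ?thesis using side[of "x0 k t"] side[of "x0 k t + fk k t"] assms(3) by (auto simp: cov_def)
qed

lemma bbx_cbx:
 assumes "P1 < Q1" "(x, y) : cuts Qs" "kt : KT" shows "bint (cbx kt) Int bint (bbx (x, y)) = {}"
proof -
 obtain k t where e: "kt = (k, t)" by (cases kt) auto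
 note d = cuts_Qs_D[OF assms(1,2)]
 show ?thesis
 proof (cases "(k, t) : cov x y")
 case True
 thus ?thesis using lob_cov[OF True] hib_cov[OF True] unfolding e cbx_def bbx_def by (cases "k < 3") (auto intro!: bint_djy)
 next
 case False
 hence "y <= x0 k t | x0 k t + fk k t <= x" using cuts_Qs_KT[OF assms(1,2)] assms(3) e by blast
 thus ?thesis unfolding e cbx_def bbx_def using d by (intro bint_djx) (auto simp: of_nat_diff)
 qed
qed

lemma bbx_sub:
 assumes "P1 < Q1" "(x, y) : cuts Qs" shows "bint (bbx (x, y)) <= room p q {real s * g<..<real c * g + sh}"
proof -
 note d = cuts_Qs_D[OF assms]
 have pq': "p <= x" "x + (y - x) <= q" using d pl_ge ql_le by (auto simp: P1_def Q1_def)
 have "bint (real x, lob x y, real (y - x), hib x y - lob x y) Int Solid = {}"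
 proof (rule solid_l[OF pq'])
 fix f assume f: "f : fx" "X f < q" "p < X f + w f"
 have "lt f | ~ isLow f" by (auto simp: isLow_def lt_def)
 hence "X f + w f <= P1 | Q1 <= X f" using fx_out_l[OF f(1)] fx_out_h[OF f(1)] by (auto simp: P1_def Q1_def)
 hence "X f + w f <= x | y <= X f" using d by auto
 thus "bint (real x, lob x y, real (y - x), hib x y - lob x y) Int bint (ibox f) = {}"
 unfolding ibox_def rbox_def prod.case using d by (intro bint_djx) (auto simp: of_nat_diff)
 qed (use mid_obc lob_ge hib_le in auto)
 moreover have "bint (real x, lob x y, real (y - x), hib x y - lob x y) <= {real p<..<real q} \<times> {real s * g<..<real c * g + sh}"
 proof -
 have "real p <= real x" "real x + real (y - x) <= real q" using pq' by linarith+
 thus ?thesis using lob_ge[of x y] hib_le[of x y] by (auto simp: bint.simps)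
 qed
 ultimately show ?thesis unfolding bbx_def by auto
qed

lemma bbx_disjoint:
 assumes "P1 < Q1" "xy : cuts Qs" "xy' : cuts Qs" "xy ~= xy'" shows "bint (bbx xy) Int bint (bbx xy') = {}"
proof -
 obtain x y x' y' where e: "xy = (x, y)" "xy' = (x', y')" by (cases xy; cases xy') auto
 have "y <= x' | y' <= x" using cuts_disjoint[of x y Qs x' y'] assms e by auto
 thus ?thesis using cuts_Qs_D[OF assms(1), of x y] cuts_Qs_D[OF assms(1), of x' y'] assms e
 unfolding bbx_def by (intro bint_djx) (auto simp: of_nat_diff)
qed

lemma sum_KT: "(SUM (k, t):KT. t * fk k t) = (SUM i:Tmid. w i * (b i - a i))"
proof -
 have "(SUM (k, t):KT. t * fk k t) = (SUM kt:KT. SUM i:Skt kt. w i * (b i - a i))"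
 unfolding fk_def by (intro sum.cong refl) (auto simp: sum_distrib_left tt_def mult.commute intro!: sum.cong)
 also have "... = (SUM i:(UN kt:KT. Skt kt). w i * (b i - a i))"
 proof (rule sum.UNION_disjoint[symmetric])
 show "ALL kt:KT. ALL kt':KT. kt ~= kt' --> Skt kt Int Skt kt' = {}"
 proof (intro ballI impI)
 fix kt kt' assume *: "kt : KT" "kt' : KT" "kt ~= kt'"
 thus "Skt kt Int Skt kt' = {}" using Sk_disjoint[of "fst kt" "fst kt'"] KT_sub by (cases kt; cases kt'; cases "fst kt = fst kt'") auto
 qed
 qed (use fin_KT finSk in auto)
 also have "(UN kt:KT. Skt kt) = Tmid" unfolding Tmid_Sk[symmetric] by (auto simp: KT_def)
 finally show ?thesis .
qed

lemma cov_len: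
 assumes "P1 < Q1" shows "(SUM (x, y):{(x, y):cuts Qs. kt : cov x y}. y - x) <= fk (fst kt) (snd kt)"
proof -
 let ?B = "{xy:cuts Qs. kt : cov (fst xy) (snd xy)}"
 have "(SUM xy:?B. snd xy - fst xy) = card (UN xy:?B. {fst xy..<snd xy})"
 proof (subst card_UN_disjoint)
 show "ALL i:?B. ALL j:?B. i ~= j --> {fst i..<snd i} Int {fst j..<snd j} = {}" using cuts_disjoint by fastforce
 qed (use finite_cuts[OF fin_Qs] in auto)
 also have "... <= card {x0 (fst kt) (snd kt)..<x0 (fst kt) (snd kt) + fk (fst kt) (snd kt)}" by (intro card_mono) (auto simp: cov_def)
 finally show ?thesis by (simp add: case_prod_unfold)
qed

text \<open>The zone has height \<open>(c - s) * g + sh\<close>. Apart from the tall items and at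
  most \<open>2 * u\<close> columns with protruding fixed items, all of it becomes gaps, and as
  every column has at most one gap, their total width is at most that of the slab. This bound on the
  width will limit the waste of the shelves.\<close>

lemma slab_mid:
 "EX Fs. lay (15 * (m + 1) + 2) Tmid Fs (room p q {real s * g<..<real c * g + sh}) &
 real (q - p) * (real (c - s) * g + sh) - g * real (SUM i:Tmid. w i * (b i - a i)) - 2 * real u * Ht
 <= ar Fs &
 wdt Fs <= real (q - p) & (ALL dg:set Fs. snd dg <= Ht)"
proof -
 define K0 where "K0 = real (c - s) * g + sh"
 have K0': "K0 = real c * g + sh - real s * g" using s_le_c by (simp add: K0_def of_nat_diff algebra_simps)
 have K0m: "K0 <= Ht" "0 <= K0"
 proof -
 have "real (c - s) * g <= real m * g" using c_le_m g by (intro mult_right_mono) auto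
 thus "K0 <= Ht" "0 <= K0" using sh_pos g by (auto simp: K0_def)
 qed
 have L1: "lay (5 * (m + 1)) Tmid [] (UN kt:KT. bint (cbx kt))" by (rule lay_Tmid)
 have sub1: "(UN kt:KT. bint (cbx kt)) <= room p q {real s * g<..<real c * g + sh}" using cbx_sub by (intro UN_least)
 define T0 where "T0 = real (SUM i:Tmid. w i * (b i - a i))"
 have T0: "0 <= T0" unfolding T0_def by (rule of_nat_0_le_iff)
 show ?thesis
 proof (cases "P1 < Q1")
 case False
 hence "q - p <= 2 * u" using pl_le ql_ge by (auto simp: P1_def Q1_def)
 hence "real (q - p) <= 2 * real u" by linarith
 hence "real (q - p) * K0 <= 2 * real u * Ht" using K0m by (intro mult_mono) auto
 hence "real (q - p) * K0 - g * T0 - 2 * real u * Ht <= 0" using T0 g by (smt (verit) mult_nonneg_nonneg)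
 moreover have "lay (15 * (m + 1) + 2) Tmid [] (room p q {real s * g<..<real c * g + sh})" by (rule lay_mono[OF L1 _ sub1]) simp
 ultimately show ?thesis unfolding K0_def[symmetric] T0_def[symmetric] by (intro exI[of _ "[]"]) simp
 next
 case True
 have lh: "lob x y <= hib x y" if "(x, y) : cuts Qs" for x y using lob_le_hib cuts_Qs_D[OF True that] by simp
 let ?BB = "UN xy:cuts Qs. bint (bbx xy)" and ?KB = "UN kt:KT. bint (cbx kt)" and ?l = "%xy. real (snd xy - fst xy)" and ?c = "%xy. SUM (k, t):cov (fst xy) (snd xy). real t * g"
 and ?w = "%kt xy. if kt : cov (fst xy) (snd xy) then real (snd xy - fst xy) * (real (snd kt) * g) else 0"
 have "EX Fs. lay (card (cuts Qs)) {} Fs ?BB &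
 lists_dims Fs (cuts Qs) bbx" by (rule lay_frees[OF finite_cuts[OF fin_Qs]]) (use lh bbx_disjoint[OF True] in "auto simp: bbx_def")
 then obtain Fs where Fs: "lay (card (cuts Qs)) {} Fs ?BB"
 "!!f :: _ => real. sum_list (map f Fs) = (SUM xy:cuts Qs. f (dims (bbx xy)))" "set Fs = (%xy. dims (bbx xy)) ` cuts Qs" by blast
 have "lay (5 * (m + 1) + card (cuts Qs)) (Tmid Un {}) ([] @ Fs) (?KB Un ?BB)"
 proof (rule lay_Un[OF L1 Fs(1)])
 show "?KB Int ?BB = {}" using bbx_cbx[OF True] by fastforce
 qed simp
 hence L2: "lay (5 * (m + 1) + card (cuts Qs)) Tmid Fs (?KB Un ?BB)" by simp
 have k: "5 * (m + 1) + card (cuts Qs) <= 15 * (m + 1) + 2" using card_cuts[OF fin_Qs] card_Qs by linarith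
 have sub2: "?BB <= room p q {real s * g<..<real c * g + sh}" using bbx_sub[OF True] by (intro UN_least) (auto simp del: Diff_iff)
 have L: "lay (15 * (m + 1) + 2) Tmid Fs (room p q {real s * g<..<real c * g + sh})" using lay_mono[OF L2 k Un_least[OF sub1 sub2]] .
 have fc: "finite (cuts Qs)" using finite_cuts[OF fin_Qs] .
 have PQ: "P1 : Qs" "Q1 : Qs" by (auto simp: Qs_def)
 have len: "(SUM xy:cuts Qs. ?l xy) = real (Q1 - P1)" using sum_cuts[OF fin_Qs Qs_sub[OF True] PQ, of "%_. 1::real"] by (simp add: case_prod_unfold)
 have D: "wdt Fs = real (Q1 - P1)" unfolding Fs(2) len[symmetric] by (simp add: bbx_def)
 \<comment> \<open>Double counting: the covering heights summed over the gaps amount to at most the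
   areas of the containers.\<close>
 have "(SUM xy:cuts Qs. ?l xy * ?c xy)
 = (SUM xy:cuts Qs. SUM kt:KT. ?w kt xy)"
 proof (intro sum.cong refl)
 fix xy
 have "cov (fst xy) (snd xy) = {kt:KT. kt : cov (fst xy) (snd xy)}" by (auto simp: cov_def)
 thus "?l xy * ?c xy =
 (SUM kt:KT. ?w kt xy)" using fin_KT by (subst sum.inter_filter[symmetric]) (auto simp: sum_distrib_left case_prod_unfold intro!: sum.cong)
 qed
 also have "... = (SUM kt:KT. SUM xy:cuts Qs. ?w kt xy)" by (rule sum.swap)
 also have "... <= (SUM kt:KT. real (fk (fst kt) (snd kt)) * (real (snd kt) * g))"
 proof (rule sum_mono)
 fix kt
 have "(SUM xy:cuts Qs. ?w kt xy)
 = (SUM xy:{xy:cuts Qs. kt : cov (fst xy) (snd xy)}. ?l xy) * (real (snd kt) * g)"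
 using fc by (subst sum.inter_filter[symmetric]) (auto simp: sum_distrib_right)
 also have "(SUM xy:{xy:cuts Qs. kt : cov (fst xy) (snd xy)}. ?l xy) = real (SUM (x, y):{(x, y):cuts Qs. kt : cov x y}. y - x)"
 by (simp add: case_prod_unfold)
 also have "... * (real (snd kt) * g) <= real (fk (fst kt) (snd kt)) * (real (snd kt) * g)"
 by (rule mult_right_mono[OF of_nat_mono[OF cov_len[OF True]]]) (use g in simp)
 finally show "(SUM xy:cuts Qs. ?w kt xy)
 <= real (fk (fst kt) (snd kt)) * (real (snd kt) * g)" .
 qed
 also have "... = g * real (SUM (k, t):KT. t * fk k t)" by (simp add: sum_distrib_left case_prod_unfold mult_ac)
 also have "... = g * T0" unfolding sum_KT T0_def ..
 finally have covT: "(SUM xy:cuts Qs. ?l xy * ?c xy) <= g * T0" .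
 have "ar Fs = (SUM xy:cuts Qs. ?l xy * (hib (fst xy) (snd xy) - lob (fst xy) (snd xy)))" unfolding Fs(2) by (simp add: bbx_def)
 also have "... >= (SUM xy:cuts Qs. ?l xy * (K0 - ?c xy))" using gap_ge K0' by (intro sum_mono mult_left_mono) auto
 also have "(SUM xy:cuts Qs. ?l xy * (K0 - ?c xy))
 = real (Q1 - P1) * K0 - (SUM xy:cuts Qs. ?l xy * ?c xy)" unfolding len[symmetric] by (simp add: right_diff_distrib sum_subtractf sum_distrib_right)
 finally have A: "real (Q1 - P1) * K0 - g * T0 <= ar Fs" using covT by linarith
 have "q - p <= (Q1 - P1) + 2 * u" using pl_le ql_ge by (auto simp: P1_def Q1_def)
 hence "real (q - p) <= real (Q1 - P1) + 2 * real u" by linarith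
 hence "real (q - p) * K0 <= (real (Q1 - P1) + 2 * real u) * K0" using K0m by (intro mult_right_mono)
 also have "... <= real (Q1 - P1) * K0 + 2 * real u * Ht" using K0m by (simp add: distrib_right mult_left_mono)
 finally have B: "real (q - p) * K0 - g * T0 - 2 * real u * Ht <= ar Fs" using A by linarith
 have C: "ALL dg:set Fs. snd dg <= Ht"
 proof
 fix dg assume "dg : set Fs"
 then obtain xy where "dg = dims (bbx xy)" using Fs(3) by auto
 hence "snd dg <= K0" using lob_ge[of "fst xy" "snd xy"] hib_le[of "fst xy" "snd xy"] K0' by (simp add: bbx_def)
 thus "snd dg <= Ht" using K0m by simp
 qed
 have "Q1 - P1 <= q - p" using pl_ge ql_le by (auto simp: P1_def Q1_def)
 hence E: "wdt Fs <= real (q - p)" unfolding D by simp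
 show ?thesis unfolding K0_def[symmetric] T0_def[symmetric] using L B C E by blast
 qed
qed

end

lemma sum_Un_le_nat:
 fixes f :: "'a => nat"
 assumes "finite A" "finite B" shows "sum f (A Un B) <= sum f A + sum f B" using sum.union_inter[OF assms, of f] by linarith

section \<open>Joining the zones and the slabs\<close>

context matrix
begin

definition slab_const :: real where "slab_const = Ht * (6 + 2 * real (pc))"

text \<open>\<open>Kp\<close> are the short items packed so far, \<open>F1\<close> the one-layer
  free boxes outside the middle zone and \<open>Fm\<close> its gaps. The number \<open>fm\<close> of
  free cells in the middle zone is debited to \<open>F1\<close> and credited to
  \<open>Fm\<close>.\<close>

definition slab_lay where "slab_lay p q Kp Tm F1 Fm R1 R2 fm <-> 0 <= fm & Tm <= Tmv p q & Kp <= Vmv p q &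
 lay (2 * pc) (Tmv p q - Tm Un Kp) F1 R1 & lay (15 * (m + 1) + 2) Tm Fm R2 & R1 Int R2 = {} &
 R1 Un R2 <= room p q {0<..<Ht} &
 g * (real (card (Fcol p q)) - fm) - real (2 * u * m) * g <= ar F1 &
 wdt F1 <= 2 * real m * real (q - p) & (ALL dg:set F1. snd dg <= g) &
 g * real (SUM i:Vmv p q - Kp. w i * (b i - a i)) + g * fm + real (q - p) * sh - real u * slab_const
 <= ar Fm &
 wdt Fm <= real (q - p) & (ALL dg:set Fm. snd dg <= Ht)"

end

context slab
begin

text \<open>The gaps of the middle zone have room for the short items not yet packed, for the former
  free cells of the zone and, in addition, for the height \<open>sh\<close> in every column, up to a
  loss proportional to \<open>u\<close>.\<close>

lemma slab_all: "EX Kp Tm F1 Fm R1 R2 fm. slab_lay p q Kp Tm F1 Fm R1 R2 fm"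
proof -
 obtain L1 F1 where low: "L1 <= Vlow" "wds L1 <= real (pc) * real u" "lay (pc) (Vlow - L1) F1 (room p q {0<..<real s * g})"
 "g * real (card (Flt)) <= ar F1" "wdt F1 <= real m * real (q - p)" "ALL dg:set F1. snd dg <= g" using slab_low by blast
 obtain L2 F2 where high: "L2 <= Vhigh" "wds L2 <= real (pc) * real u" "lay (pc) (Thigh Un Vhigh - L2) F2 (room p q {real c * g + sh<..<Ht})"
 "g * real (card (Fge)) - g * real (2 * u * m) <= ar F2" "wdt F2 <= real m * real (q - p)" "ALL dg:set F2. snd dg <= g" using slab_high by blast
 obtain Fm where mid: "lay (15 * (m + 1) + 2) Tmid Fm (room p q {real s * g<..<real c * g + sh})"
 "real (q - p) * (real (c - s) * g + sh) - g * real (SUM i:Tmid. w i * (b i - a i)) - 2 * real u * Ht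
 <= ar Fm" "wdt Fm <= real (q - p)" "ALL dg:set Fm. snd dg <= Ht" using slab_mid by blast
 let ?Rl = "room p q {0<..<real s * g}" and ?Rh = "room p q {real c * g + sh<..<Ht}" and ?Rm = "room p q {real s * g<..<real c * g + sh}"
 have sc: "real s * g <= real c * g" "real c * g <= real m * g" using s_le_c c_le_m g by (auto simp del: of_nat_mult)
 have rdj: "?Rl Int ?Rh = {}" "(?Rl Un ?Rh) Int ?Rm = {}" using sc sh_pos by auto
 have rsub: "(?Rl Un ?Rh) Un ?Rm <= room p q {0<..<Ht}"
 proof -
 have "0 <= real s * g" using g by simp
 thus ?thesis using sc sh_pos by auto
 qed
 define Kp where "Kp = (Vlow - L1) Un (Vhigh - L2)"
 have VV: "Vlow Int Vhigh = {}" using s_le_c it by (fastforce simp: Vlow_def Vhigh_def)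
 have TV': "Thigh Int Vv = {}" using TV by (auto simp: Thigh_def)
 have Tsplit: "Tmv p q = Tmid Un Thigh" "Tmid Int Thigh = {}"
 proof -
 show "Tmv p q = Tmid Un Thigh" using item_c mv_slab by (auto simp: Tmid_def Thigh_def)
 show "Tmid Int Thigh = {}" using it by (fastforce simp: Tmid_def Thigh_def)
 qed
 have "lay (pc + pc) ((Vlow - L1) Un (Thigh Un Vhigh - L2)) (F1 @ F2) (?Rl Un ?Rh)"
 by (rule lay_Un[OF low(3) high(3) _ rdj(1)]) (use VV TV' in "auto simp: Vlow_def")
 moreover have "(Vlow - L1) Un (Thigh Un Vhigh - L2) = Tmv p q - Tmid Un Kp" using Tsplit high(1) TV' by (auto simp: Kp_def Vhigh_def)
 ultimately have layA: "lay (2 * pc) (Tmv p q - Tmid Un Kp) (F1 @ F2) (?Rl Un ?Rh)" by (simp add: mult_2)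
 define fm where "fm = real (card Fmid)"
 have fsplit: "Fcol p q = Flt Un
 (Fmid Un Fge)" using s_le_c by auto
 have "card (Fcol p q) <= card (Flt) +
 (card Fmid + card (Fge))" unfolding fsplit by (rule order_trans[OF card_Un_le add_left_mono[OF card_Un_le]])
 hence fsum: "real (card (Fcol p q)) - fm <= real (card (Flt))
 + real (card (Fge))" unfolding fm_def by linarith
 have A1: "g * (real (card (Fcol p q)) - fm) - real (2 * u * m) * g <= ar (F1 @ F2)"
 using low(4) high(4) mult_left_mono[OF fsum, of g] g by (simp add: algebra_simps)
 have D1: "wdt (F1 @ F2) <= 2 * real m * real (q - p)" using low(5) high(5) by simp
 define Vm where "Vm = {i:Vv. mv p q i & s <= a i & b i <= c}"
 \<comment> \<open>Short items above \<open>c\<close> that stick out of the columns used by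
   \<open>slab_high\<close>; they lie within \<open>2 * u\<close> columns of the borders of the
   slab.\<close>
 define Ve where "Ve = {i:Vv. mv p q i & c <= a i & ~ (ph <= X i & X i + w i <= qh)}"
 have fV: "finite S" if "S <= Vv" for S using that finTV finite_subset by blast
 let ?c = "%i. w i * (b i - a i)"
 have "Vmv p q - Kp <= Vm Un (Ve Un (L1 Un L2))"
 proof
 fix i assume i: "i : Vmv p q - Kp"
 hence "b i <= s | s <= a i" "b i <= c | c <= a i" using item_s[of i] item_c[of i] mv_slab[of i] by auto
 thus "i : Vm Un (Ve Un (L1 Un L2))" using i by (auto simp: Kp_def Vlow_def Vhigh_def Vm_def Ve_def)
 qed
 moreover have LV: "L1 <= Vv" "L2 <= Vv" "Vm <= Vv" "Ve <= Vv" using low(1) high(1) by (auto simp: Vlow_def Vhigh_def Vm_def Ve_def)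
 ultimately have "sum ?c (Vmv p q - Kp) <= sum ?c (Vm Un (Ve Un (L1 Un L2)))" using fV by (intro sum_mono2) auto
 also have "... <= sum ?c Vm + (sum ?c Ve + (sum ?c L1 + sum ?c L2))"
 using sum_Un_le_nat[of Vm "Ve Un (L1 Un L2)" ?c] sum_Un_le_nat[of Ve "L1 Un L2" ?c] sum_Un_le_nat[of L1 L2 ?c]
 fV[OF LV(1)] fV[OF LV(2)] fV[OF LV(3)] fV[OF LV(4)] by simp
 finally have split: "sum ?c (Vmv p q - Kp) <= sum ?c Vm + (sum ?c Ve + (sum ?c L1 + sum ?c L2))" .
 have Lle: "real (sum ?c L) <= real m * (real (pc) * real u)" if "L <= Vv" "wds L <= real (pc) * real u" for L
 proof -
 have "real (sum ?c L) <= (SUM i:L. real m * rw i)" unfolding of_nat_sum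
 proof (rule sum_mono)
 fix i assume "i : L"
 hence "i : Tl Un Vv" using that(1) by blast
 hence "b i <= m" using it[of i] by blast
 hence "b i - a i <= m" by linarith
 hence "w i * (b i - a i) <= m * w i" by (metis mult.commute mult_le_mono1)
 thus "real (w i * (b i - a i)) <= real m * rw i" by (metis of_nat_mono of_nat_mult)
 qed
 also have "... = real m * wds L" by (simp add: sum_distrib_left)
 also have "... <= real m * (real (pc) * real u)" using that(2) by (intro mult_left_mono) auto
 finally show ?thesis .
 qed
 have Vele: "sum ?c Ve <= 4 * u * m"
 proof -
 have "sum ?c Ve <= card ({p..<p + 2 * u} Un {q - 2 * u..<q}) * m"
 proof (rule sum_cells_le)
 fix i assume i: "i : Ve"
 hence "w i <= u" "p <= X i" "X i + w i <= q" "X i < ph | qh < X i + w i" using it[of i] by (auto simp: Ve_def mv_def)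
 thus "xiv i <= {p..<p + 2 * u} Un {q - 2 * u..<q}" using pl_le ql_ge by auto
 qed (use LV in auto)
 moreover have "card ({p..<p + 2 * u} Un {q - 2 * u..<q}) <= 4 * u" using card_Un_le[of "{p..<p + 2 * u}" "{q - 2 * u..<q}"] by simp
 ultimately show ?thesis by (meson mult_le_mono1 order_trans)
 qed
 \<comment> \<open>Tall items, short items and free cells occupy disjoint cells of the zone.\<close>
 have midc: "sum ?c Tmid + sum ?c Vm + card Fmid <= (q - p) * (c - s)"
 proof -
 have TM: "Tmid Un Vm <= Tl Un Vv" "Tmid Int Vm = {}" using TV by (auto simp: Tmid_def Vm_def)
 let ?C = "UN i:Tmid Un Vm. cells i" and ?F = "Fmid"
 have "sum ?c Tmid + sum ?c Vm = sum ?c (Tmid Un Vm)" using TM fV[of Vm] finTmid by (subst sum.union_disjoint) (auto simp: Vm_def)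
 also have "... = card ?C" by (rule sum_cells[OF TM(1)])
 finally have e: "sum ?c Tmid + sum ?c Vm = card ?C" .
 have fin: "finite ?C" "finite ?F" using fin_Free fV[of Vm] finTmid by (auto simp: Vm_def cells_def intro: finite_subset[OF _ fin_Free])
 have "?C Int ?F = {}" using TM(1) by (auto simp: cells_def Free_def)
 hence "card ?C + card ?F = card (?C Un ?F)" using fin by (simp add: card_Un_disjoint)
 also have "... <= card ({p..<q} \<times> {s..<c})"
 proof (rule card_mono)
 have "cells i <= {p..<q} \<times> {s..<c}" if "i : Tmid Un Vm" for i using that Tmid_D[of i] by (auto simp: cells_def Vm_def mv_def)
 thus "?C Un ?F <= {p..<q} \<times> {s..<c}" by auto
 qed simp
 finally show ?thesis unfolding e by (simp add: card_cartesian_product)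
 qed
 have "real (sum ?c Tmid) + real (sum ?c Vm) + fm <= real (q - p) * real (c - s)"
 using of_nat_mono[OF midc, where 'a = real] unfolding fm_def by (simp only: of_nat_add of_nat_mult)
 hence "g * (real (sum ?c Tmid) + real (sum ?c Vm) + fm) <= g * (real (q - p) * real (c - s))" using g by (intro mult_left_mono) auto
 hence A2: "g * real (sum ?c Vm) + g * fm + real (q - p) * sh - 2 * real u * Ht <= ar Fm"
 using mid(2) by (simp only: distrib_left right_diff_distrib mult_ac)
 have "real (sum ?c (Vmv p q - Kp)) <= real (sum ?c Vm) + (real (4 * u * m) + 2 * (real m * (real (pc) * real u)))"
 using of_nat_mono[OF split, where 'a = real] of_nat_mono[OF Vele, where 'a = real] Lle[OF LV(1) low(2)] Lle[OF LV(2) high(2)]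
 by (simp only: of_nat_add)
 hence "g * real (sum ?c (Vmv p q - Kp)) <= g * (real (sum ?c Vm) + (real (4 * u * m) + 2 * (real m * (real (pc) * real u))))"
 using g by (intro mult_left_mono) auto
 also have "... = g * real (sum ?c Vm) + real u * (real m * g) * (4 + 2 * real (pc))" by (simp add: algebra_simps)
 also have "... <= g * real (sum ?c Vm) + real u * Ht * (4 + 2 * real (pc))" using sh_pos by (intro add_left_mono mult_right_mono mult_left_mono) auto
 finally have A3: "g * real (sum ?c (Vmv p q - Kp)) + g * fm + real (q - p) * sh - real u * slab_const <= ar Fm"
 using A2 unfolding slab_const_def by (simp add: algebra_simps)
 have fm0: "0 <= fm" by (simp add: fm_def)
 have Tms: "Tmid <= Tmv p q" using Tsplit by blast
 have Kps: "Kp <= Vmv p q" by (auto simp: Kp_def Vlow_def Vhigh_def)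
 have g1: "ALL dg:set (F1 @ F2). snd dg <= g" using low(6) high(6) by auto
 show ?thesis unfolding slab_lay_def
 by (intro exI[of _ Kp] exI[of _ Tmid] exI[of _ "F1 @ F2"] exI[of _ Fm] exI[of _ "?Rl Un ?Rh"] exI[of _ ?Rm] exI[of _ fm] conjI)
 (fact fm0 Tms Kps layA mid(1) rdj(2) rsub A1 D1 g1 A3 mid(3) mid(4))+
qed

end

context matrix
begin

lemma slabI: "(p, q) : Sl ==> slab ord w h m3 W u g sh X a b Ob Tl Vv p q" by unfold_locales

lemma mv_unique:
 assumes "(p, q) : Sl" "(p', q') : Sl" "mv p q i" "mv p' q' i" "0 < w i" shows "(p, q) = (p', q')"
 using cuts_disjoint[of p q bps p' q'] assms by (fastforce simp: Sl_def mv_def)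

lemma crossing:
 assumes "i : Tl Un Vv" "ALL (p, q):Sl. ~ mv p q i" shows "EX z:bps. X i < z & z < X i + w i"
proof -
 have "X i < W" using it[OF assms(1)] w_pos'[OF assms(1)] by linarith
 then obtain p q where pq: "(p, q) : Sl" "p <= X i" "X i < q" using cuts_cover[OF fin_bps bps_ends, of "X i"] unfolding Sl_def by auto
 hence "q < X i + w i" using assms(2) by (auto simp: mv_def)
 moreover have "q : bps" using pq(1) by (auto simp: Sl_def cuts_def)
 ultimately show ?thesis using pq by blast
qed

text \<open>Every fixed item crosses a breakpoint, and over a breakpoint there is at most one with
  \<open>lt\<close> and at most one without.\<close>

lemma card_fx: "card fx <= 2 * card bps"
proof -
 define z where "z i = (SOME z. z : bps & X i < z & z < X i + w i)" for i
 have z: "z i : bps & X i < z i & z i < X i + w i" if "i : fx" for i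
 proof -
 have "EX z. z : bps & X i < z & z < X i + w i" using crossing[of i] that fx_sub by (auto simp: fx_def)
 thus ?thesis unfolding z_def by (rule someI_ex)
 qed
 have "inj_on (%i. (z i, lt i)) fx"
 proof (rule inj_onI, rule ccontr)
 fix i j assume *: "i : fx" "j : fx" "(z i, lt i) = (z j, lt j)" "i ~= j"
 have "i : Tl" "j : Tl" using * fx_sub by auto
 hence "X i + w i <= X j | X j + w j <= X i" using xd_lt[of i j] xd_nl[of i j] * by (cases "lt i") (auto simp: lt_def isLow_def)
 thus False using z[OF *(1)] z[OF *(2)] *(3) by auto
 qed
 hence "card fx <= card (bps \<times> (UNIV :: bool set))" by (rule card_inj_on_le) (use z fin_bps in auto)
 thus ?thesis by (simp add: card_cartesian_product mult.commute)
qed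

lemma card_Sl: "card Sl <= card bps" unfolding Sl_def by (rule card_cuts[OF fin_bps])

text \<open>Per breakpoint: two uses of \<open>part\<close>, the boxes of a middle zone, once more
  as many for the splitting of its gaps, and two fixed items.\<close>

definition mcount :: nat where "mcount = 2 * pc + 2 * (15 * (m + 1) + 2) + 2"

definition mloss :: real where "mloss = Ht * (12 + 2 * real (pc) + 2 * real (15 * (m + 1) + 2))"

lemma sum_list_bound: "(!!x. x : set xs ==> f x <= (c::real)) ==> (SUM x<-xs. f x) <= real (length xs) * c"
 by (induct xs) (auto simp: algebra_simps intro!: add_mono)

text \<open>The items of \<open>Vh\<close> are packed into the fraction \<open>th\<close> of the height of each band that exceeds
 \<open>h0\<close>, so that the rest of the bands remains free.\<close>

lemma fill_bands:
 assumes L: "lay k A Fs R" and V: "Vh <= Vv" "A Int Vh = {}" and G: "!!dg. dg : set Fs ==> snd dg <= M" and D: "wdt Fs <= rW"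
 and big: "area Vh + rW * (real m3 * g) + real u * real (length Fs) * M <= ar Fs" and M: "0 <= M" shows "EX F'. lay (k + length Fs) (A Un Vh) F' R &
 ar Fs - rW * (real m3 * g) - area Vh - real u * real (length Fs) * M <= ar F' &
 wdt F' <= rW & (ALL dg:set F'. snd dg <= M)"
proof -
 define h0 where "h0 = real m3 * g"
 have h0: "0 <= h0" using g by (simp add: h0_def)
 define ex where "ex dg = max 0 (snd dg - h0)" for dg :: "real * real"
 define P where "P = (SUM dg<-Fs. fst dg * ex dg)"
 define E where "E = real u * real (length Fs) * M"
 have nn: "0 <= fst dg & 0 <= snd dg" if "dg : set Fs" for dg using lay_dims[OF L that] .
 have "ar Fs - wdt Fs * h0 = (SUM dg<-Fs. fst dg * (snd dg - h0))" by (simp add: right_diff_distrib sum_list_subtractf sum_list_mult_const)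
 also have "... <= P" unfolding P_def ex_def using nn by (intro sum_list_mono mult_left_mono) auto
 finally have P: "ar Fs - rW * h0 <= P" using mult_right_mono[OF D h0] by linarith
 have E0: "0 <= E" using M by (simp add: E_def)
 have Vo: "Vh <= set ord" using V TV by blast
 have aV: "0 <= area Vh" unfolding area_def by (intro sum_nonneg) auto
 define Q where "Q = P - E"
 have Q: "area Vh <= Q" using P big unfolding Q_def E_def h0_def by linarith
 \<comment> \<open>If \<open>Q = 0\<close> then \<open>area Vh = 0\<close>, so the value 0 is
   right.\<close>
 define th where "th = (if Q = 0 then 0 else area Vh / Q)"
 have th: "0 <= th" "th <= 1" "th * Q = area Vh" using Q aV by (auto simp: th_def divide_le_eq)
 define e where "e dg = (if h0 < snd dg then h0 + th * (snd dg - h0) else 0)" for dg :: "real * real"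
 have e: "0 <= e dg & e dg <= snd dg" if "dg : set Fs" for dg
 proof (cases "h0 < snd dg")
 case True
 have "0 <= snd dg - h0" using True by simp
 from add_left_mono[OF mult_right_mono[OF th(2) this], of h0] have "h0 + th * (snd dg - h0) <= h0 + 1 * (snd dg - h0)" .
 also have "... = snd dg" by simp
 finally have "h0 + th * (snd dg - h0) <= snd dg" .
 moreover have "0 <= h0 + th * (snd dg - h0)" using True h0 th(1) by simp
 moreover have "e dg = h0 + th * (snd dg - h0)" using True by (simp add: e_def)
 ultimately show ?thesis by metis
 qed (use nn[OF that] in "auto simp: e_def")
 have exM: "ex dg <= M" if "dg : set Fs" for dg using G[OF that] h0 M by (auto simp: ex_def)
 have "th * Q <= (SUM dg<-Fs. cap (real u) h0 (fst dg, e dg))"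
 proof -
 have "th * Q <= th * (P - real u * (SUM dg<-Fs. ex dg))"
 proof -
 have "(SUM dg<-Fs. ex dg) <= real (length Fs) * M" by (rule sum_list_bound) (rule exM)
 hence "real u * (SUM dg<-Fs. ex dg) <= E" unfolding E_def by (simp add: mult.assoc mult_left_mono)
 thus ?thesis using th(1) unfolding Q_def by (intro mult_left_mono) auto
 qed
 also have "... = (SUM dg<-Fs. (fst dg - real u) * (th * ex dg))"
 unfolding P_def by (simp add: sum_list_const_mult[symmetric] sum_list_subtractf[symmetric] algebra_simps)
 also have "... <= (SUM dg<-Fs. cap (real u) h0 (fst dg, e dg))"
 proof (rule sum_list_mono)
 fix dg assume dg: "dg : set Fs"
 have "th * ex dg = max 0 (e dg - h0)" using th(1) h0 by (auto simp: ex_def e_def max_def mult_nonneg_nonpos)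
 moreover have "(fst dg - real u) * (th * ex dg) <= max 0 (fst dg - real u) * (th * ex dg)"
 using th(1) by (intro mult_right_mono) (auto simp: ex_def)
 ultimately show "(fst dg - real u) * (th * ex dg) <= cap (real u) h0 (fst dg, e dg)" by (simp add: cap_def)
 qed
 finally show ?thesis .
 qed
 hence fillc: "area Vh <= (SUM dg<-Fs. cap (real u) h0 (fst dg, e dg))" using th(3) by simp
 define F' where "F' = map (%dg. (fst dg, snd dg - e dg)) Fs"
 have "lay (k + length Fs) (A Un Vh) ([] @ map (%dg. (fst dg, snd dg - e dg)) Fs) R"
 proof (rule lay_fill_split[OF _ Vo V(2) _ _ e fillc])
 show "lay k A ([] @ Fs) R" using L by simp
 fix i assume "i : Vh"
 thus "rw i <= real u" "rh i <= h0" using it[of i] short[of i] V(1) by (auto simp: h0_def)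
 qed
 hence "lay (k + length Fs) (A Un Vh) F' R" by (simp add: F'_def)
 moreover have "P - area Vh - E <= ar F'"
 proof -
 have "P - th * P = (SUM dg<-Fs. fst dg * ((1 - th) * ex dg))"
 unfolding P_def by (simp add: sum_list_const_mult[symmetric] sum_list_subtractf[symmetric] algebra_simps)
 also have "... <= (SUM dg<-Fs. fst dg * (snd dg - e dg))"
 proof (rule sum_list_mono, rule mult_left_mono)
 fix dg assume "dg : set Fs"
 thus "(1 - th) * ex dg <= snd dg - e dg" "0 <= fst dg" using nn[of dg] by (auto simp: ex_def e_def algebra_simps)
 qed
 finally have "P - th * P <= ar F'" by (simp add: F'_def o_def)
 moreover have "th * P = area Vh + th * E" using th(3) unfolding Q_def by (simp add: algebra_simps)
 moreover have "th * E <= E" using th E0 mult_right_mono[of th 1 E] by simp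
 ultimately show ?thesis by linarith
 qed
 moreover have "wdt F' <= rW" using D by (simp add: F'_def o_def)
 moreover have "ALL dg:set F'. snd dg <= M" using G e by (fastforce simp: F'_def)
 ultimately show ?thesis using P unfolding E_def h0_def by (intro exI[of _ F']) auto
qed

text \<open>Packing the short items into the gaps wastes \<open>m3 * g\<close> over a total width of
  at most \<open>rW\<close>, while the shift has gained \<open>sh\<close> in every column. The
  difference remains as a surplus of free area besides the original free cells; \<open>mloss\<close>
  is the loss per breakpoint and unit of item width.\<close>

theorem matrix_layout:
 assumes cond: "real u * real (card bps) * mloss <= rW * (sh - real m3 * g)" shows "EX Fs. lay (card bps * mcount) (Tl Un Vv) Fs (strip) &
 g * real (card Free) + rW * (sh - real m3 * g) - real u * real (card bps) * mloss <= ar Fs &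
 wdt Fs <= rW * (2 * real m + 1) & (ALL dg:set Fs. snd dg <= Ht)"
proof -
 define M where "M = Ht"
 have M0: "0 <= M" "real m * g <= M" "g <= M"
 proof -
 have "g <= real m * g" using mult_right_mono[of 1 "real m" g] m3 g by simp
 thus "0 <= M" "real m * g <= M" "g <= M" using g sh_pos unfolding M_def by linarith+
 qed
 define sc where "sc = M * (6 + 2 * real (pc))"
 let ?c = "%i. w i * (b i - a i)" and ?T = "%J. Tmv (fst J) (snd J)" and ?V = "%J. Vmv (fst J) (snd J)" and ?F = "%J. Fcol (fst J) (snd J)"
 have sc: "slab_const = sc" by (simp add: slab_const_def sc_def M_def)
 have "EX Kp Tm F1 Fm R1 R2 fm. slab_lay (fst J) (snd J) Kp Tm F1 Fm R1 R2 fm" if "J : Sl" for J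
 proof -
 obtain p q where J: "J = (p, q)" by (cases J) auto
 interpret S: slab ord w h m3 W u g sh X a b Ob Tl Vv p q using slabI that J by simp
 show ?thesis using S.slab_all unfolding J fst_conv snd_conv .
 qed
 then obtain Kp Tm F1 Fm R1 R2 fm where q: "!!J. J : Sl ==> slab_lay (fst J) (snd J) (Kp J) (Tm J) (F1 J) (Fm J) (R1 J) (R2 J) (fm J)" by metis
 note qq = q[unfolded slab_lay_def sc]
 let ?TK = "UN J:Sl. ?T J - Tm J Un Kp J" and ?VK = "UN J:Sl. ?V J - Kp J" and ?R1 = "UN J:Sl. R1 J" and ?R2 = "UN J:Sl. R2 J"
 and ?fx = "UN i:fx. bint (ibox i)"
 have fm: "0 <= fm J" if "J : Sl" for J using qq[OF that] by (elim conjE)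
 have Tm: "Tm J <= ?T J" if "J : Sl" for J using qq[OF that] by (elim conjE)
 have Kp: "Kp J <= ?V J" if "J : Sl" for J using qq[OF that] by (elim conjE)
 have l1: "lay (2 * pc) (?T J - Tm J Un Kp J) (F1 J) (R1 J)" if "J : Sl" for J using qq[OF that] by (elim conjE)
 have l2: "lay (15 * (m + 1) + 2) (Tm J) (Fm J) (R2 J)" if "J : Sl" for J using qq[OF that] by (elim conjE)
 have RR: "R1 J Int R2 J = {}" if "J : Sl" for J using qq[OF that] by (elim conjE)
 have Rs: "R1 J Un R2 J <= room (fst J) (snd J) {0<..<Ht}" if "J : Sl" for J using qq[OF that] by (elim conjE)
 have A1: "g * (real (card (?F J)) - fm J) - real (2 * u * m) * g <= ar (F1 J)" if "J : Sl" for J using qq[OF that] by (elim conjE)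
 have D1: "wdt (F1 J) <= 2 * real m * real (snd J - fst J)" if "J : Sl" for J using qq[OF that] by (elim conjE)
 have G1: "ALL dg:set (F1 J). snd dg <= g" if "J : Sl" for J using qq[OF that] by (elim conjE)
 have A2: "g * real (SUM i:?V J - Kp J. w i * (b i - a i)) + g * fm J + real (snd J - fst J) * sh - real u * sc
 <= ar (Fm J)" if "J : Sl" for J using qq[OF that] by (elim conjE)
 have D2: "wdt (Fm J) <= real (snd J - fst J)" if "J : Sl" for J using qq[OF that] by (elim conjE)
 have G2: "ALL dg:set (Fm J). snd dg <= M" if "J : Sl" for J using qq[OF that] unfolding M_def by (elim conjE)
 have Sdj: "{real (fst J)<..<real (snd J)} Int {real (fst J')<..<real (snd J')} = {}" if "J : Sl" "J' : Sl" "J ~= J'" for J J'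
 using cuts_disjoint[of "fst J" "snd J" bps "fst J'" "snd J'"] that unfolding Sl_def by force
 have Rdj: "R J Int R' J' = {}" if "J : Sl" "J' : Sl" "J ~= J'" "R J <= R1 J Un R2 J" "R' J' <= R1 J' Un R2 J'" for J J' R R'
 using Sdj[OF that(1,2,3)] Rs[OF that(1)] Rs[OF that(2)] that(4,5) by fastforce
 have mvu: "J = J'" if "J : Sl" "J' : Sl" "mv (fst J) (snd J) i" "mv (fst J') (snd J') i" "i : Tl Un Vv" for J J' i
 using mv_unique[of "fst J" "snd J" "fst J'" "snd J'" i] that w_pos'[of i] by simp
 obtain Fa where Fa: "lay (SUM J:Sl. 2 * pc) ?TK Fa ?R1"
 "!!f :: _ => real. sum_list (map f Fa) = (SUM J:Sl. sum_list (map f (F1 J)))" "set Fa = (UN J:Sl. set (F1 J))"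
 proof -
 have "EX Fs. lay (SUM J:Sl. 2 * pc) ?TK Fs ?R1 &
 joins Fs Sl F1"
 proof (rule lay_UN[OF fin_Sl l1])
 fix J J' assume J: "J : Sl" "J' : Sl" "J ~= J'"
 have "(?T J - Tm J Un Kp J) Int (?T J' - Tm J' Un Kp J') = {}" using mvu[OF J(1,2)] J(3) Kp[OF J(1)] Kp[OF J(2)] by blast
 thus "(?T J - Tm J Un Kp J) Int (?T J' - Tm J' Un Kp J') = {} & R1 J Int R1 J' = {}" using Rdj[OF J, of R1 R1] by blast
 qed
 thus ?thesis using that by blast
 qed
 obtain Fb where Fb: "lay (SUM J:Sl. 15 * (m + 1) + 2) (UN J:Sl. Tm J) Fb ?R2"
 "!!f :: _ => real. sum_list (map f Fb) = (SUM J:Sl. sum_list (map f (Fm J)))" "set Fb = (UN J:Sl. set (Fm J))"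
 proof -
 have "EX Fs. lay (SUM J:Sl. 15 * (m + 1) + 2) (UN J:Sl. Tm J) Fs ?R2 &
 joins Fs Sl Fm"
 proof (rule lay_UN[OF fin_Sl l2])
 fix J J' assume J: "J : Sl" "J' : Sl" "J ~= J'"
 have "Tm J Int Tm J' = {}" using mvu[OF J(1,2)] J(3) Tm[OF J(1)] Tm[OF J(2)] by blast
 thus "Tm J Int Tm J' = {} & R2 J Int R2 J' = {}" using Rdj[OF J, of R2 R2] by blast
 qed
 thus ?thesis using that by blast
 qed
 define Vh where "Vh = Vv - (UN J:Sl. Kp J)"
 let ?TV = "(UN J:Sl. Tm J) Un Vh"
 \<comment> \<open>Short items that belong to no slab; they lie within distance \<open>u\<close> of
   a breakpoint.\<close>
 define Vx where "Vx = {i:Vv. ALL J:Sl. ~ mv (fst J) (snd J) i}"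
 have Vsub: "Vh <= ?VK Un Vx" by (auto simp: Vh_def Vx_def)
 have fV: "finite S" if "S <= Vv" for S using that finTV finite_subset by blast
 have Vxle: "sum ?c Vx <= (card bps * (2 * u)) * m"
 proof -
 have "sum ?c Vx <= card (UN z:bps. {z - u..<z + u}) * m"
 proof (rule sum_cells_le)
 fix i assume i: "i : Vx"
 hence "i : Tl Un Vv" "ALL (p, q):Sl. ~ mv p q i" by (auto simp: Vx_def)
 then obtain z where "z : bps" "X i < z" "z < X i + w i" using crossing[of i] by blast
 moreover have "w i <= u" using it[of i] i by (auto simp: Vx_def)
 ultimately show "xiv i <= (UN z:bps. {z - u..<z + u})" by fastforce
 qed (use fin_bps in "auto simp: Vx_def")
 also have "card (UN z:bps. {z - u..<z + u}) <= (SUM z:bps. card {z - u..<z + u})" by (rule card_UN_le[OF fin_bps])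
 also have "... <= (SUM z:bps. 2 * u)" by (intro sum_mono) auto
 finally show ?thesis by simp
 qed
 define VJ where "VJ J = sum ?c (?V J - Kp J)" for J
 have "sum ?c Vh <= sum ?c (?VK Un Vx)" by (rule sum_mono2[OF fV Vsub]) (auto simp: Vx_def)
 also have "... <= sum ?c ?VK + sum ?c Vx" by (rule sum_Un_le_nat; rule fV) (auto simp: Vx_def)
 also have "sum ?c ?VK = (SUM J:Sl. VJ J)" unfolding VJ_def
 proof (rule sum.UNION_disjoint[OF fin_Sl])
 show "ALL J:Sl. ALL J':Sl. J ~= J' --> (?V J - Kp J) Int (?V J' - Kp J') = {}" using mvu by blast
 qed (use fV in auto)
 finally have Vhc: "sum ?c Vh <= (SUM J:Sl. VJ J) + (card bps * (2 * u)) * m" using Vxle by linarith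
 have areaV: "area Vh <= g * real (sum ?c Vh)"
 proof -
 have "area Vh <= (SUM i:Vh. g * real (w i * (b i - a i)))" unfolding area_def
 proof (rule sum_mono)
 fix i assume "i : Vh"
 hence "rh i <= real (b i - a i) * g" using it[of i] by (auto simp: Vh_def)
 hence "rw i * rh i <= rw i * (real (b i - a i) * g)" by (intro mult_left_mono) auto
 thus "rw i * rh i <= g * real (w i * (b i - a i))" by (simp add: mult_ac)
 qed
 thus ?thesis by (simp add: sum_distrib_left)
 qed
 have sumlen: "(SUM J:Sl. real (snd J - fst J)) = rW"
 using sum_cuts[OF fin_bps bps_sub bps_ends, of "%_. 1::real"] unfolding Sl_def by (simp add: case_prod_unfold)
 have sumFree: "real (card Free) <= (SUM J:Sl. real (card (?F J)))"
 proof -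
 have "Free <= (UN J:Sl. ?F J)"
 proof
 fix z assume z: "z : Free"
 obtain x k where xk: "z = (x, k)" by (cases z) auto
 hence "x < W" using z by (simp add: Free_def)
 then obtain J where "J : Sl" "fst J <= x" "x < snd J" using cuts_cover[OF fin_bps bps_ends, of x] unfolding Sl_def by force
 thus "z : (UN J:Sl. ?F J)" using z xk by blast
 qed
 hence "card Free <= card (UN J:Sl. ?F J)" using fin_Sl by (intro card_mono) (auto intro: finite_subset[OF _ fin_Free])
 also have "... <= (SUM J:Sl. card (?F J))" by (rule card_UN_le[OF fin_Sl])
 finally have "real (card Free) <= real (SUM J:Sl. card (?F J))" by (rule of_nat_mono)
 thus ?thesis by simp
 qed
 define N where "N = real (card bps)"
 have SN: "real (card Sl) <= N" using card_Sl by (simp add: N_def)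
 define fmS where "fmS = (SUM J:Sl. fm J)"
 have um: "0 <= real u * M" using M0 by simp
 have umg: "real (2 * u * m) * g <= 2 * (real u * M)" using mult_left_mono[OF M0(2), of "2 * real u"] by (simp add: mult_ac)
 have FaA: "g * (real (card Free) - fmS) - N * (2 * (real u * M)) <= ar Fa"
 proof -
 have "g * (real (card Free) - fmS) <= g * (SUM J:Sl. real (card (?F J)) - fm J)"
 using sumFree g by (intro mult_left_mono) (auto simp: fmS_def sum_subtractf)
 also have "... = (SUM J:Sl. g * (real (card (?F J)) - fm J))" by (simp add: sum_distrib_left)
 also have "... <= (SUM J:Sl. ar (F1 J) + 2 * (real u * M))" using A1 umg by (intro sum_mono) (smt (verit))
 also have "... = ar Fa + real (card Sl) * (2 * (real u * M))" unfolding Fa(2) by (simp add: sum.distrib)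
 also have "real (card Sl) * (2 * (real u * M)) <= N * (2 * (real u * M))" using SN um by (intro mult_right_mono) auto
 finally show ?thesis by linarith
 qed
 have FbA: "g * real (SUM J:Sl. VJ J) + g * fmS + rW * sh - N * (real u * sc) <= ar Fb"
 proof -
 have sc0: "0 <= real u * sc" using M0 by (simp add: sc_def)
 have "(SUM J:Sl. g * real (VJ J) + g * fm J + real (snd J - fst J) * sh - real u * sc) <= ar Fb" unfolding Fb(2) VJ_def using A2 by (intro sum_mono)
 moreover have "(SUM J:Sl. g * real (VJ J) + g * fm J + real (snd J - fst J) * sh - real u * sc)
 = g * real (SUM J:Sl. VJ J) + g * fmS + rW * sh - real (card Sl) * (real u * sc)"
 unfolding sumlen[symmetric] fmS_def by (simp add: sum.distrib sum_subtractf sum_distrib_left sum_distrib_right)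
 moreover have "real (card Sl) * (real u * sc) <= N * (real u * sc)" using SN sc0 by (intro mult_right_mono) auto
 ultimately show ?thesis by linarith
 qed
 define K2 where "K2 = 15 * (m + 1) + 2"
 have lenFb: "real (length Fb) <= N * real K2"
 proof -
 have "length Fb <= card Sl * K2" using lay_len[OF Fb(1)] by (simp add: K2_def)
 also have "... <= card bps * K2" using card_Sl by simp
 finally show ?thesis unfolding N_def by (metis of_nat_mono of_nat_mult)
 qed
 have lenM: "real u * real (length Fb) * M <= N * (real K2 * (real u * M))" using mult_right_mono[OF lenFb um] by (simp add: mult_ac)
 have areaV2: "area Vh <= g * real (SUM J:Sl. VJ J) + N * (2 * (real u * M))"
 proof -
 have "real (sum ?c Vh) <= real (SUM J:Sl. VJ J) + N * real (2 * u * m)"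
 using of_nat_mono[OF Vhc, where 'a = real] unfolding N_def by (simp add: mult_ac)
 hence "g * real (sum ?c Vh) <= g * real (SUM J:Sl. VJ J) + N * (real (2 * u * m) * g)"
 using mult_left_mono[of _ _ g] g by (fastforce simp: algebra_simps)
 also have "N * (real (2 * u * m) * g) <= N * (2 * (real u * M))" using umg by (intro mult_left_mono) (auto simp: N_def)
 finally show ?thesis using areaV by linarith
 qed
 have mloss: "real u * N * mloss = N * (real u * sc) + 2 * (N * (real K2 * (real u * M))) + N * (6 * (real u * M))"
 unfolding mloss_def sc_def K2_def M_def by (simp only: algebra_simps)
 have cond': "N * (real u * sc) + 2 * (N * (real K2 * (real u * M))) + N * (6 * (real u * M)) <= rW * (sh - real m3 * g)"
 using cond unfolding N_def[symmetric] mloss .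
 have nn: "0 <= N * (real K2 * (real u * M))" "0 <= N * (real u * M)" "0 <= g * fmS"
 using um g fm by (auto simp: N_def fmS_def intro!: mult_nonneg_nonneg sum_nonneg)
 have D2': "wdt Fb <= rW" unfolding Fb(2) sumlen[symmetric] using D2 by (intro sum_mono)
 have "EX F'. lay ((SUM J:Sl. K2) + length Fb) ?TV F' ?R2 &
 ar Fb - rW * (real m3 * g) - area Vh - real u * real (length Fb) * M <= ar F' &
 wdt F' <= rW & (ALL dg:set F'. snd dg <= M)"
 proof (rule fill_bands[OF Fb(1)[folded K2_def] _ _ _ D2' _ M0(1)])
 show "Vh <= Vv" by (auto simp: Vh_def)
 show "(UN J:Sl. Tm J) Int Vh = {}" using Tm TV by (fastforce simp: Vh_def)
 show "snd dg <= M" if "dg : set Fb" for dg using that G2 Fb(3) by auto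
 show "area Vh + rW * (real m3 * g) + real u * real (length Fb) * M <= ar Fb" using areaV2 FbA lenM cond' nn by (simp add: algebra_simps)
 qed
 then obtain F' where F': "lay ((SUM J:Sl. K2) + length Fb) ?TV F' ?R2"
 "ar Fb - rW * (real m3 * g) - area Vh - real u * real (length Fb) * M <= ar F'" "wdt F' <= rW" "ALL dg:set F'. snd dg <= M" by blast
 have lfx: "lay (card fx) fx [] ?fx"
 proof -
 have "lay (card fx) (UN i:fx. {i}) [] ?fx"
 proof (rule lay_boxes)
 show "finite fx" using fx_sub finTV finite_subset by blast
 fix i assume "i : fx"
 hence i: "i : Tl" using fx_sub by blast
 hence "shelfable {i} (rw i) (real (b i - a i) * g)" using it[of i] TV g by (intro shelfable_row) auto
 thus "shelfb {i} (ibox i) & nnb (ibox i)" using g by (simp add: ibox_def rbox_def)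
 next
 fix i j assume *: "i : fx" "j : fx" "i ~= j"
 hence ij: "i : Tl Un Vv" "j : Tl Un Vv" using fx_sub by auto
 thus "{i} Int {j} = {} & bint (ibox i) Int bint (ibox j) = {}"
 using rbox_disjoint[of "X i + w i" "X j" "X j + w j" "X i" "b i" "a j" "b j" "a i"] dj[OF ij *(3)]
 it[OF ij(1)] it[OF ij(2)] w_pos'[OF ij(1)] w_pos'[OF ij(2)] *(3) unfolding ibox_def by auto
 qed
 thus ?thesis by simp
 qed
 have fxS: "?fx <= Solid" by (auto simp: Solid_def)
 have R12: "?R1 Int ?R2 = {}"
 proof -
 have "R1 J Int R2 J' = {}" if "J : Sl" "J' : Sl" for J J' using RR[OF that(1)] Rdj[OF that, of R1 R2] by (cases "J = J'") auto
 thus ?thesis by blast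
 qed
 have RS: "(?R1 Un ?R2) Int Solid = {}" using Rs by fastforce
 have A12: "?TK Int ?TV = {}"
 proof -
 have "(?T J - Tm J) Int Tm J' = {}" if "J : Sl" "J' : Sl" for J J' using mvu[OF that] Tm[OF that(2)] by (cases "J = J'") blast+
 moreover have "Kp J Int Tm J' = {}" if "J : Sl" "J' : Sl" for J J' using Kp[OF that(1)] Tm[OF that(2)] TV by blast
 moreover have "?T J Int Vh = {}" for J using TV by (auto simp: Vh_def)
 moreover have "Kp J Int Vh = {}" if "J : Sl" for J using that by (auto simp: Vh_def)
 ultimately show ?thesis by blast
 qed
 have fxA: "(?TK Un ?TV) Int fx = {}"
 proof -
 have "i ~: fx" if "J : Sl" "mv (fst J) (snd J) i" for J i using that by (auto simp: fx_def)
 moreover have "i ~: fx" if "i : Vv" for i using that fx_sub TV by blast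
 ultimately show ?thesis using Tm Kp by (fastforce simp: Vh_def)
 qed
 have "lay ((SUM J:Sl. 2 * pc) + ((SUM J:Sl. K2) + length Fb) + card fx)
 (?TK Un ?TV Un fx) ((Fa @ F') @ [])
 ((?R1 Un ?R2) Un ?fx)" by (intro lay_Un Fa(1) F'(1) lfx A12 R12 fxA) (use RS fxS in blast)
 moreover have "?TK Un ?TV Un fx = Tl Un Vv"
 proof (intro equalityI subsetI)
 fix i assume "i : Tl Un Vv"
 thus "i : ?TK Un ?TV Un fx" unfolding Vh_def fx_def by (auto simp: case_prod_unfold)
 qed (use Tm Kp fx_sub in "fastforce simp: Vh_def")
 moreover have "(SUM J:Sl. 2 * pc) + ((SUM J:Sl. K2) + length Fb) + card fx <= card bps * mcount"
 proof -
 have "length Fb <= card Sl * K2" using lay_len[OF Fb(1)] by (simp add: K2_def)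
 hence "(SUM J:Sl. 2 * pc) + ((SUM J:Sl. K2) + length Fb) + card fx <= card Sl * (2 * pc + 2 * K2) + 2 * card bps"
 using card_fx by (simp add: algebra_simps)
 also have "... <= card bps * (2 * pc + 2 * K2) + 2 * card bps" using card_Sl by simp
 finally show ?thesis unfolding mcount_def K2_def by (simp only: algebra_simps)
 qed
 moreover have "(?R1 Un ?R2) Un ?fx <= strip"
 proof -
 have 1: "R1 J Un R2 J <= strip" if "J : Sl" for J
 proof -
 have "snd J <= W" using Sl_D[of "fst J" "snd J"] that by simp
 hence "real (snd J) <= rW" "0 <= real (fst J)" by auto
 hence "room (fst J) (snd J) {0<..<Ht} <= strip" by (auto simp: Solid_def)
 thus ?thesis using Rs[OF that] by blast
 qed
 have 2: "bint (ibox i) <= strip" if i: "i : fx" for i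
 proof -
 have iT: "i : Tl Un Vv" using i fx_sub by blast
 have "bint (ibox i) Int bint (rbox o') = {}" if o: "o' : Ob" for o'
 proof -
 obtain l r c d where e: "o' = (l, r, c, d)" by (cases o') auto
 thus ?thesis using rbox_disjoint[of "X i + w i" l r "X i" "b i" c d "a i"] djO[OF iT, of l r c d] o
 it[OF iT] w_pos'[OF iT] Ob[of l r c d] unfolding ibox_def by auto
 qed
 moreover have "bint (ibox i) <= {0<..<rW} \<times> {0<..<Ht}"
 proof -
 have "real (X i) + rw i <= rW" "real (b i) * g <= real m * g" "a i < b i" using it[OF iT] g by (auto simp del: of_nat_mult)
 moreover have "0 <= real (a i) * g" using g by simp
 ultimately show ?thesis using sh_pos unfolding ibox_def rbox_def by (auto simp: bint.simps of_nat_diff algebra_simps)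
 qed
 ultimately show ?thesis by blast
 qed
 show ?thesis using 1 2 by blast
 qed
 ultimately have final: "lay (card bps * mcount) (Tl Un Vv) (Fa @ F') (strip)" by (metis (no_types, lifting) append_Nil2 lay_mono)
 have Afin: "g * real (card Free) + rW * (sh - real m3 * g) - real u * real (card bps) * mloss <= ar (Fa @ F')"
 using FaA FbA F'(2) areaV2 lenM nn mloss unfolding N_def[symmetric] by (simp add: algebra_simps)
 have "wdt Fa <= (SUM J:Sl. 2 * real m * real (snd J - fst J))" unfolding Fa(2) using D1 by (intro sum_mono)
 also have "... = 2 * real m * rW" unfolding sumlen[symmetric] by (simp only: sum_distrib_left)
 finally have Dfin: "wdt (Fa @ F') <= rW * (2 * real m + 1)" using F'(3) by (simp add: algebra_simps)
 have "ALL dg:set (Fa @ F'). snd dg <= Ht" using F'(4) G1 Fa(3) M0(3) unfolding M_def by fastforce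
 thus ?thesis using final Afin Dfin by blast
qed

end

section \<open>Rounding an optimal packing to layers\<close>

locale inst = items ord w h for ord w h +
 fixes X Y :: "nat => nat" and W H :: nat
 assumes W_pos: "0 < W" and H_pos: "0 < H" and fits: "i : set ord ==> X i + w i <= W & Y i + h i <= H"
 and disj: "i : set ord ==> j : set ord ==> i ~= j ==>
 X i + w i <= X j | X j + w j <= X i | Y i + h i <= Y j | Y j + h j <= Y i"
begin

abbreviation "rW == real W"
abbreviation "rH == real H"

definition sqs :: "nat => (nat * nat) set" where "sqs i = {X i..<X i + w i} \<times> {Y i..<Y i + h i}"

lemma sqs_disjoint: "i : set ord ==> j : set ord ==> i ~= j ==> sqs i Int sqs j = {}" using disj[of i j] by (auto simp: sqs_def)

lemma area_sqs:
 assumes "A <= set ord" shows "area A = real (card (UN i:A. sqs i))"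
proof -
 have "card (UN i:A. sqs i) = (SUM i:A. card (sqs i))"
 proof (rule card_UN_disjoint)
 show "finite A" using assms by (auto intro: finite_subset)
 show "ALL i:A. finite (sqs i)" by (simp add: sqs_def)
 show "ALL i:A. ALL j:A. i ~= j --> sqs i Int sqs j = {}" using sqs_disjoint assms by blast
 qed
 thus ?thesis by (simp add: area_def sqs_def card_cartesian_product)
qed

lemma area_le: "A <= set ord ==> area A <= rW * rH"
proof -
 assume A: "A <= set ord"
 have "card (UN i:A. sqs i) <= card ({..<W} \<times> {..<H})" using fits A by (intro card_mono) (fastforce simp: sqs_def)+
 thus ?thesis unfolding area_sqs[OF A] by (simp add: card_cartesian_product flip: of_nat_mult)
qed

end

text \<open>\<open>de\<close> and \<open>eh\<close> are the two thresholds for heights,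
  \<open>wm\<close> and \<open>nv\<close> those for widths, relative to \<open>H\<close> and
  \<open>W\<close>. The last assumption says that two stretched layers amount to at most the part
  \<open>e\<close> of the height \<open>de * H\<close>.\<close>

locale params = inst +
 fixes e de eh wm nv :: real and m3 :: nat
 assumes e: "0 < e" "e <= 1" and del: "0 < de" "de <= e" and eta: "0 < eh" "eh <= de" and om: "0 < wm" "wm <= 1" and nu: "0 < nv" "nv <= wm"
 and m3: "0 < m3" and mbig: "2 * (1 + e) <= e * de * real (3 * m3)"
begin

abbreviation m :: nat where "m == 3 * m3"
text \<open>Layers are stretched by the factor \<open>1 + e\<close>, so that a thick item fits into
  the layers it contains completely.\<close>

definition g :: real where "g = (1 + e) * rH / real m"
definition sh :: real where "sh = real m3 * g + e * rH"
definition u :: nat where "u = nat \<lfloor>nv * rW\<rfloor>"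
text \<open>A ceiling, whereas \<open>bl\<close> is a floor: rounding inwards keeps disjoint items
  disjoint.\<close>

definition al :: "nat => nat" where "al i = (Y i * m + H - 1) div H"
definition bl :: "nat => nat" where "bl i = ((Y i + h i) * m) div H"

definition thick where "thick = {i:set ord. de * rH < rh i}"
definition blks where "blks = {i:thick. nv * rW < rw i}"
definition Tl where "Tl = {i:thick. rw i <= nv * rW & real m3 * g < rh i}"
definition Vv where "Vv = {i:thick. rw i <= nv * rW & rh i <= real m3 * g}"
definition wide where "wide = {i:set ord. rh i <= eh * rH & wm * rW < rw i}"
definition small where "small = {i:set ord. rh i <= eh * rH & rw i <= nv * rW}"

lemma gm: "real m * g = (1 + e) * rH" using m3 by (simp add: g_def)
lemma g_pos: "0 < g" using e m3 H_pos by (simp add: g_def)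
lemma u_le: "real u <= nv * rW" using nu W_pos by (simp add: u_def)
lemma w_u: "rw i <= nv * rW ==> w i <= u" unfolding u_def by (simp add: le_nat_floor)

lemma al_ge: "Y i * m <= al i * H"
proof -
 have "Y i * m + H - 1 = al i * H + (Y i * m + H - 1) mod H" unfolding al_def by simp
 moreover have "(Y i * m + H - 1) mod H <= H - 1" using H_pos by (metis Suc_pred' less_Suc_eq_le mod_less_divisor)
 ultimately show ?thesis using H_pos by linarith
qed

lemma al_less: "al i * H < Y i * m + H"
proof -
 have "al i * H <= Y i * m + H - 1" unfolding al_def by (rule div_times_less_eq_dividend)
 thus ?thesis using H_pos by linarith
qed

lemma bl_le: "bl i * H <= (Y i + h i) * m" unfolding bl_def by (rule div_times_less_eq_dividend)

lemma bl_greater: "(Y i + h i) * m < bl i * H + H"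
 unfolding bl_def using H_pos by (metis add.commute dividend_less_times_div mult.commute mult_Suc_right mult_Suc)

lemma bl_m: "i : set ord ==> bl i <= m" using fits[of i] H_pos unfolding bl_def by (metis div_le_mono div_mult_self1_is_m mult_le_mono1 mult.commute)

text \<open>The rounding costs less than two layers, and by \<open>mbig\<close> the stretching makes
  up for them.\<close>

lemma thick_ab:
 assumes "i : thick" shows "al i < bl i" "rh i <= real (bl i - al i) * g"
proof -
 have m: "0 < real m" using m3 by simp
 have "real (al i) * rH < real (Y i) * real m + rH" using al_less[of i] by (metis of_nat_add of_nat_less_iff of_nat_mult)
 moreover have "(real (Y i) + rh i) * real m < real (bl i) * rH + rH" using bl_greater[of i] by (metis of_nat_add of_nat_less_iff of_nat_mult)
 ultimately have d: "rh i * real m - 2 * rH < (real (bl i) - real (al i)) * rH" by (simp add: algebra_simps)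
 have hh: "de * rH < rh i" using assms by (simp add: thick_def)
 have "2 * (1 + e) * rH <= e * real m * (de * rH)" using mult_right_mono[OF mbig, of "rH"] by (simp add: mult_ac)
 also have "... <= e * real m * rh i" using hh e m by (intro mult_left_mono) auto
 finally have k: "2 * (1 + e) * rH <= e * real m * rh i" .
 have "rh i * real m <= (1 + e) * (rh i * real m - 2 * rH)" using k by (simp add: algebra_simps)
 also have "... <= (1 + e) * ((real (bl i) - real (al i)) * rH)" using d e by (intro mult_left_mono) auto
 finally have "rh i * real m <= (real (bl i) - real (al i)) * (real m * g)" unfolding gm by (simp add: mult_ac)
 hence f: "rh i <= (real (bl i) - real (al i)) * g" using m by (simp add: mult_ac)
 have "0 < rh i" using assms h_pos by (auto simp: thick_def)
 hence "0 < real (bl i) - real (al i)" using f g_pos by (metis less_le_trans zero_less_mult_pos2)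
 thus "al i < bl i" by simp
 thus "rh i <= real (bl i - al i) * g" using f by (simp add: of_nat_diff)
qed

lemma thick_dj:
 assumes "i : thick" "j : thick" "i ~= j" shows "X i + w i <= X j | X j + w j <= X i | bl i <= al j | bl j <= al i"
proof -
 have *: "bl i <= al j" if "Y i + h i <= Y j" for i j
 proof -
 have "bl i * H <= al j * H" using bl_le[of i] al_ge[of j] mult_le_mono1[OF that, of m] by linarith
 thus ?thesis using H_pos by simp
 qed
 show ?thesis using disj[of i j] assms *[of i j] *[of j i] by (auto simp: thick_def)
qed

definition occ :: "nat => nat => bool" where "occ k x <-> (EX i:thick. X i <= x & x < X i + w i & al i <= k & k < bl i)"

definition fr :: "nat => nat => bool" where "fr k x <-> x < W & ~ occ k x"

definition ly :: "nat => nat" where "ly y = (y * m) div H"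
definition inrow :: "nat => bool" where "inrow y <-> (y + 1) * m <= (ly y + 1) * H"

lemma ly_le: "ly y * H <= y * m" unfolding ly_def by (rule div_times_less_eq_dividend)
lemma ly_gr: "y * m < (ly y + 1) * H" unfolding ly_def using H_pos dividend_less_times_div[of H "y * m"] by (simp add: algebra_simps)
lemma ly_m: "y < H ==> ly y < m" unfolding ly_def using H_pos m3 by (simp add: div_less_iff_less_mult)

lemma ly_mono: "y <= y' ==> ly y <= ly y'" unfolding ly_def by (intro div_le_mono mult_le_mono1)

text \<open>A layer occupied by a thick item after rounding lies inside the item as originally
  placed. A unit row within this layer would therefore meet the item.\<close>

lemma not_occ:
 assumes i: "i : set ord" "i ~: thick" and xy: "(x, y) : sqs i" and r: "inrow y" shows "fr (ly y) x"
proof -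
 have "~ occ (ly y) x"
 proof
 assume "occ (ly y) x"
 then obtain j where j: "j : thick" "X j <= x" "x < X j + w j" "al j <= ly y" "ly y < bl j" by (auto simp: occ_def)
 have ij: "j : set ord" "i ~= j" using j(1) i by (auto simp: thick_def)
 have "Y j * m <= ly y * H" using al_ge[of j] mult_le_mono1[OF j(4), of H] by linarith
 hence "Y j * m <= y * m" using ly_le[of y] by linarith
 hence a: "Y j <= y" using m3 by simp
 have "(ly y + 1) * H <= (Y j + h j) * m" using bl_le[of j] mult_le_mono1[of "ly y + 1" "bl j" H] j(5) by linarith
 hence "(y + 1) * m <= (Y j + h j) * m" using r unfolding inrow_def by linarith
 hence b: "y + 1 <= Y j + h j" using m3 mult_le_cancel2[of "y + 1" m "Y j + h j"] by simp
 have "(x, y) : sqs j" using a b j by (simp add: sqs_def)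
 thus False using sqs_disjoint[OF i(1) ij] xy by blast
 qed
 moreover have "x < W" using fits[OF i(1)] xy by (auto simp: sqs_def)
 ultimately show ?thesis by (simp add: fr_def)
qed

definition rows :: "nat => nat set" where "rows k = {y. y < H & ly y = k & inrow y}"

lemma fin_rows: "finite (rows k)" by (simp add: rows_def)

lemma card_rows: "real (card (rows k)) <= g"
proof (cases "rows k = {}")
 case True
 thus ?thesis using g_pos by simp
next
 case False
 let ?a = "Min (rows k)" and ?b = "Max (rows k)"
 have ab: "?a : rows k" "?b : rows k" using False fin_rows by auto
 have "rows k <= {?a..<?b + 1}" using fin_rows by (auto simp: less_Suc_eq_le)
 hence "card (rows k) <= card {?a..<?b + 1}" by (intro card_mono) auto
 hence c: "card (rows k) <= (?b + 1) - ?a" by simp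
 have key: "k * H <= y * m & (y + 1) * m <= (k + 1) * H" if "y : rows k" for y using that ly_le[of y] by (auto simp: rows_def inrow_def)
 have "k * H <= ?a * m" using key[OF ab(1)] by blast
 moreover have "(?b + 1) * m <= (k + 1) * H" using key[OF ab(2)] by blast
 ultimately have "((?b + 1) - ?a) * m <= H" by (simp add: diff_mult_distrib algebra_simps)
 hence "card (rows k) * m <= H" using c by (meson le_trans mult_le_mono1)
 hence "real (card (rows k)) * real m <= rH" by (metis of_nat_le_iff of_nat_mult)
 also have "... <= real m * g" unfolding gm using e by (simp add: algebra_simps)
 finally show ?thesis using m3 by (simp add: mult.commute)
qed

text \<open>Of the rows that begin in a given layer only the last one can cross its upper
  border.\<close>

lemma card_badrows: "card {y. y < H & ~ inrow y} <= m"
proof -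
 have "inj_on ly {y. y < H & ~ inrow y}"
 proof (rule inj_onI, rule ccontr)
 fix y y' assume *: "y : {y. y < H & ~ inrow y}" "y' : {y. y < H & ~ inrow y}" "ly y = ly y'" "y ~= y'"
 have "False" if "y < y'" "ly y = ly y'" "~ inrow y" for y y'
 proof -
 have "(y + 1) * m <= y' * m" using that(1) by (intro mult_le_mono1) simp
 moreover have "~ (y + 1) * m <= (ly y' + 1) * H" using that(2,3) by (simp add: inrow_def)
 ultimately show False using ly_gr[of y'] by linarith
 qed
 thus False using * by (metis (mono_tags, lifting) linorder_neqE_nat mem_Collect_eq)
 qed
 hence "card {y. y < H & ~ inrow y} <= card {..<m}" by (rule card_inj_on_le) (use ly_m in auto)
 thus ?thesis by simp
qed

text \<open>Wide items inside a single layer. The others cross a layer border and are packed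
  separately, in one row per border.\<close>

definition win where "win = {i:wide. (Y i + h i) * m <= (ly (Y i) + 1) * H}"

lemma wide_ord: "i : wide ==> i : set ord & i ~: thick & 0 < w i & 0 < h i"
proof -
 assume i: "i : wide"
 have "eh * rH <= de * rH" using eta by (intro mult_right_mono) auto
 thus ?thesis using i w_pos h_pos by (auto simp: wide_def thick_def)
qed

lemma small_ord: "i : small ==> i : set ord & i ~: thick"
proof -
 assume i: "i : small"
 have "eh * rH <= de * rH" using eta by (intro mult_right_mono) auto
 thus ?thesis using i by (auto simp: small_def thick_def)
qed

lemma win_rows:
 assumes "i : win" "Y i <= y" "y < Y i + h i" shows "y : rows (ly (Y i))"
proof -
 have i: "i : wide" "i : set ord" using assms wide_ord by (auto simp: win_def)
 have "(y + 1) * m <= (Y i + h i) * m" using assms(3) by (intro mult_le_mono1) simp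
 hence a: "(y + 1) * m <= (ly (Y i) + 1) * H" using assms(1) by (simp add: win_def)
 have "ly y < ly (Y i) + 1"
 proof (rule ccontr)
 assume "~ ?thesis"
 hence "(ly (Y i) + 1) * H <= ly y * H" by (intro mult_le_mono1) simp
 thus False using ly_le[of y] a m3 by (simp add: algebra_simps)
 qed
 hence "ly y = ly (Y i)" using ly_mono[OF assms(2)] by simp
 thus ?thesis using a fits[OF i(2)] assms(3) by (simp add: rows_def inrow_def)
qed

lemma win_fr:
 assumes "i : win" "X i <= x" "x < X i + w i" shows "fr (ly (Y i)) x"
proof -
 have i: "i : set ord" "i ~: thick" "0 < h i" using assms wide_ord by (auto simp: win_def)
 have "Y i : rows (ly (Y i))" using win_rows[OF assms(1)] i by simp
 thus ?thesis using not_occ[OF i(1,2), of x "Y i"] assms i by (simp add: rows_def sqs_def)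
qed

text \<open>The classes of this relation are the maximal intervals of columns that no thick item
  occupies in the layer \<open>k\<close>.\<close>

definition conn :: "nat => nat => nat => bool" where "conn k x y <-> (ALL z. min x y <= z & z <= max x y --> fr k z)"

lemma conn_refl: "fr k x ==> conn k x x" by (auto simp: conn_def)
lemma conn_sym: "conn k x y ==> conn k y x" by (auto simp: conn_def min.commute max.commute)
lemma conn_trans: "conn k x y ==> conn k y z ==> conn k x z"
 unfolding conn_def by (metis (no_types, opaque_lifting) le_cases max.coboundedI1 max.coboundedI2 max_def min.coboundedI1 min.coboundedI2 min_def)
lemma conn_between: "conn k x y ==> conn k x z ==> y <= t ==> t <= z ==> conn k x t"
 unfolding conn_def by (metis (no_types, opaque_lifting) le_cases le_trans max_def min_def)

definition comp :: "nat => nat => nat set" where "comp k x = {y. conn k x y}"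

lemma comp_fr: "y : comp k x ==> fr k y" unfolding comp_def conn_def mem_Collect_eq by (drule spec[of _ y]) simp

lemma fin_comp: "finite (comp k x)" by (rule finite_subset[of _ "{..<W}"]) (use comp_fr in "auto simp: fr_def")

definition bxr :: "nat => nat => nat * nat * nat * nat" where "bxr k x = (Min (comp k x), Max (comp k x) + 1, k, k + 1)"

lemma comp_eq:
 assumes "fr k x" shows "comp k x = {Min (comp k x)..<Max (comp k x) + 1}"
proof -
 have ne: "comp k x ~= {}" using conn_refl[OF assms] by (auto simp: comp_def)
 have m: "Min (comp k x) : comp k x" "Max (comp k x) : comp k x" using ne fin_comp by auto
 show ?thesis
 proof (intro equalityI subsetI)
 fix y assume "y : {Min (comp k x)..<Max (comp k x) + 1}"
 thus "y : comp k x" using m conn_between[of k x "Min (comp k x)" "Max (comp k x)" y] by (auto simp: comp_def)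
 qed (use fin_comp in "auto simp: less_Suc_eq_le")
qed

lemma comp_same: "conn k x y ==> comp k x = comp k y" unfolding comp_def using conn_trans conn_sym by blast

text \<open>Multiples of \<open>wm * rW\<close>, rounded down. Every wide item covers one of them,
  so the free intervals with wide items are named by a layer and a grid point and are bounded in
  number.\<close>

definition grid :: "nat set" where "grid = (%j. nat \<lfloor>real j * (wm * rW)\<rfloor>) ` {..nat \<lceil>1 / wm\<rceil>}"

lemma card_grid: "card grid <= nat \<lceil>1 / wm\<rceil> + 1"
 unfolding grid_def using card_image_le[of "{..nat \<lceil>1 / wm\<rceil>}"] by fastforce

lemma wide_grid:
 assumes "i : wide" shows "EX x:grid. X i <= x & x < X i + w i"
proof -
 define d where "d = wm * rW"
 have d: "0 < d" "d < rw i" using om W_pos assms by (auto simp: d_def wide_def)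
 define j where "j = nat \<lceil>real (X i) / d\<rceil>"
 have j1: "real (X i) <= real j * d" "real j * d < real (X i) + d"
 proof -
 have "0 <= real (X i) / d" using d by simp
 hence r: "real j = of_int \<lceil>real (X i) / d\<rceil>" unfolding j_def by (simp add: of_nat_nat)
 have "real (X i) / d <= real j" "real j < real (X i) / d + 1" unfolding r by linarith+
 thus "real (X i) <= real j * d" "real j * d < real (X i) + d" using d(1) by (simp_all add: field_simps)
 qed
 have X: "real (X i) <= rW" using fits[of i] wide_ord[OF assms] by auto
 have "j <= nat \<lceil>1 / wm\<rceil>"
 proof -
 have "real (X i) / d <= 1 / wm" using X om W_pos by (simp add: d_def field_simps)
 thus ?thesis unfolding j_def by (intro nat_mono ceiling_mono)
 qed
 hence "nat \<lfloor>real j * d\<rfloor> : grid" by (auto simp: grid_def d_def)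
 moreover have "X i <= nat \<lfloor>real j * d\<rfloor>" using j1 by (simp add: le_nat_floor)
 moreover have "nat \<lfloor>real j * d\<rfloor> < X i + w i"
 proof -
 have "real (nat \<lfloor>real j * d\<rfloor>) <= real j * d" using d by simp
 hence "real (nat \<lfloor>real j * d\<rfloor>) < real (X i + w i)" using j1 d unfolding of_nat_add by linarith
 thus ?thesis by (simp only: of_nat_less_iff)
 qed
 ultimately show ?thesis by blast
qed

definition gc :: "nat => nat" where "gc i = (SOME x. x : grid & X i <= x & x < X i + w i)"

lemma gc:
 assumes "i : wide" shows "gc i : grid & X i <= gc i & gc i < X i + w i"
proof -
 have "EX x. x : grid & X i <= x & x < X i + w i" using wide_grid[OF assms] by blast
 thus ?thesis unfolding gc_def by (rule someI_ex)
qed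

definition bxw :: "nat => nat * nat * nat * nat" where "bxw i = bxr (ly (Y i)) (gc i)"
definition Bx :: "(nat * nat * nat * nat) set" where "Bx = bxw ` win"

lemma fin_win: "finite win" by (rule finite_subset[of _ "set ord"]) (auto simp: win_def wide_def)
lemma fin_Bx: "finite Bx" using fin_win by (simp add: Bx_def)

lemma win_ly: "i : win ==> ly (Y i) < m" using ly_m[of "Y i"] fits[of i] wide_ord[of i] by (auto simp: win_def)

lemma card_Bx: "card Bx <= m * (nat \<lceil>1 / wm\<rceil> + 1)"
proof -
 have "Bx <= (%(k, x). bxr k x) ` ({..<m} \<times> grid)"
 proof
 fix z assume "z : Bx"
 then obtain i where i: "i : win" "z = bxr (ly (Y i)) (gc i)" by (auto simp: Bx_def bxw_def)
 have "(ly (Y i), gc i) : {..<m} \<times> grid" using gc[of i] win_ly[OF i(1)] i(1) by (simp add: win_def)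
 thus "z : (%(k, x). bxr k x) ` ({..<m} \<times> grid)" using i(2) by force
 qed
 hence "card Bx <= card ((%(k, x). bxr k x) ` ({..<m} \<times> grid))" by (rule card_mono[rotated]) (simp add: grid_def)
 also have "... <= card ({..<m} \<times> grid)" by (rule card_image_le) (simp add: grid_def)
 also have "... <= m * (nat \<lceil>1 / wm\<rceil> + 1)" using mult_le_mono2[OF card_grid, of m] by (simp only: card_cartesian_product card_lessThan)
 finally show ?thesis .
qed

lemma gc_fr: "i : win ==> fr (ly (Y i)) (gc i)" using win_fr[of i] gc[of i] by (auto simp: win_def)

lemma win_conn: "i : win ==> X i <= x ==> x < X i + w i ==> conn (ly (Y i)) (gc i) x"
 using win_fr[of i] gc[of i] unfolding conn_def win_def by (auto simp: min_def max_def split: if_splits)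

lemma Bx_D:
 assumes "(l, r, k, k') : Bx" shows "EX i:win. k = ly (Y i) & k' = k + 1 & comp k (gc i) = {l..<r} & l < r & r <= W & k < m"
proof -
 obtain i where i: "i : win" "(l, r, k, k') = bxr (ly (Y i)) (gc i)" using assms by (auto simp: Bx_def bxw_def)
 hence e: "k = ly (Y i)" "k' = k + 1" "l = Min (comp k (gc i))" "r = Max (comp k (gc i)) + 1" by (auto simp: bxr_def)
 have c: "comp k (gc i) = {l..<r}" using comp_eq[OF gc_fr[OF i(1)]] e by simp
 have "gc i : comp k (gc i)" using conn_refl[OF gc_fr[OF i(1)]] e by (simp add: comp_def)
 hence "l < r" using c by auto
 moreover have "Max (comp k (gc i)) : comp k (gc i)" using `gc i : _` fin_comp by (intro Max_in) auto
 hence "Max (comp k (gc i)) < W" using comp_fr by (auto simp: fr_def)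
 hence "r <= W" using e by simp
 ultimately show ?thesis using i(1) e c win_ly by auto
qed

lemma Bx_fr: "(l, r, k, k') : Bx ==> l <= x ==> x < r ==> fr k x"
proof -
 assume *: "(l, r, k, k') : Bx" "l <= x" "x < r"
 then obtain i where "comp k (gc i) = {l..<r}" using Bx_D by blast
 hence "x : comp k (gc i)" using * by simp
 thus "fr k x" by (rule comp_fr)
qed

lemma Bx_disj:
 assumes "(l, r, k, k1) : Bx" "(l', r', k', k1') : Bx" "(l, r, k, k1) ~= (l', r', k', k1')" shows "r <= l' | r' <= l | k1 <= k' | k1' <= k"
proof (rule ccontr)
 assume n: "~ ?thesis"
 obtain i where i: "i : win" "k1 = k + 1" "comp k (gc i) = {l..<r}" "l < r" using Bx_D[OF assms(1)] by blast
 obtain j where j: "j : win" "k1' = k' + 1" "comp k' (gc j) = {l'..<r'}" "l' < r'" using Bx_D[OF assms(2)] by blast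
 have k: "k = k'" using n i(2) j(2) by simp
 have "max l l' : {l..<r}" "max l l' : {l'..<r'}" using n i(4) j(4) by auto
 hence "conn k (gc i) (max l l')" "conn k (gc j) (max l l')" using i(3) j(3) k by (auto simp: comp_def)
 hence "comp k (gc i) = comp k (gc j)" using comp_same by metis
 hence "{l..<r} = {l'..<r'}" using i(3) j(3) k by simp
 hence "l = l' & r = r'" using i(4) j(4) by (simp add: atLeastLessThan_eq_iff)
 thus False using assms(3) k i(2) j(2) by simp
qed

text \<open>Besides the big items, the free intervals that contain wide items count as obstacles.
  Thick items avoid them, since they consist of unoccupied columns.\<close>

definition Ob where "Ob = (%i. (X i, X i + w i, al i, bl i)) ` blks Un Bx"

lemma thick_fr:
 assumes "i : thick" "(l, r, k, k') : Bx" shows "X i + w i <= l | r <= X i | bl i <= k | k' <= al i"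
proof (rule ccontr)
 assume n: "~ ?thesis"
 have k': "k' = k + 1" "l < r" using Bx_D[OF assms(2)] by auto
 have "0 < w i" using assms(1) w_pos by (auto simp: thick_def)
 hence x: "max (X i) l < r" "max (X i) l < X i + w i" using n k' by auto
 hence "occ k (max (X i) l)" using n assms(1) k' by (auto simp: occ_def intro!: bexI[of _ i])
 thus False using Bx_fr[OF assms(2), of "max (X i) l"] x by (auto simp: fr_def)
qed

lemma fin_blks: "finite blks" by (rule finite_subset[of _ "set ord"]) (auto simp: blks_def thick_def)

lemma is_matrix: "matrix ord w h m3 W u g sh X al bl Ob Tl Vv"
proof
 show "0 < g" by (rule g_pos)
 show "0 < m3" by (rule m3)
 show "real m3 * g <= sh" using e H_pos by (simp add: sh_def)
 show "0 < W" by (rule W_pos)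
 show "finite Ob" using fin_blks fin_Bx by (simp add: Ob_def)
 have th: "i : set ord" "0 < w i" "X i + w i <= W" if "i : thick" for i using that w_pos fits by (auto simp: thick_def)
 show "l < r & r <= W & c < d & d <= m" if o: "(l, r, c, d) : Ob" for l r c d
 proof (cases "(l, r, c, d) : Bx")
 case True
 thus ?thesis using Bx_D by fastforce
 next
 case False
 then obtain i where "i : thick" "(l, r, c, d) = (X i, X i + w i, al i, bl i)" using o by (auto simp: Ob_def blks_def)
 thus ?thesis using th[of i] thick_ab(1)[of i] bl_m[of i] by auto
 qed
 show "r <= l' | r' <= l | d <= c' | d' <= c"
 if o: "(l, r, c, d) : Ob" "(l', r', c', d') : Ob" "(l, r, c, d) ~= (l', r', c', d')" for l r c d l' r' c' d'
 proof -
 consider "(l, r, c, d) : Bx" "(l', r', c', d') : Bx"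
 | i where "(l, r, c, d) : Bx" "i : thick" "(l', r', c', d') = (X i, X i + w i, al i, bl i)"
 | i where "(l', r', c', d') : Bx" "i : thick" "(l, r, c, d) = (X i, X i + w i, al i, bl i)"
 | i j where "i : thick" "(l, r, c, d) = (X i, X i + w i, al i, bl i)" "j : thick" "(l', r', c', d') = (X j, X j + w j, al j, bl j)"
 using o(1,2) by (auto simp: Ob_def blks_def)
 thus ?thesis
 proof cases
 case 1 thus ?thesis using Bx_disj o(3) by blast
 next
 case 2 thus ?thesis using thick_fr[OF 2(2,1)] by auto
 next
 case 3 thus ?thesis using thick_fr[OF 3(2,1)] by auto
 next
 case 4
 hence "i ~= j" using o(3) by auto
 thus ?thesis using thick_dj[OF 4(1,3)] 4 by auto
 qed
 qed
 have TVt: "i : thick" "w i <= u" if "i : Tl Un Vv" for i using that w_u by (auto simp: Tl_def Vv_def)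
 show "Tl <= set ord" "Vv <= set ord" "Tl Int Vv = {}" by (auto simp: Tl_def Vv_def thick_def)
 show "X i + w i <= W & al i < bl i & bl i <= m & rh i <= real (bl i - al i) * g & w i <= u" if "i : Tl Un Vv" for i
 using TVt[OF that] th[of i] thick_ab[of i] bl_m[of i] by blast
 show "X i + w i <= X j | X j + w j <= X i | bl i <= al j | bl j <= al i" if "i : Tl Un Vv" "j : Tl Un Vv" "i ~= j" for i j
 using thick_dj TVt that by blast
 show "X i + w i <= l | r <= X i | bl i <= c | d <= al i" if o: "i : Tl Un Vv" "(l, r, c, d) : Ob" for i l r c d
 proof (cases "(l, r, c, d) : Bx")
 case True
 thus ?thesis using thick_fr TVt(1)[OF o(1)] by blast
 next
 case False
 then obtain j where j: "j : blks" "(l, r, c, d) = (X j, X j + w j, al j, bl j)" using o by (auto simp: Ob_def)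
 hence "i ~= j" "j : thick" using o(1) by (auto simp: blks_def Tl_def Vv_def)
 thus ?thesis using thick_dj[OF TVt(1)[OF o(1)], of j] j by auto
 qed
 show "m3 < bl i - al i" if "i : Tl" for i
 proof -
 have "real m3 * g < real (bl i - al i) * g" using thick_ab(2)[of i] that by (auto simp: Tl_def)
 thus ?thesis using g_pos by simp
 qed
 show "rh i <= real m3 * g" if "i : Vv" for i using that by (simp add: Vv_def)
qed

end

section \<open>Repacking the wide flat items\<close>

lemma sum_fibers:
 fixes F :: "'b => nat"
 assumes "finite R" shows "(SUM c:f ` R. card {y:R. f y = c} * F c) = (SUM y:R. F (f y))" using sum.image_gen[OF assms, of "%y. F (f y)" f] by simp

lemma sum_Un_le_real:
 fixes f :: "'a => real"
 assumes "finite A" "finite B" "!!x. 0 <= f x" shows "sum f (A Un B) <= sum f A + sum f B"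
 using sum.union_inter[OF assms(1,2), of f] sum_nonneg[of "A Int B" f] assms(3) by (smt (verit))

lemma sum_UN_le_real:
 fixes f :: "'a => real"
 assumes "finite I" "!!i. i : I ==> finite (A i)" "!!x. 0 <= f x" shows "sum f (UN i:I. A i) <= (SUM i:I. sum f (A i))" using assms(1,2)
proof (induct I rule: finite_induct)
 case (insert i I)
 have "sum f (A i Un (UN i:I. A i)) <= sum f (A i) + sum f (UN i:I. A i)" using insert assms(3) by (intro sum_Un_le_real) auto
 thus ?case using insert by fastforce
qed simp

context params
begin

sublocale M: matrix ord w h m3 W u g sh X al bl Ob Tl Vv by (rule is_matrix)

text \<open>\<open>qn\<close> bounds the index of a group: total height at most
  \<open>rH / wm\<close>, groups of height \<open>e * rH\<close>. \<open>NN\<close> bounds the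
  number of wide items in a unit row.\<close>

definition qn :: nat where "qn = nat \<lfloor>1 / (wm * e)\<rfloor>"
definition NN :: nat where "NN = nat \<lfloor>1 / wm\<rfloor>"
abbreviation "CN == (NN + 1) ^ (qn + 1) * (NN + 1)"
abbreviation "cs0 == nat \<lceil>1 / wm\<rceil> + 1"
definition krk :: nat where "krk = m * cs0 * CN"

definition cross :: "(nat * nat * nat * nat) => nat => nat set" where "cross B y = {i:win. bxw i = B & Y i <= y & y < Y i + h i}"

lemma fin_cross: "finite (cross B y)" by (rule finite_subset[OF _ fin_win]) (auto simp: cross_def)

lemma win_comp:
 assumes "i : win" "bxw i = (l, r, k, k')" shows "k = ly (Y i) & l <= X i & X i + w i <= r"
proof -
 have e: "k = ly (Y i)" "l = Min (comp k (gc i))" "r = Max (comp k (gc i)) + 1" using assms(2) by (auto simp: bxw_def bxr_def)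
 have c: "comp k (gc i) = {l..<r}" using comp_eq[OF gc_fr[OF assms(1)]] e by simp
 have w: "0 < w i" using assms(1) wide_ord by (auto simp: win_def)
 have "X i : comp k (gc i)" "X i + w i - 1 : comp k (gc i)" using win_conn[OF assms(1)] e(1) w by (auto simp: comp_def)
 hence "l <= X i" "X i + w i - 1 < r" unfolding c by auto
 thus ?thesis using e(1) w by linarith
qed

lemma cross_sum:
 assumes "(l, r, k, k') : Bx" "y : rows k"
 shows "card {x. l <= x & x < r & (x, y) : (UN i:small. sqs i)} + (SUM i:cross (l, r, k, k') y. w i) <= r - l"
proof -
 let ?C = "cross (l, r, k, k') y" and ?S = "{x. l <= x & x < r & (x, y) : (UN i:small. sqs i)}"
 have o: "i : set ord" if "i : ?C" for i using that wide_ord by (auto simp: cross_def win_def)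
 have "(SUM i:?C. w i) = card (UN i:?C. {X i..<X i + w i})"
 proof (subst card_UN_disjoint)
 show "ALL i:?C. ALL j:?C. i ~= j --> {X i..<X i + w i} Int {X j..<X j + w j} = {}"
 proof (intro ballI impI)
 fix i j assume ij: "i : ?C" "j : ?C" "i ~= j"
 show "{X i..<X i + w i} Int {X j..<X j + w j} = {}" using disj[OF o[OF ij(1)] o[OF ij(2)] ij(3)] ij by (auto simp: cross_def)
 qed
 qed (use fin_cross in auto)
 moreover have "?S Int (UN i:?C. {X i..<X i + w i}) = {}"
 proof -
 have False if "x : ?S" "i : ?C" "x : {X i..<X i + w i}" for x i
 proof -
 obtain j where j: "j : small" "(x, y) : sqs j" using `x : ?S` by blast
 have "i ~= j" using j(1) `i : ?C` mult_right_mono[OF nu(2), of "rW"] by (auto simp: cross_def win_def wide_def small_def)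
 moreover have "(x, y) : sqs i" using `i : ?C` \<open>x : {X i..<X i + w i}\<close> by (auto simp: sqs_def cross_def)
 ultimately show False using sqs_disjoint[OF o[OF `i : ?C`], of j] j small_ord by auto
 qed
 thus ?thesis by blast
 qed
 hence "card ?S + card (UN i:?C. {X i..<X i + w i}) = card (?S Un (UN i:?C. {X i..<X i + w i}))" using fin_cross by (subst card_Un_disjoint) auto
 moreover have "card (?S Un (UN i:?C. {X i..<X i + w i})) <= card {l..<r}" by (rule card_mono) (use win_comp in "auto simp: cross_def, fastforce+")
 ultimately show ?thesis by simp
qed

lemma card_cross: "(l, r, k, k') : Bx ==> y : rows k ==> card (cross (l, r, k, k') y) <= NN"
proof -
 assume *: "(l, r, k, k') : Bx" "y : rows k"
 let ?C = "cross (l, r, k, k') y"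
 have "real (card ?C) * (wm * rW) <= wds ?C" by (rule sum_bounded_below) (auto simp: cross_def win_def wide_def)
 also have "... <= rW"
 proof -
 have "(SUM i:?C. w i) <= r - l" using cross_sum[OF *] by simp
 hence "(SUM i:?C. w i) <= W" using Bx_D[OF *(1)] by fastforce
 thus ?thesis by (metis of_nat_mono of_nat_sum)
 qed
 finally have "real (card ?C) * wm <= 1" using W_pos by (simp add: mult.assoc[symmetric])
 hence "real (card ?C) <= 1 / wm" using om by (simp add: field_simps)
 thus "card ?C <= NN" unfolding NN_def by (simp add: le_nat_floor)
qed

lemma sum_win: "hts win <= rH / wm"
proof -
 have "hts win * (wm * rW) <= area win" unfolding area_def sum_distrib_right
 by (intro sum_mono) (auto simp: win_def wide_def mult.commute intro!: mult_left_mono)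
 also have "... <= rW * rH" by (rule area_le) (use wide_ord in "auto simp: win_def")
 finally show ?thesis using W_pos om by (simp add: field_simps)
qed

definition smb :: "(nat * nat * nat * nat) => (nat * nat) set" where
 "smb = (%(l, r, k, k'). {(x, y). l <= x & x < r & y : rows k & (x, y) : (UN i:small. sqs i)})"

text \<open>Repacking the boxes: unit rows are sorted by their configuration, and each group of items is
 packed into the slots of the next wider group.\<close>

lemma kr:
 "EX L Fs. L <= win & hts L <= e * rH + eh * rH * real (krk + qn + 2) &
 lay krk (win - L) Fs (UN B:Bx. bint (M.rbox B)) &
 (SUM B:Bx. real (card (smb B))) <= ar Fs &
 wdt Fs <= real krk * rW & (ALL dg:set Fs. snd dg <= g)"
proof -
 define th where "th = e * rH"
 define eh' where "eh' = eh * rH"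
 have th: "0 < th" and eh': "0 <= eh'" using e eta H_pos by (auto simp: th_def eh'_def)
 have hw: "rh i <= eh'" if "i : win" for i using that by (auto simp: win_def wide_def eh'_def)
 obtain kp where kp: "ALL i:win. ALL j:win. kp i < kp j --> w j <= w i" "ALL k. (hts {i:win. kp i = k}) <= th + eh'"
 "ALL k. (hts {i:win. kp i = Suc k}) <= hts {i:win. kp i = k} + eh'" "ALL i:win. real (kp i) * th <= hts win"
 using grouping[OF fin_win, of "%i. rh i" eh' th w] hw th eh' by auto
 have kpq: "kp i <= qn" if "i : win" for i
 proof -
 have "real (kp i) * th <= rH / wm" using kp(4) that sum_win by (meson order_trans)
 hence "real (kp i) <= 1 / (wm * e)" using H_pos e om by (simp add: th_def field_simps)
 thus ?thesis unfolding qn_def by (simp add: le_nat_floor)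
 qed
 let ?W = "%k. {i:win. kp i = k}" and ?C = "%B y k. {i:cross B y. kp i = k}"
 \<comment> \<open>A slot of group \<open>k\<close> has the width of the widest item in group
   \<open>k + 1\<close>; no item of group \<open>k\<close> is narrower than that.\<close>
 define sw where "sw k = Max (insert 0 (w ` (?W (Suc k))))" for k
 have sw1: "w i <= sw k" if "i : win" "kp i = Suc k" for i k unfolding sw_def using that fin_win by (intro Max_ge) auto
 have sw2: "sw (kp i) <= w i" if "i : win" for i unfolding sw_def using kp(1) that fin_win by (subst Max_le_iff) auto
 \<comment> \<open>The configuration of a unit row: the number of items of each group that it
   meets.\<close>
 define cf where "cf B y = map (%k. card (?C B y k)) [0..<qn+1]" for B y
 define kk where "kk = (%B :: nat * nat * nat * nat. fst (snd (snd B)))"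
 define len where "len = (%B :: nat * nat * nat * nat. fst (snd B) - fst B)"
 define Cs where "Cs B = cf B ` rows (kk B)" for B
 define f1 where "f1 B c = card {y:rows (kk B). cf B y = c}" for B c
 define SL where "SL c = {(k, j). k <= qn & j < c ! k}" for c :: "nat list"
 define tot where "tot c = (SUM s:SL c. sw (fst s))" for c
 have finSL: "finite (SL c)" for c
 proof -
 have "SL c = (SIGMA k:{..qn}. {..<c ! k})" by (auto simp: SL_def)
 thus ?thesis by simp
 qed
 have sumSL: "(SUM s:SL c. F (fst s)) = (SUM k<=qn. c ! k * F k)" for c and F :: "nat => nat"
 proof -
 have "SL c = (SIGMA k:{..qn}. {..<c ! k})" by (auto simp: SL_def)
 hence "(SUM s:SL c. F (fst s)) = (SUM (k, j):(SIGMA k:{..qn}. {..<c ! k}). F k)" by (simp add: case_prod_unfold)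
 also have "... = (SUM k<=qn. SUM j<c ! k. F k)" by (rule sum.Sigma[symmetric]) auto
 finally show ?thesis by simp
 qed
 have cfn: "cf B y ! k = card (?C B y k)" if "k <= qn" for B y k unfolding cf_def using that by (simp add: nth_append nth_map_upt del: upt_Suc)
 have crossq: "kp ` cross B y <= {..qn}" for B y using kpq by (auto simp: cross_def)
 have tot_cf: "tot (cf B y) <= (SUM i:cross B y. w i)" for B y
 proof -
 have "tot (cf B y) = (SUM k<=qn. card (?C B y k) * sw k)" unfolding tot_def sumSL[of sw] by (intro sum.cong refl) (simp add: cfn)
 also have "... = (SUM k<=qn. SUM i:?C B y k. sw (kp i))" by simp
 also have "... = (SUM i:cross B y. sw (kp i))" by (rule sum.group[OF fin_cross _ crossq]) simp
 also have "... <= (SUM i:cross B y. w i)" by (intro sum_mono sw2) (auto simp: cross_def)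
 finally show ?thesis .
 qed
 have card_SL: "card (SL (cf B y)) = card (cross B y)" for B y
 proof -
 have "card (SL (cf B y)) = (SUM k<=qn. card (?C B y k))" using sumSL[of "%_. 1" "cf B y"] by (simp add: cfn)
 also have "... = (SUM k<=qn. SUM i:?C B y k. 1)" by simp
 also have "... = (SUM i:cross B y. 1)" by (rule sum.group[OF fin_cross _ crossq]) simp
 finally show ?thesis by simp
 qed
 have finCs: "finite (Cs B)" for B by (simp add: Cs_def fin_rows)
 have Bx4: "B = (fst B, fst B + len B, kk B, kk B + 1) & 0 < len B" if "B : Bx" for B
 using Bx_D[of "fst B" "fst (snd B)" "kk B" "snd (snd (snd B))"] that by (cases B) (auto simp: kk_def len_def)
 have cr: "card {x. fst B <= x & x < fst B + len B & (x, y) : (UN i:small. sqs i)} + (SUM i:cross B y. w i) <= len B"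
 "card (cross B y) <= NN" if "B : Bx" "y : rows (kk B)" for B y
 using cross_sum[of "fst B" "fst B + len B" "kk B" "kk B + 1" y] card_cross[of "fst B" "fst B + len B" "kk B" "kk B + 1" y]
 Bx4[OF that(1)] that by auto
 have totlen: "tot c <= len B" if "B : Bx" "c : Cs B" for B c
 proof -
 obtain y where y: "y : rows (kk B)" "c = cf B y" using `c : Cs B` by (auto simp: Cs_def)
 show ?thesis using cr(1)[OF that(1) y(1)] tot_cf[of B y] unfolding y(2) by linarith
 qed
 have cardCs: "card (Cs B) <= (NN + 1) ^ (qn + 1)" if "B : Bx" for B
 proof -
 have "Cs B <= {xs. set xs <= {..NN} & length xs = qn + 1}"
 proof
 fix c assume "c : Cs B"
 then obtain y where y: "y : rows (kk B)" "c = cf B y" by (auto simp: Cs_def)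
 have "card (?C B y k) <= NN" for k using cr(2)[OF that y(1)] card_mono[OF fin_cross[of B y], of "?C B y k"] by auto
 thus "c : {xs. set xs <= {..NN} & length xs = qn + 1}" using y(2) by (auto simp: cf_def)
 qed
 hence "card (Cs B) <= card {xs. set xs <= {..NN} & length xs = qn + 1}" by (rule card_mono[rotated]) (simp add: finite_lists_length_eq)
 thus ?thesis by (simp add: card_lists_length_eq)
 qed
 have "EX st. (ALL c:Cs B. st c + f1 B c <= card (rows (kk B))) &
 (ALL c:Cs B. ALL c':Cs B. c ~= c' --> st c + f1 B c <= st c' | st c' + f1 B c' <= st c)" for B
 using bucket[OF finCs[of B], of "f1 B"] card_fibers[OF fin_rows[of "kk B"], of "cf B"] unfolding f1_def Cs_def by simp
 then obtain st1 where st1: "!!B c. c : Cs B ==> st1 B c + f1 B c <= card (rows (kk B))"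
 "!!B c c'. c : Cs B ==> c' : Cs B ==> c ~= c' ==> st1 B c + f1 B c <= st1 B c' | st1 B c' + f1 B c' <= st1 B c" by metis
 have "EX st. (ALL s:SL c. st s + sw (fst s) <= tot c) &
 (ALL s:SL c. ALL s':SL c. s ~= s' --> st s + sw (fst s) <= st s' | st s' + sw (fst s') <= st s)" for c
 using bucket[OF finSL[of c], of "%s. sw (fst s)"] unfolding tot_def .
 then obtain st2 where st2: "!!c s. s : SL c ==> st2 c s + sw (fst s) <= tot c"
 "!!c s s'. s : SL c ==> s' : SL c ==> s ~= s' ==> st2 c s + sw (fst s) <= st2 c s' | st2 c s' + sw (fst s') <= st2 c s" by metis
 \<comment> \<open>All slots: a box, a configuration, and a group with an index. The height of a
   slot is the number of unit rows with the configuration.\<close>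
 define JB where "JB = (SIGMA B:Bx. SIGMA c:Cs B. SL c)"
 let ?J = "%k. {j:JB. fst (snd (snd j)) = k}"
 have finJB: "finite JB" unfolding JB_def using fin_Bx finCs finSL by (intro finite_SigmaI) auto
 \<comment> \<open>Counting unit rows in two ways: the slots of group \<open>k\<close> have together
   the height of the items of group \<open>k\<close>. The next group is higher by at most
   \<open>eh'\<close>, so little of it is left over.\<close>
 have capsum: "(SUM j:?J k. f1 (fst j) (fst (snd j))) = (SUM i:?W k. h i)" if k: "k <= qn" for k
 proof -
 have "?J k = (SIGMA B:Bx. SIGMA c:Cs B. Pair k ` {..<c ! k})" using k by (auto simp: JB_def SL_def)
 hence "(SUM j:?J k. f1 (fst j) (fst (snd j))) = (SUM B:Bx. SUM c:Cs B. SUM s:Pair k ` {..<c ! k}. f1 B c)"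
 proof -
 assume eq: "?J k = (SIGMA B:Bx. SIGMA c:Cs B. Pair k ` {..<c ! k})"
 have "(SUM B:Bx. SUM c:Cs B. SUM s:Pair k ` {..<c ! k}. f1 B c) = (SUM B:Bx. SUM (c, s):(SIGMA c:Cs B. Pair k ` {..<c ! k}). f1 B c)"
 by (intro sum.cong refl sum.Sigma) (auto simp: finCs)
 also have "... = (SUM (B, cs):(SIGMA B:Bx. SIGMA c:Cs B. Pair k ` {..<c ! k}). f1 B (fst cs))"
 unfolding case_prod_unfold by (subst sum.Sigma) (auto simp: fin_Bx finCs case_prod_unfold)
 finally show ?thesis unfolding eq by (simp add: case_prod_unfold)
 qed
 also have "... = (SUM B:Bx. SUM c:Cs B. f1 B c * c ! k)" by (intro sum.cong refl) (simp add: card_image inj_on_def)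
 also have "... = (SUM B:Bx. SUM y:rows (kk B). cf B y ! k)" unfolding f1_def Cs_def by (intro sum.cong refl sum_fibers fin_rows)
 also have "... = (SUM B:Bx. SUM i:{i:?W k. bxw i = B}. h i)"
 proof (rule sum.cong[OF refl])
 fix B assume B: "B : Bx"
 let ?G = "{i:?W k. bxw i = B}"
 have finG: "finite ?G" using fin_win by simp
 have "(SUM y:rows (kk B). cf B y ! k) = (SUM y:rows (kk B). SUM i:?G. if Y i <= y & y < Y i + h i then 1 else 0)"
 proof (rule sum.cong[OF refl])
 fix y
 have "?C B y k = {i:?G. Y i <= y & y < Y i + h i}" by (auto simp: cross_def)
 thus "cf B y ! k = (SUM i:?G. if Y i <= y & y < Y i + h i then 1 else 0)" using finG by (simp add: cfn[OF k] sum.inter_filter[symmetric])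
 qed
 also have "... = (SUM i:?G. SUM y:rows (kk B). if Y i <= y & y < Y i + h i then 1 else 0)" by (rule sum.swap)
 also have "... = (SUM i:?G. h i)"
 proof (rule sum.cong[OF refl])
 fix i assume i: "i : ?G"
 hence "kk B = ly (Y i)" using win_comp[of i "fst B" "fst B + len B" "kk B" "kk B + 1"] Bx4[OF B] by auto
 hence "{y:rows (kk B). Y i <= y & y < Y i + h i} = {Y i..<Y i + h i}" using win_rows[of i] i by auto
 thus "(SUM y:rows (kk B). if Y i <= y & y < Y i + h i then 1 else 0) = h i" using fin_rows by (simp add: sum.inter_filter[symmetric])
 qed
 finally show "(SUM y:rows (kk B). cf B y ! k) = (SUM i:?G. h i)" .
 qed
 also have "... = (SUM i:?W k. h i)" by (rule sum.group) (use fin_win fin_Bx in "auto simp: Bx_def")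
 finally show ?thesis .
 qed
 define Q where "Q k S L <-> ?W (Suc k) = (UN j:?J k. S j) Un L &
 (ALL j:?J k. (hts (S j)) <= real (f1 (fst j) (fst (snd j))) & S j Int L = {}) &
 (ALL j:?J k. ALL j':?J k. j ~= j' --> S j Int S j' = {}) &
 (hts L) <= eh' + real (card (?J k)) * eh'" for k S L
 have "EX S L. Q k S L" if k: "k <= qn" for k
 proof -
 let ?A = "?W (Suc k)" and ?B = "?J k"
 have "EX S L. ?A = (UN j:?B. S j) Un L & (ALL j:?B. (hts (S j)) <= real (f1 (fst j) (fst (snd j))) & S j Int L = {}) &
 (ALL j:?B. ALL j':?B. j ~= j' --> S j Int S j' = {}) &
 (hts L) <= max 0 (hts ?A - (SUM j:?B. real (f1 (fst j) (fst (snd j))))) + real (card ?B) * eh'" using finJB fin_win hw eh' by (intro bins) auto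
 moreover have "(SUM j:?B. real (f1 (fst j) (fst (snd j)))) = hts (?W k)" using arg_cong[OF capsum[OF k], of real] by simp
 moreover have "max 0 (hts ?A - hts (?W k)) <= eh'" using kp(3) eh' by (simp add: algebra_simps)
 ultimately show ?thesis unfolding Q_def by (smt (verit))
 qed
 then obtain S' L' where SLQ: "!!k. k <= qn ==> Q k (S' k) (L' k)" by metis
 define SB where "SB j = S' (fst (snd (snd j))) j" for j
 \<comment> \<open>Left over are the widest group, for which there are no slots, and what does not
   fit into the slots.\<close>
 define L where "L = ?W 0 Un (UN k<=qn. L' k)"
 have JBq: "fst (snd (snd j)) <= qn" if "j : JB" for j using that by (auto simp: JB_def SL_def)
 have g1: "?W (Suc k) = (UN j:?J k. SB j) Un L' k" if "k <= qn" for k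
 proof -
 have "(UN j:?J k. SB j) = (UN j:?J k. S' k j)" by (auto simp: SB_def)
 thus ?thesis using SLQ[OF that, unfolded Q_def, THEN conjunct1] by simp
 qed
 have g2: "hts (SB j) <= real (f1 (fst j) (fst (snd j))) & SB j Int L' (fst (snd (snd j))) = {}" if "j : JB" for j
 using SLQ[OF JBq[OF that], unfolded Q_def, THEN conjunct2, THEN conjunct1] that unfolding SB_def by blast
 have g3: "SB j Int SB j' = {}" if "j : JB" "j' : JB" "j ~= j'" "fst (snd (snd j)) = fst (snd (snd j'))" for j j'
 proof -
 let ?k = "fst (snd (snd j))"
 have "S' ?k j Int S' ?k j' = {}"
 using SLQ[OF JBq[OF that(1)], unfolded Q_def, THEN conjunct2, THEN conjunct2, THEN conjunct1, THEN bspec[where x = j], THEN bspec[where x = j']] that by simp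
 thus ?thesis unfolding SB_def that(4)[symmetric] .
 qed
 have g4: "hts (L' k) <= eh' + real (card (?J k)) * eh'" if "k <= qn" for k
 using SLQ[OF that, unfolded Q_def, THEN conjunct2, THEN conjunct2, THEN conjunct2] .
 have SBw: "SB j <= ?W (Suc (fst (snd (snd j))))" if "j : JB" for j using g1[OF JBq[OF that]] that by blast
 have L'w: "L' k <= ?W (Suc k)" if "k <= qn" for k using g1[OF that] by blast
 have SBdj: "SB j Int SB j' = {}" if "j : JB" "j' : JB" "j ~= j'" for j j'
 proof (cases "fst (snd (snd j)) = fst (snd (snd j'))")
 case True
 thus ?thesis using g3[OF that] by blast
 next
 case False
 have "i ~: SB j'" if i: "i : SB j" for i using subsetD[OF SBw[OF `j : JB`] i] subsetD[OF SBw[OF `j' : JB`], of i] False by auto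
 thus ?thesis by blast
 qed
 have Lw: "L <= win" using L'w unfolding L_def by blast
 have SBL: "(UN j:JB. SB j) = win - L"
 proof (intro equalityI subsetI)
 fix i assume "i : (UN j:JB. SB j)"
 then obtain j where j: "j : JB" "i : SB j" by blast
 have i: "i : win" "kp i = Suc (fst (snd (snd j)))" using subsetD[OF SBw[OF j(1)] j(2)] by auto
 have "i ~: L' k" if "k <= qn" for k using g2[OF j(1)] j(2) subsetD[OF L'w[OF that], of i] i by (cases "k = fst (snd (snd j))") auto
 thus "i : win - L" using i by (auto simp: L_def)
 next
 fix i assume i: "i : win - L"
 then obtain k where k: "kp i = Suc k" by (cases "kp i") (auto simp: L_def)
 hence "k <= qn" using kpq[of i] i by auto
 moreover have "i : ?W (Suc k)" "i ~: L' k" using i k `k <= qn` by (auto simp: L_def)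
 ultimately show "i : (UN j:JB. SB j)" using g1[of k] by blast
 qed
 have cardJB: "card JB <= m * cs0 * ((NN + 1) ^ (qn + 1) * NN)"
 proof -
 have "card JB = (SUM B:Bx. SUM c:Cs B. card (SL c))" unfolding JB_def using fin_Bx finCs finSL by (simp add: card_SigmaI)
 also have "... <= (SUM B:Bx. SUM c:Cs B. NN)"
 proof (intro sum_mono)
 fix B c assume B: "B : Bx" "c : Cs B"
 thus "card (SL c) <= NN" using card_SL[of B] cr(2)[OF B(1)] by (auto simp: Cs_def)
 qed
 also have "... <= (SUM B:Bx. (NN + 1) ^ (qn + 1) * NN)" using cardCs by (intro sum_mono) (auto simp del: power_Suc intro: mult_le_mono1)
 also have "... = card Bx * ((NN + 1) ^ (qn + 1) * NN)" by simp
 also have "... <= m * cs0 * ((NN + 1) ^ (qn + 1) * NN)" using card_Bx by (rule mult_le_mono1)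
 finally show ?thesis .
 qed
 have Lsum: "hts L <= e * rH + eh * rH * real (krk + qn + 2)"
 proof -
 have "hts L <= hts (?W 0) + (SUM i:(UN k<=qn. L' k). rh i)" unfolding L_def using fin_win L'w by (intro sum_Un_le_real) (auto intro: finite_subset)
 also have "(SUM i:(UN k<=qn. L' k). rh i) <= (SUM k<=qn. SUM i:L' k. rh i)" using fin_win L'w by (intro sum_UN_le_real) (auto intro: finite_subset)
 also have "... <= (SUM k<=qn. eh' + real (card (?J k)) * eh')" using g4 by (intro sum_mono) auto
 also have "... = real (qn + 1) * eh' + real (SUM k<=qn. card (?J k)) * eh'" by (simp add: sum.distrib sum_distrib_right)
 also have "(SUM k<=qn. card (?J k)) = card JB"
 proof -
 have "(%j. fst (snd (snd j))) ` JB <= {..qn}" using JBq by blast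
 from sum.group[OF finJB _ this, of "%_. 1::nat"] show ?thesis by simp
 qed
 finally have "hts L <= hts (?W 0) + (real (qn + 1) * eh' + real (card JB) * eh')" by linarith
 moreover have "hts (?W 0) <= th + eh'" using kp(2) by blast
 moreover have "real (card JB) * eh' <= real krk * eh'"
 proof (rule mult_right_mono[OF _ eh'])
 have "m * cs0 * ((NN + 1) ^ (qn + 1) * NN) <= krk" unfolding krk_def by (intro mult_le_mono2) simp
 thus "real (card JB) <= real krk" using cardJB by (meson le_trans of_nat_mono)
 qed
 ultimately have "hts L <= th + eh' + (real (qn + 1) * eh' + real krk * eh')" by linarith
 also have "... = e * rH + eh * rH * real (krk + qn + 2)" by (simp add: th_def eh'_def algebra_simps)
 finally show ?thesis .
 qed
 define yb where "yb B = real (kk B) * g + (if kk B < m3 then 0 else sh)" for B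
 have rb: "M.rbox B = (real (fst B), yb B, real (len B), g)" if "B : Bx" for B
 proof -
 have "M.rbox B = M.rbox (fst B, fst B + len B, kk B, kk B + 1)" using Bx4[OF that] by simp
 thus ?thesis by (simp add: M.rbox_def yb_def)
 qed
 define bb where "bb B cs = (real (fst B + st2 (fst cs) (snd cs)), yb B + real (st1 B (fst cs)), real (sw (fst (snd cs))), real (f1 B (fst cs)))" for B and cs :: "nat list \<times> nat * nat"
 \<comment> \<open>The free part to the right of the slots, for each configuration.\<close>
 define bf where "bf B c = (real (fst B + tot c), yb B + real (st1 B c), real (len B - tot c), real (f1 B c))" for B c
 have boxlay: "EX Fs. lay CN (UN cs:(SIGMA c:Cs B. SL c). SB (B, cs)) Fs (bint (M.rbox B)) &
 lists_dims Fs (Cs B) (bf B)" if B: "B : Bx" for B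
 proof -
 let ?J = "SIGMA c:Cs B. SL c"
 have finJ: "finite ?J" using finCs finSL by auto
 have l1: "lay (card ?J) (UN cs:?J. SB (B, cs)) [] (UN cs:?J. bint (bb B cs))"
 proof (rule lay_boxes[OF finJ])
 fix cs assume cs: "cs : ?J"
 hence j: "(B, cs) : JB" using B by (auto simp: JB_def)
 have "shelfable (SB (B, cs)) (real (sw (fst (snd cs)))) (real (f1 B (fst cs)))"
 proof (rule shelfable_stack)
 show "SB (B, cs) <= set ord" using SBw[OF j] wide_ord by (auto simp: win_def)
 show "(SUM i:SB (B, cs). rh i) <= real (f1 B (fst cs))" using g2[OF j] by simp
 fix i assume "i : SB (B, cs)"
 thus "rw i <= real (sw (fst (snd cs)))" using SBw[OF j] sw1[of i "fst (snd cs)"] by auto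
 qed
 thus "shelfb (SB (B, cs)) (bb B cs) & nnb (bb B cs)" by (simp add: bb_def)
 next
 fix cs cs' assume *: "cs : ?J" "cs' : ?J" "cs ~= cs'"
 have "SB (B, cs) Int SB (B, cs') = {}" using SBdj[of "(B, cs)" "(B, cs')"] * B by (auto simp: JB_def)
 moreover have "bint (bb B cs) Int bint (bb B cs') = {}"
 proof (cases "fst cs = fst cs'")
 case True
 hence "st2 (fst cs) (snd cs) + sw (fst (snd cs)) <= st2 (fst cs) (snd cs') | st2 (fst cs) (snd cs') + sw (fst (snd cs')) <= st2 (fst cs) (snd cs)"
 using * by (intro st2(2)) (auto simp: prod_eq_iff)
 thus ?thesis unfolding bb_def using True by (intro bint_djx) auto
 next
 case False
 hence "st1 B (fst cs) + f1 B (fst cs) <= st1 B (fst cs') | st1 B (fst cs') + f1 B (fst cs') <= st1 B (fst cs)" using * by (intro st1(2)) auto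
 thus ?thesis unfolding bb_def by (intro bint_djy) auto
 qed
 ultimately show "SB (B, cs) Int SB (B, cs') = {} & bint (bb B cs) Int bint (bb B cs') = {}" by blast
 qed
 have "EX Fs. lay (card (Cs B)) {} Fs (UN c:Cs B. bint (bf B c)) &
 lists_dims Fs (Cs B) (bf B)"
 proof (rule lay_frees[OF finCs])
 fix c c' assume "c : Cs B" "c' : Cs B" "c ~= c'"
 hence "st1 B c + f1 B c <= st1 B c' | st1 B c' + f1 B c' <= st1 B c" by (rule st1(2))
 thus "bint (bf B c) Int bint (bf B c') = {}" unfolding bf_def by (intro bint_djy) auto
 qed (auto simp: bf_def)
 then obtain Fs where Fs: "lay (card (Cs B)) {} Fs (UN c:Cs B. bint (bf B c))"
 "ALL f :: _ => real. sum_list (map f Fs) = (SUM c:Cs B. f (dims (bf B c)))" "set Fs = (%c. dims (bf B c)) ` Cs B" by blast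
 have x: "bint (bb B cs) Int bint (bf B c) = {}" if "cs : ?J" "c : Cs B" for cs c
 proof (cases "fst cs = c")
 case True
 hence "st2 c (snd cs) + sw (fst (snd cs)) <= tot c" using that by (intro st2(1)) auto
 hence "real (st2 c (snd cs)) + real (sw (fst (snd cs))) <= real (tot c)" by (metis of_nat_add of_nat_mono)
 hence "real (fst B + st2 (fst cs) (snd cs)) + real (sw (fst (snd cs))) <= real (fst B + tot c)" unfolding True by simp
 thus ?thesis unfolding bb_def bf_def by (intro bint_djx disjI1)
 next
 case False
 hence "st1 B (fst cs) + f1 B (fst cs) <= st1 B c | st1 B c + f1 B c <= st1 B (fst cs)" using that by (intro st1(2)) auto
 thus ?thesis unfolding bb_def bf_def by (intro bint_djy) auto
 qed
 have "lay (card ?J + card (Cs B)) ((UN cs:?J. SB (B, cs)) Un {}) ([] @ Fs) ((UN cs:?J. bint (bb B cs)) Un (UN c:Cs B. bint (bf B c)))"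
 by (rule lay_Un[OF l1 Fs(1)]) (use x in blast)+
 hence lay0: "lay (card ?J + card (Cs B)) (UN cs:?J. SB (B, cs)) Fs ((UN cs:?J. bint (bb B cs)) Un (UN c:Cs B. bint (bf B c)))" by simp
 have "card ?J = (SUM c:Cs B. card (SL c))" using finCs finSL by (simp add: card_SigmaI)
 also have "... <= (SUM c:Cs B. NN)"
 proof (rule sum_mono)
 fix c assume "c : Cs B"
 thus "card (SL c) <= NN" using card_SL[of B] cr(2)[OF B] by (auto simp: Cs_def)
 qed
 finally have "card ?J + card (Cs B) <= card (Cs B) * (NN + 1)" by simp
 hence cnt: "card ?J + card (Cs B) <= CN" using cardCs[OF B] by (meson le_trans mult_le_mono1)
 have yr: "real (st1 B c) + real (f1 B c) <= g" if "c : Cs B" for c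
 proof -
 have "real (st1 B c + f1 B c) <= real (card (rows (kk B)))" using st1(1)[OF that] by (rule of_nat_mono)
 thus ?thesis using card_rows[of "kk B"] by simp
 qed
 have sub1: "bint (bb B cs) <= bint (M.rbox B)" if "cs : ?J" for cs
 proof -
 have "st2 (fst cs) (snd cs) + sw (fst (snd cs)) <= len B"
 using st2(1)[of "snd cs" "fst cs"] totlen[OF B, of "fst cs"] that by (auto intro: le_trans)
 hence "real (st2 (fst cs) (snd cs)) + real (sw (fst (snd cs))) <= real (len B)" by linarith
 thus ?thesis using yr[of "fst cs"] that unfolding rb[OF B] bb_def by (auto simp: bint.simps)
 qed
 have sub2: "bint (bf B c) <= bint (M.rbox B)" if "c : Cs B" for c
 using yr[OF that] totlen[OF B that] unfolding rb[OF B] bf_def by (auto simp: bint.simps of_nat_diff)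
 have "(UN cs:?J. bint (bb B cs)) Un (UN c:Cs B. bint (bf B c)) <= bint (M.rbox B)" using sub1 sub2 by blast
 from lay_mono[OF lay0 cnt this] show ?thesis using Fs(2,3) by blast
 qed
 then obtain FB where FB: "!!B. B : Bx ==> lay CN (UN cs:(SIGMA c:Cs B. SL c). SB (B, cs)) (FB B) (bint (M.rbox B))"
 "!!B (f :: _ => real). B : Bx ==> sum_list (map f (FB B)) = (SUM c:Cs B. f (dims (bf B c)))" "!!B. B : Bx ==> set (FB B) = (%c. dims (bf B c)) ` Cs B"
 by metis
 have "EX Fs. lay (SUM B:Bx. CN) (UN B:Bx. UN cs:(SIGMA c:Cs B. SL c). SB (B, cs)) Fs (UN B:Bx. bint (M.rbox B)) &
 joins Fs Bx FB"
 proof (rule lay_UN[OF fin_Bx FB(1)])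
 fix B B' assume *: "B : Bx" "B' : Bx" "B ~= B'"
 have "(UN cs:(SIGMA c:Cs B. SL c). SB (B, cs)) Int (UN cs:(SIGMA c:Cs B'. SL c). SB (B', cs)) = {}"
 proof -
 have "SB (B, cs) Int SB (B', cs') = {}" if "cs : (SIGMA c:Cs B. SL c)" "cs' : (SIGMA c:Cs B'. SL c)" for cs cs'
 by (rule SBdj) (use that * in "auto simp: JB_def")
 thus ?thesis by blast
 qed
 moreover have "bint (M.rbox B) Int bint (M.rbox B') = {}"
 proof -
 obtain l r k k1 l' r' k' k1' where e: "B = (l, r, k, k1)" "B' = (l', r', k', k1')" by (cases B; cases B') auto
 show ?thesis unfolding e by (rule M.rbox_disjoint[OF Bx_disj]) (use * e Bx_D[of l r k k1] Bx_D[of l' r' k' k1'] in auto)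
 qed
 ultimately show "(UN cs:(SIGMA c:Cs B. SL c). SB (B, cs)) Int (UN cs:(SIGMA c:Cs B'. SL c). SB (B', cs)) = {} &
 bint (M.rbox B) Int bint (M.rbox B') = {}" by blast
 qed
 then obtain Fs where Fs: "lay (SUM B:Bx. CN) (UN B:Bx. UN cs:(SIGMA c:Cs B. SL c). SB (B, cs)) Fs (UN B:Bx. bint (M.rbox B))"
 "!!f :: _ => real. sum_list (map f Fs) = (SUM B:Bx. sum_list (map f (FB B)))" "set Fs = (UN B:Bx. set (FB B))" by blast
 have eqU: "(UN B:Bx. UN cs:(SIGMA c:Cs B. SL c). SB (B, cs)) = win - L" unfolding SBL[symmetric] by (auto simp: JB_def)
 have krle: "(SUM B:Bx. CN) <= krk" using card_Bx unfolding krk_def by (simp del: power_Suc add: mult_le_mono1)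
 have layF: "lay krk (win - L) Fs (UN B:Bx. bint (M.rbox B))" using lay_mono[OF Fs(1) krle order_refl] unfolding eqU .
 \<comment> \<open>In every row the small items lie beside the wide items, whose total width is at
   least that of the slots; so the free parts are as large as the small cells of the box.\<close>
 have areaB: "real (card (smb B)) <= ar (FB B)" if B: "B : Bx" for B
 proof -
 let ?S = "%y. {x. fst B <= x & x < fst B + len B & (x, y) : (UN i:small. sqs i)}"
 have "smb B = (UN y:rows (kk B). (%x. (x, y)) ` ?S y)"
 proof -
 have "smb B = smb (fst B, fst B + len B, kk B, kk B + 1)" using Bx4[OF B] by simp
 thus ?thesis by (auto simp: smb_def)
 qed
 hence "card (smb B) <= (SUM y:rows (kk B). card ((%x. (x, y)) ` ?S y))" by (simp only: card_UN_le[OF fin_rows])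
 also have "... <= (SUM y:rows (kk B). len B - tot (cf B y))"
 proof (rule sum_mono)
 fix y assume y: "y : rows (kk B)"
 have "card ((%x. (x, y)) ` ?S y) <= card (?S y)" by (rule card_image_le) simp
 thus "card ((%x. (x, y)) ` ?S y) <= len B - tot (cf B y)" using cr(1)[OF B y] tot_cf[of B y] by linarith
 qed
 also have "... = (SUM c:Cs B. f1 B c * (len B - tot c))" unfolding Cs_def f1_def by (rule sum_fibers[OF fin_rows, symmetric])
 finally have "real (card (smb B)) <= real (SUM c:Cs B. f1 B c * (len B - tot c))" by (rule of_nat_mono)
 thus ?thesis unfolding FB(2)[OF B] by (simp add: bf_def mult.commute)
 qed
 have A: "(SUM B:Bx. real (card (smb B))) <= ar Fs" unfolding Fs(2) using areaB by (intro sum_mono)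
 have D: "wdt Fs <= real krk * rW"
 proof -
 have "fst dg <= rW" if "dg : set Fs" for dg
 proof -
 obtain B where B: "B : Bx" "dg : set (FB B)" using `dg : set Fs` unfolding Fs(3) by blast
 obtain c where Bc: "B : Bx" "c : Cs B" "dg = dims (bf B c)" using B(2) B(1) unfolding FB(3)[OF B(1)] by blast
 have "len B <= W" using Bx_D[of "fst B" "fst B + len B" "kk B" "kk B + 1"] Bx4[OF Bc(1)] Bc(1) by auto
 thus ?thesis using Bc(3) by (simp add: bf_def)
 qed
 hence "wdt Fs <= real (length Fs) * rW" by (rule M.sum_list_bound)
 also have "... <= real krk * rW" using lay_len[OF layF] by (intro mult_right_mono) auto
 finally show ?thesis .
 qed
 have G: "ALL dg:set Fs. snd dg <= g"
 proof
 fix dg assume "dg : set Fs"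
 then obtain B where B: "B : Bx" "dg : set (FB B)" unfolding Fs(3) by blast
 obtain c where Bc: "B : Bx" "c : Cs B" "dg = dims (bf B c)" using B(2) B(1) unfolding FB(3)[OF B(1)] by blast
 have "f1 B c <= card (rows (kk B))" unfolding f1_def using fin_rows by (intro card_mono) auto
 thus "snd dg <= g" using Bc(3) card_rows[of "kk B"] by (simp add: bf_def)
 qed
 show ?thesis using Lw Lsum layF A D G by blast
qed

end

section \<open>Assembling the layout\<close>

context items
begin

text \<open>A bound linear in \<open>D\<close> and \<open>G\<close> beside the area, so that it can
  be summed over many boxes of which only total area, total width and number are known.\<close>

lemma cap_ge: "0 <= D ==> 0 <= G ==> 0 <= a ==> 0 <= b ==> D * G - a * G - b * D <= cap a b (D, G)"
proof -
 assume *: "0 <= D" "0 <= G" "0 <= a" "0 <= b"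
 show ?thesis
 proof (cases "a <= D & b <= G")
 case True
 hence "cap a b (D, G) = D * G - a * G - b * D + a * b" by (simp add: cap_def algebra_simps)
 moreover have "0 <= a * b" using * by simp
 ultimately show ?thesis by linarith
 next
 case False
 have c: "0 <= cap a b (D, G)" by (simp add: cap_def)
 show ?thesis
 proof (cases "a <= D")
 case True
 hence "G * D <= b * D" using False * by (intro mult_right_mono) auto
 hence "D * G <= b * D" by (simp add: mult.commute)
 moreover have "0 <= a * G" using * by simp
 ultimately show ?thesis using c by linarith
 next
 case False
 hence "D * G <= a * G" using * by (simp add: mult_right_mono)
 moreover have "0 <= b * D" using * by simp
 ultimately show ?thesis using c by linarith
 qed
 qed
qed

lemma cap_sum_ge:
 assumes "!!dg. dg : set Fs ==> 0 <= fst dg & 0 <= snd dg" "0 <= a" "0 <= b"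
 shows "ar Fs - a * (SUM dg<-Fs. snd dg) - b * wdt Fs <= (SUM dg<-Fs. cap a b dg)" using assms(1)
proof (induct Fs)
 case (Cons dg Fs)
 have "fst dg * snd dg - a * snd dg - b * fst dg <= cap a b dg" using cap_ge[of "fst dg" "snd dg" a b] Cons.prems[of dg] assms(2,3) by simp
 thus ?case using Cons by (simp add: algebra_simps)
qed simp

end

context params
begin

text \<open>The two ends of the strip and two ends of every obstacle.\<close>

definition bpb :: nat where "bpb = 2 + 2 * (card blks + m * (nat \<lceil>1 / wm\<rceil> + 1))"

lemma card_bps: "card M.bps <= bpb"
proof -
 have "M.bps = {0, W} Un (fst ` Ob Un (%z. fst (snd z)) ` Ob)" unfolding M.bps_def by force
 hence "card M.bps <= card {0, W} + card (fst ` Ob Un (%z. fst (snd z)) ` Ob)" by (simp only: card_Un_le)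
 hence "card M.bps <= card {0, W} + (card (fst ` Ob) + card ((%z. fst (snd z)) ` Ob))"
 using card_Un_le[of "fst ` Ob" "(%z. fst (snd z)) ` Ob"] by linarith
 moreover have "card {0, W} <= 2" by (simp add: card_insert_if)
 moreover have f: "finite Ob" using M.finOb .
 have "card (fst ` Ob) <= card Ob" "card ((%z. fst (snd z)) ` Ob) <= card Ob" using f by (auto intro: card_image_le)
 moreover have "card Ob <= card blks + card Bx" unfolding Ob_def
 using card_Un_le[of "(%i. (X i, X i + w i, al i, bl i)) ` blks" Bx] card_image_le[OF fin_blks, of "%i. (X i, X i + w i, al i, bl i)"] by linarith
 moreover have "a' <= 2 + 2 * (p' + q')" if "a' <= b' + (c' + d')" "b' <= 2" "c' <= x'" "d' <= x'" "x' <= p' + q'"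
 for a' b' c' d' x' p' q' :: nat using that by presburger
 ultimately have "card M.bps <= 2 + 2 * (card blks + card Bx)" by blast
 also have "... <= bpb" unfolding bpb_def by (intro add_left_mono mult_le_mono2 card_Bx)
 finally show ?thesis .
qed

text \<open>A unit cell of a small item lies in a row crossing a layer border, in a box of wide
  items, or in a free cell of the matrix; each free cell accounts for at most \<open>g\<close>
  rows.\<close>

lemma area_small: "area small <= real m * rW + g * real (card M.Free) + (SUM B:Bx. real (card (smb B)))"
proof -
 let ?S = "UN i:small. sqs i"
 let ?bad = "{..<W} \<times> {y. y < H & ~ inrow y}"
 let ?free = "SIGMA z:M.Free. rows (snd z)"
 let ?f = "%z. (fst (fst z), snd z)"
 have finB: "finite (smb B)" for B
 proof -
 obtain l r k k' where B: "B = (l, r, k, k')" by (cases B)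
 have "smb B <= {l..<r} \<times> rows k" by (auto simp: smb_def B)
 thus ?thesis using fin_rows by (meson finite_SigmaI finite_atLeastLessThan finite_subset)
 qed
 have sub: "?S <= ?bad Un (?f ` ?free Un (UN B:Bx. smb B))"
 proof (rule subsetI, rule ccontr)
 fix z assume z: "z : ?S" and nz: "z ~: ?bad Un (?f ` ?free Un (UN B:Bx. smb B))"
 obtain x y where zxy: "z = (x, y)" by (cases z)
 obtain i where i: "i : small" and xy: "(x, y) : sqs i" using z zxy by blast
 have n: "(x, y) ~: (UN B:Bx. smb B)" "(x, y) ~: ?f ` ?free" "(x, y) ~: ?bad" using nz zxy by blast+
 have io: "i : set ord" "i ~: thick" using small_ord[OF i] by auto
 have xW: "x < W" "y < H" using fits[OF io(1)] xy by (auto simp: sqs_def)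
 show False
 proof -
 have r: "inrow y" using xW n(3) by simp
 hence f: "fr (ly y) x" using not_occ[OF io xy] by blast
 have yr: "y : rows (ly y)" using xW r by (simp add: rows_def)
 have nb: "~ (l <= x & x < r & c <= ly y & ly y < d)" if o: "(l, r, c, d) : Ob" for l r c d
 proof
 assume *: "l <= x & x < r & c <= ly y & ly y < d"
 show False
 proof (cases "(l, r, c, d) : Bx")
 case True
 hence "c = ly y" using Bx_D[OF True] * by auto
 hence "(x, y) : smb (l, r, c, d)" using * yr i xy by (auto simp: smb_def)
 thus False using n(1) True by blast
 next
 case False
 then obtain j where "j : blks" "(l, r, c, d) = (X j, X j + w j, al j, bl j)" using o by (auto simp: Ob_def)
 hence "occ (ly y) x" using * by (auto simp: occ_def blks_def)
 thus False using f by (simp add: fr_def)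
 qed
 qed
 have nt: "~ (X j <= x & x < X j + w j & al j <= ly y & ly y < bl j)" if "j : Tl Un Vv" for j
 using f that by (auto simp: fr_def occ_def Tl_def Vv_def)
 have "(x, ly y) : M.Free" unfolding M.Free_def using xW ly_m[OF xW(2)] nb nt by blast
 hence "((x, ly y), y) : ?free" using yr by simp
 hence "?f ((x, ly y), y) : ?f ` ?free" by (rule imageI)
 thus False using n(2) by simp
 qed
 qed
 have finF: "finite ?free" using M.fin_Free fin_rows by auto
 have fb: "finite ?bad" by simp
 have "card ?S <= card (?bad Un (?f ` ?free Un (UN B:Bx. smb B)))" using fb finF finB fin_Bx by (intro card_mono[OF _ sub]) auto
 also have "... <= card ?bad + (card (?f ` ?free) + card (UN B:Bx. smb B))" using card_Un_le by (meson add_left_mono le_trans)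
 also have "... <= card ?bad + (card ?free + (SUM B:Bx. card (smb B)))" using card_image_le[OF finF, of ?f] card_UN_le[OF fin_Bx, of smb] by linarith
 finally have "real (card ?S) <= real (card ?bad + (card ?free + (SUM B:Bx. card (smb B))))" by (rule of_nat_mono)
 hence "real (card ?S) <= real (card ?bad) + (real (card ?free) + (SUM B:Bx. real (card (smb B))))" unfolding of_nat_add of_nat_sum .
 moreover have "real (card ?bad) <= real m * rW"
 proof -
 have "card ?bad <= m * W" using mult_le_mono2[OF card_badrows, of W] by (simp add: card_cartesian_product mult.commute)
 thus ?thesis by (metis of_nat_mono of_nat_mult)
 qed
 moreover have "real (card ?free) <= g * real (card M.Free)"
 proof -
 have "real (card ?free) = (SUM z:M.Free. real (card (rows (snd z))))" using M.fin_Free fin_rows by (simp add: card_SigmaI)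
 also have "... <= (SUM z:M.Free. g)" by (intro sum_mono card_rows)
 finally show ?thesis by (simp add: mult.commute)
 qed
 moreover have "area small = real (card ?S)" by (rule area_sqs) (auto simp: small_def)
 ultimately show ?thesis by linarith
qed

text \<open>These items start in the layer \<open>k\<close> and reach beyond its upper border, so no
  two of them lie one above the other.\<close>

lemma cross_row: "(SUM i:{i:wide - win. ly (Y i) = k}. w i) <= W"
proof (cases "{i:wide - win. ly (Y i) = k} = {}")
 case False
 let ?S = "{i:wide - win. ly (Y i) = k}"
 have o: "i : set ord" if "i : ?S" for i using that wide_ord by auto
 have "0 + sum w ?S <= W"
 proof (rule sum_intervals[of _ _ X])
 show "finite ?S" by (rule finite_subset[of _ "set ord"]) (auto simp: wide_def)
 show "?S ~= {}" by fact
 show "0 <= X i & X i + w i <= W" if "i : ?S" for i using fits[OF o[OF that]] by simp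
 fix i j assume ij: "i : ?S" "j : ?S" "i ~= j"
 have *: "~ Y i + h i <= Y j" if "i : ?S" "j : ?S" for i j
 proof
 assume "Y i + h i <= Y j"
 hence "(Y i + h i) * m <= Y j * m" by (rule mult_le_mono1)
 moreover have "(k + 1) * H < (Y i + h i) * m" using that(1) by (auto simp: win_def not_le)
 moreover have "Y j * m < (k + 1) * H" using ly_gr[of "Y j"] that(2) by auto
 ultimately show False by linarith
 qed
 show "X i + w i <= X j | X j + w j <= X i" using disj[OF o[OF ij(1)] o[OF ij(2)] ij(3)] *[OF ij(1,2)] *[OF ij(2,1)] by blast
 qed
 thus ?thesis by simp
next
 case True
 thus ?thesis by (simp only: sum.empty)
qed

definition mid where "mid = set ord - (thick Un wide Un small)"
definition Cm :: real where "Cm = 12 + 2 * real (part_count m) + 2 * real (15 * (m + 1) + 2)"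
definition Kb :: nat where "Kb = card blks + (bpb * M.mcount + krk) + m + 3"

text \<open>The surplus \<open>rW * eH\<close> of free area pays, with a fifth each, for the slices,
  for the rows crossing layer borders and for the two linear terms in \<open>cap_sum_ge\<close>. On
  top of the height \<open>y0\<close>, strips of heights 1, 2, 4 and 5 times \<open>eH\<close> take
  the wide items crossing layer borders, the leftovers \<open>L\<close>, and the medium items wider
  and narrower than half of the strip. With \<open>y0 = 4/3 * rH + 7/3 * eH\<close> the sum stays
  within \<open>4/3 + 15 * e\<close>.\<close>

theorem assembly:
 assumes A1: "area {i:set ord. eh * rH < rh i & rh i <= de * rH} <= e * rW * rH"
 and A2: "area {i:set ord. rh i <= de * rH & nv * rW < rw i & rw i <= wm * rW} <= e * rW * rH" and s1: "nv * real bpb * (4 * Cm) <= e / 5"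
 and s2: "real m * eh <= e / 5" and s3: "nv * (4 * real (bpb * M.mcount + krk)) <= e / 5" and s4: "eh * real (2 * m + 1 + krk) <= e / 5"
 and s5: "eh * real (krk + qn + 2) <= e" shows "lay Kb (set ord) [] ({0<..<rW} \<times> {0<..<(4/3 + 15 * e) * rH})"
proof -
 define y0 where "y0 = real m * g + sh"
 define eH where "eH = e * rH"
 have HW: "0 < rH" "0 < rW" using H_pos W_pos by auto
 have eH: "0 < eH" using e HW by (simp add: eH_def)
 have mg3: "3 * (real m3 * g) = (1 + e) * rH" using gm by simp
 have y0: "y0 = 4/3 * rH + 7/3 * eH" using gm mg3 by (simp add: y0_def sh_def eH_def algebra_simps)
 have y04: "y0 <= 4 * rH" unfolding y0 eH_def using e HW mult_right_mono[OF e(2), of "rH"] by linarith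
 have y0p: "0 < y0" unfolding y0 using eH HW by linarith
 have shm: "sh - real m3 * g = eH" by (simp add: sh_def eH_def)
 have eWH: "rW * eH = e * rW * rH" by (simp add: eH_def)
 have bp: "real (card M.bps) <= real bpb" using card_bps by (rule of_nat_mono)
 have Cm0: "0 <= Cm" by (simp add: Cm_def)
 have loss: "real u * real (card M.bps) * M.mloss <= rW * eH / 5"
 proof -
 have ml: "M.mloss <= 4 * rH * Cm" "0 <= M.mloss" unfolding M.mloss_def Cm_def[symmetric] y0_def[symmetric]
 using y04 y0p Cm0 by (auto intro: mult_right_mono)
 have "real u * real (card M.bps) * M.mloss <= (nv * rW) * real bpb * (4 * rH * Cm)" using u_le bp ml nu HW Cm0 by (intro mult_mono) auto
 also have "... = (nv * real bpb * (4 * Cm)) * (rW * rH)" by (simp add: mult_ac)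
 also have "... <= e / 5 * (rW * rH)" using s1 by (intro mult_right_mono) auto
 finally show ?thesis by (simp add: eH_def mult_ac)
 qed
 have cond: "real u * real (card M.bps) * M.mloss <= rW * (sh - real m3 * g)" unfolding shm using loss mult_pos_pos[OF HW(2) eH] by linarith
 let ?R0 = "{0<..<rW} \<times> {0<..<y0}"
 obtain Fs1 where Fs1: "lay (card M.bps * M.mcount) (Tl Un Vv) Fs1 (?R0 - (UN o':Ob. bint (M.rbox o')))"
 "g * real (card M.Free) + rW * eH - real u * real (card M.bps) * M.mloss <= ar Fs1"
 "wdt Fs1 <= rW * (2 * real m + 1)" "ALL dg:set Fs1. snd dg <= y0" using M.matrix_layout[OF cond] unfolding shm y0_def[symmetric] by blast
 obtain L Fs2 where L: "L <= win" "hts L <= eH + eh * rH * real (krk + qn + 2)" and Fs2: "lay krk (win - L) Fs2 (UN B:Bx. bint (M.rbox B))"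
 "(SUM B:Bx. real (card (smb B))) <= ar Fs2" "wdt Fs2 <= real krk * rW" "ALL dg:set Fs2. snd dg <= g" using kr unfolding eH_def[symmetric] by blast
 have gy: "g <= y0"
 proof -
 have "g <= real m * g" using mult_right_mono[of 1 "real m" g] m3 g_pos by simp
 thus ?thesis using M.sh_pos unfolding y0_def by linarith
 qed
 have thick3: "thick = blks Un (Tl Un Vv)" by (auto simp: blks_def Tl_def Vv_def)
 have bTV: "blks Int (Tl Un Vv) = {}" by (auto simp: blks_def Tl_def Vv_def)
 have tw: "thick Int wide = {}" "thick Int small = {}" using wide_ord small_ord by blast+
 have nW: "nv * rW <= wm * rW" using nu HW by (intro mult_right_mono) auto
 have ws: "wide Int small = {}" using nW by (auto simp: wide_def small_def)
 have ww: "win <= wide" by (auto simp: win_def)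
 have so: "small <= set ord" "wide <= set ord" "thick <= set ord" by (auto simp: wide_def small_def thick_def)
 have rb_sub: "bint (M.rbox o') <= ?R0" if o: "o' : Ob" for o'
 proof -
 obtain l r c d where o': "o' = (l, r, c, d)" by (cases o')
 have b: "l < r" "r <= W" "c < d" "d <= m" using M.Ob[of l r c d] o o' by auto
 have "real d * g <= real m * g" using b g_pos by (intro mult_right_mono) auto
 moreover have "0 <= real c * g" using g_pos by simp
 moreover have "real r <= rW" using b by simp
 ultimately show ?thesis using b M.sh_pos unfolding o' M.rbox_def y0_def by (auto simp: bint.simps of_nat_diff left_diff_distrib split: if_splits)
 qed
 let ?ob = "%i. (X i, X i + w i, al i, bl i)"
 have lb: "lay (card blks) (UN i:blks. {i}) [] (UN i:blks. bint (M.rbox (?ob i)))"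
 proof (rule lay_boxes[OF fin_blks])
 fix i assume i: "i : blks"
 hence t: "i : thick" "i : set ord" by (auto simp: blks_def thick_def)
 have "shelfable {i} (rw i) (real (bl i - al i) * g)" by (rule shelfable_stack) (use t thick_ab(2)[OF t(1)] in auto)
 thus "shelfb {i} (M.rbox (?ob i)) & nnb (M.rbox (?ob i))" using g_pos by (simp add: M.rbox_def)
 next
 fix i j assume ij: "i : blks" "j : blks" "i ~= j"
 hence t: "i : thick" "j : thick" by (auto simp: blks_def)
 have "0 < w i" "0 < w j" using t w_pos by (auto simp: thick_def)
 hence "bint (M.rbox (?ob i)) Int bint (M.rbox (?ob j)) = {}" by (intro M.rbox_disjoint thick_dj t ij thick_ab(1)) auto
 thus "{i} Int {j} = {} & bint (M.rbox (?ob i)) Int bint (M.rbox (?ob j)) = {}" using ij by simp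
 qed
 have x12: "(UN i:blks. bint (M.rbox (?ob i))) Int (UN B:Bx. bint (M.rbox B)) = {}"
 proof -
 have "bint (M.rbox (?ob i)) Int bint (M.rbox B) = {}" if i: "i : blks" and B: "B : Bx" for i B
 proof -
 obtain l r k k' where e: "B = (l, r, k, k')" by (cases B)
 have t: "i : thick" using i by (simp add: blks_def)
 have wi: "0 < w i" using t w_pos by (auto simp: thick_def)
 have Bd: "l < r" "k' = k + 1" using Bx_D[of l r k k'] B e by auto
 show ?thesis unfolding e by (rule M.rbox_disjoint[OF thick_fr[OF t]]) (use B e wi Bd thick_ab(1)[OF t] in auto)
 qed
 thus ?thesis by blast
 qed
 have l1: "lay (card blks + krk) (blks Un (win - L)) Fs2 (UN o':Ob. bint (M.rbox o'))"
 proof -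
 have "lay (card blks + krk) ((UN i:blks. {i}) Un (win - L)) ([] @ Fs2) ((UN i:blks. bint (M.rbox (?ob i))) Un (UN B:Bx. bint (M.rbox B)))"
 by (rule lay_Un[OF lb Fs2(1) _ x12]) (use thick3 tw ww in blast)
 moreover have "(UN i:blks. bint (M.rbox (?ob i))) Un (UN B:Bx. bint (M.rbox B)) = (UN o':Ob. bint (M.rbox o'))"
 unfolding Ob_def by (simp add: UN_Un image_image)
 ultimately show ?thesis by simp
 qed
 have l2: "lay (card M.bps * M.mcount + (card blks + krk)) ((Tl Un Vv) Un (blks Un (win - L))) (Fs1 @ Fs2) ?R0"
 by (rule lay_mono[OF lay_Un[OF Fs1(1) l1]]) (use thick3 tw ww bTV rb_sub in blast)+
 have FF: "0 <= fst dg & 0 <= snd dg & snd dg <= 4 * rH" if "dg : set (Fs1 @ Fs2)" for dg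
 using lay_dims[OF l2 that] Fs1(4) Fs2(4) gy y04 that by fastforce
 have cap: "area small <= (SUM dg<-Fs1 @ Fs2. cap (nv * rW) (eh * rH) dg)"
 proof (cases "small = {}")
 case True
 have "0 <= (SUM dg<-Fs1 @ Fs2. cap (nv * rW) (eh * rH) dg)" by (rule sum_list_nonneg) (auto simp: cap_def)
 thus ?thesis using True by (simp add: area_def)
 next
 case False
 then obtain i where i: "i : small" by blast
 \<comment> \<open>Heights are integral, so a small item exists only if \<open>eh * rH\<close> is at
   least 1; this makes the area of \<open>m\<close> unit rows negligible.\<close>
 have "1 <= rh i" using i so h_pos by (metis One_nat_def Suc_leI of_nat_1 of_nat_mono subsetD)
 hence "1 <= eh * rH" using i by (simp add: small_def)
 hence "real m * rW * 1 <= real m * rW * (eh * rH)" by (intro mult_left_mono) auto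
 also have "... = (real m * eh) * (rW * rH)" by (simp only: mult_ac)
 also have "... <= e / 5 * (rW * rH)" using s2 by (intro mult_right_mono) auto
 finally have mW: "real m * rW <= rW * eH / 5" by (simp add: eH_def mult_ac)
 have lenF: "real (length (Fs1 @ Fs2)) <= real (bpb * M.mcount + krk)"
 proof -
 have "length Fs1 <= card M.bps * M.mcount" "length Fs2 <= krk" using lay_len Fs1(1) Fs2(1) by blast+
 moreover have "card M.bps * M.mcount <= bpb * M.mcount" using card_bps by (rule mult_le_mono1)
 ultimately have "length (Fs1 @ Fs2) <= bpb * M.mcount + krk" unfolding length_append by linarith
 thus ?thesis by (rule of_nat_mono)
 qed
 have "(SUM dg<-Fs1 @ Fs2. snd dg) <= real (length (Fs1 @ Fs2)) * (4 * rH)" by (rule M.sum_list_bound) (use FF in blast)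
 also have "... <= real (bpb * M.mcount + krk) * (4 * rH)" using lenF by (intro mult_right_mono) auto
 finally have "nv * rW * (SUM dg<-Fs1 @ Fs2. snd dg) <= nv * rW * (real (bpb * M.mcount + krk) * (4 * rH))"
 using nu HW by (intro mult_left_mono) auto
 also have "... = (nv * (4 * real (bpb * M.mcount + krk))) * (rW * rH)" by (simp only: mult_ac)
 also have "... <= e / 5 * (rW * rH)" using s3 by (intro mult_right_mono) auto
 finally have G: "nv * rW * (SUM dg<-Fs1 @ Fs2. snd dg) <= rW * eH / 5" by (simp add: eH_def mult_ac)
 have "wdt (Fs1 @ Fs2) <= rW * real (2 * m + 1 + krk)" using Fs1(3) Fs2(3) by (simp add: algebra_simps)
 hence "eh * rH * wdt (Fs1 @ Fs2) <= eh * rH * (rW * real (2 * m + 1 + krk))" using eta HW by (intro mult_left_mono) auto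
 also have "... = (eh * real (2 * m + 1 + krk)) * (rW * rH)" by (simp only: mult_ac)
 also have "... <= e / 5 * (rW * rH)" using s4 by (intro mult_right_mono) auto
 finally have D: "eh * rH * wdt (Fs1 @ Fs2) <= rW * eH / 5" by (simp add: eH_def mult_ac)
 have "ar (Fs1 @ Fs2) - nv * rW * (SUM dg<-Fs1 @ Fs2. snd dg) - eh * rH * wdt (Fs1 @ Fs2)
 <= (SUM dg<-Fs1 @ Fs2. cap (nv * rW) (eh * rH) dg)" by (rule cap_sum_ge) (use FF nu eta in auto)
 moreover have "g * real (card M.Free) + rW * eH - rW * eH / 5 + (SUM B:Bx. real (card (smb B))) <= ar (Fs1 @ Fs2)"
 unfolding map_append sum_list_append using Fs1(2) Fs2(2) loss by linarith
 moreover have "0 <= rW * eH" using HW eH by simp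
 ultimately show ?thesis using area_small mW G D by linarith
 qed
 have l3: "lay (card M.bps * M.mcount + (card blks + krk)) ((Tl Un Vv) Un (blks Un (win - L)) Un small) [] ?R0"
 proof (rule lay_fill[where F = "Fs1 @ Fs2" and u = "nv * rW" and v = "eh * rH"])
 show "((Tl Un Vv) Un (blks Un (win - L))) Int small = {}" using thick3 tw ws ww by blast
 qed (use l2 so cap in "auto simp: small_def")
 define rowk where "rowk k = {i:wide - win. ly (Y i) = k}" for k
 define rbx where "rbx k = (0::real, y0 + real k * (eh * rH), rW, eh * rH)" for k :: nat
 have l4: "lay (card {..<m}) (UN k:{..<m}. rowk k) [] (UN k:{..<m}. bint (rbx k))"
 proof (rule lay_boxes)
 fix k
 have "shelfable (rowk k) (rW) (eh * rH)"
 proof (rule shelfable_row)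
 show "rowk k <= set ord" using so by (auto simp: rowk_def)
 show "wds (rowk k) <= rW" using of_nat_mono[OF cross_row[of k]] by (simp add: rowk_def)
 qed (use eta in "auto simp: rowk_def wide_def")
 thus "shelfb (rowk k) (rbx k) & nnb (rbx k)" using eta by (simp add: rbx_def)
 next
 fix k k' :: nat assume n: "k ~= k'"
 have *: "real k * (eh * rH) + eh * rH <= real k' * (eh * rH)" if "k < k'" for k k' :: nat
 proof -
 have "(real k + 1) * (eh * rH) <= real k' * (eh * rH)" using that eta by (intro mult_right_mono) auto
 thus ?thesis by (simp add: algebra_simps)
 qed
 have "bint (rbx k) Int bint (rbx k') = {}" unfolding rbx_def using n *[of k k'] *[of k' k] by (intro bint_djy) linarith
 thus "rowk k Int rowk k' = {} & bint (rbx k) Int bint (rbx k') = {}" using n by (auto simp: rowk_def)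
 qed simp
 have rows_eq: "(UN k:{..<m}. rowk k) = wide - win"
 proof -
 have "ly (Y i) < m" if "i : wide" for i using ly_m[of "Y i"] fits[of i] wide_ord[OF that] by auto
 thus ?thesis by (auto simp: rowk_def)
 qed
 let ?R1 = "{0<..<rW} \<times> {y0<..<y0 + eH}"
 have l4': "lay m (wide - win) [] ?R1"
 proof (rule lay_mono[OF l4[unfolded rows_eq]])
 have "bint (rbx k) <= ?R1" if "k < m" for k
 proof -
 have "(real k + 1) * (eh * rH) <= real m * (eh * rH)" using that eta by (intro mult_right_mono) auto
 also have "... = (real m * eh) * rH" by simp
 also have "... <= e / 5 * rH" using s2 by (intro mult_right_mono) auto
 finally have "real k * (eh * rH) + eh * rH <= eH" using eH by (simp add: eH_def algebra_simps)
 moreover have "0 <= real k * (eh * rH)" using eta by simp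
 moreover have "bint (0, y0 + t, rW, d) <= ?R1" if "t + d <= eH" "0 <= t" for t d using that by (auto simp: bint.simps)
 ultimately show ?thesis unfolding rbx_def by blast
 qed
 thus "(UN k:{..<m}. bint (rbx k)) <= ?R1" by blast
 qed simp
 let ?R2 = "{0<..<rW} \<times> {y0 + eH<..<y0 + 3 * eH}"
 have wW: "rw i <= rW" if "i : set ord" for i using fits[OF that] by simp
 have l5: "lay 1 L [] ?R2"
 proof (rule lay_items[where d = "rW" and g = "2 * eH" and x = 0 and y = "y0 + eH"])
 show "shelfable L (rW) (2 * eH)"
 proof (rule shelfable_stack)
 show Lo: "L <= set ord" using L(1) ww so by blast
 have "eh * rH * real (krk + qn + 2) = (eh * real (krk + qn + 2)) * rH" by (simp only: mult_ac)
 also have "... <= eH" unfolding eH_def using s5 by (intro mult_right_mono) auto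
 finally show "hts L <= 2 * eH" using L(2) by linarith
 qed (use wW L(1) ww so in blast)
 qed (use eH in "auto simp: bint.simps")
 \<comment> \<open>Medium items wider than half of the strip are stacked; the area bound limits
   their total height.\<close>
 define mw where "mw = {i:mid. rW / 2 < rw i}"
 have mo: "mid <= set ord" by (auto simp: mid_def)
 have midh: "rh i <= eH" if "i : mid" for i
 proof -
 have "rh i <= de * rH" using that by (auto simp: mid_def thick_def)
 also have "... <= eH" unfolding eH_def using del by (intro mult_right_mono) auto
 finally show ?thesis .
 qed
 have ar_mono: "area A <= area B" if "A <= B" "B <= set ord" for A B unfolding area_def using that by (intro sum_mono2) (auto intro: finite_subset)
 have amid: "area mid <= 2 * (rW * eH)"
 proof -
 let ?A = "{i:set ord. eh * rH < rh i & rh i <= de * rH}"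
 let ?B = "{i:set ord. rh i <= de * rH & nv * rW < rw i & rw i <= wm * rW}"
 have "mid <= ?A Un (?B - ?A)" by (auto simp: mid_def thick_def wide_def small_def)
 hence "area mid <= area (?A Un (?B - ?A))" by (rule ar_mono) auto
 also have "... = area ?A + area (?B - ?A)" by (rule area_Un) auto
 also have "area (?B - ?A) <= area ?B" by (rule ar_mono) auto
 finally show ?thesis using A1 A2 unfolding eWH by linarith
 qed
 let ?R3 = "{0<..<rW} \<times> {y0 + 3 * eH<..<y0 + 7 * eH}"
 have l6: "lay 1 mw [] ?R3"
 proof (rule lay_items[where d = "rW" and g = "4 * eH" and x = 0 and y = "y0 + 3 * eH"])
 show "shelfable mw (rW) (4 * eH)"
 proof (rule shelfable_stack)
 show "mw <= set ord" using mo by (auto simp: mw_def)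
 have "hts mw * (rW / 2) <= area mw" unfolding area_def sum_distrib_right
 by (intro sum_mono, subst mult.commute, intro mult_right_mono) (auto simp: mw_def)
 also have "... <= area mid" by (rule ar_mono) (use mo in "auto simp: mw_def")
 also have "... <= (4 * eH) * (rW / 2)" using amid by (simp add: mult.commute)
 finally show "hts mw <= 4 * eH" using HW by simp
 qed (use wW mo in "auto simp: mw_def")
 qed (use eH in "auto simp: bint.simps")
 let ?R4 = "{0<..<rW} \<times> {y0 + 7 * eH<..<y0 + 12 * eH}"
 have l7: "lay 1 ({} Un (mid - mw)) [] ?R4"
 \<comment> \<open>Here \<open>cap\<close> is half the width times \<open>4 * eH\<close>, exactly
   the bound in \<open>amid\<close>.\<close>
 proof (rule lay_fill[where F = "[(rW, 5 * eH)]" and u = "rW / 2" and v = eH])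
 have "lay 1 {} [(rW, 5 * eH)] ?R4" by (rule lay_free[where x = 0 and y = "y0 + 7 * eH"]) (use eH in "auto simp: bint.simps")
 thus "lay 1 {} ([(rW, 5 * eH)] @ []) ?R4" by simp
 have "area (mid - mw) <= area mid" by (rule ar_mono) (use mo in auto)
 thus "area (mid - mw) <= (SUM dg<-[(rW, 5 * eH)]. cap (rW / 2) eH dg)" using amid eH HW by (simp add: cap_def mult.commute)
 qed (use midh mo in "auto simp: mw_def")
 have D: "mid Int (thick Un wide Un small) = {}" by (auto simp: mid_def)
 have mwm: "mw <= mid" by (auto simp: mw_def)
 have l67: "lay (1 + 1) (mw Un (mid - mw)) ([] @ []) (?R3 Un ?R4)" by (rule lay_Un[OF l6]) (use l7 in auto)
 have l57: "lay (1 + (1 + 1)) (L Un (mw Un (mid - mw))) ([] @ ([] @ [])) (?R2 Un (?R3 Un ?R4))"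
 by (rule lay_Un[OF l5 l67]) (use D L(1) ww mwm in "blast, auto")
 have l47: "lay (m + (1 + (1 + 1))) ((wide - win) Un (L Un (mw Un (mid - mw)))) ([] @ ([] @ ([] @ []))) (?R1 Un (?R2 Un (?R3 Un ?R4)))"
 by (rule lay_Un[OF l4' l57]) (use D L(1) ww mwm eH in "blast, auto")
 have "lay ((card M.bps * M.mcount + (card blks + krk)) + (m + (1 + (1 + 1)))) (((Tl Un Vv) Un (blks Un (win - L)) Un small) Un ((wide - win) Un (L Un (mw Un (mid - mw))))) ([] @ ([] @ ([] @ ([] @ [])))) (?R0 Un (?R1 Un (?R2 Un (?R3 Un ?R4))))"
 proof (rule lay_Un[OF l3 l47])
 show "((Tl Un Vv) Un (blks Un (win - L)) Un small) Int ((wide - win) Un (L Un (mw Un (mid - mw)))) = {}" using D L(1) ww mwm thick3 tw ws by blast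
 qed (use eH in auto)
 moreover have "((Tl Un Vv) Un (blks Un (win - L)) Un small) Un ((wide - win) Un (L Un (mw Un (mid - mw)))) = set ord"
 using L(1) ww mwm thick3 so unfolding mid_def by blast
 ultimately have fin: "lay ((card M.bps * M.mcount + (card blks + krk)) + (m + (1 + (1 + 1)))) (set ord) [] (?R0 Un (?R1 Un (?R2 Un (?R3 Un ?R4))))" by simp
 show ?thesis
 proof (rule lay_mono[OF fin])
 show "card M.bps * M.mcount + (card blks + krk) + (m + (1 + (1 + 1))) <= Kb"
 using mult_le_mono1[OF card_bps, of M.mcount] unfolding Kb_def by linarith
 have t: "y0 + 12 * eH <= (4/3 + 15 * e) * rH" unfolding y0 using eH by (simp add: eH_def algebra_simps)
 show "?R0 Un (?R1 Un (?R2 Un (?R3 Un ?R4))) <= {0<..<rW} \<times> {0<..<(4/3 + 15 * e) * rH}" using t eH y0p by auto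
 qed
qed

end

section \<open>Choosing the thresholds by averaging\<close>

lemma sum_bands:
 fixes f F :: "'a => real" and b :: "nat => real"
 assumes "finite A" "!!i. 0 <= F i" "decseq b" shows "(SUM l<J. SUM i:{i:A. b (Suc l) < f i & f i <= b l}. F i) <= sum F A"
proof -
 let ?B = "%l. {i:A. b (Suc l) < f i & f i <= b l}"
 have dj: "?B l Int ?B l' = {}" if "l < l'" for l l'
 proof -
 have "b l' <= b (Suc l)" using assms(3) that by (simp add: decseq_def)
 thus ?thesis by fastforce
 qed
 have "(SUM l<J. sum F (?B l)) = sum F (UN l<J. ?B l)"
 proof (rule sum.UNION_disjoint[symmetric])
 show "ALL l:{..<J}. ALL l':{..<J}. l ~= l' --> ?B l Int ?B l' = {}"
 proof (intro ballI impI)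
 fix l l' :: nat assume "l ~= l'"
 then consider "l < l'" | "l' < l" by linarith
 thus "?B l Int ?B l' = {}"
 proof cases
 case 1 thus ?thesis by (rule dj)
 next
 case 2 show ?thesis unfolding Int_commute[of "?B l"] by (rule dj[OF 2])
 qed
 qed
 qed (use assms(1) in auto)
 also have "... <= sum F A" using assms by (intro sum_mono2) auto
 finally show ?thesis .
qed

lemma sum_halving:
 fixes a :: "nat => real"
 assumes "!!l. 0 <= a l" "!!l. a (Suc l) <= a l / 2" shows "sum a {..<J} <= 2 * a 0" using assms
proof (induct J arbitrary: a)
 case (Suc J)
 have "sum (%l. a (Suc l)) {..<J} <= 2 * a (Suc 0)" by (rule Suc.hyps) (use Suc.prems in auto)
 moreover have "a (Suc 0) <= a 0 / 2" by (rule Suc.prems)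
 ultimately show ?case unfolding sum.lessThan_Suc_shift by linarith
qed simp

text \<open>The sum starts with the first term below \<open>x\<close> and then at least halves. It
  serves to charge all thresholds below the width of an item to this width.\<close>

lemma sum_halving_below:
 fixes a :: "nat => real"
 assumes "!!l. 0 <= a l" "!!l. a (Suc l) <= a l / 2" "0 <= x" shows "(SUM l<J. if a l < x then a l else 0) <= 2 * x" using assms
proof (induct J arbitrary: a)
 case (Suc J)
 show ?case
 proof (cases "a 0 < x")
 case True
 have "(SUM l<Suc J. if a l < x then a l else 0) <= sum a {..<Suc J}" using Suc.prems by (intro sum_mono) auto
 also have "... <= 2 * a 0" by (rule sum_halving) (use Suc.prems in auto)
 finally show ?thesis using True by linarith
 next
 case False
 have "(SUM l<J. if a (Suc l) < x then a (Suc l) else 0) <= 2 * x" by (rule Suc.hyps) (use Suc.prems in auto)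
 thus ?thesis unfolding sum.lessThan_Suc_shift using False by simp
 qed
qed (use assms in simp)

definition boxes_bound :: "real => nat => nat" where "boxes_bound wm m3 = 3 * m3 * (nat \<lceil>1 / wm\<rceil> + 1)"
definition loss_const :: "nat => real" where "loss_const m3 = 4 * \<bar>params.Cm m3\<bar> + 4 * real (matrix.mcount m3) + 1"
text \<open>The halving makes the sequence geometric. The second bound makes the slices caused by
  the boxes of wide items, together with the boxes of the repacking, cost at most
  \<open>e / 10\<close>.\<close>

definition next_width :: "real => nat => real => real" where "next_width e m3 wm = min (wm / 2)
 (e / (10 * ((2 + 2 * real (boxes_bound wm m3)) * loss_const m3 + 4 * real (params.krk e wm m3))))"
fun widths :: "real => nat => nat => real" where "widths e m3 0 = 1"
| "widths e m3 (Suc l) = next_width e m3 (widths e m3 l)"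
text \<open>The other \<open>e / 10\<close> of the budget, for the slices caused by big items: the
  bound demanded of \<open>nv\<close> times their number.\<close>

definition blk_const :: "real => nat => real" where "blk_const e m3 = e / (20 * loss_const m3)"
text \<open>Chosen so that the assumption \<open>mbig\<close> of \<open>params\<close>
  holds.\<close>

definition third :: "real => real => nat" where "third e de = nat \<lceil>2 * (1 + e) / (3 * e * de)\<rceil> + 1"
text \<open>At least the bound on the sum in \<open>choose_width\<close>, so that some term of the
  sum is at most 1.\<close>

definition wsteps :: "real => real => nat" where "wsteps e de = nat \<lceil>1 / e + 2 / (de * blk_const e (third e de))\<rceil> + 1"
definition stack_const :: "real => nat => real => nat" where "stack_const e m3 wm = 2 * (3 * m3) + 4 + params.krk e wm m3 + params.qn e wm"
text \<open>The width threshold is chosen after the heights, so the next height has to be small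
  enough for every width of the sequence. Dividing by the sum over all of them achieves
  this.\<close>

definition next_height :: "real => real => real" where
 "next_height e de = min de (e / (5 * (SUM l<wsteps e de. real (stack_const e (third e de) (widths e (third e de) l)))))"
fun heights :: "real => nat => real" where "heights e 0 = e"
| "heights e (Suc j) = next_height e (heights e j)"
definition hsteps :: "real => nat" where "hsteps e = nat \<lceil>1 / e\<rceil> + 1"
definition box_count :: "real => nat => real => real => nat" where "box_count e m3 wm nv = (let b = nat \<lfloor>blk_const e m3 / nv\<rfloor> in
 b + ((2 + 2 * (b + boxes_bound wm m3)) * matrix.mcount m3 + params.krk e wm m3) + 3 * m3 + 3)"

lemma loss_const_pos: "0 < loss_const m3" by (simp add: loss_const_def add_nonneg_pos)

lemma next_width_pos: "0 < e ==> 0 < wm ==> 0 < next_width e m3 wm" unfolding next_width_def using loss_const_pos[of m3]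
 by (auto intro!: divide_pos_pos mult_pos_pos add_pos_nonneg)

lemma widths_pos: "0 < e ==> 0 < widths e m3 l" by (induct l) (auto intro: next_width_pos)

lemma widths_half: "widths e m3 (Suc l) <= widths e m3 l / 2" unfolding widths.simps next_width_def by (rule min.cobounded1)

lemma widths_dec: "0 < e ==> decseq (widths e m3)" by (rule decseq_SucI) (use widths_half widths_pos in "smt (verit) field_sum_of_halves")

lemma widths_le: "0 < e ==> widths e m3 l <= 1" using widths_dec[of e m3] by (metis decseq_def le0 widths.simps(1))

lemma stack_sum_pos: "0 < (SUM l<wsteps e de. real (stack_const e m3 (widths e m3 l)))" by (intro sum_pos) (auto simp: wsteps_def stack_const_def)

lemma heights_pos: "0 < e ==> 0 < heights e j" by (induct j) (auto simp: next_height_def intro!: divide_pos_pos mult_pos_pos stack_sum_pos)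

lemma heights_dec: "decseq (heights e)" by (rule decseq_SucI) (simp add: next_height_def)

lemma heights_le: "heights e j <= e" using heights_dec[of e] by (metis decseq_def le0 heights.simps(1))

lemma heights_stack:
 assumes e: "0 < e" and l: "l < wsteps e (heights e j)"
 shows "heights e (Suc j) * (5 * real (stack_const e (third e (heights e j)) (widths e (third e (heights e j)) l))) <= e"
proof -
 define m3 where "m3 = third e (heights e j)"
 define s where "s = (SUM l<wsteps e (heights e j). real (stack_const e m3 (widths e m3 l)))"
 have s0: "0 < s" unfolding s_def by (rule stack_sum_pos)
 have "heights e (Suc j) <= e / (5 * s)" by (simp add: next_height_def m3_def s_def)
 hence h1: "heights e (Suc j) * (5 * s) <= e" using s0 by (simp add: pos_le_divide_eq del: heights.simps)
 have "real (stack_const e m3 (widths e m3 l)) <= s" unfolding s_def using l by (intro member_le_sum) auto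
 hence "heights e (Suc j) * (5 * real (stack_const e m3 (widths e m3 l))) <= heights e (Suc j) * (5 * s)"
 using heights_pos[OF e, of "Suc j"] by (intro mult_left_mono) auto
 thus ?thesis using h1 unfolding m3_def by linarith
qed

context params
begin

lemma assembly_box_count:
 assumes A1: "area {i:set ord. eh * rH < rh i & rh i <= de * rH} <= e * rW * rH"
 and A2: "area {i:set ord. rh i <= de * rH & nv * rW < rw i & rw i <= wm * rW} <= e * rW * rH"
 and b: "nv * real (card {i:set ord. de * rH < rh i & nv * rW < rw i}) <= blk_const e m3" and n: "nv <= next_width e m3 wm"
 and et: "eh * (5 * real (stack_const e m3 wm)) <= e" shows "lay (box_count e m3 wm nv) (set ord) [] ({0<..<rW} \<times> {0<..<(4/3 + 15 * e) * rH})"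
proof -
 define C where "C = loss_const m3"
 define br where "br = real (boxes_bound wm m3)"
 have C0: "0 < C" unfolding C_def by (rule loss_const_pos)
 have C: "4 * Cm <= C" "4 * real M.mcount <= C" unfolding C_def loss_const_def by linarith+
 have bl: "nv * real (card blks) * (20 * C) <= e"
 proof -
 have "blks = {i:set ord. de * rH < rh i & nv * rW < rw i}" by (auto simp: blks_def thick_def)
 hence "nv * real (card blks) <= e / (20 * C)" using b unfolding blk_const_def C_def by simp
 thus ?thesis using C0 by (simp add: field_simps)
 qed
 have nu': "nv * ((2 + 2 * br) * C + 4 * real krk) <= e / 10"
 proof -
 have p: "0 < (2 + 2 * br) * C + 4 * real krk" using C0 unfolding br_def by (intro add_pos_nonneg mult_pos_pos) auto
 have "nv <= e / (10 * ((2 + 2 * br) * C + 4 * real krk))" using n unfolding next_width_def br_def C_def by simp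
 thus ?thesis using p by (simp add: field_simps)
 qed
 have bp: "real bpb = 2 + 2 * real (card blks) + 2 * br" by (simp add: bpb_def br_def boxes_bound_def)
 have key: "nv * real bpb * C + nv * (4 * real krk) <= e / 5"
 proof -
 have "nv * real bpb * C + nv * (4 * real krk) = nv * ((2 + 2 * br) * C + 4 * real krk) + 2 * (nv * real (card blks) * C)"
 unfolding bp by (simp add: algebra_simps)
 thus ?thesis using nu' bl by linarith
 qed
 have kn: "0 <= nv * (4 * real krk)" using nu by simp
 have nb: "0 <= nv * real bpb" using nu by simp
 have s1: "nv * real bpb * (4 * Cm) <= e / 5" using key kn mult_left_mono[OF C(1) nb] by linarith
 have s3: "nv * (4 * real (bpb * M.mcount + krk)) <= e / 5"
 proof -
 have "nv * (4 * real (bpb * M.mcount + krk)) = nv * real bpb * (4 * real M.mcount) + nv * (4 * real krk)" by (simp add: algebra_simps)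
 thus ?thesis using key mult_left_mono[OF C(2) nb] by linarith
 qed
 have et': "eh * real k <= e / 5" if "k <= stack_const e m3 wm" for k
 proof -
 have "eh * real k <= eh * real (stack_const e m3 wm)" using that eta by (intro mult_left_mono) auto
 thus ?thesis using et by linarith
 qed
 have s2: "real m * eh <= e / 5" using et'[of m] by (simp add: stack_const_def mult.commute)
 have s4: "eh * real (2 * m + 1 + krk) <= e / 5" by (rule et') (simp add: stack_const_def)
 have "eh * real (krk + qn + 2) <= e / 5" by (rule et') (simp add: stack_const_def)
 hence s5: "eh * real (krk + qn + 2) <= e" using e by linarith
 have "card blks <= nat \<lfloor>blk_const e m3 / nv\<rfloor>"
 proof -
 have "blks = {i:set ord. de * rH < rh i & nv * rW < rw i}" by (auto simp: blks_def thick_def)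
 hence "real (card blks) <= blk_const e m3 / nv" using b nu by (simp add: field_simps)
 thus ?thesis by (rule le_nat_floor)
 qed
 hence "Kb <= box_count e m3 wm nv" unfolding Kb_def box_count_def Let_def bpb_def boxes_bound_def by (intro add_mono mult_le_mono le_refl)
 thus ?thesis using lay_mono[OF assembly[OF A1 A2 s1 s2 s3 s4 s5]] by blast
qed

end

context inst
begin

lemma choose_height:
 assumes "0 < e" shows "EX j<hsteps e. area {i:set ord. heights e (Suc j) * rH < rh i & rh i <= heights e j * rH} <= e * rW * rH"
proof -
 let ?A = "%j. area {i:set ord. heights e (Suc j) * rH < rh i & rh i <= heights e j * rH}"
 have "decseq (%j. heights e j * rH)" using heights_dec by (auto simp: decseq_def intro: mult_right_mono)
 hence "(SUM j<hsteps e. ?A j) <= area (set ord)" unfolding area_def by (intro sum_bands[where b = "%j. heights e j * rH"]) auto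
 also have "... <= rW * rH" by (rule area_le) simp
 finally have s: "(SUM j<hsteps e. ?A j) <= rW * rH" .
 obtain j where j: "j < hsteps e" "?A j <= rW * rH / real (hsteps e)" using pigeonhole_avg[OF _ s] by (auto simp: hsteps_def)
 have "1 / e <= real (hsteps e)" unfolding hsteps_def by linarith
 hence "1 <= e * real (hsteps e)" using assms by (simp add: field_simps)
 hence "rW * rH * 1 <= rW * rH * (e * real (hsteps e))" by (intro mult_left_mono) auto
 hence "rW * rH / real (hsteps e) <= e * rW * rH" by (simp add: field_simps hsteps_def)
 thus ?thesis using j by (meson order_trans)
qed

text \<open>Two demands are averaged at once. The bands of medium widths are disjoint, so their
  areas sum to at most \<open>rW * rH\<close>. A big item counts at the level \<open>l\<close> only
  if the threshold is below its relative width; these thresholds sum to at most twice that width,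
  and the thick items have total width at most \<open>rW / de\<close>.\<close>

lemma choose_width:
 assumes e: "0 < e" and de: "0 < de"
 defines "W' == widths e (third e de)" shows "EX l<wsteps e de.
 area {i:set ord. rh i <= de * rH & W' (Suc l) * rW < rw i & rw i <= W' l * rW} <= e * rW * rH &
 W' (Suc l) * real (card {i:set ord. de * rH < rh i & W' (Suc l) * rW < rw i}) <= blk_const e (third e de)"
proof -
 let ?J = "wsteps e de" and ?ga = "blk_const e (third e de)"
 define S where "S = {i:set ord. rh i <= de * rH}"
 define T where "T = {i:set ord. de * rH < rh i}"
 have HW: "0 < rH" "0 < rW" using H_pos W_pos by auto
 have ga: "0 < ?ga" using e loss_const_pos by (simp add: blk_const_def)
 have Wp: "0 < W' l" for l unfolding W'_def using widths_pos[OF e] .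
 have Wh: "W' (Suc l) <= W' l / 2" for l unfolding W'_def by (rule widths_half)
 define f1 where "f1 l = area {i:S. W' (Suc l) * rW < rw i & rw i <= W' l * rW}" for l
 define f2 where "f2 l = W' (Suc l) * real (card {i:T. W' (Suc l) * rW < rw i})" for l
 have finT: "finite T" by (simp add: T_def)
 have "decseq (%j. W' j * rW)" using widths_dec[OF e, of "third e de"] unfolding W'_def by (auto simp: decseq_def intro: mult_right_mono)
 hence "sum f1 {..<?J} <= area S" unfolding area_def f1_def by (intro sum_bands[where b = "%j. W' j * rW"]) (auto simp: S_def)
 also have "... <= rW * rH" by (rule area_le) (auto simp: S_def)
 finally have s1: "sum f1 {..<?J} <= rW * rH" .
 have "f2 l = (SUM i:T. if W' (Suc l) < rw i / rW then W' (Suc l) else 0)" for l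
 proof -
 have "{i:T. W' (Suc l) * rW < rw i} = {i:T. W' (Suc l) < rw i / rW}" using HW by (simp add: field_simps)
 thus ?thesis unfolding f2_def using finT by (simp add: sum.inter_filter[symmetric] mult.commute)
 qed
 hence "sum f2 {..<?J} = (SUM l<?J. SUM i:T. if W' (Suc l) < rw i / rW then W' (Suc l) else 0)" by simp
 also have "... = (SUM i:T. SUM l<?J. if W' (Suc l) < rw i / rW then W' (Suc l) else 0)" by (rule sum.swap)
 also have "... <= (SUM i:T. 2 * (rw i / rW))" by (intro sum_mono sum_halving_below) (use Wp Wh in "auto intro: less_imp_le")
 also have "... <= 2 / de"
 proof -
 have "wds T * (de * rH) <= area T" unfolding area_def sum_distrib_right by (intro sum_mono mult_left_mono) (auto simp: T_def)
 also have "... <= rW * rH" by (rule area_le) (auto simp: T_def)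
 finally have "wds T * de <= rW" using HW by (simp add: mult.assoc[symmetric])
 hence "(wds T) / rW <= 1 / de" using HW de by (simp add: field_simps)
 thus ?thesis by (simp add: sum_distrib_left[symmetric] sum_divide_distrib[symmetric])
 qed
 finally have s2: "sum f2 {..<?J} <= 2 / de" .
 \<comment> \<open>Both quantities are divided by their permitted values. Where the sum is at most
   1, both demands hold, as both terms are nonnegative.\<close>
 let ?f = "%l. f1 l / (e * rW * rH) + f2 l / ?ga"
 have "sum ?f {..<?J} = sum f1 {..<?J} / (e * rW * rH) + sum f2 {..<?J} / ?ga" by (simp add: sum.distrib sum_divide_distrib)
 also have "... <= rW * rH / (e * rW * rH) + (2 / de) / ?ga" using s1 s2 e HW ga by (intro add_mono divide_right_mono) auto
 also have "... = 1 / e + 2 / (de * ?ga)" using HW by simp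
 finally have s: "sum ?f {..<?J} <= 1 / e + 2 / (de * ?ga)" .
 obtain l where l: "l < ?J" "?f l <= (1 / e + 2 / (de * ?ga)) / real ?J" using pigeonhole_avg[OF _ s] by (auto simp: wsteps_def)
 have "1 / e + 2 / (de * ?ga) <= real ?J" unfolding wsteps_def by linarith
 hence "(1 / e + 2 / (de * ?ga)) / real ?J <= 1" by (simp add: divide_le_eq_1 wsteps_def)
 hence fl: "?f l <= 1" using l by linarith
 have "0 <= f1 l" unfolding f1_def area_def by (intro sum_nonneg) auto
 moreover have "0 <= f2 l" unfolding f2_def using Wp[of "Suc l"] by simp
 ultimately have "0 <= f1 l / (e * rW * rH)" "0 <= f2 l / ?ga" using e ga by auto
 hence "f1 l / (e * rW * rH) <= 1" "f2 l / ?ga <= 1" using fl by linarith+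
 hence "f1 l <= e * rW * rH" "f2 l <= ?ga" using e HW ga by (auto simp: divide_le_eq_1_pos)
 moreover have "{i:S. W' (Suc l) * rW < rw i & rw i <= W' l * rW} =
 {i:set ord. rh i <= de * rH & W' (Suc l) * rW < rw i & rw i <= W' l * rW}"
 "{i:T. W' (Suc l) * rW < rw i} = {i:set ord. de * rH < rh i & W' (Suc l) * rW < rw i}" by (auto simp: S_def T_def)
 ultimately show ?thesis unfolding f1_def f2_def using l(1) by auto
qed

end

text \<open>The suitable thresholds depend on the instance, but the number of boxes must not. So the
  counts of all candidates are added.\<close>

definition total_boxes :: "real => nat" where "total_boxes e = (SUM j<hsteps e. SUM l<wsteps e (heights e j).
 (let m3 = third e (heights e j) in box_count e m3 (widths e m3 l) (widths e m3 (Suc l))))"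

theorem (in inst) few_boxes:
 assumes e: "0 < e" "e <= 1" shows "lay (total_boxes e) (set ord) [] ({0<..<real W} \<times> {0<..<(4/3 + 15 * e) * real H})"
proof -
 obtain j where j: "j < hsteps e" "area {i:set ord. heights e (Suc j) * real H < real (h i) & real (h i) <= heights e j * real H} <= e * real W * real H"
 using choose_height[OF e(1)] by blast
 define de where "de = heights e j"
 define m3 where "m3 = third e de"
 have de: "0 < de" "de <= e" unfolding de_def using heights_pos[OF e(1)] heights_le by auto
 obtain l where l: "l < wsteps e de"
 "area {i:set ord. real (h i) <= de * real H & widths e m3 (Suc l) * real W < real (w i) & real (w i) <= widths e m3 l * real W} <= e * real W * real H"
 "widths e m3 (Suc l) * real (card {i:set ord. de * real H < real (h i) & widths e m3 (Suc l) * real W < real (w i)}) <= blk_const e m3"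
 using choose_width[OF e(1) de(1)] unfolding m3_def by blast
 have mb: "2 * (1 + e) <= e * de * real (3 * m3)"
 proof -
 have "2 * (1 + e) / (3 * e * de) <= real m3" unfolding m3_def third_def by linarith
 thus ?thesis using e de by (simp add: field_simps)
 qed
 have wl: "widths e m3 (Suc l) <= widths e m3 l" using widths_dec[OF e(1), of m3] by (simp add: decseq_Suc_iff)
 have hl: "heights e (Suc j) <= de" unfolding de_def using heights_dec[of e] by (simp add: decseq_Suc_iff)
 have m30: "0 < m3" by (simp add: m3_def third_def)
 have P: "params ord w h X Y W H e de (heights e (Suc j)) (widths e m3 l) (widths e m3 (Suc l)) m3"
 by unfold_locales (use e de mb wl hl heights_pos[OF e(1)] widths_pos[OF e(1)] widths_le[OF e(1)] m30 in "simp_all del: heights.simps widths.simps")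
 have n: "widths e m3 (Suc l) <= next_width e m3 (widths e m3 l)" by simp
 have *: "lay (box_count e m3 (widths e m3 l) (widths e m3 (Suc l))) (set ord) [] ({0<..<real W} \<times> {0<..<(4/3 + 15 * e) * real H})"
 using params.assembly_box_count[OF P _ l(2,3) n] j(2) heights_stack[OF e(1), of l j] l(1) unfolding de_def m3_def by blast
 have "box_count e m3 (widths e m3 l) (widths e m3 (Suc l)) <= (SUM l<wsteps e de. box_count e m3 (widths e m3 l) (widths e m3 (Suc l)))"
 using l(1) by (intro member_le_sum) auto
 also have "... = (SUM l<wsteps e (heights e j). (let m3 = third e (heights e j) in box_count e m3 (widths e m3 l) (widths e m3 (Suc l))))"
 by (simp add: de_def m3_def Let_def)
 also have "... <= total_boxes e" unfolding total_boxes_def using j(1) by (intro member_le_sum) auto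
 finally show ?thesis using lay_mono[OF *] by blast
qed

text \<open>\<open>okb\<close>: the items of the list can be put, in this order, into the box with left, right and top
 border \<open>X\<close>, \<open>R\<close>, \<open>T\<close>, either on the current shelf, filled up to column \<open>cx\<close>, or on a new shelf
 starting at height \<open>ny\<close>.\<close>

fun okb :: "(nat => nat) => (nat => nat) => nat => nat => nat => nat => nat => nat list => bool" where "okb w h X R T cx ny [] <-> True"
| "okb w h X R T cx ny (i # xs) <-> (cx + w i <= R & okb w h X R T (cx + w i) ny xs) |
 (ny + h i <= T & X + w i <= R & okb w h X R T (X + w i) (ny + h i) xs)"

section \<open>Integral boxes\<close>

text \<open>The chunks tell where to open a new shelf; \<open>c'\<close> is the part of the current
  shelf that is still to come.\<close>

lemma okb_chunks:
 assumes "ALL c:set cs. c ~= [] & X + (SUM i<-c. w i) <= R" "ny + (SUM c<-cs. h (hd c)) <= T" "c' = [] | cx + (SUM i<-c'. w i) <= R"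
 shows "okb w h X R T cx ny (c' @ concat cs)" using assms
proof (induct cs arbitrary: c' cx ny)
 case Nil
 thus ?case by (induct c' arbitrary: cx) auto
next
 case (Cons c cs)
 obtain i c2 where c: "c = i # c2" using Cons.prems(1) by (cases c) auto
 show ?case using Cons.prems(3)
 proof (induct c' arbitrary: cx)
 case Nil
 have "okb w h X R T (X + w i) (ny + h i) (c2 @ concat cs)" by (rule Cons.hyps) (use Cons.prems(1,2) c in auto)
 thus ?case using Cons.prems(1,2) c by auto
 next
 case (Cons j c')
 thus ?case by auto
 qed
qed

lemma real_sum_list: "real (SUM i<-xs. f i) = (SUM i<-xs. real (f i))" by (induct xs) auto

context items
begin

text \<open>Corners and dimensions are rounded down separately. If \<open>x + d\<close> is at most
  \<open>z\<close>, the floors of \<open>x\<close> and \<open>d\<close> add up to at most the floor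
  of \<open>z\<close>, so boxes stay disjoint and inside the strip; the integral items still fit
  into the rounded dimensions. A box with a side below 1 holds no item and is replaced by the empty
  box at the origin.\<close>

lemma lay_integral:
 assumes "lay K (set ord) [] ({0<..<real W} \<times> {0<..<T})"
 shows "EX (X :: nat => nat) R Y U f. (ALL b<K. X b <= R b & R b <= W & Y b <= U b & U b <= nat \<lfloor>T\<rfloor>) &
 (ALL b<K. ALL b'<K. b ~= b' --> R b <= X b' | R b' <= X b | U b <= Y b' | U b' <= Y b) &
 (ALL i:set ord. f i < K) &
 (ALL b<K. okb w h (X b) (R b) (U b) (R b) (Y b) (filter (%i. f i = b) ord))"
proof -
 obtain cs :: "(box * nat set) list" where len: "length cs <= K" and dj: "bdj (map fst cs)"
 and sub: "ALL b:set (map fst cs). bint b <= {0<..<real W} \<times> {0<..<T} & nnb b"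
 and un: "set ord = \<Union>(snd ` set cs)" and Sdj: "pdj (map snd cs)" and sh: "ALL (b, S):set cs. shelfb S b" using assms unfolding lay_def by auto
 define bx where "bx b = fst (cs ! b)" for b
 define S where "S b = snd (cs ! b)" for b
 define ok where "ok b <-> b < length cs & 1 <= fst (dims (bx b)) & 1 <= snd (dims (bx b))" for b
 define px :: "box => real" where "px = (%(x, y, d, g). x)"
 define py :: "box => real" where "py = (%(x, y, d, g). y)"
 define X where "X b = (if ok b then nat \<lfloor>px (bx b)\<rfloor> else 0)" for b
 define Y where "Y b = (if ok b then nat \<lfloor>py (bx b)\<rfloor> else 0)" for b
 define R where "R b = (if ok b then nat \<lfloor>px (bx b)\<rfloor> + nat \<lfloor>fst (dims (bx b))\<rfloor> else 0)" for b
 define U where "U b = (if ok b then nat \<lfloor>py (bx b)\<rfloor> + nat \<lfloor>snd (dims (bx b))\<rfloor> else 0)" for b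
 define f where "f i = (SOME b. b < length cs & i : S b)" for i
 have bxd: "bx b = (px (bx b), py (bx b), fst (dims (bx b)), snd (dims (bx b)))" for b by (cases "bx b") (simp add: px_def py_def)
 have csin: "cs ! b : set cs" if "b < length cs" for b using that by simp
 have okD: "0 <= px (bx b) & px (bx b) + fst (dims (bx b)) <= real W & 0 <= py (bx b) & py (bx b) + snd (dims (bx b)) <= T" if o: "ok b" for b
 proof -
 define x y d g where e: "x = px (bx b)" "y = py (bx b)" "d = fst (dims (bx b))" "g = snd (dims (bx b))"
 have dg: "1 <= d" "1 <= g" using o by (auto simp: ok_def e)
 have "bx b = (x, y, d, g)" unfolding e by (rule bxd)
 moreover have "bint (bx b) <= {0<..<real W} \<times> {0<..<T}" using sub o by (auto simp: ok_def bx_def)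
 ultimately have "{x<..<x + d} \<times> {y<..<y + g} <= {0<..<real W} \<times> {0<..<T}" by (simp add: bint.simps)
 moreover have "{x<..<x + d} ~= {}" "{y<..<y + g} ~= {}" using dg by auto
 ultimately have "{x<..<x + d} <= {0<..<real W}" "{y<..<y + g} <= {0<..<T}" unfolding times_subset_iff by blast+
 hence "0 <= x & x + d <= real W & 0 <= y & y + g <= T" using dg by (auto simp: greaterThanLessThan_subseteq_greaterThanLessThan)
 thus ?thesis by (simp add: e)
 qed
 have fl: "nat \<lfloor>x\<rfloor> + nat \<lfloor>d\<rfloor> <= nat \<lfloor>z\<rfloor>" if "x + d <= z" "0 <= x" "0 <= d" for x d z :: real
 proof -
 have "real (nat \<lfloor>x\<rfloor> + nat \<lfloor>d\<rfloor>) <= z" using that by (simp add: of_nat_nat) linarith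
 thus ?thesis by (rule le_nat_floor)
 qed
 have 1: "X b <= R b & R b <= W & Y b <= U b & U b <= nat \<lfloor>T\<rfloor>" for b
 proof (cases "ok b")
 case True
 have "nat \<lfloor>px (bx b)\<rfloor> + nat \<lfloor>fst (dims (bx b))\<rfloor> <= nat \<lfloor>real W\<rfloor>" by (rule fl) (use okD[OF True] True in "auto simp: ok_def")
 moreover have "nat \<lfloor>py (bx b)\<rfloor> + nat \<lfloor>snd (dims (bx b))\<rfloor> <= nat \<lfloor>T\<rfloor>" by (rule fl) (use okD[OF True] True in "auto simp: ok_def")
 ultimately show ?thesis using True by (simp add: X_def R_def Y_def U_def)
 qed (simp add: X_def R_def Y_def U_def)
 have sep: "R b <= X b' | R b' <= X b | U b <= Y b' | U b' <= Y b" if "b < b'" for b b'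
 proof (cases "ok b & ok b'")
 case False
 thus ?thesis by (auto simp: X_def R_def Y_def U_def)
 next
 case True
 define x y d g where e: "x = px (bx b)" "y = py (bx b)" "d = fst (dims (bx b))" "g = snd (dims (bx b))"
 define x' y' d' g' where e': "x' = px (bx b')" "y' = py (bx b')" "d' = fst (dims (bx b'))" "g' = snd (dims (bx b'))"
 have dg: "1 <= d" "1 <= g" "1 <= d'" "1 <= g'" using True by (auto simp: ok_def e e')
 have p: "0 <= x" "0 <= y" "0 <= x'" "0 <= y'" using okD True by (auto simp: e e')
 have "bint (bx b) Int bint (bx b') = {}" using sorted_wrt_nth_less[OF dj, of b b'] True that by (auto simp: ok_def bx_def)
 moreover have "bx b = (x, y, d, g)" "bx b' = (x', y', d', g')" unfolding e e' by (rule bxd)+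
 ultimately have i: "{x<..<x + d} Int {x'<..<x' + d'} = {} | {y<..<y + g} Int {y'<..<y' + g'} = {}"
 by (simp only: bint.simps Times_Int_Times Times_empty)
 have iv: "p + q <= p' | p' + q' <= p" if "{p<..<p + q} Int {p'<..<p' + q'} = {}" "1 <= q" "1 <= q'" for p q p' q' :: real
 proof (rule ccontr)
 assume n: "~ ?thesis"
 have "(max p p' + min (p + q) (p' + q')) / 2 : {p<..<p + q} Int {p'<..<p' + q'}" using n that(2,3) by (auto simp: max_def min_def field_simps)
 thus False using that(1) by blast
 qed
 have "x + d <= x' | x' + d' <= x | y + g <= y' | y' + g' <= y" using i iv dg by blast
 moreover have "nat \<lfloor>x\<rfloor> + nat \<lfloor>d\<rfloor> <= nat \<lfloor>x'\<rfloor>" if "x + d <= x'" using fl[OF that] p dg by simp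
 moreover have "nat \<lfloor>x'\<rfloor> + nat \<lfloor>d'\<rfloor> <= nat \<lfloor>x\<rfloor>" if "x' + d' <= x" using fl[OF that] p dg by simp
 moreover have "nat \<lfloor>y\<rfloor> + nat \<lfloor>g\<rfloor> <= nat \<lfloor>y'\<rfloor>" if "y + g <= y'" using fl[OF that] p dg by simp
 moreover have "nat \<lfloor>y'\<rfloor> + nat \<lfloor>g'\<rfloor> <= nat \<lfloor>y\<rfloor>" if "y' + g' <= y" using fl[OF that] p dg by simp
 ultimately show ?thesis using True unfolding X_def R_def Y_def U_def e[symmetric] e'[symmetric] by auto
 qed
 have 2: "R b <= X b' | R b' <= X b | U b <= Y b' | U b' <= Y b" if "b ~= b'" for b b' using sep[of b b'] sep[of b' b] that by (cases "b < b'") auto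
 have fex: "f i < length cs & i : S (f i)" if "i : set ord" for i
 proof -
 have "i : \<Union>(snd ` set cs)" using that unfolding un .
 then obtain c where "c : set cs" "i : snd c" by blast
 hence "EX b. b < length cs & i : S b" by (auto simp: S_def in_set_conv_nth)
 thus ?thesis unfolding f_def by (rule someI_ex)
 qed
 have Sd: "S b Int S b' = {}" if "b < b'" "b' < length cs" for b b' using sorted_wrt_nth_less[OF Sdj that(1)] that by (simp add: S_def)
 have fb: "f i = b <-> b < length cs & i : S b" if "i : set ord" for i b
 proof
 assume "b < length cs & i : S b"
 thus "f i = b" using fex[OF that] Sd[of "f i" b] Sd[of b "f i"] by (cases "f i" b rule: linorder_cases) auto
 qed (use fex[OF that] in auto)
 have 4: "okb w h (X b) (R b) (U b) (R b) (Y b) (filter (%i. f i = b) ord)" for b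
 proof (cases "b < length cs")
 case False
 hence "filter (%i. f i = b) ord = []" using fb by (auto simp: filter_empty_conv)
 thus ?thesis by simp
 next
 case True
 have F: "filter (%i. f i = b) ord = sl (S b)" unfolding sl_def using fb True by (intro filter_cong) auto
 have "shelfb (S b) (bx b)" using sh csin[OF True] by (auto simp: S_def bx_def)
 then obtain css where css: "concat css = sl (S b)" "chunked css (fst (dims (bx b))) (snd (dims (bx b)))" by (auto simp: shelfable_def)
 show ?thesis
 proof (cases "css = []")
 case True
 thus ?thesis using F css by simp
 next
 case False
 have ws: "c ~= [] & real (SUM i<-c. w i) <= fst (dims (bx b))" if "c : set css" for c using css(2) that by (auto simp: chunked_def real_sum_list)
 have hs: "real (SUM c<-css. h (hd c)) <= snd (dims (bx b))" using css(2) by (auto simp: chunked_def real_sum_list)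
 obtain c cs' where c: "css = c # cs'" using False by (cases css) auto
 obtain i c2 where i: "c = i # c2" using ws[of c] c by (cases c) auto
 have "i : set (concat css)" using c i by simp
 hence "i : set ord" unfolding css(1) sl_def by simp
 hence "0 < w i" "0 < h i" using w_pos h_pos by auto
 hence "1 <= (SUM i<-c. w i)" "1 <= (SUM c<-css. h (hd c))" using c i by auto
 hence "1 <= real (SUM i<-c. w i)" "1 <= real (SUM c<-css. h (hd c))" by (metis of_nat_1 of_nat_mono)+
 hence o: "ok b" using True ws[of c] hs c unfolding ok_def by (metis list.set_intros(1) order_trans)
 have "okb w h (X b) (R b) (U b) (R b) (Y b) ([] @ concat css)"
 proof (rule okb_chunks)
 show "ALL c:set css. c ~= [] & X b + (SUM i<-c. w i) <= R b" using ws o by (auto simp: X_def R_def intro: le_nat_floor)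
 show "Y b + (SUM c<-css. h (hd c)) <= U b" using hs o by (auto simp: Y_def U_def intro: le_nat_floor)
 qed simp
 thus ?thesis using F css by simp
 qed
 qed
 have 3: "f i < K" if "i : set ord" for i using fex[OF that] len by simp
 show ?thesis
 proof (rule exI[of _ X], rule exI[of _ R], rule exI[of _ Y], rule exI[of _ U], rule exI[of _ f], intro conjI allI ballI impI)
 qed (use 1 2 3 4 in blast)+
qed

end

subsection \<open>The optimum\<close>

abbreviation wd :: "rect list => nat => nat" where "wd rs i == fst (rs ! i)"
abbreviation ht :: "rect list => nat => nat" where "ht rs i == snd (rs ! i)"

definition separated :: "nat => nat => nat => nat => nat => nat => nat => nat => bool" where
 "separated x y w h x' y' w' h' <-> x + w <= x' | x' + w' <= x | y + h <= y' | y' + h' <= y"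

lemma interiors_disjoint:
 assumes "0 < fst r" "0 < snd r" "0 < fst r'" "0 < snd r'" shows "placed_interior p r Int placed_interior p' r' = {} <->
 separated (fst p) (snd p) (fst r) (snd r) (fst p') (snd p') (fst r') (snd r')"
proof
 assume d: "placed_interior p r Int placed_interior p' r' = {}"
 show "separated (fst p) (snd p) (fst r) (snd r) (fst p') (snd p') (fst r') (snd r')"
 proof (rule ccontr)
 assume n: "~ ?thesis"
 \<comment> \<open>The centre of the unit cell at the componentwise maximum of the two corners lies
   in both interiors.\<close>
 have "(real (max (fst p) (fst p')) + 1/2, real (max (snd p) (snd p')) + 1/2) : placed_interior p r Int placed_interior p' r'"
 using n assms unfolding placed_interior_def separated_def by (auto simp: max_def)
 thus False using d by blast
 qed
next
 assume "separated (fst p) (snd p) (fst r) (snd r) (fst p') (snd p') (fst r') (snd r')"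
 thus "placed_interior p r Int placed_interior p' r' = {}" unfolding separated_def placed_interior_def by (auto simp flip: of_nat_add)
qed

lemma feasible_iff:
 assumes "valid_instance W' rs" shows "feasible_packing W rs p <-> (ALL i<length rs. fst (p i) + wd rs i <= W) &
 (ALL i<length rs. ALL j<length rs. i ~= j --> separated (fst (p i)) (snd (p i)) (wd rs i) (ht rs i) (fst (p j)) (snd (p j)) (wd rs j) (ht rs j))"
proof -
 have "placed_interior (p i) (rs ! i) Int placed_interior (p j) (rs ! j) = {} <->
 separated (fst (p i)) (snd (p i)) (wd rs i) (ht rs i) (fst (p j)) (snd (p j)) (wd rs j) (ht rs j)"
 if "i < length rs" "j < length rs" for i j by (rule interiors_disjoint) (use assms that in "auto simp: valid_instance_def")
 thus ?thesis unfolding feasible_packing_def by auto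
qed

lemma packing_height_le: "packing_height rs p <= H <-> (ALL i<length rs. snd (p i) + ht rs i <= H)"
 unfolding packing_height_def by (subst Max_le_iff) auto

lemma Nmax_ge:
 assumes i: "i < length rs" shows "wd rs i <= Nmax rs" "ht rs i <= Nmax rs"
proof -
 have "wd rs i <= Max (insert 0 (fst ` set rs))" "ht rs i <= Max (insert 0 (snd ` set rs))" using i by (intro Max_ge; simp)+
 thus "wd rs i <= Nmax rs" "ht rs i <= Nmax rs" unfolding Nmax_def by auto
qed

lemma stacking:
 assumes "valid_instance W rs" shows "EX p. feasible_packing W rs p & packing_height rs p <= length rs * Nmax rs"
proof -
 let ?p = "%i. (0, i * Nmax rs)"
 have *: "i * Nmax rs + ht rs i <= j * Nmax rs" if "i < j" "j <= length rs" for i j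
 proof -
 have "i * Nmax rs + ht rs i <= (i + 1) * Nmax rs" using Nmax_ge(2)[of i rs] that by simp
 also have "... <= j * Nmax rs" using that by (intro mult_le_mono1) simp
 finally show ?thesis .
 qed
 have "feasible_packing W rs ?p" unfolding feasible_iff[OF assms] separated_def
 using assms *[OF _ less_imp_le] by (auto simp: valid_instance_def) (metis linorder_neqE_nat)
 moreover have "packing_height rs ?p <= length rs * Nmax rs" unfolding packing_height_le using * by simp
 ultimately show ?thesis by blast
qed

lemma OPT_witness:
 assumes "valid_instance W rs" shows "EX p. feasible_packing W rs p & packing_height rs p = OPT W rs" "OPT W rs <= length rs * Nmax rs"
proof -
 obtain p where p: "feasible_packing W rs p" "packing_height rs p <= length rs * Nmax rs" using stacking[OF assms] by blast
 hence "EX q. feasible_packing W rs q & packing_height rs q = packing_height rs p" by blast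
 from LeastI[of "%H. EX q. feasible_packing W rs q & packing_height rs q = H", OF this]
 Least_le[of "%H. EX q. feasible_packing W rs q & packing_height rs q = H", OF this] p(2)
 show "EX p. feasible_packing W rs p & packing_height rs p = OPT W rs" "OPT W rs <= length rs * Nmax rs" unfolding OPT_def by auto
qed

text \<open>The strip may be far wider than any polynomial in the sizes of the items. The new
  abscissa is the number of covered columns to the left, that is, uncovered columns are deleted,
  which respects the order from left to right.\<close>

lemma compress:
 fixes X w :: "nat => nat"
 assumes "finite A" "!!i. i : A ==> X i + w i <= W"
 shows "EX X'. (ALL i:A. X' i + w i <= min W (sum w A)) & (ALL i:A. ALL j:A. X i + w i <= X j --> X' i + w i <= X' j)"
proof -
 define C where "C t = {c. c < t & (EX i:A. X i <= c & c < X i + w i)}" for t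
 have fin: "finite (C t)" for t by (simp add: C_def)
 have st: "card (C (X i)) + w i = card (C (X i + w i))" if "i : A" for i
 proof -
 have "C (X i + w i) = C (X i) Un {X i..<X i + w i}" using that by (auto simp: C_def)
 moreover have "C (X i) Int {X i..<X i + w i} = {}" by (auto simp: C_def)
 ultimately show ?thesis using fin by (simp add: card_Un_disjoint)
 qed
 have mono: "card (C s) <= card (C t)" if "s <= t" for s t using that fin by (intro card_mono) (auto simp: C_def)
 have tot: "card (C t) <= sum w A" for t
 proof -
 have "card (C t) <= card (UN i:A. {X i..<X i + w i})" using assms(1) by (intro card_mono) (auto simp: C_def)
 also have "... <= (SUM i:A. card {X i..<X i + w i})" using assms(1) by (rule card_UN_le)
 finally show ?thesis by simp
 qed
 have W: "card (C t) <= W" for t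
 proof -
 have "card (C t) <= card {..<W}" using assms(2) by (intro card_mono) (auto simp: C_def, meson less_le_trans)
 thus ?thesis by simp
 qed
 show ?thesis using st tot W mono by (intro exI[of _ "%i. card (C (X i))"]) (metis min.boundedI)
qed

text \<open>Scanning all items once for each height, from \<open>Nmax\<close> downwards: the very
  order that the program \<open>SORT\<close> produces.\<close>

definition height_order :: "rect list => nat list" where
 "height_order rs = concat (map (%a. filter (%i. ht rs i = Nmax rs - a) [0..<length rs]) [0..<Nmax rs])"

lemma height_order:
 assumes "valid_instance W rs" shows "set (height_order rs) = {..<length rs}" "distinct (height_order rs)" "length (height_order rs) = length rs"
 "sorted_wrt (%i j. ht rs j <= ht rs i) (height_order rs)"
proof -
 have mem: "set (height_order rs) = {i. i < length rs & (EX a<Nmax rs. ht rs i = Nmax rs - a)}" by (auto simp: height_order_def)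
 have "EX a<Nmax rs. ht rs i = Nmax rs - a" if "i < length rs" for i
 proof -
 have "0 < ht rs i" "ht rs i <= Nmax rs" using assms that Nmax_ge(2)[OF that] by (auto simp: valid_instance_def)
 thus ?thesis by (intro exI[of _ "Nmax rs - ht rs i"]) auto
 qed
 thus s: "set (height_order rs) = {..<length rs}" using mem by auto
 define f where "f a = filter (%i. ht rs i = Nmax rs - a) [0..<length rs]" for a
 have *: "distinct (concat (map f [0..<k])) & sorted_wrt (%i j. ht rs j <= ht rs i) (concat (map f [0..<k]))" if "k <= Nmax rs" for k using that
 proof (induct k)
 case (Suc k)
 have a: "Nmax rs - k < ht rs i" if "i : set (concat (map f [0..<k]))" for i using that Suc.prems by (auto simp: f_def)
 have b: "ht rs i = Nmax rs - k" if "i : set (f k)" for i using that by (auto simp: f_def)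
 have "set (concat (map f [0..<k])) Int set (f k) = {}" using a b by fastforce
 moreover have "distinct (f k)" by (simp add: f_def)
 moreover have "sorted_wrt (%i j. ht rs j <= ht rs i) (f k)" unfolding sorted_wrt_iff_nth_less using b by (metis le_refl less_trans nth_mem)
 moreover have "ht rs j <= ht rs i" if "i : set (concat (map f [0..<k]))" "j : set (f k)" for i j using a[OF that(1)] b[OF that(2)] by simp
 ultimately show ?case using Suc by (simp add: sorted_wrt_append)
 qed simp
 have eq: "height_order rs = concat (map f [0..<Nmax rs])" unfolding height_order_def f_def by (rule refl)
 show d: "distinct (height_order rs)" "sorted_wrt (%i j. ht rs j <= ht rs i) (height_order rs)" using *[of "Nmax rs"] unfolding eq by auto
 show "length (height_order rs) = length rs" using distinct_card[OF d(1)] s by simp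
qed

lemma opt_inst:
 assumes v: "valid_instance W rs" and n: "rs ~= []"
 shows "EX X Y. inst (height_order rs) (wd rs) (ht rs) X Y (min W (length rs * Nmax rs)) (OPT W rs)"
proof -
 obtain p where p: "feasible_packing W rs p" "packing_height rs p = OPT W rs" using OPT_witness(1)[OF v] by blast
 have hO: "snd (p i) + ht rs i <= OPT W rs" if "i < length rs" for i using p(2) packing_height_le[of rs p "OPT W rs"] that by simp
 have pos: "0 < wd rs i" "0 < ht rs i" "wd rs i <= W" if "i < length rs" for i using v that by (auto simp: valid_instance_def)
 note pf = p(1)[unfolded feasible_iff[OF v]]
 obtain X' where X': "ALL i:{..<length rs}. X' i + wd rs i <= min W (sum (wd rs) {..<length rs})"
 "ALL i:{..<length rs}. ALL j:{..<length rs}. fst (p i) + wd rs i <= fst (p j) --> X' i + wd rs i <= X' j"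
 using compress[of "{..<length rs}" "%i. fst (p i)" "wd rs" W] pf by auto
 have sw: "sum (wd rs) {..<length rs} <= length rs * Nmax rs" using sum_bounded_above[of "{..<length rs}" "wd rs" "Nmax rs"] Nmax_ge(1) by auto
 have l: "0 < length rs" using n by simp
 note ho = height_order[OF v]
 have "inst (height_order rs) (wd rs) (ht rs) X' (%i. snd (p i)) (min W (length rs * Nmax rs)) (OPT W rs)"
 proof
 show "distinct (height_order rs)" "sorted_wrt (%i j. ht rs j <= ht rs i) (height_order rs)" by (rule ho)+
 show "0 < wd rs i" "0 < ht rs i" if "i : set (height_order rs)" for i using that pos unfolding ho(1) by auto
 show "0 < min W (length rs * Nmax rs)" using pos[OF l] Nmax_ge(1)[OF l] l by auto
 show "0 < OPT W rs" using hO[OF l] pos(2)[OF l] by linarith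
 show "X' i + wd rs i <= min W (length rs * Nmax rs) & snd (p i) + ht rs i <= OPT W rs" if "i : set (height_order rs)" for i
 using that X'(1) hO[of i] sw unfolding ho(1) by fastforce
 show "X' i + wd rs i <= X' j | X' j + wd rs j <= X' i | snd (p i) + ht rs i <= snd (p j) | snd (p j) + ht rs j <= snd (p i)"
 if "i : set (height_order rs)" "j : set (height_order rs)" "i ~= j" for i j
 using that pf X'(2) unfolding ho(1) separated_def by (metis lessThan_iff)
 qed
 thus ?thesis by blast
qed

text \<open>A state of the dynamic program is a number with \<open>6K+1\<close> digits in base \<open>B\<close>: six digits for each
 box (left, right, bottom and top border, fill of the current shelf, bottom of the next shelf) and the
 height of the packing as leading digit.\<close>

definition dig :: "nat => nat => nat => nat" where "dig B c j = c div B ^ j mod B"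

abbreviation "dgt B c b k == dig B c (6*b+k)"

definition enc :: "nat => nat => (nat => nat) => nat" where "enc B D f = (SUM j<D. f j * B ^ j)"

lemma dig_less: "0 < B ==> dig B c j < B" by (simp add: dig_def)

lemma dig_high_add:
 assumes "0 < B" "j < D" shows "dig B (a + q * B ^ D) j = dig B a j"
proof -
 obtain k where k: "D = j + Suc k" using assms(2) less_imp_Suc_add by auto
 have e: "a + q * B ^ D = a + (q * B ^ k * B) * B ^ j" unfolding k by (simp add: power_add)
 have "(a + q * B ^ D) div B ^ j = q * B ^ k * B + a div B ^ j" unfolding e by (rule div_mult_self1) (use assms(1) in simp)
 thus ?thesis by (simp add: dig_def)
qed

lemma enc_less: "(!!j. j < D ==> f j < B) ==> 0 < B ==> enc B D f < B ^ D"
proof (induct D)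
 case (Suc D)
 have "enc B D f < B ^ D" using Suc by simp
 moreover have "(f D + 1) * B ^ D <= B * B ^ D" using Suc.prems(1)[of D] by (intro mult_le_mono1) simp
 ultimately show ?case by (simp add: enc_def)
qed (simp add: enc_def)

lemma dig_enc: "(!!j. j < D ==> f j < B) ==> 0 < B ==> j < D ==> dig B (enc B D f) j = f j"
proof (induct D)
 case (Suc D)
 have e: "enc B (Suc D) f = enc B D f + f D * B ^ D" by (simp add: enc_def)
 have l: "enc B D f < B ^ D" using enc_less Suc.prems by simp
 show ?case
 proof (cases "j = D")
 case True
 thus ?thesis unfolding e dig_def using l Suc.prems by simp
 next
 case False
 thus ?thesis unfolding e using Suc by (simp add: dig_high_add)
 qed
qed simp

lemma enc_dig: "c < B ^ D ==> enc B D (dig B c) = c"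
proof (induct D arbitrary: c)
 case (Suc D)
 have "0 < B" using Suc.prems by (cases B) auto
 have c: "c mod B ^ D + (c div B ^ D) * B ^ D = c" by (rule mod_div_mult_eq)
 have q: "c div B ^ D < B" using Suc.prems `0 < B` by (simp add: div_less_iff_less_mult)
 have "dig B c j = dig B (c mod B ^ D) j" if "j < D" for j using dig_high_add[OF `0 < B` that, of "c mod B ^ D" "c div B ^ D"] c by simp
 hence "enc B D (dig B c) = enc B D (dig B (c mod B ^ D))" by (simp add: enc_def)
 also have "... = c mod B ^ D" using `0 < B` by (intro Suc.hyps) simp
 finally show ?case using q c by (simp add: enc_def dig_def)
qed (simp add: enc_def)

lemma dig_out: "c < B ^ D ==> 0 < B ==> D <= j ==> dig B c j = 0"
 unfolding dig_def by (metis div_less less_le_trans mod_0 nat_less_le neq0_conv power_increasing Suc_leI One_nat_def)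

text \<open>As \<open>v < B\<close>, no carry occurs. The equation avoids subtraction, so it covers
  increases and decreases of the digit alike.\<close>

lemma upd_digit:
 assumes "c < B ^ D" "j < D" "v < B" "c' + dig B c j * B ^ j = c + v * B ^ j" shows "c' < B ^ D" "dig B c' = (dig B c)(j := v)"
proof -
 have B: "0 < B" using assms(3) by simp
 let ?f = "(dig B c)(j := v)"
 have f: "?f i < B" for i using dig_less[OF B] assms(3) by simp
 have r: "{..<D} = insert j ({..<D} - {j})" using assms(2) by auto
 have "enc B D ?f = v * B ^ j + (SUM i:{..<D} - {j}. dig B c i * B ^ i)" unfolding enc_def by (subst r) (simp add: sum.insert_remove)
 moreover have "enc B D (dig B c) = dig B c j * B ^ j + (SUM i:{..<D} - {j}. dig B c i * B ^ i)"
 unfolding enc_def by (subst r) (simp add: sum.insert_remove)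
 ultimately have c': "c' = enc B D ?f" using assms(4) enc_dig[OF assms(1)] by linarith
 show l: "c' < B ^ D" unfolding c' by (rule enc_less[OF f B])
 show "dig B c' = ?f"
 proof
 fix i show "dig B c' i = ?f i"
 using dig_enc[where f = ?f and D = D and j = i, OF f B] dig_out[OF l B, of i] dig_out[OF assms(1) B, of i] assms(2) by (cases "i < D") (auto simp: c')
 qed
qed

section \<open>Transitions of the dynamic program\<close>

text \<open>The two ways to put an item into box \<open>b\<close>, leading to state
  \<open>c'\<close> and position \<open>x\<close>, \<open>y\<close>: on the current shelf or on a
  new one. On the current shelf the item hangs from the top, for digit 5 records the top of the
  shelf and its bottom is not stored.\<close>

definition opt :: "nat => nat => nat => nat => nat => nat => nat => nat => bool" where "opt B w h c b c' x y <->
 (dgt B c b 4 + w <= dgt B c b 1 & c' = c + w * B ^ (6*b+4) & x = dgt B c b 4 & y = dgt B c b 5 - h) |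
 (dgt B c b 5 + h <= dgt B c b 3 & dig B c (6*b) + w <= dgt B c b 1 &
 c' = c + (dig B c (6*b) + w) * B ^ (6*b+4) + h * B ^ (6*b+5) - dgt B c b 4 * B ^ (6*b+4) &
 x = dig B c (6*b) & y = dgt B c b 5)"

fun good :: "nat => nat => (nat => nat) => (nat => nat) => nat list => nat => bool" where "good K B w h [] c <-> True"
| "good K B w h (i # xs) c <-> (EX b<K. EX c' x y. opt B (w i) (h i) c b c' x y & good K B w h xs c')"

text \<open>Digit 4 starts at the right border, as if a shelf were full, so the first item of a box
  has to open a shelf.\<close>

definition start :: "nat => nat => nat => nat => bool" where
 "start K B W c <-> (ALL b<K. dig B c (6*b) <= dgt B c b 1 & dgt B c b 1 <= W & dgt B c b 2 <= dgt B c b 3 &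
 dgt B c b 3 <= dig B c (6*K) & dgt B c b 4 = dgt B c b 1 & dgt B c b 5 = dgt B c b 2 &
 (ALL b'<K. b' = b | dgt B c b 1 <= dig B c (6*b') | dgt B c b' 1 <= dig B c (6*b) |
 dgt B c b 3 <= dgt B c b' 2 | dgt B c b' 3 <= dgt B c b 2))"

lemma opt_same:
 assumes c: "c < B ^ (6*K+1)" and B: "0 < B" and b: "b < K" and f: "dgt B c b 4 + w <= dgt B c b 1"
 shows "c + w * B ^ (6*b+4) < B ^ (6*K+1)" "dig B (c + w * B ^ (6*b+4)) = (dig B c)(6*b+4 := dgt B c b 4 + w)"
proof -
 have "dgt B c b 4 + w < B" using f dig_less[OF B, of c "6*b+1"] by linarith
 from upd_digit[OF c _ this, of "6*b+4" "c + w * B ^ (6*b+4)"] b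
 show "c + w * B ^ (6*b+4) < B ^ (6*K+1)" "dig B (c + w * B ^ (6*b+4)) = (dig B c)(6*b+4 := dgt B c b 4 + w)" by (simp_all add: algebra_simps)
qed

lemma opt_new:
 assumes c: "c < B ^ (6*K+1)" and B: "0 < B" and b: "b < K" and f: "dgt B c b 5 + h <= dgt B c b 3" "dig B c (6*b) + w <= dgt B c b 1"
 and c': "c' = c + (dig B c (6*b) + w) * B ^ (6*b+4) + h * B ^ (6*b+5) - dgt B c b 4 * B ^ (6*b+4)"
 shows "c' < B ^ (6*K+1)" "dig B c' = (dig B c)(6*b+4 := dig B c (6*b) + w, 6*b+5 := dgt B c b 5 + h)"
proof -
 define c1 where "c1 = c + (dig B c (6*b) + w) * B ^ (6*b+4) - dgt B c b 4 * B ^ (6*b+4)"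
 have le: "dgt B c b 4 * B ^ (6*b+4) <= c"
 proof -
 have "dgt B c b 4 <= c div B ^ (6*b+4)" unfolding dig_def by simp
 thus ?thesis by (metis div_times_less_eq_dividend le_trans mult_le_mono1)
 qed
 have v: "dig B c (6*b) + w < B" "dgt B c b 5 + h < B" using f dig_less[OF B, of c] by (meson le_less_trans)+
 have 1: "c1 < B ^ (6*K+1)" "dig B c1 = (dig B c)(6*b+4 := dig B c (6*b) + w)" using upd_digit[OF c _ v(1), of "6*b+4" c1] b le by (auto simp: c1_def)
 have "c' = c1 + h * B ^ (6*b+5)" unfolding c' c1_def using le by simp
 hence "c' + dgt B c1 b 5 * B ^ (6*b+5) = c1 + (dgt B c b 5 + h) * B ^ (6*b+5)" by (simp add: 1(2) algebra_simps)
 from upd_digit[OF 1(1) _ v(2) this] b 1(2)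
 show "c' < B ^ (6*K+1)" "dig B c' = (dig B c)(6*b+4 := dig B c (6*b) + w, 6*b+5 := dgt B c b 5 + h)" by simp_all
qed

lemma opt_less: "opt B w h c b c' x y ==> c < B ^ (6*K+1) ==> 0 < B ==> b < K ==> c' < B ^ (6*K+1)"
 unfolding opt_def using opt_same(1)[of c B K b w] opt_new(1)[of c B K b h w c'] by blast

text \<open>\<open>f\<close> distributes the items. A transition changes only the digits 4 and 5 of
  one box, so the fillings of the boxes can be interleaved in the order of the list.\<close>

lemma good_complete:
 assumes "ALL b<K. okb w h (dig B c (6*b)) (dgt B c b 1) (dgt B c b 3) (dgt B c b 4) (dgt B c b 5) (filter (%i. f i = b) xs)"
 "ALL i:set xs. f i < K" "c < B ^ (6*K+1)" "0 < B" shows "good K B w h xs c" using assms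
proof (induct xs arbitrary: c)
 case (Cons i xs)
 define b where "b = f i"
 have b: "b < K" using Cons.prems(2) by (simp add: b_def)
 let ?d = "dig B c"
 let ?ok = "%c b. okb w h (dig B c (6*b)) (dgt B c b 1) (dgt B c b 3) (dgt B c b 4) (dgt B c b 5) (filter (%i. f i = b) xs)"
 have "okb w h (?d (6*b)) (?d (6*b+1)) (?d (6*b+3)) (?d (6*b+4)) (?d (6*b+5)) (i # filter (%i. f i = b) xs)"
 using Cons.prems(1) b by (auto simp: b_def)
 then consider (same) "?d (6*b+4) + w i <= ?d (6*b+1)" "okb w h (?d (6*b)) (?d (6*b+1)) (?d (6*b+3)) (?d (6*b+4) + w i) (?d (6*b+5)) (filter (%i. f i = b) xs)"
 | (new) "?d (6*b+5) + h i <= ?d (6*b+3)" "?d (6*b) + w i <= ?d (6*b+1)" "okb w h (?d (6*b)) (?d (6*b+1)) (?d (6*b+3)) (?d (6*b) + w i) (?d (6*b+5) + h i) (filter (%i. f i = b) xs)"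
 by auto
 hence "EX c' x y. opt B (w i) (h i) c b c' x y & c' < B ^ (6*K+1) & ?ok c' b & (ALL j. j ~= 6*b+4 & j ~= 6*b+5 --> dig B c' j = dig B c j)"
 proof cases
 case same
 let ?c = "c + w i * B ^ (6*b+4)"
 note o = opt_same[OF Cons.prems(3,4) b same(1)]
 have "opt B (w i) (h i) c b ?c (?d (6*b+4)) (?d (6*b+5) - h i)" using same(1) by (simp add: opt_def)
 moreover have "?ok ?c b" unfolding o(2) using same(2) by simp
 ultimately show ?thesis using o(1) by - (rule exI[of _ ?c], rule exI[of _ "?d (6*b+4)"], rule exI[of _ "?d (6*b+5) - h i"], simp add: o(2))
 next
 case new
 define c' where c': "c' = c + (?d (6*b) + w i) * B ^ (6*b+4) + h i * B ^ (6*b+5) - ?d (6*b+4) * B ^ (6*b+4)"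
 note o = opt_new[OF Cons.prems(3,4) b new(1,2) c']
 have "opt B (w i) (h i) c b c' (?d (6*b)) (?d (6*b+5))" using new(1,2) c' by (simp add: opt_def)
 moreover have "?ok c' b" unfolding o(2) using new(3) by simp
 ultimately show ?thesis using o(1) by - (rule exI[of _ c'], rule exI[of _ "?d (6*b)"], rule exI[of _ "?d (6*b+5)"], simp add: o(2))
 qed
 then obtain c' x y where c': "opt B (w i) (h i) c b c' x y" "c' < B ^ (6*K+1)" "?ok c' b" "ALL j. j ~= 6*b+4 & j ~= 6*b+5 --> dig B c' j = dig B c j" by blast
 have "?ok c' b'" if b': "b' < K" for b'
 proof (cases "b' = b")
 case False
 have ne: "6*b'+k ~= 6*b+l" if "k < 6" "l < 6" for k l using False that by presburger
 have "dgt B c' b' k = dgt B c b' k" if "k < 6" for k using c'(4) ne[OF that] by simp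
 from this[of 0] this[of 1] this[of 3] this[of 4] this[of 5] have e: "dig B c' (6*b') = dig B c (6*b')" "dgt B c' b' 1 = dgt B c b' 1"
 "dgt B c' b' 3 = dgt B c b' 3" "dgt B c' b' 4 = dgt B c b' 4" "dgt B c' b' 5 = dgt B c b' 5" by simp_all
 have "filter (%i. f i = b') (i # xs) = filter (%i. f i = b') xs" using False by (simp add: b_def)
 thus ?thesis using Cons.prems(1) b' unfolding e by metis
 qed (use c'(3) in simp)
 hence "good K B w h xs c'" by (intro Cons.hyps) (use Cons.prems(2,4) c'(2) in auto)
 thus ?case using c'(1) b by auto
qed simp

text \<open>Soundness. The number \<open>hh\<close> bounds the heights of the items still to be packed, so that an item
 hanging from the top of the current shelf cannot reach below it.\<close>

definition packed :: "nat => nat => (nat => nat) => (nat => nat) => nat => nat set => nat => nat => (nat => nat) => (nat => nat) => bool" where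
 "packed K B w h c0 A hh c px py <-> c < B ^ (6*K+1) &
 (ALL b<K. ALL k<4. dgt B c b k = dgt B c0 b k) &
 (ALL b<K. dig B c0 (6*b) <= dgt B c b 4 & dgt B c0 b 2 <= dgt B c b 5 & dgt B c b 5 <= dgt B c0 b 3 &
 (dgt B c0 b 2 + hh <= dgt B c b 5 | dgt B c0 b 1 <= dgt B c b 4)) &
 (ALL i:A. EX b<K. dig B c0 (6*b) <= px i & px i + w i <= dgt B c0 b 1 & dgt B c0 b 2 <= py i & py i + h i <= dgt B c b 5 &
 (px i + w i <= dgt B c b 4 | py i + h i + hh <= dgt B c b 5)) &
 (ALL i:A. ALL j:A. i ~= j --> separated (px i) (py i) (w i) (h i) (px j) (py j) (w j) (h j))"

lemma packed_start:
 assumes "start K B W c" "c < B ^ (6*K+1)" shows "packed K B w h c {} hh c px py" using assms by (auto simp: start_def packed_def)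

text \<open>On the current shelf, earlier items of the box end left of the fill level or at least
  \<open>hh\<close> below the top of the shelf, and \<open>h i <= hh\<close>. A new shelf starts
  above all earlier items of its box. Items in other boxes are kept apart by the disjointness of the
  boxes.\<close>

lemma packed_step:
 assumes st: "start K B W c0" and P: "packed K B w h c0 A hh c px py" and B: "0 < B" and b: "b < K"
 and o: "opt B (w i) (h i) c b c' x y" and i: "i ~: A" "h i <= hh" "0 < w i" and hh': "hh' <= h i"
 shows "packed K B w h c0 (insert i A) hh' c' (px(i := x)) (py(i := y))"
proof -
 define X R Y T where st4: "X = (%b. dig B c0 (6*b))" "R = (%b. dgt B c0 b 1)" "Y = (%b. dgt B c0 b 2)" "T = (%b. dgt B c0 b 3)"
 define CX NY CX' NY' where dy4: "CX = (%b. dgt B c b 4)" "NY = (%b. dgt B c b 5)" "CX' = (%b. dgt B c' b 4)" "NY' = (%b. dgt B c' b 5)"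
 have c: "c < B ^ (6*K+1)" and stat: "!!b k. b < K ==> k < 4 ==> dgt B c b k = dgt B c0 b k" using P by (auto simp: packed_def)
 have box: "!!b. b < K ==> X b <= CX b & Y b <= NY b & NY b <= T b & (Y b + hh <= NY b | R b <= CX b)"
 and it: "!!j. j : A ==> EX b<K. X b <= px j & px j + w j <= R b & Y b <= py j & py j + h j <= NY b & (px j + w j <= CX b | py j + h j + hh <= NY b)"
 and sep: "!!i j. i : A ==> j : A ==> i ~= j ==> separated (px i) (py i) (w i) (h i) (px j) (py j) (w j) (h j)"
 using P unfolding packed_def st4 dy4 by blast+
 have boxes: "!!b b'. b < K ==> b' < K ==> b' ~= b ==> R b <= X b' | R b' <= X b | T b <= Y b' | T b' <= Y b"
 using st unfolding start_def st4 by blast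
 have s: "dig B c (6*b) = X b" "dgt B c b 1 = R b" "dgt B c b 3 = T b" using stat[OF b, of 0] stat[OF b, of 1] stat[OF b, of 3] by (simp_all add: st4)
 have ne: "6*b'+k ~= 6*b+l" if "k < 6" "l < 6" "b' ~= b | k ~= l" for b' k l using that by presburger
 note o' = o[unfolded opt_def s, folded dy4[THEN fun_cong]]
 have main: "c' < B ^ (6*K+1) & (ALL j. j ~= 6*b+4 & j ~= 6*b+5 --> dig B c' j = dig B c j) &
 X b <= x & x + w i <= R b & Y b <= y & y + h i = NY' b & x + w i = CX' b & NY' b <= T b & NY b <= NY' b &
 ((CX b <= x & NY b = NY' b & Y b + hh <= NY b) | NY b = y)" using o'
 proof (elim disjE conjE)
 assume f: "CX b + w i <= R b" and e: "c' = c + w i * B ^ (6*b+4)" "x = CX b" "y = NY b - h i"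
 have f': "dgt B c b 4 + w i <= dgt B c b 1" using f unfolding s dy4 .
 note u = opt_same[OF c B b f', folded e(1)]
 have "CX' b = CX b + w i" "NY' b = NY b" by (simp_all add: dy4 u(2))
 moreover have "ALL j. j ~= 6*b+4 & j ~= 6*b+5 --> dig B c' j = dig B c j" by (simp add: u(2))
 moreover have "Y b + hh <= NY b" using box[OF b] f i(3) by linarith
 ultimately show ?thesis using u(1) f e(2,3) box[OF b] i(2) by auto
 next
 assume f: "NY b + h i <= T b" "X b + w i <= R b"
 and e: "c' = c + (X b + w i) * B ^ (6*b+4) + h i * B ^ (6*b+5) - CX b * B ^ (6*b+4)" "x = X b" "y = NY b"
 have f': "dgt B c b 5 + h i <= dgt B c b 3" "dig B c (6*b) + w i <= dgt B c b 1" using f unfolding s dy4 by blast+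
 have e': "c' = c + (dig B c (6*b) + w i) * B ^ (6*b+4) + h i * B ^ (6*b+5) - dgt B c b 4 * B ^ (6*b+4)" using e(1) unfolding s dy4 .
 note u = opt_new[OF c B b f' e']
 have "CX' b = X b + w i" "NY' b = NY b + h i" by (simp_all add: dy4 u(2) s)
 moreover have "ALL j. j ~= 6*b+4 & j ~= 6*b+5 --> dig B c' j = dig B c j" by (simp add: u(2))
 ultimately show ?thesis using u(1) f e(2,3) box[OF b] by auto
 qed
 have oth: "CX' b' = CX b' & NY' b' = NY b'" if "b' ~= b" for b'
 using main ne[of 4 4 b'] ne[of 4 5 b'] ne[of 5 4 b'] ne[of 5 5 b'] that by (simp add: dy4)
 have stat': "dgt B c' b' k = dgt B c0 b' k" if "b' < K" "k < 4" for b' k using main stat[OF that] ne[of k 4 b'] ne[of k 5 b'] that by simp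
 have box': "X b' <= CX' b' & Y b' <= NY' b' & NY' b' <= T b' & (Y b' + hh' <= NY' b' | R b' <= CX' b')" if b': "b' < K" for b'
 proof (cases "b' = b")
 case True
 have m: "X b <= x" "y + h i = NY' b" "x + w i = CX' b" "NY' b <= T b" "Y b <= y" using main by blast+
 have "X b <= CX' b & Y b <= NY' b & NY' b <= T b & Y b + hh' <= NY' b" using m hh' by linarith
 thus ?thesis using True by blast
 next
 case False
 thus ?thesis using oth[OF False] box[OF b'] hh' i(2) by auto
 qed
 let ?in = "%px py j b. X b <= px & px + w j <= R b & Y b <= py & py + h j <= NY' b & (px + w j <= CX' b | py + h j + hh' <= NY' b)"
 have old: "(EX b<K. ?in (px j) (py j) j b) & separated x y (w i) (h i) (px j) (py j) (w j) (h j)" if j: "j : A" for j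
 proof -
 obtain b' where b': "b' < K" and k: "X b' <= px j" "px j + w j <= R b'" "Y b' <= py j" "py j + h j <= NY b'"
 and k5: "px j + w j <= CX b' | py j + h j + hh <= NY b'" using it[OF j] by blast
 have m: "X b <= x" "x + w i <= R b" "Y b <= y" "y + h i = NY' b" "x + w i = CX' b" "NY' b <= T b" "NY b <= NY' b"
 "(CX b <= x & NY b = NY' b & Y b + hh <= NY b) | NY b = y" using main by blast+
 show ?thesis
 proof (cases "b' = b")
 case True
 note k = k[unfolded True] and k5 = k5[unfolded True]
 have "?in (px j) (py j) j b & separated x y (w i) (h i) (px j) (py j) (w j) (h j)" unfolding separated_def using k k5 m hh' i(2) by linarith
 thus ?thesis using b by blast
 next
 case False
 have "?in (px j) (py j) j b'" using k k5 oth[OF False] hh' i(2) by auto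
 moreover have "NY b' <= T b'" using box[OF b'] by simp
 hence "separated x y (w i) (h i) (px j) (py j) (w j) (h j)" unfolding separated_def using boxes[OF b b' False] k m by linarith
 ultimately show ?thesis using b' by blast
 qed
 qed
 have new: "?in x y i b" using main by simp
 have sym: "separated x y w h x' y' w' h' <-> separated x' y' w' h' x y w h" for x y w h x' y' w' h' by (auto simp: separated_def)
 have all: "ALL j:insert i A. EX b<K. ?in ((px(i := x)) j) ((py(i := y)) j) j b" using old new b i(1) by (metis fun_upd_apply insert_iff)
 have seps: "ALL j:insert i A. ALL k:insert i A. j ~= k --> separated ((px(i := x)) j) ((py(i := y)) j) (w j) (h j) ((px(i := x)) k) ((py(i := y)) k) (w k) (h k)"
 using old sep sym i(1) by (metis fun_upd_apply insert_iff)
 show ?thesis unfolding packed_def using main stat' box'[unfolded st4 dy4] all[unfolded st4 dy4] seps by blast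
qed

lemma packed_final:
 assumes st: "start K B W c0" and P: "packed K B w h c0 A hh c px py" and i: "i : A" shows "px i + w i <= W" "py i + h i <= dig B c0 (6*K)"
proof -
 obtain b where "b < K" "px i + w i <= dgt B c0 b 1" "py i + h i <= dgt B c b 5" "dgt B c b 5 <= dgt B c0 b 3" using P i unfolding packed_def by blast
 moreover have "dgt B c0 b 1 <= W" "dgt B c0 b 3 <= dig B c0 (6*K)" using st `b < K` unfolding start_def by blast+
 ultimately show "px i + w i <= W" "py i + h i <= dig B c0 (6*K)" by linarith+
qed

text \<open>With \<open>e <= 1/9\<close> the height is at most \<open>3 * OPT\<close>, and
  \<open>OPT <= P\<close>; together with the width \<open>min W P\<close> this puts all digits below
  \<open>4 * P + 1\<close>.\<close>

theorem good_start:
 assumes v: "valid_instance W rs" and n: "rs ~= []" and e: "0 < e" "e <= 1/9"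
 defines "K == total_boxes e" and "P == length rs * Nmax rs"
 defines "B == 4 * P + 1" shows "EX c < B ^ (6*K+1). start K B (min W P) c & good K B (wd rs) (ht rs) (height_order rs) c &
 real (dig B c (6*K)) <= (4/3 + 15 * e) * real (OPT W rs)"
proof -
 obtain X0 Y0 where "inst (height_order rs) (wd rs) (ht rs) X0 Y0 (min W P) (OPT W rs)" using opt_inst[OF v n] unfolding P_def by blast
 then interpret I: inst "height_order rs" "wd rs" "ht rs" X0 Y0 "min W P" "OPT W rs" .
 let ?T = "(4/3 + 15 * e) * real (OPT W rs)"
 have e1: "e <= 1" using e by linarith
 obtain X R Y U f where bx: "ALL b<K. X b <= R b & R b <= min W P & Y b <= U b & U b <= nat \<lfloor>?T\<rfloor>"
 "ALL b<K. ALL b'<K. b ~= b' --> R b <= X b' | R b' <= X b | U b <= Y b' | U b' <= Y b" "ALL i:set (height_order rs). f i < K"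
 "ALL b<K. okb (wd rs) (ht rs) (X b) (R b) (U b) (R b) (Y b) (filter (%i. f i = b) (height_order rs))"
 using I.lay_integral[OF I.few_boxes[OF e(1) e1]] unfolding K_def by blast
 have B: "0 < B" by (simp add: B_def)
 have T: "nat \<lfloor>?T\<rfloor> < B"
 proof -
 have "?T <= 3 * real (OPT W rs)" using e by (intro mult_right_mono) auto
 also have "... <= 3 * real P" using OPT_witness(2)[OF v] unfolding P_def by (intro mult_left_mono of_nat_mono) auto
 finally show ?thesis unfolding B_def by linarith
 qed
 define d where "d j = (if j < 6 * K then [X, R, Y, U, R, Y] ! (j mod 6) else (%_. nat \<lfloor>?T\<rfloor>)) (j div 6)" for j
 have dk: "d (6*b+k) = ([X, R, Y, U, R, Y] ! k) b" if "b < K" "k < 6" for b k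
 proof -
 have "(6*b+k) div 6 = b" "(6*b+k) mod 6 = k" "6*b+k < 6*K" using that by (auto simp: div_add1_eq)
 thus ?thesis by (simp add: d_def)
 qed
 have dl: "d j < B" if "j < 6*K+1" for j
 proof (cases "j < 6*K")
 case True
 hence b: "j div 6 < K" "j mod 6 < 6" by auto
 have j: "j = 6 * (j div 6) + j mod 6" by simp
 have "([X, R, Y, U, R, Y] ! k) b < B" if "b < K" "k < 6" for b k
 proof -
 have v: "X b < B" "R b < B" "Y b < B" "U b < B" using bx(1) T that unfolding B_def by (auto dest!: spec[of _ b])
 have "k : {0, 1, 2, 3, 4, 5}" using that by auto
 thus ?thesis using v by auto
 qed
 thus ?thesis using dk[OF b] b j by metis
 next
 case False
 thus ?thesis using T by (simp add: d_def)
 qed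
 define c where "c = enc B (6*K+1) d"
 have c: "c < B ^ (6*K+1)" unfolding c_def by (rule enc_less[OF dl B])
 have dc: "dgt B c b k = ([X, R, Y, U, R, Y] ! k) b" if "b < K" "k < 6" for b k
 unfolding c_def using dig_enc[where f = d and j = "6*b+k", OF dl B] dk[OF that] that by simp
 have digs: "dig B c (6*b) = X b" "dgt B c b 1 = R b" "dgt B c b 2 = Y b" "dgt B c b 3 = U b" "dgt B c b 4 = R b" "dgt B c b 5 = Y b" if "b < K" for b
 using dc[OF that, of 0] dc[OF that, of 1] dc[OF that, of 2] dc[OF that, of 3] dc[OF that, of 4] dc[OF that, of 5] by simp_all
 have top: "dig B c (6*K) = nat \<lfloor>?T\<rfloor>" unfolding c_def using dig_enc[where f = d and j = "6*K", OF dl B] by (simp add: d_def)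
 have "start K B (min W P) c" unfolding start_def
 proof (intro allI impI)
 fix b assume b: "b < K"
 have "ALL b'<K. b' = b | R b <= dig B c (6*b') | dgt B c b' 1 <= X b | U b <= dgt B c b' 2 | dgt B c b' 3 <= Y b"
 proof (intro allI impI)
 fix b' assume b': "b' < K"
 show "b' = b | R b <= dig B c (6*b') | dgt B c b' 1 <= X b | U b <= dgt B c b' 2 | dgt B c b' 3 <= Y b"
 unfolding digs[OF b'] using bx(2) b b' by blast
 qed
 thus "dig B c (6*b) <= dgt B c b 1 & dgt B c b 1 <= min W P & dgt B c b 2 <= dgt B c b 3 &
 dgt B c b 3 <= dig B c (6*K) & dgt B c b 4 = dgt B c b 1 & dgt B c b 5 = dgt B c b 2 &
 (ALL b'<K. b' = b | dgt B c b 1 <= dig B c (6*b') | dgt B c b' 1 <= dig B c (6*b) |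
 dgt B c b 3 <= dgt B c b' 2 | dgt B c b' 3 <= dgt B c b 2)" unfolding digs[OF b] top using bx(1) b by blast
 qed
 moreover have "good K B (wd rs) (ht rs) (height_order rs) c" by (rule good_complete[where f = f]) (use bx(3,4) digs c B in auto)
 moreover have "real (nat \<lfloor>?T\<rfloor>) <= ?T" using e by (intro of_nat_floor) auto
 ultimately show ?thesis using c top by metis
qed

section \<open>A structured language for the machine\<close>

text \<open>Registers below 60 hold program variables, registers 60 to 127 intermediate results, and the
 cell \<open>y\<close> of the heap is the memory cell \<open>128 + y\<close>.\<close>

datatype ex = V nat | N nat | Ad ex ex | Mi ex ex | Rd ex
datatype cm = Asg nat ex (infix "::=" 62) | Wr ex ex | Sq cm cm (infixr ";;" 60) | Ife ex cm cm | For nat nat cm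

type_synonym st = "(nat => nat) \<times> (nat => nat)"

fun ev :: "ex => st => nat" where "ev (V x) s = fst s x"
| "ev (N k) s = k"
| "ev (Ad e f) s = ev e s + ev f s"
| "ev (Mi e f) s = ev e s - ev f s"
| "ev (Rd e) s = snd s (ev e s)"

definition put :: "nat => nat => st => st" where "put v k s = ((fst s)(v := k), snd s)"
definition inc :: "nat => st => st" where "inc v s = put v (Suc (fst s v)) s"

fun sm :: "cm => st => st" where "sm (x ::= e) s = put x (ev e s) s"
| "sm (Wr e f) s = (fst s, (snd s)(ev e s := ev f s))"
| "sm (c ;; d) s = sm d (sm c s)"
| "sm (Ife e c d) s = (if ev e s ~= 0 then sm c s else sm d s)"
| "sm (For v b c) s = ((%s. inc v (sm c s)) ^^ (fst s b)) (put v 0 s)"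

fun asg :: "cm => nat set" where "asg (x ::= e) = {x}"
| "asg (Wr e f) = {}"
| "asg (c ;; d) = asg c Un asg d"
| "asg (Ife e c d) = asg c Un asg d"
| "asg (For v b c) = insert v (asg c)"

fun dpt :: "ex => nat" where "dpt (V x) = 0"
| "dpt (N k) = 0"
| "dpt (Ad e f) = max (dpt e) (dpt f + 1)"
| "dpt (Mi e f) = max (dpt e) (dpt f + 1)"
| "dpt (Rd e) = max (dpt e) 1"

fun vok :: "ex => bool" where "vok (V x) <-> x < 60"
| "vok (N k) <-> True"
| "vok (Ad e f) <-> vok e & vok f"
| "vok (Mi e f) <-> vok e & vok f"
| "vok (Rd e) <-> vok e"

fun wf :: "cm => bool" where "wf (x ::= e) <-> x < 60 & vok e & dpt e < 60"
| "wf (Wr e f) <-> vok e & dpt e < 60 & vok f & dpt f < 60"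
| "wf (c ;; d) <-> wf c & wf d"
| "wf (Ife e c d) <-> vok e & dpt e < 60 & wf c & wf d"
| "wf (For v b c) <-> v < 60 & b < 60 & v ~= b & v ~: asg c & b ~: asg c & wf c"

abbreviation "itr v c k s == ((%s. inc v (sm c s)) ^^ k) s"

text \<open>\<open>bd P c s\<close>: every loop in the execution of \<open>c\<close> from \<open>s\<close> has at most \<open>P\<close> rounds.\<close>

fun bd :: "nat => cm => st => bool" where "bd P (x ::= e) s <-> True"
| "bd P (Wr e f) s <-> True"
| "bd P (c ;; d) s <-> bd P c s & bd P d (sm c s)"
| "bd P (Ife e c d) s <-> (if ev e s ~= 0 then bd P c s else bd P d s)"
| "bd P (For v b c) s <-> fst s b <= P & (ALL i<fst s b. bd P c (itr v c i (put v 0 s)))"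

text \<open>A syntactic condition that implies \<open>bd\<close>: all loop bounds are registers of
  \<open>X\<close>, and no register of \<open>X\<close> is ever assigned.\<close>

fun loops_over :: "nat set => cm => bool" where "loops_over X (For v b c) <-> b : X & v ~: X & loops_over X c"
| "loops_over X (c ;; d) <-> loops_over X c & loops_over X d"
| "loops_over X (Ife e c d) <-> loops_over X c & loops_over X d"
| "loops_over X (x ::= e) <-> x ~: X"
| "loops_over X (Wr e f) <-> True"

lemma put_simps [simp]: "fst (put v k s) = (fst s)(v := k)" "snd (put v k s) = snd s" by (simp_all add: put_def)
lemma inc_simps [simp]: "fst (inc v s) = (fst s)(v := Suc (fst s v))" "snd (inc v s) = snd s" by (simp_all add: inc_def)

lemma frame: "x ~: asg c ==> fst (sm c s) x = fst s x"
proof (induct c arbitrary: s)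
 case (For v b c)
 have "fst (itr v c k s) x = fst s x" for k s using For by (induct k) auto
 thus ?case using For by simp
qed auto

lemma loop_var:
 assumes "v ~: asg c" "b ~: asg c" "v ~= b" shows "fst (itr v c k (put v 0 s)) v = k & fst (itr v c k (put v 0 s)) b = fst s b"
 using assms by (induct k) (auto simp: frame)

lemma loop_frame: "x ~: asg c ==> x ~= v ==> fst (itr v c k s) x = fst s x" by (induct k) (auto simp: frame)

lemma loops_over_asg: "loops_over X c ==> asg c Int X = {}" by (induct c) auto

lemma loops_over_bd: "loops_over X c ==> ALL x:X. fst s x <= P ==> bd P c s"
proof (induct c arbitrary: s)
 case (For v b c)
 have "bd P c (itr v c k (put v 0 s))" for k
 proof (rule For.hyps)
 have "x ~: asg c & x ~= v" if "x : X" for x using loops_over_asg[of X c] For.prems that by auto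
 thus "ALL x:X. fst (itr v c k (put v 0 s)) x <= P" using For.prems(2) by (simp add: loop_frame)
 qed (use For.prems in simp)
 thus ?case using For.prems by simp
next
 case (Sq c d)
 have "x ~: asg c" if "x : X" for x using loops_over_asg[of X c] Sq.prems that by auto
 thus ?case using Sq by (simp add: frame)
qed auto

text \<open>Besides the invariant, each round may rely on the value of the counter, the unchanged
  bound and all registers that the body does not assign.\<close>

lemma For_inv:
 assumes "v ~: asg c" "b ~: asg c" "v ~= b" and "I 0 (put v 0 s)" and "!!i t. i < fst s b ==> I i t ==> fst t v = i ==> fst t b = fst s b ==>
 (!!x. x ~: asg c ==> x ~= v ==> fst t x = fst s x) ==> I (Suc i) (inc v (sm c t))" shows "I (fst s b) (sm (For v b c) s)"
proof -
 have "I k (itr v c k (put v 0 s))" if "k <= fst s b" for k using that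
 proof (induct k)
 case (Suc k)
 have "!!x. x ~: asg c ==> x ~= v ==> fst (itr v c k (put v 0 s)) x = fst s x" by (simp add: loop_frame)
 thus ?case using Suc assms(5)[of k] loop_var[OF assms(1-3), of k s] by simp
 qed (use assms(4) in simp)
 thus ?thesis by simp
qed

section \<open>Compilation\<close>

text \<open>The value ends up in register \<open>t\<close>, and only registers from \<open>t\<close>
  on are changed. A copy is programmed as an addition to zero; 128 is the offset of the
  heap.\<close>

fun ce :: "ex => nat => instr list" where "ce (V x) t = [Const t 0, Add t t x]"
| "ce (N k) t = [Const t k]"
| "ce (Ad e f) t = ce e t @ ce f (t+1) @ [Add t t (t+1)]"
| "ce (Mi e f) t = ce e t @ ce f (t+1) @ [Sub t t (t+1)]"
| "ce (Rd e) t = ce e t @ [Const (t+1) 128, Add t t (t+1), Load t t]"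

text \<open>Jumps are absolute, so the code depends on its address \<open>p\<close>. Setting
  register 60 to zero before \<open>Jz 60\<close> gives an unconditional jump, and a loop ends when
  the truncated difference of bound and counter vanishes.\<close>

fun cc :: "nat => cm => instr list" where "cc p (x ::= e) = ce e 60 @ [Const 61 0, Add x 60 61]"
| "cc p (Wr e f) = ce e 60 @ ce f 61 @ [Const 62 128, Add 60 60 62, Store 60 61]"
| "cc p (c ;; d) = cc p c @ cc (p + length (cc p c)) d"
| "cc p (Ife e c d) = (let a = length (ce e 60); C = cc (p+a+1) c; q = p+a+1+length C+2; D = cc q d in
 ce e 60 @ [Jz 60 q] @ C @ [Const 60 0] @ [Jz 60 (q + length D)] @ D)"
| "cc p (For v b c) = (let C = cc (p+3) c in [Const v 0] @ [Sub 60 b v] @ [Jz 60 (p+3+length C+4)] @ C @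
 [Const 60 1, Add v v 60, Const 60 0] @ [Jz 60 (p+1)])"

fun cost :: "nat => cm => nat" where "cost P (x ::= e) = length (ce e 60) + 2"
| "cost P (Wr e f) = length (ce e 60) + length (ce f 61) + 3"
| "cost P (c ;; d) = cost P c + cost P d"
| "cost P (Ife e c d) = length (ce e 60) + cost P c + cost P d + 3"
| "cost P (For v b c) = 3 + P * (cost P c + 6)"

lemma cost_poly: "EX a k. ALL P. cost P c <= a * (P + 1) ^ k"
proof (induct c)
 case (Sq c d)
 then obtain a k a' k' where *: "!!P. cost P c <= a * (P + 1) ^ k" "!!P. cost P d <= a' * (P + 1) ^ k'" by blast
 have "cost P (c ;; d) <= (a + a') * (P + 1) ^ (k + k')" for P
 proof -
 have "a * (P + 1) ^ k <= a * (P + 1) ^ (k + k')" "a' * (P + 1) ^ k' <= a' * (P + 1) ^ (k + k')" by (intro mult_le_mono2 power_increasing; simp)+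
 hence "cost P c <= a * (P + 1) ^ (k + k')" "cost P d <= a' * (P + 1) ^ (k + k')" using * le_trans by blast+
 thus ?thesis by (simp only: cost.simps distrib_right add_mono)
 qed
 thus ?case by blast
next
 case (Ife e c d)
 then obtain a k a' k' where *: "!!P. cost P c <= a * (P + 1) ^ k" "!!P. cost P d <= a' * (P + 1) ^ k'" by blast
 have "cost P (Ife e c d) <= (a + a' + length (ce e 60) + 3) * (P + 1) ^ (k + k')" for P
 proof -
 have "a * (P + 1) ^ k <= a * (P + 1) ^ (k + k')" "a' * (P + 1) ^ k' <= a' * (P + 1) ^ (k + k')" by (intro mult_le_mono2 power_increasing; simp)+
 hence 1: "cost P c <= a * (P + 1) ^ (k + k')" "cost P d <= a' * (P + 1) ^ (k + k')" using * le_trans by blast+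
 have 2: "(length (ce e 60) + 3) * 1 <= (length (ce e 60) + 3) * (P + 1) ^ (k + k')" by (intro mult_le_mono2) simp
 have "cost P (Ife e c d) = cost P c + cost P d + (length (ce e 60) + 3) * 1" by simp
 also have "... <= (a + a' + (length (ce e 60) + 3)) * (P + 1) ^ (k + k')" unfolding distrib_right by (intro add_mono 1 2[unfolded distrib_right])
 finally show ?thesis by (simp only: add.assoc)
 qed
 thus ?case by blast
next
 case (For v b c)
 then obtain a k where *: "!!P. cost P c <= a * (P + 1) ^ k" by blast
 have "cost P (For v b c) <= (a + 9) * (P + 1) ^ (k + 1)" for P
 proof -
 have p: "1 <= (P + 1) ^ k" by simp
 have "cost P (For v b c) <= 3 * ((P + 1) * (P + 1) ^ k) + (P + 1) * (a * (P + 1) ^ k + 6 * (P + 1) ^ k)"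
 proof -
 have "P * (cost P c + 6) <= (P + 1) * (a * (P + 1) ^ k + 6 * (P + 1) ^ k)" using *[of P] p by (intro mult_le_mono) linarith+
 moreover have "3 * (1 * 1) <= 3 * ((P + 1) * (P + 1) ^ k)" using p by (intro mult_le_mono) auto
 ultimately show ?thesis by simp
 qed
 also have "... = (a + 9) * (P + 1) ^ (k + 1)" by (simp add: algebra_simps)
 finally show ?thesis .
 qed
 thus ?case by blast
next
 case (Asg x e)
 show ?case by (rule exI[of _ "length (ce e 60) + 2"], rule exI[of _ 0]) simp
next
 case (Wr e f)
 show ?case by (rule exI[of _ "length (ce e 60) + length (ce f 61) + 3"], rule exI[of _ 0]) simp
qed

definition code :: "nat => instr list => instr list => bool" where "code p is prog <-> (EX a b. prog = a @ is @ b & length a = p)"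

definition rc :: "instr list => nat => config => config => bool" where "rc prog T c c' <-> (EX t<=T. run prog t c = c')"

lemma code_append: "code p (is @ js) prog <-> code p is prog & code (p + length is) js prog"
proof
 assume "code p (is @ js) prog"
 then obtain a b where "prog = a @ (is @ js) @ b" "length a = p" by (auto simp: code_def)
 hence "prog = a @ is @ (js @ b)" "prog = (a @ is) @ js @ b" "length a = p" "length (a @ is) = p + length is" by auto
 thus "code p is prog & code (p + length is) js prog" unfolding code_def by blast
next
 assume "code p is prog & code (p + length is) js prog"
 then obtain a b a' b' where "prog = a @ is @ b" "length a = p" "prog = a' @ js @ b'" "length a' = p + length is" unfolding code_def by blast
 hence "prog = (a @ is) @ js @ b'" by (metis append.assoc append_eq_append_conv length_append)
 thus "code p (is @ js) prog" using `length a = p` by (auto simp: code_def)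
qed

lemma rc_refl: "rc prog 0 c c" by (auto simp: rc_def run_def)

lemma rc_trans: "rc prog s c c' ==> rc prog t c' c'' ==> rc prog (s + t) c c''"
proof -
 assume "rc prog s c c'" "rc prog t c' c''"
 then obtain i j where "i <= s" "j <= t" "run prog i c = c'" "run prog j c' = c''" by (auto simp: rc_def)
 hence "run prog (j + i) c = c''" "j + i <= s + t" by (simp_all add: run_def funpow_add)
 thus ?thesis unfolding rc_def by blast
qed

lemma rc_mono: "rc prog s c c' ==> s <= t ==> rc prog t c c'" unfolding rc_def using le_trans by blast

lemma rc_step: "code p [i] prog ==> rc prog 1 (p, m) (exec i (p, m))"
 unfolding rc_def by (rule exI[of _ 1]) (auto simp: code_def run_def step_def halted_def nth_append)

lemma rc_step': "code p [i] prog ==> exec i (p, m) = c ==> rc prog 1 (p, m) c" using rc_step by blast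

abbreviation ex1 :: "instr => (nat => nat) => nat => nat" where "ex1 i m == snd (exec i (0, m))"

fun straight :: "instr => bool" where "straight (Jz r l) <-> False" | "straight _ <-> True"

lemma rc_list1: "code p is prog ==> list_all straight is ==> rc prog (length is) (p, m) (p + length is, fold ex1 is m)"
proof (induct "is" arbitrary: p m)
 case (Cons i "is")
 have c: "code p [i] prog" "code (p + 1) is prog" using Cons.prems(1) code_append[of p "[i]" "is" prog] by auto
 have e: "exec i (p, m) = (p + 1, ex1 i m)" using Cons.prems(2) by (cases i) auto
 have "rc prog (length is) (p + 1, ex1 i m) (p + 1 + length is, fold ex1 is (ex1 i m))" by (rule Cons.hyps) (use c Cons.prems in auto)
 from rc_trans[OF rc_step[OF c(1), of m, unfolded e] this] show ?case by simp
qed (simp add: rc_refl)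

lemma rc_list:
 "code p is prog ==> list_all straight is ==> T = length is ==> q = p + length is ==> m' = fold ex1 is m ==> rc prog T (p, m) (q, m')"
 using rc_list1 by simp

text \<open>Nothing is demanded of the registers 60 to 127, the scratch space of the compiled
  code.\<close>

definition sim :: "st => (nat => nat) => bool" where "sim s m <-> (ALL x<60. m x = fst s x) & (ALL y. m (128 + y) = snd s y)"

lemma straight_ce: "list_all straight (ce e t)" by (induct e arbitrary: t) auto

lemma ce_fold:
 "vok e ==> 60 <= t ==> t + dpt e < 128 ==> sim s m ==>
 fold ex1 (ce e t) m t = ev e s & (ALL x. x < t | 128 <= x --> fold ex1 (ce e t) m x = m x)"
proof (induct e arbitrary: t m)
 case (Ad e f)
 let ?m = "fold ex1 (ce e t) m"
 have 1: "?m t = ev e s & (ALL x. x < t | 128 <= x --> ?m x = m x)" by (rule Ad.hyps) (use Ad.prems in auto)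
 hence "sim s ?m" using Ad.prems(2,4) by (auto simp: sim_def)
 hence "fold ex1 (ce f (t+1)) ?m (t+1) = ev f s & (ALL x. x < t+1 | 128 <= x --> fold ex1 (ce f (t+1)) ?m x = ?m x)"
 by (intro Ad.hyps) (use Ad.prems in auto)
 thus ?case using 1 Ad.prems by simp
next
 case (Mi e f)
 let ?m = "fold ex1 (ce e t) m"
 have 1: "?m t = ev e s & (ALL x. x < t | 128 <= x --> ?m x = m x)" by (rule Mi.hyps) (use Mi.prems in auto)
 hence "sim s ?m" using Mi.prems(2,4) by (auto simp: sim_def)
 hence "fold ex1 (ce f (t+1)) ?m (t+1) = ev f s & (ALL x. x < t+1 | 128 <= x --> fold ex1 (ce f (t+1)) ?m x = ?m x)"
 by (intro Mi.hyps) (use Mi.prems in auto)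
 thus ?case using 1 Mi.prems by simp
next
 case (Rd e)
 have 1: "fold ex1 (ce e t) m t = ev e s & (ALL x. x < t | 128 <= x --> fold ex1 (ce e t) m x = m x)" by (rule Rd.hyps) (use Rd.prems in auto)
 have t: "Suc t < 128" using Rd.prems(3) by simp
 have "m (ev e s + 128) = snd s (ev e s)" using Rd.prems(4) by (simp add: sim_def add.commute)
 thus ?case using 1 t by simp
qed (auto simp: sim_def)

lemma sim_ce: "vok e ==> 60 <= t ==> t + dpt e < 128 ==> sim s m ==> sim s (fold ex1 (ce e t) m)" using ce_fold[of e t s m] by (auto simp: sim_def)

theorem compile:
 "wf c ==> code p (cc p c) prog ==> sim s m ==> bd P c s ==>
 EX m'. rc prog (cost P c) (p, m) (p + length (cc p c), m') & sim (sm c s) m'"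
proof (induct c arbitrary: p s m)
 case (Asg x e)
 have "rc prog (length (cc p (x ::= e))) (p, m) (p + length (cc p (x ::= e)), fold ex1 (cc p (x ::= e)) m)"
 using Asg.prems by (intro rc_list1) (auto simp: straight_ce)
 moreover have "sim (sm (x ::= e) s) (fold ex1 (cc p (x ::= e)) m)" using ce_fold[of e 60 s m] Asg.prems by (auto simp: sim_def)
 moreover have "cost P (x ::= e) = length (cc p (x ::= e))" by simp
 ultimately show ?case by metis
next
 case (Wr e f)
 let ?m = "fold ex1 (ce e 60) m"
 have 1: "?m 60 = ev e s" and s1: "sim s ?m" using ce_fold[of e 60 s m] sim_ce[of e 60 s m] Wr.prems by auto
 have 2: "fold ex1 (ce f 61) ?m 61 = ev f s" "fold ex1 (ce f 61) ?m 60 = ev e s" and s2: "sim s (fold ex1 (ce f 61) ?m)"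
 using ce_fold[of f 61 s ?m] sim_ce[of f 61 s ?m] Wr.prems s1 1 by auto
 have "rc prog (length (cc p (Wr e f))) (p, m) (p + length (cc p (Wr e f)), fold ex1 (cc p (Wr e f)) m)"
 using Wr.prems by (intro rc_list1) (auto simp: straight_ce)
 moreover have "sim (sm (Wr e f) s) (fold ex1 (cc p (Wr e f)) m)" using 2 s2 by (auto simp: sim_def add.commute)
 moreover have "cost P (Wr e f) = length (cc p (Wr e f))" by simp
 ultimately show ?case by metis
next
 case (Sq c d)
 have cd: "code p (cc p c) prog" "code (p + length (cc p c)) (cc (p + length (cc p c)) d) prog" using Sq.prems(2) by (auto simp: code_append)
 obtain m1 where 1: "rc prog (cost P c) (p, m) (p + length (cc p c), m1)" "sim (sm c s) m1" using Sq.hyps(1)[OF _ cd(1) Sq.prems(3)] Sq.prems by auto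
 obtain m2 where 2: "rc prog (cost P d) (p + length (cc p c), m1) (p + length (cc p c) + length (cc (p + length (cc p c)) d), m2)" "sim (sm d (sm c s)) m2"
 using Sq.hyps(2)[OF _ cd(2) 1(2)] Sq.prems by auto
 show ?case using rc_trans[OF 1(1) 2(1)] 2(2) by (simp only: cc.simps cost.simps sm.simps length_append add.assoc) blast
next
 case (Ife e c d)
 define p1 p2 where p12: "p1 = p + length (ce e 60)" "p2 = p1 + 1"
 define C where "C = cc p2 c"
 define p3 p4 p5 where p345: "p3 = p2 + length C" "p4 = p3 + 1" "p5 = p4 + 1"
 define D where "D = cc p5 d"
 let ?m = "fold ex1 (ce e 60) m"
 have e60: "?m 60 = ev e s" and s1: "sim s ?m" using ce_fold[of e 60 s m] sim_ce[of e 60 s m] Ife.prems by auto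
 have q: "p + length (ce e 60) + 1 = p2" "p2 + length C + 2 = p5" by (simp_all add: p12 p345)
 have whole: "cc p (Ife e c d) = ce e 60 @ [Jz 60 p5] @ C @ [Const 60 0] @ [Jz 60 (p5 + length D)] @ D"
 unfolding cc.simps Let_def q C_def[symmetric] D_def[symmetric] ..
 have cd: "code p (ce e 60) prog" "code p1 [Jz 60 p5] prog" "code p2 C prog" "code p3 [Const 60 0] prog"
 "code p4 [Jz 60 (p5 + length D)] prog" "code p5 D prog" using Ife.prems(2) unfolding whole code_append by (simp_all add: p12 p345)
 have len: "p + length (cc p (Ife e c d)) = p5 + length D" unfolding whole by (simp add: p12 p345)
 have r1: "rc prog (length (ce e 60)) (p, m) (p1, ?m)" using rc_list1[OF cd(1), of m] straight_ce by (simp add: p12)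
 have wfs: "wf c" "wf d" using Ife.prems by auto
 show ?case
 proof (cases "ev e s = 0")
 case True
 have r2: "rc prog 1 (p1, ?m) (p5, ?m)" by (rule rc_step'[OF cd(2)]) (simp add: e60 True)
 have "bd P d s" using Ife.prems(4) True by simp
 from Ife.hyps(2)[OF wfs(2) cd(6)[unfolded D_def] s1 this, folded D_def]
 obtain m' where 3: "rc prog (cost P d) (p5, ?m) (p5 + length D, m')" "sim (sm d s) m'" by blast
 have "rc prog (cost P (Ife e c d)) (p, m) (p5 + length D, m')" by (rule rc_mono[OF rc_trans[OF rc_trans[OF r1 r2] 3(1)]]) simp
 thus ?thesis unfolding len using 3(2) True by (metis sm.simps(4))
 next
 case False
 have r2: "rc prog 1 (p1, ?m) (p2, ?m)" by (rule rc_step'[OF cd(2)]) (simp add: e60 False p12)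
 have "bd P c s" using Ife.prems(4) False by simp
 from Ife.hyps(1)[OF wfs(1) cd(3)[unfolded C_def] s1 this, folded C_def]
 obtain m' where 3: "rc prog (cost P c) (p2, ?m) (p3, m')" "sim (sm c s) m'" unfolding p345(1) by blast
 have r4: "rc prog 1 (p3, m') (p4, m'(60 := 0))" by (rule rc_step'[OF cd(4)]) (simp add: p345)
 have r5: "rc prog 1 (p4, m'(60 := 0)) (p5 + length D, m'(60 := 0))" by (rule rc_step'[OF cd(5)]) simp
 have "rc prog (cost P (Ife e c d)) (p, m) (p5 + length D, m'(60 := 0))"
 by (rule rc_mono[OF rc_trans[OF rc_trans[OF rc_trans[OF rc_trans[OF r1 r2] 3(1)] r4] r5]]) simp
 moreover have "sim (sm c s) (m'(60 := 0))" using 3(2) by (auto simp: sim_def)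
 ultimately show ?thesis unfolding len using False by (metis sm.simps(4))
 qed
next
 case (For v b c)
 define p1 p2 p3 where p123: "p1 = p + 1" "p2 = p1 + 1" "p3 = p2 + 1"
 define C where "C = cc p3 c"
 define p4 p5 p6 where p456: "p4 = p3 + length C" "p5 = p4 + 1 + 1 + 1" "p6 = p5 + 1"
 let ?f = "%s. inc v (sm c s)"
 have q: "p + 3 = p3" "p3 + length C + 4 = p6" "p + 1 = p1" by (simp_all add: p123 p456)
 have whole: "cc p (For v b c) = [Const v 0] @ [Sub 60 b v] @ [Jz 60 p6] @ C @ [Const 60 1, Add v v 60, Const 60 0] @ [Jz 60 p1]"
 unfolding cc.simps Let_def q C_def[symmetric] ..
 have cd: "code p [Const v 0] prog" "code p1 [Sub 60 b v] prog" "code p2 [Jz 60 p6] prog" "code p3 C prog"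
 "code p4 [Const 60 1, Add v v 60, Const 60 0] prog" "code p5 [Jz 60 p1] prog"
 using For.prems(2) unfolding whole code_append by (simp_all add: p123 p456)
 have len: "p + length (cc p (For v b c)) = p6" unfolding whole by (simp add: p123 p456)
 have w: "v < 60" "b < 60" "v ~= b" "v ~: asg c" "b ~: asg c" "wf c" using For.prems(1) by auto
 let ?s = "%k. (?f ^^ k) (put v 0 s)"
 have vb: "fst (?s k) v = k" "fst (?s k) b = fst s b" for k using loop_var[OF w(4,5,3), of k s] by auto
 have it: "EX m'. rc prog (k * (cost P c + 6)) (p1, m(v := 0)) (p1, m') & sim (?s k) m'" if "k <= fst s b" for k using that
 proof (induct k)
 case 0
 have "sim (put v 0 s) (m(v := 0))" using For.prems(3) w by (auto simp: sim_def)
 thus ?case unfolding mult_0 funpow_0 using rc_refl by blast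
 next
 case (Suc k)
 have "k <= fst s b" using Suc.prems by simp
 from Suc.hyps[OF this] obtain m1 where m1: "rc prog (k * (cost P c + 6)) (p1, m(v := 0)) (p1, m1)" "sim (?s k) m1" by blast
 have vals: "m1 b - m1 v = fst s b - k" using m1(2) w vb[of k] by (simp add: sim_def)
 let ?m2 = "m1(60 := fst s b - k)"
 have r2: "rc prog 1 (p1, m1) (p2, ?m2)" by (rule rc_step'[OF cd(2)]) (simp add: vals p123)
 have r3: "rc prog 1 (p2, ?m2) (p3, ?m2)" by (rule rc_step'[OF cd(3)]) (use Suc.prems in "simp add: p123")
 have s2: "sim (?s k) ?m2" using m1(2) by (auto simp: sim_def)
 have "bd P c (?s k)" using For.prems(4) Suc.prems by simp
 from For.hyps[OF w(6) cd(4)[unfolded C_def] s2 this, folded C_def]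
 obtain m3 where 4: "rc prog (cost P c) (p3, ?m2) (p4, m3)" "sim (sm c (?s k)) m3" unfolding p456(1) by blast
 let ?m4 = "m3(60 := 0, v := Suc (m3 v))"
 have r5: "rc prog 3 (p4, m3) (p5, ?m4)" by (rule rc_list[OF cd(5)]) (use w(1) in "simp_all add: p456 fun_upd_twist")
 have r6: "rc prog 1 (p5, ?m4) (p1, ?m4)" by (rule rc_step'[OF cd(6)]) (use w(1) in simp)
 have "rc prog (k * (cost P c + 6) + 1 + 1 + cost P c + 3 + 1) (p1, m(v := 0)) (p1, ?m4)"
 by (rule rc_trans[OF rc_trans[OF rc_trans[OF rc_trans[OF rc_trans[OF m1(1) r2] r3] 4(1)] r5] r6])
 moreover have "sim (?s (Suc k)) ?m4" using 4(2) w(1) by (auto simp: sim_def)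
 moreover have "k * (cost P c + 6) + 1 + 1 + cost P c + 3 + 1 = Suc k * (cost P c + 6)" by simp
 ultimately show ?case by metis
 qed
 from it[OF le_refl] obtain m1 where m1: "rc prog (fst s b * (cost P c + 6)) (p1, m(v := 0)) (p1, m1)" "sim (?s (fst s b)) m1" by blast
 have r0: "rc prog 1 (p, m) (p1, m(v := 0))" by (rule rc_step'[OF cd(1)]) (simp add: p123)
 have vals: "m1 b - m1 v = 0" using m1(2) w vb[of "fst s b"] by (simp add: sim_def)
 have r2: "rc prog 1 (p1, m1) (p2, m1(60 := 0))" by (rule rc_step'[OF cd(2)]) (simp add: vals p123)
 have r3: "rc prog 1 (p2, m1(60 := 0)) (p6, m1(60 := 0))" by (rule rc_step'[OF cd(3)]) simp
 have "rc prog (1 + fst s b * (cost P c + 6) + 1 + 1) (p, m) (p6, m1(60 := 0))" by (rule rc_trans[OF rc_trans[OF rc_trans[OF r0 m1(1)] r2] r3])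
 moreover have "1 + fst s b * (cost P c + 6) + 1 + 1 <= cost P (For v b c)" using For.prems(4) by simp
 ultimately have "rc prog (cost P (For v b c)) (p, m) (p6, m1(60 := 0))" by (rule rc_mono)
 moreover have "sim (sm (For v b c) s) (m1(60 := 0))" using m1(2) by (auto simp: sim_def)
 ultimately show ?case unfolding len by blast
qed

text \<open>The input occupies the registers, so it is first copied out of the way: after the prologue, with
 \<open>n\<close> rectangles, register 1 contains \<open>128n\<close>, the width is in cell \<open>128n\<close>, and an input cell
 \<open>a < 128\<close> is in cell \<open>128n + a\<close>. The epilogue conversely loads the output cells below 128 from the
 cells whose addresses are shifted by the content of register 0.\<close>

definition prologue :: "instr list" where
 "prologue = replicate 7 (Add 1 1 1) @ [Store 1 0] @ concat (map (%a. [Const 0 a, Add 0 0 1, Store 0 a]) [2..<128])"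
definition epilogue :: "instr list" where "epilogue = concat (map (%a. [Const 1 a, Add a 0 1, Load a a]) [2..<128])"
text \<open>An empty input halts at once: for \<open>n = 0\<close> the copies of the prologue would
  fall onto the registers.\<close>

definition program :: "cm => instr list" where
 "program c = (let q = 1 + length prologue; C = cc q c in [Jz 1 (q + length C + length epilogue)] @ prologue @ C @ epilogue)"

lemma prologue_copies:
 assumes "m 1 = r" "128 <= r" "2 <= k" "k <= 128"
 defines "m' == fold ex1 (concat (map (%a. [Const 0 a, Add 0 0 1, Store 0 a]) [2..<k])) m"
 shows "ALL a. 0 < a & (a < r + 2 | r + k <= a) --> m' a = m a" "ALL a. 2 <= a & a < k --> m' (r + a) = m a" using assms(3,4) unfolding m'_def
proof (induct k rule: nat_induct_at_least)
 case (Suc k)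
 { case 1 thus ?case using Suc assms(1,2) by (auto simp: Suc_le_eq) }
 { case 2 thus ?case using Suc assms(1,2) by (auto simp: Suc_le_eq less_Suc_eq) }
qed auto

lemma epilogue_loads:
 assumes "128 <= m 0" "2 <= k" "k <= 128"
 defines "m' == fold ex1 (concat (map (%a. [Const 1 a, Add a 0 1, Load a a]) [2..<k])) m"
 shows "m' 0 = m 0 & (ALL a>=k. m' a = m a) & (ALL a. 2 <= a & a < k --> m' a = m (m 0 + a))" using assms(2,3) unfolding m'_def
proof (induct k rule: nat_induct_at_least)
 case (Suc k)
 thus ?case using assms(1) by (auto simp: less_Suc_eq)
qed auto

definition after :: "(nat => nat) => st" where "after m = (fold ex1 prologue m, %y. fold ex1 prologue m (128 + y))"

lemma after:
 assumes "m 1 = n" "0 < n" shows "fst (after m) 1 = 128 * n" "snd (after m) (128 * n - 128) = m 0"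
 "2 <= a ==> a < 128 ==> snd (after m) (128 * n + a - 128) = m a" "128 <= a ==> a < 128 * n ==> snd (after m) (a - 128) = m a"
proof -
 define m1 where "m1 = m(1 := 128 * n, 128 * n := m 0)"
 have r: "replicate 7 (Add 1 1 1) = [Add 1 1 1, Add 1 1 1, Add 1 1 1, Add 1 1 1, Add 1 1 1, Add 1 1 1, Add 1 1 1]" by (simp add: eval_nat_numeral)
 have m1e: "fold ex1 [Store 1 0] (fold ex1 (replicate 7 (Add 1 1 1)) m) = m1" unfolding r m1_def using assms by (auto simp: fun_eq_iff)
 have e: "fold ex1 prologue m = fold ex1 (concat (map (%a. [Const 0 a, Add 0 0 1, Store 0 a]) [2..<128])) m1"
 unfolding prologue_def fold_append o_apply m1e ..
 have n: "128 <= 128 * n" using assms by simp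
 have m1: "m1 1 = 128 * n" using assms by (simp add: m1_def)
 note c = prologue_copies[of m1 "128 * n" 128, OF m1 n, folded e, simplified]
 show "fst (after m) 1 = 128 * n" using c(1) m1 by (simp add: after_def)
 show "snd (after m) (128 * n - 128) = m 0" using c(1) n by (simp add: after_def m1_def)
 show "2 <= a ==> a < 128 ==> snd (after m) (128 * n + a - 128) = m a" using c(2) n by (auto simp: after_def m1_def)
 show "128 <= a ==> a < 128 * n ==> snd (after m) (a - 128) = m a" using c(1) by (auto simp: after_def m1_def)
qed

theorem machine:
 assumes wf: "wf c" and n: "m 1 ~= 0" and bd: "bd P c (after m)" and r0: "128 <= fst (sm c (after m)) 0"
 defines "f == sm c (after m)" shows "EX t <= cost P c + (1 + length prologue + length epilogue). halted (program c) (run (program c) t (0, m)) &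
 (ALL a>=2. snd (run (program c) t (0, m)) a = (if a < 128 then snd f (fst f 0 + a - 128) else snd f (a - 128)))"
proof -
 define q where "q = 1 + length prologue"
 define C where "C = cc q c"
 define L where "L = q + length C + length epilogue"
 have pr: "program c = [Jz 1 L] @ prologue @ C @ epilogue" by (simp add: program_def Let_def q_def C_def L_def)
 have "code 0 ([Jz 1 L] @ prologue @ C @ epilogue) (program c)" unfolding code_def pr by (intro exI[of _ "[]"]) simp
 hence cd: "code 0 [Jz 1 L] (program c)" "code 1 prologue (program c)" "code q C (program c)" "code (q + length C) epilogue (program c)"
 unfolding code_append by (simp_all add: q_def)
 have cs: "list_all straight (concat (map f xs))" if "!!a. list_all straight (f a)" for f :: "nat => instr list" and xs using that by (induct xs) auto
 have st: "list_all straight prologue" "list_all straight epilogue" unfolding prologue_def epilogue_def list_all_append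
 by (intro conjI cs; simp add: list_all_iff)+
 have r1: "rc (program c) 1 (0, m) (1, m)" by (rule rc_step'[OF cd(1)]) (use n in simp)
 have r2: "rc (program c) (length prologue) (1, m) (q, fold ex1 prologue m)" by (rule rc_list[OF cd(2) st(1)]) (simp_all add: q_def)
 have "sim (after m) (fold ex1 prologue m)" by (simp add: sim_def after_def)
 from compile[OF wf cd(3)[unfolded C_def] this bd, folded C_def f_def]
 obtain m2 where m2: "rc (program c) (cost P c) (q, fold ex1 prologue m) (q + length C, m2)" "sim f m2" by blast
 have r4: "rc (program c) (length epilogue) (q + length C, m2) (L, fold ex1 epilogue m2)" by (rule rc_list[OF cd(4) st(2)]) (simp_all add: L_def)
 have "rc (program c) (1 + length prologue + cost P c + length epilogue) (0, m) (L, fold ex1 epilogue m2)"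
 by (rule rc_trans[OF rc_trans[OF rc_trans[OF r1 r2] m2(1)] r4])
 then obtain t where t: "t <= 1 + length prologue + cost P c + length epilogue" "run (program c) t (0, m) = (L, fold ex1 epilogue m2)" by (auto simp: rc_def)
 have m20: "m2 0 = fst f 0" using m2(2) by (simp add: sim_def)
 have h: "m2 a = snd f (a - 128)" if "128 <= a" for a using m2(2) that unfolding sim_def by (metis le_add_diff_inverse)
 have "fold ex1 epilogue m2 a = (if a < 128 then snd f (fst f 0 + a - 128) else snd f (a - 128))" if "2 <= a" for a
 using epilogue_loads[of m2 128] r0 that h m20 unfolding epilogue_def[symmetric] f_def[symmetric] by auto
 moreover have "halted (program c) (L, fold ex1 epilogue m2)" by (simp add: halted_def pr L_def q_def)
 ultimately show ?thesis using t by (intro exI[of _ t]) auto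
qed

lemma machine_empty:
 assumes "m 1 = 0" shows "halted (program c) (run (program c) 1 (0, m)) & snd (run (program c) 1 (0, m)) = m"
 using assms by (simp add: run_def step_def halted_def program_def Let_def)

section \<open>Arithmetic and digits\<close>

abbreviation skip :: cm where "skip == 19 ::= N 0"
text \<open>Division by repeated subtraction. The number of rounds is the content of register
  \<open>l\<close>, which has to be at least the dividend. The comparison of \<open>y\<close> with
  \<open>r\<close> tests whether \<open>r + 1 - y\<close> is nonzero.\<close>

definition DIVMOD :: "nat => nat => ex => ex => nat => nat => cm" where "DIVMOD q r x y l v = (q ::= N 0 ;; r ::= x ;;
 For v l (Ife (Mi (Ad (V r) (N 1)) y) (r ::= Mi (V r) y ;; q ::= Ad (V q) (N 1)) skip))"
text \<open>The test succeeds in exactly the first \<open>a\<close> rounds, so register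
  \<open>l\<close> has to be at least \<open>a\<close>.\<close>

definition MULADD :: "nat => ex => ex => nat => nat => cm" where "MULADD x a y l v = For v l (Ife (Mi a (V v)) (x ::= Ad (V x) y) skip)"

fun nowr :: "cm => bool" where "nowr (x ::= e) <-> True"
| "nowr (Wr e f) <-> False"
| "nowr (c ;; d) <-> nowr c & nowr d"
| "nowr (Ife e c d) <-> nowr c & nowr d"
| "nowr (For v b c) <-> nowr c"

lemma nowr_heap: "nowr c ==> snd (sm c s) = snd s"
proof (induct c arbitrary: s)
 case (For v b c)
 have "snd (((%s. inc v (sm c s)) ^^ k) s) = snd s" for k s using For by (induct k) auto
 thus ?case by simp
qed auto

fun vars :: "ex => nat set" where "vars (V x) = {x}"
| "vars (N k) = {}"
| "vars (Ad e f) = vars e Un vars f"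
| "vars (Mi e f) = vars e Un vars f"
| "vars (Rd e) = vars e"

lemma ev_cong: "(!!x. x : vars e ==> fst t x = fst s x) ==> snd t = snd s ==> ev e t = ev e s" by (induct e) auto

lemma DIVMOD:
 assumes y: "ev y s = b" "0 < b" and l: "ev x s <= fst s l" and d: "distinct [q, r, l, v, 19]" "vars y Int {q, r, v, 19} = {}" "q ~: vars x"
 shows "fst (sm (DIVMOD q r x y l v) s) q = ev x s div b" "fst (sm (DIVMOD q r x y l v) s) r = ev x s mod b"
proof -
 define s1 where "s1 = put r (ev x s) (put q 0 s)"
 have x: "ev x (put q 0 s) = ev x s" using d by (intro ev_cong) auto
 let ?c = "Ife (Mi (Ad (V r) (N 1)) y) (r ::= Mi (V r) y ;; q ::= Ad (V q) (N 1)) skip"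
 have e: "sm (DIVMOD q r x y l v) s = sm (For v l ?c) s1" unfolding DIVMOD_def sm.simps(3) by (simp add: s1_def x)
 define I where "I i t <-> snd t = snd s & fst t q * b + fst t r = ev x s & (fst t r < b | fst t q = i)" for i and t :: st
 have "I (fst s1 l) (sm (For v l ?c) s1)"
 proof (rule For_inv)
 show "I 0 (put v 0 s1)" using d by (auto simp: I_def s1_def)
 fix i t assume t: "I i t" "!!x. x ~: asg ?c ==> x ~= v ==> fst t x = fst s1 x"
 have yt: "ev y (put a k t) = b" if "a : {q, r, v, 19}" for a k
 proof -
 have "fst (put a k t) z = fst s z" if "z : vars y" for z
 proof -
 have "z ~: {q, r, v, 19}" using d(2) that by blast
 thus ?thesis using t(2)[of z] `a : _` by (auto simp: s1_def)
 qed
 hence "ev y (put a k t) = ev y s" using t(1) by (intro ev_cong) (auto simp: I_def)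
 thus ?thesis using y by simp
 qed
 have yt0: "ev y t = b" using yt[of q "fst t q"] by (simp add: put_def)
 show "I (Suc i) (inc v (sm ?c t))"
 proof (cases "fst t r < b")
 case True
 thus ?thesis using t(1) d yt0 by (auto simp: I_def)
 next
 case False
 have "fst t q * b + fst t r = ev x s" using t(1) by (simp add: I_def)
 hence "(Suc (fst t q)) * b + (fst t r - b) = ev x s" using False by simp
 thus ?thesis using t(1) False d yt0 by (auto simp: I_def)
 qed
 qed (use d in auto)
 moreover have "fst s1 l = fst s l" using d by (auto simp: s1_def)
 ultimately obtain Q R where QR: "fst (sm (For v l ?c) s1) q = Q" "fst (sm (For v l ?c) s1) r = R" "Q * b + R = ev x s" "R < b | Q = fst s l" by (auto simp: I_def)
 have "R < b"
 proof (rule ccontr)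
 assume n: "~ R < b"
 hence "ev x s <= Q" using QR(4) l by simp
 moreover have "Q * 1 <= Q * b" using y(2) by (intro mult_le_mono2) simp
 ultimately show False using QR(3) n y(2) by linarith
 qed
 hence "Q = ev x s div b" "R = ev x s mod b" using QR(3) by (auto simp flip: QR(3))
 thus "fst (sm (DIVMOD q r x y l v) s) q = ev x s div b" "fst (sm (DIVMOD q r x y l v) s) r = ev x s mod b" unfolding e using QR by auto
qed

lemma MULADD:
 assumes l: "ev a s <= fst s l" and d: "distinct [x, l, v, 19]" "vars a Int {x, v, 19} = {}" "vars y Int {x, v, 19} = {}"
 shows "fst (sm (MULADD x a y l v) s) x = fst s x + ev a s * ev y s"
proof -
 let ?c = "Ife (Mi a (V v)) (x ::= Ad (V x) y) skip"
 define I where "I i t <-> snd t = snd s & fst t x = fst s x + min i (ev a s) * ev y s" for i and t :: st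
 have "I (fst s l) (sm (For v l ?c) s)"
 proof (rule For_inv)
 show "I 0 (put v 0 s)" using d by (auto simp: I_def)
 fix i t assume t: "I i t" "fst t v = i" "!!z. z ~: asg ?c ==> z ~= v ==> fst t z = fst s z"
 have fr: "fst t z = fst s z" if "z ~: {x, v, 19}" for z using t(3)[of z] that by simp
 have "ev a t = ev a s" "ev y t = ev y s" using t(1) d(2,3) by (intro ev_cong fr; auto simp: I_def)+
 thus "I (Suc i) (inc v (sm ?c t))" using t d by (auto simp: I_def min_def)
 qed (use d in auto)
 thus ?thesis using l by (simp add: I_def MULADD_def min_def)
qed

section \<open>Decoding states and searching for a transition\<close>

definition env :: "nat => nat => nat => nat => st => bool" where
 "env K B PW DG s <-> 0 < B & fst s 5 = B & fst s 6 = B ^ (6*K+1) & fst s 8 = K & fst s 9 = 6*K+1 & fst s 14 = PW &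
 fst s 15 = DG & PW + (6*K+1) <= DG & (ALL j<6*K+1. snd s (PW + j) = B ^ j)"

definition UNPACK :: cm where "UNPACK = (40 ::= V 35 ;; For 41 9 (DIVMOD 42 43 (V 40) (V 5) 6 44 ;; Wr (Ad (V 15) (V 41)) (V 43) ;; 40 ::= V 42))"

lemma unpack:
 assumes e: "env K B PW DG s" and c: "fst s 35 < B ^ (6*K+1)" shows "ALL j<6*K+1. snd (sm UNPACK s) (DG + j) = dig B (fst s 35) j"
 "ALL y. y < DG | DG + (6*K+1) <= y --> snd (sm UNPACK s) y = snd s y"
proof -
 let ?c = "fst s 35"
 let ?d = "DIVMOD 42 43 (V 40) (V 5) 6 44"
 let ?b = "?d ;; Wr (Ad (V 15) (V 41)) (V 43) ;; 40 ::= V 42"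
 have B: "0 < B" "fst s 5 = B" "fst s 6 = B ^ (6*K+1)" "fst s 9 = 6*K+1" "fst s 15 = DG" using e by (auto simp: env_def)
 define s1 where "s1 = put 40 ?c s"
 define I where "I i t <-> fst t 40 = ?c div B ^ i & (ALL j<i. snd t (DG + j) = dig B ?c j) &
 (ALL y. y < DG | DG + (6*K+1) <= y --> snd t y = snd s y)" for i and t :: st
 have "I (fst s1 9) (sm (For 41 9 ?b) s1)"
 proof (rule For_inv)
 show "I 0 (put 41 0 s1)" by (simp add: I_def s1_def)
 fix i t assume i: "i < fst s1 9" and t: "I i t" "fst t 41 = i" and fr: "!!x. x ~: asg ?b ==> x ~= 41 ==> fst t x = fst s1 x"
 have r: "fst t 5 = B" "fst t 6 = B ^ (6*K+1)" "fst t 15 = DG" using fr[of 5] fr[of 6] fr[of 15] B by (simp_all add: DIVMOD_def s1_def)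
 have q: "fst t 40 = ?c div B ^ i" using t(1) by (simp add: I_def)
 have "ev (V 40) t <= fst t 6" using q r(2) c by (simp add: le_trans[OF div_le_dividend less_imp_le])
 hence dm: "fst (sm ?d t) 42 = ?c div B ^ i div B" "fst (sm ?d t) 43 = ?c div B ^ i mod B"
 using DIVMOD[of "V 5" t B "V 40" 6 42 43 44] r B(1) q by simp_all
 have k: "fst (sm ?d t) 15 = DG" "fst (sm ?d t) 41 = i" using frame[of 15 ?d t] frame[of 41 ?d t] r t(2) by (simp_all add: DIVMOD_def)
 have h: "snd (sm ?d t) = snd t" by (rule nowr_heap) (simp add: DIVMOD_def)
 have "?c div B ^ i div B = ?c div B ^ Suc i" by (metis div_mult2_eq mult.commute power_Suc)
 thus "I (Suc i) (inc 41 (sm ?b t))" using t(1) i dm k h B by (auto simp: I_def dig_def less_Suc_eq s1_def)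
 qed (auto simp: DIVMOD_def)
 moreover have "sm UNPACK s = sm (For 41 9 ?b) s1" unfolding UNPACK_def sm.simps(3) by (simp add: s1_def)
 ultimately show "ALL j<6*K+1. snd (sm UNPACK s) (DG + j) = dig B (fst s 35) j"
 "ALL y. y < DG | DG + (6*K+1) <= y --> snd (sm UNPACK s) y = snd s y" using B by (simp_all add: I_def s1_def)
qed

abbreviation six :: "nat => ex" where "six x == Ad (Ad (Ad (V x) (V x)) (Ad (V x) (V x))) (Ad (V x) (V x))"

definition LOADB :: cm where "LOADB = (45 ::= Ad (V 15) (six 41) ;; 46 ::= Ad (V 14) (six 41) ;;
 50 ::= Rd (V 45) ;; 51 ::= Rd (Ad (V 45) (N 1)) ;; 52 ::= Rd (Ad (V 45) (N 2)) ;; 53 ::= Rd (Ad (V 45) (N 3)) ;;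
 54 ::= Rd (Ad (V 45) (N 4)) ;; 55 ::= Rd (Ad (V 45) (N 5)) ;; 56 ::= Rd (Ad (V 46) (N 4)) ;; 57 ::= Rd (Ad (V 46) (N 5)))"

definition loaded :: "nat => nat => nat => nat => nat => st => bool" where
 "loaded K B PW DG c s <-> fst s 14 = PW & fst s 15 = DG & (ALL j<6*K+1. snd s (PW + j) = B ^ j) & (ALL j<6*K+1. snd s (DG + j) = dig B c j)"

lemma loadb:
 assumes l: "loaded K B PW DG c s" and b: "fst s 41 < K"
 defines "b == fst s 41" and "t == sm LOADB s"
 shows "snd t = snd s" "fst t 50 = dig B c (6*b)" "fst t 51 = dgt B c b 1" "fst t 52 = dgt B c b 2" "fst t 53 = dgt B c b 3"
 "fst t 54 = dgt B c b 4" "fst t 55 = dgt B c b 5" "fst t 56 = B ^ (6*b+4)" "fst t 57 = B ^ (6*b+5)"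
proof -
 have d: "snd s (DG + 6*b + k) = dgt B c b k" "snd s (PW + 6*b + k) = B ^ (6*b+k)" if "k < 6" for k
 using l b that by (simp_all add: loaded_def b_def add.assoc)
 have e: "DG + (b + b + (b + b) + (b + b)) = DG + 6*b" "PW + (b + b + (b + b) + (b + b)) = PW + 6*b" by simp_all
 have r: "fst s 15 = DG" "fst s 14 = PW" using l by (auto simp: loaded_def)
 show "snd t = snd s" by (simp add: t_def LOADB_def)
 show "fst t 50 = dig B c (6*b)" "fst t 51 = dgt B c b 1" "fst t 52 = dgt B c b 2" "fst t 53 = dgt B c b 3"
 "fst t 54 = dgt B c b 4" "fst t 55 = dgt B c b 5" "fst t 56 = B ^ (6*b+4)" "fst t 57 = B ^ (6*b+5)"
 unfolding t_def LOADB_def by (simp_all add: r e b_def[symmetric]) (use d[of 0] d[of 1] d[of 2] d[of 3] d[of 4] d[of 5] in simp_all)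
qed

text \<open>Register 47 contains a candidate for the next state and register 17 the address of the
  table row of the remaining items. If the entry is nonzero, a flag, the state and the position are
  recorded.\<close>

definition TRY :: "ex => ex => cm" where "TRY x y = Ife (Rd (Ad (V 17) (V 47))) (36 ::= N 1 ;; 37 ::= V 47 ;; 38 ::= x ;; 39 ::= y) skip"
definition OPT0 :: cm where "OPT0 = Ife (Mi (Ad (V 51) (N 1)) (Ad (V 54) (V 32)))
 ((47 ::= V 35 ;; MULADD 47 (V 32) (V 56) 5 48) ;; TRY (V 54) (Mi (V 55) (V 33))) skip"
definition OPT1 :: cm where "OPT1 = Ife (Mi (Ad (V 53) (N 1)) (Ad (V 55) (V 33))) (Ife (Mi (Ad (V 51) (N 1)) (Ad (V 50) (V 32)))
 ((47 ::= V 35 ;; MULADD 47 (Ad (V 50) (V 32)) (V 56) 5 48 ;; MULADD 47 (V 33) (V 57) 5 48 ;;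
 49 ::= N 0 ;; MULADD 49 (V 54) (V 56) 5 48 ;; 47 ::= Mi (V 47) (V 49)) ;; TRY (V 50) (V 55)) skip) skip"

definition found :: "bool => nat => nat => nat => st => st => bool" where
 "found g c x y s t <-> snd t = snd s & (if g then fst t 36 = 1 & fst t 37 = c & fst t 38 = x & fst t 39 = y
 else fst t 36 = fst s 36 & fst t 37 = fst s 37 & fst t 38 = fst s 38 & fst t 39 = fst s 39)"

lemma record_option:
 assumes "vars x Int {36, 37, 38} = {}" "vars y Int {36, 37, 38} = {}"
 shows "found (snd s (fst s 17 + fst s 47) ~= 0) (fst s 47) (ev x s) (ev y s) s (sm (TRY x y) s)"
proof -
 have "ev x (put 37 k (put 36 l s)) = ev x s" "ev y (put 38 j (put 37 k (put 36 l s))) = ev y s" for j k l using assms by (intro ev_cong; auto)+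
 thus ?thesis by (simp add: TRY_def found_def)
qed

lemma opt0:
 assumes "fst s 51 < fst s 5" shows "found (fst s 54 + fst s 32 <= fst s 51 & snd s (fst s 17 + (fst s 35 + fst s 32 * fst s 56)) ~= 0)
 (fst s 35 + fst s 32 * fst s 56) (fst s 54) (fst s 55 - fst s 33) s (sm OPT0 s)"
proof (cases "fst s 54 + fst s 32 <= fst s 51")
 case True
 let ?c = "47 ::= V 35 ;; MULADD 47 (V 32) (V 56) 5 48"
 have 1: "fst (sm ?c s) 47 = fst s 35 + fst s 32 * fst s 56" using MULADD[of "V 32" "put 47 (fst s 35) s" 5 47 48 "V 56"] True assms by simp
 have 2: "snd (sm ?c s) = snd s" by (rule nowr_heap) (simp add: MULADD_def)
 have fr: "fst (sm ?c s) x = fst s x" if "x ~: {47, 48, 19}" for x using frame[of x ?c s] that by (simp add: MULADD_def)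
 define s' where "s' = sm ?c s"
 have "sm OPT0 s = sm (TRY (V 54) (Mi (V 55) (V 33))) s'" unfolding OPT0_def sm.simps(4) using True by (simp add: s'_def)
 thus ?thesis using record_option[of "V 54" "Mi (V 55) (V 33)" s'] True 1 2 fr unfolding s'_def[symmetric] by (simp add: found_def)
next
 case False
 thus ?thesis by (simp add: OPT0_def found_def)
qed

lemma opt1:
 assumes "fst s 51 < fst s 5" "fst s 53 < fst s 5" "fst s 54 < fst s 5"
 defines "c' == fst s 35 + (fst s 50 + fst s 32) * fst s 56 + fst s 33 * fst s 57 - fst s 54 * fst s 56"
 shows "found (fst s 55 + fst s 33 <= fst s 53 & fst s 50 + fst s 32 <= fst s 51 & snd s (fst s 17 + c') ~= 0)
 c' (fst s 50) (fst s 55) s (sm OPT1 s)"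
proof (cases "fst s 55 + fst s 33 <= fst s 53 & fst s 50 + fst s 32 <= fst s 51")
 case True
 let ?m1 = "MULADD 47 (Ad (V 50) (V 32)) (V 56) 5 48" and ?m2 = "MULADD 47 (V 33) (V 57) 5 48" and ?m3 = "MULADD 49 (V 54) (V 56) 5 48"
 let ?c = "47 ::= V 35 ;; ?m1 ;; ?m2 ;; 49 ::= N 0 ;; ?m3 ;; 47 ::= Mi (V 47) (V 49)"
 define s1 where "s1 = sm ?m1 (put 47 (fst s 35) s)"
 define s2 where "s2 = sm ?m2 s1"
 define s3 where "s3 = sm ?m3 (put 49 0 s2)"
 have f1: "fst s1 x = fst s x" if "x ~: {47, 48, 19}" for x using frame[of x ?m1 "put 47 (fst s 35) s"] that by (simp add: MULADD_def s1_def)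
 have f2: "fst s2 x = fst s x" if "x ~: {47, 48, 19}" for x using frame[of x ?m2 s1] f1 that by (simp add: MULADD_def s2_def)
 have f3: "fst s3 x = fst (put 49 0 s2) x" if "x ~: {49, 48, 19}" for x using frame[of x ?m3 "put 49 0 s2"] that by (simp add: MULADD_def s3_def)
 have "fst s1 47 = fst s 35 + (fst s 50 + fst s 32) * fst s 56" unfolding s1_def
 using MULADD[of "Ad (V 50) (V 32)" "put 47 (fst s 35) s" 5 47 48 "V 56"] True assms(1) by simp
 hence "fst s2 47 = fst s 35 + (fst s 50 + fst s 32) * fst s 56 + fst s 33 * fst s 57" unfolding s2_def
 using MULADD[of "V 33" s1 5 47 48 "V 57"] True assms(2) by (simp add: f1)
 moreover have "fst s3 49 = fst s 54 * fst s 56" unfolding s3_def using MULADD[of "V 54" "put 49 0 s2" 5 49 48 "V 56"] assms(3) by (simp add: f2)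
 moreover have e: "sm ?c s = put 47 (fst s3 47 - fst s3 49) s3" by (simp add: s1_def s2_def s3_def)
 ultimately have 1: "fst (sm ?c s) 47 = c'" by (simp add: f3 c'_def)
 have 2: "snd (sm ?c s) = snd s" by (rule nowr_heap) (simp add: MULADD_def)
 have fr: "fst (sm ?c s) x = fst s x" if "x ~: {47, 48, 49, 19}" for x using frame[of x ?c s] that by (simp add: MULADD_def)
 define s' where "s' = sm ?c s"
 have "sm OPT1 s = sm (TRY (V 50) (V 55)) s'" unfolding OPT1_def sm.simps(4) using True by (simp add: s'_def)
 thus ?thesis using record_option[of "V 50" "V 55" s'] True 1 2 fr unfolding s'_def[symmetric] by (simp add: found_def)
next
 case False
 thus ?thesis by (auto simp: OPT1_def found_def)
qed

definition SEARCH :: cm where "SEARCH = (UNPACK ;; 36 ::= N 0 ;; For 41 8 (LOADB ;; OPT0 ;; OPT1))"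

lemma asg_search: "asg LOADB = {45, 46, 50, 51, 52, 53, 54, 55, 56, 57}" "asg OPT0 = {47, 48, 19, 36, 37, 38, 39}" "asg OPT1 = {47, 48, 49, 19, 36, 37, 38, 39}"
 "asg UNPACK = {40, 41, 42, 43, 44, 19}" by (auto simp: LOADB_def OPT0_def OPT1_def TRY_def MULADD_def UNPACK_def DIVMOD_def)

lemma search:
 assumes e: "env K B PW DG s" and c: "fst s 35 < B ^ (6*K+1)" and rp: "DG + (6*K+1) <= fst s 17"
 defines "t == sm SEARCH s" and "w == fst s 32" and "h == fst s 33" and "ok == %c'. snd s (fst s 17 + c') ~= 0"
 shows "fst t 36 ~= 0 <-> (EX b<K. EX c' x y. opt B w h (fst s 35) b c' x y & ok c')"
 "fst t 36 ~= 0 --> (EX b<K. opt B w h (fst s 35) b (fst t 37) (fst t 38) (fst t 39) & ok (fst t 37))"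
 "ALL y. y < DG | DG + (6*K+1) <= y --> snd t y = snd s y"
 "x ~: {40, 41, 42, 43, 44, 19, 36, 45, 46, 50, 51, 52, 53, 54, 55, 56, 57, 47, 48, 49, 37, 38, 39} ==> fst t x = fst s x"
proof -
 let ?c = "fst s 35"
 let ?b = "LOADB ;; OPT0 ;; OPT1"
 define s1 where "s1 = put 36 0 (sm UNPACK s)"
 have B: "0 < B" "fst s 5 = B" "fst s 8 = K" using e by (auto simp: env_def)
 note u = unpack[OF e c]
 have s1r: "fst s1 x = fst s x" if "x ~: {40, 41, 42, 43, 44, 19, 36}" for x using that frame[of x UNPACK s] by (simp add: s1_def asg_search)
 have ld: "loaded K B PW DG ?c s1"
 proof -
 have "snd s1 (PW + j) = B ^ j" if "j < 6*K+1" for j using u(2) e that by (simp add: s1_def env_def)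
 thus ?thesis using u(1) e by (auto simp: loaded_def env_def s1_def frame asg_search)
 qed
 have okr: "ok c' <-> snd s1 (fst s 17 + c') ~= 0" for c' using u(2) rp by (simp add: ok_def s1_def)
 define J where "J i t <-> snd t = snd s1 & (fst t 36 ~= 0 <-> (EX b<i. EX c' x y. opt B w h ?c b c' x y & ok c')) &
 (fst t 36 ~= 0 --> (EX b<i. opt B w h ?c b (fst t 37) (fst t 38) (fst t 39) & ok (fst t 37)))" for i and t :: st
 have "J (fst s1 8) (sm (For 41 8 ?b) s1)"
 proof (rule For_inv)
 show "J 0 (put 41 0 s1)" by (simp add: J_def s1_def)
 fix b t0 assume b: "b < fst s1 8" and t0: "J b t0" "fst t0 41 = b" and fr: "!!x. x ~: asg ?b ==> x ~= 41 ==> fst t0 x = fst s1 x"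
 define t1 where "t1 = sm LOADB t0"
 define t2 where "t2 = sm OPT0 t1"
 define t3 where "t3 = sm OPT1 t2"
 have bK: "b < K" using b B by (simp add: s1r)
 have r0: "fst t0 x = fst s x" if "x : {5, 14, 15, 17, 32, 33, 35}" for x
 proof -
 have "x ~: asg ?b" "x ~= 41" "x ~: {40, 41, 42, 43, 44, 19, 36}" using that by (auto simp: asg_search)
 thus ?thesis using fr s1r by simp
 qed
 have h0: "snd t0 = snd s1" using t0(1) by (simp add: J_def)
 have "loaded K B PW DG ?c t0" using ld r0[of 14] r0[of 15] e h0 by (simp add: loaded_def env_def)
 note L = loadb[OF this, unfolded t0(2), OF bK, folded t1_def]
 have r1: "fst t1 x = fst t0 x" if "x ~: {45, 46, 50, 51, 52, 53, 54, 55, 56, 57}" for x unfolding t1_def using that by (simp add: frame asg_search)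
 have r2: "fst t2 x = fst t1 x" if "x ~: {47, 48, 19, 36, 37, 38, 39}" for x unfolding t2_def using that by (simp add: frame asg_search)
 have dl: "dig B ?c j < B" for j by (rule dig_less[OF B(1)])
 let ?d = "dig B ?c"
 define c0 where "c0 = ?c + w * B ^ (6*b+4)"
 define c1 where "c1 = ?c + (?d (6*b) + w) * B ^ (6*b+4) + h * B ^ (6*b+5) - ?d (6*b+4) * B ^ (6*b+4)"
 define g0 where "g0 <-> ?d (6*b+4) + w <= ?d (6*b+1) & ok c0"
 define g1 where "g1 <-> ?d (6*b+5) + h <= ?d (6*b+3) & ?d (6*b) + w <= ?d (6*b+1) & ok c1"
 have F0: "found g0 c0 (?d (6*b+4)) (?d (6*b+5) - h) t1 t2"
 using opt0[of t1] dl unfolding g0_def c0_def okr by (simp add: L r1 r0 B h0 w_def h_def t2_def)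
 have F1: "found g1 c1 (?d (6*b)) (?d (6*b+5)) t2 t3"
 using opt1[of t2] dl F0 unfolding g1_def c1_def okr by (simp add: L r2 r1 r0 B h0 w_def h_def t3_def found_def)
 have ex: "(EX c' x y. opt B w h ?c b c' x y & ok c') <-> g0 | g1" unfolding opt_def g0_def g1_def c0_def c1_def by blast
 have o0: "opt B w h ?c b c0 (?d (6*b+4)) (?d (6*b+5) - h) & ok c0" if g0 using that unfolding g0_def opt_def c0_def by blast
 have o1: "opt B w h ?c b c1 (?d (6*b)) (?d (6*b+5)) & ok c1" if g1 using that unfolding g1_def opt_def c1_def by blast
 have res: "snd t3 = snd s1" "fst t3 36 ~= 0 <-> g0 | g1 | fst t0 36 ~= 0" using F0 F1 h0 L(1) r1[of 36] by (auto simp: found_def split: if_splits)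
 have val: "fst t3 36 ~= 0 --> (EX b'<Suc b. opt B w h ?c b' (fst t3 37) (fst t3 38) (fst t3 39) & ok (fst t3 37))"
 proof -
 consider g1 | "~ g1" g0 | "~ g1" "~ g0" by blast
 thus ?thesis
 proof cases
 case 1 thus ?thesis using F1 o1 by (auto simp: found_def)
 next
 case 2 thus ?thesis using F1 F0 o0 by (auto simp: found_def)
 next
 case 3
 hence "fst t3 36 = fst t0 36" "fst t3 37 = fst t0 37" "fst t3 38 = fst t0 38" "fst t3 39 = fst t0 39" using F0 F1 r1 by (auto simp: found_def)
 thus ?thesis using t0(1) unfolding J_def by (metis less_Suc_eq)
 qed
 qed
 have "sm ?b t0 = t3" by (simp add: t1_def t2_def t3_def)
 moreover have "fst t3 36 ~= 0 <-> (EX b'<Suc b. EX c' x y. opt B w h ?c b' c' x y & ok c')"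
 unfolding Ex_less_Suc ex res(2) using t0(1) unfolding J_def by blast
 ultimately show "J (Suc b) (inc 41 (sm ?b t0))" using res(1) val by (simp add: J_def)
 qed (auto simp: asg_search)
 moreover have te: "t = sm (For 41 8 ?b) s1" unfolding t_def SEARCH_def s1_def by simp
 moreover have "fst s1 8 = K" using s1r B by simp
 ultimately have J: "J K t" by simp
 show "fst t 36 ~= 0 <-> (EX b<K. EX c' x y. opt B w h (fst s 35) b c' x y & ok c')"
 "fst t 36 ~= 0 --> (EX b<K. opt B w h (fst s 35) b (fst t 37) (fst t 38) (fst t 39) & ok (fst t 37))" using J unfolding J_def by blast+
 show "ALL y. y < DG | DG + (6*K+1) <= y --> snd t y = snd s y" using J u(2) by (simp add: J_def s1_def)
 show "x ~: {40, 41, 42, 43, 44, 19, 36, 45, 46, 50, 51, 52, 53, 54, 55, 56, 57, 47, 48, 49, 37, 38, 39} ==> fst t x = fst s x"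
 unfolding t_def SEARCH_def by (subst frame) (auto simp: asg_search)
qed

text \<open>The flag is cleared only if two different boxes fail all four ways of being
  separated.\<close>

definition PAIR :: cm where "PAIR = (46 ::= Ad (V 15) (six 42) ;; Ife (Ad (Mi (V 41) (V 42)) (Mi (V 42) (V 41))) (Ife (Mi (V 51) (Rd (V 46)))
 (Ife (Mi (Rd (Ad (V 46) (N 1))) (V 50)) (Ife (Mi (V 53) (Rd (Ad (V 46) (N 2))))
 (Ife (Mi (Rd (Ad (V 46) (N 3))) (V 52)) (36 ::= N 0) skip) skip) skip) skip) skip)"
text \<open>A sum of truncated differences is zero exactly if all the inequalities hold; an equality
  takes two differences.\<close>

definition RANGE :: cm where "RANGE = Ife (Ad (Ad (Ad (Mi (V 50) (V 51)) (Mi (V 51) (V 7))) (Ad (Mi (V 52) (V 53)) (Mi (V 53) (V 47))))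
 (Ad (Ad (Mi (V 54) (V 51)) (Mi (V 51) (V 54))) (Ad (Mi (V 55) (V 52)) (Mi (V 52) (V 55))))) (36 ::= N 0) skip"
definition CHECK :: cm where "CHECK = (36 ::= N 1 ;; 47 ::= Rd (Ad (V 15) (Mi (V 9) (N 1))) ;; For 41 8 (LOADB ;; RANGE ;; For 42 8 PAIR))"

lemma check:
 assumes ld: "loaded K B PW DG c s" and K: "fst s 8 = K" "fst s 9 = 6*K+1"
 shows "fst (sm CHECK s) 36 ~= 0 <-> start K B (fst s 7) c" "snd (sm CHECK s) = snd s"
proof -
 let ?d = "dig B c"
 let ?b = "LOADB ;; RANGE ;; For 42 8 PAIR"
 have nw: "nowr LOADB" "nowr RANGE" "nowr PAIR" "nowr CHECK" by (simp_all add: LOADB_def RANGE_def PAIR_def CHECK_def)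
 have ag: "asg LOADB = {45, 46, 50, 51, 52, 53, 54, 55, 56, 57}" "asg RANGE = {36, 19}" "asg PAIR = {46, 36, 19}"
 by (auto simp: asg_search RANGE_def PAIR_def)
 show "snd (sm CHECK s) = snd s" by (rule nowr_heap[OF nw(4)])
 have r: "fst s 14 = PW" "fst s 15 = DG" and dd: "!!j. j < 6*K+1 ==> snd s (DG + j) = ?d j" using ld by (auto simp: loaded_def)
 define s1 where "s1 = put 47 (?d (6*K)) (put 36 1 s)"
 define P1 where "P1 b <-> ?d (6*b) <= ?d (6*b+1) & ?d (6*b+1) <= fst s 7 & ?d (6*b+2) <= ?d (6*b+3) &
 ?d (6*b+3) <= ?d (6*K) & ?d (6*b+4) = ?d (6*b+1) & ?d (6*b+5) = ?d (6*b+2)" for b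
 define P2 where "P2 b b' <-> b' = b | ?d (6*b+1) <= ?d (6*b') | ?d (6*b'+1) <= ?d (6*b) |
 ?d (6*b+3) <= ?d (6*b'+2) | ?d (6*b'+3) <= ?d (6*b+2)" for b b'
 define J where "J i t <-> snd t = snd s & (fst t 36 ~= 0 <-> (ALL b<i. P1 b & (ALL b'<K. P2 b b')))" for i and t :: st
 have "J (fst s1 8) (sm (For 41 8 ?b) s1)"
 proof (rule For_inv)
 show "J 0 (put 41 0 s1)" by (simp add: J_def s1_def)
 fix b t0 assume b: "b < fst s1 8" and t0: "J b t0" "fst t0 41 = b" and fr: "!!x. x ~: asg ?b ==> x ~= 41 ==> fst t0 x = fst s1 x"
 have bK: "b < K" using b K by (simp add: s1_def)
 define t1 where "t1 = sm LOADB t0"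
 define t2 where "t2 = sm RANGE t1"
 have h0: "snd t0 = snd s" using t0(1) by (simp add: J_def)
 have r0: "fst t0 7 = fst s 7" "fst t0 8 = K" "fst t0 14 = PW" "fst t0 15 = DG" "fst t0 47 = ?d (6*K)"
 using fr[of 7] fr[of 8] fr[of 14] fr[of 15] fr[of 47] r K by (simp_all add: ag s1_def)
 have "loaded K B PW DG c t0" using ld r0 h0 by (simp add: loaded_def)
 note L = loadb[OF this, unfolded t0(2), OF bK, folded t1_def]
 have r1: "fst t1 x = fst t0 x" if "x ~: asg LOADB" for x unfolding t1_def using that by (rule frame)
 have m1: "fst t2 36 ~= 0 <-> fst t0 36 ~= 0 & P1 b" unfolding t2_def RANGE_def P1_def by (auto simp: L r1 ag r0)
 have r2: "fst t2 x = fst t1 x" if "x ~: {36, 19}" for x unfolding t2_def using that by (simp add: frame ag)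
 have h2: "snd t2 = snd s" unfolding t2_def nowr_heap[OF nw(2)] using L(1) h0 by simp
 define I where "I i t <-> (fst t 36 ~= 0 <-> fst t2 36 ~= 0 & (ALL b'<i. P2 b b')) & snd t = snd s" for i and t :: st
 have "I (fst t2 8) (sm (For 42 8 PAIR) t2)"
 proof (rule For_inv)
 show "I 0 (put 42 0 t2)" by (simp add: I_def h2)
 fix b' t assume b': "b' < fst t2 8" and t: "I b' t" "fst t 42 = b'" and fr': "!!x. x ~: asg PAIR ==> x ~= 42 ==> fst t x = fst t2 x"
 have bK': "b' < K" using b' r0 by (simp add: r2 r1 ag)
 have rt: "fst t 15 = DG" "fst t 41 = b" "fst t 50 = ?d (6*b)" "fst t 51 = ?d (6*b+1)" "fst t 52 = ?d (6*b+2)" "fst t 53 = ?d (6*b+3)"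
 using fr' t0(2) r0 L by (simp_all add: ag r2 r1)
 have ht: "snd t = snd s" using t(1) by (simp add: I_def)
 have e: "DG + (b' + b' + (b' + b') + (b' + b')) = DG + 6*b'" by simp
 have dk: "snd s (DG + 6*b' + k) = ?d (6*b'+k)" if "k < 6" for k using dd[of "6*b'+k"] bK' that by (simp add: add.assoc)
 have "fst (sm PAIR t) 36 ~= 0 <-> fst t 36 ~= 0 & P2 b b'"
 using dk[of 0] dk[of 1] dk[of 2] dk[of 3] unfolding PAIR_def P2_def by (auto simp: rt t(2) ht e)
 thus "I (Suc b') (inc 42 (sm PAIR t))" using t(1) nowr_heap[OF nw(3), of t] by (auto simp: I_def less_Suc_eq)
 qed (auto simp: ag)
 moreover have "fst t2 8 = K" using r0 by (simp add: r2 r1 ag)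
 ultimately have "I K (sm (For 42 8 PAIR) t2)" by simp
 moreover have "sm ?b t0 = sm (For 42 8 PAIR) t2" by (simp add: t1_def t2_def)
 ultimately show "J (Suc b) (inc 41 (sm ?b t0))" using t0(1) m1 unfolding J_def I_def by (auto simp: less_Suc_eq)
 qed (auto simp: ag)
 moreover have "sm CHECK s = sm (For 41 8 ?b) s1" unfolding CHECK_def sm.simps(3) using dd[of "6*K"] by (simp add: s1_def r K)
 ultimately have "fst (sm CHECK s) 36 ~= 0 <-> (ALL b<K. P1 b & (ALL b'<K. P2 b b'))" using K by (simp add: J_def s1_def)
 thus "fst (sm CHECK s) 36 ~= 0 <-> start K B (fst s 7) c" unfolding start_def P1_def P2_def by auto
qed

section \<open>The complete program\<close>

definition READ1 :: cm where "READ1 = (21 ::= Ad (N 2) (Ad (V 20) (V 20)) ;; Ife (Mi (N 128) (V 21)) (21 ::= Ad (V 21) (V 1)) skip)"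
definition READ :: cm where "READ = (READ1 ;; 23 ::= Rd (Mi (V 21) (N 128)) ;; 24 ::= Rd (Mi (Ad (V 21) (N 1)) (N 128)) ;;
 3 ::= Ad (V 3) (Mi (V 23) (V 3)) ;; 3 ::= Ad (V 3) (Mi (V 24) (V 3)) ;;
 Wr (Ad (V 10) (V 20)) (V 23) ;; Wr (Ad (V 11) (V 20)) (V 24))"
text \<open>\<open>n\<close> is recovered from \<open>128 * n\<close>. The registers 10 to 16 then
  hold the heap addresses of the widths, the heights, the sorted order, the output buffer, the
  powers of the base, the digits and the table.\<close>

definition S1 :: "nat => cm" where "S1 K = (DIVMOD 2 20 (V 1) (N 128) 1 21 ;; 22 ::= Rd (Mi (V 1) (N 128)) ;; 8 ::= N K ;; 9 ::= N (6*K+1) ;;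
 10 ::= V 1 ;; 11 ::= Ad (V 10) (V 2) ;; 12 ::= Ad (V 11) (V 2) ;; 13 ::= Ad (V 12) (V 2) ;;
 14 ::= Ad (Ad (V 13) (Ad (V 2) (V 2))) (N 2) ;; 15 ::= Ad (V 14) (V 9) ;; 16 ::= Ad (V 15) (V 9) ;; 3 ::= N 0 ;; 4 ::= N 0)"
text \<open>Register 4 receives \<open>n * Nmax\<close>, and \<open>W - (W - P)\<close> in truncated
  subtraction is the minimum of \<open>W\<close> and \<open>P\<close>.\<close>

definition S2 :: cm where "S2 = (For 20 2 READ ;; MULADD 4 (V 2) (V 3) 2 20 ;; 7 ::= Mi (V 22) (Mi (V 22) (V 4)) ;;
 5 ::= Ad (Ad (Ad (V 4) (V 4)) (Ad (V 4) (V 4))) (N 1) ;; 6 ::= N 1)"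
definition POW :: cm where "POW = (Wr (Ad (V 14) (V 20)) (V 6) ;; 23 ::= N 0 ;; MULADD 23 (V 5) (V 6) 5 24 ;; 6 ::= V 23)"
definition S3 :: cm where "S3 = For 20 9 POW"
definition SORT :: cm where "SORT = (23 ::= V 12 ;; For 20 3 (24 ::= Mi (V 3) (V 20) ;; For 21 2 (25 ::= Rd (Ad (V 11) (V 21)) ;;
 Ife (Ad (Mi (V 24) (V 25)) (Mi (V 25) (V 24))) skip (Wr (V 23) (V 21) ;; 23 ::= Ad (V 23) (N 1)))))"
definition ITEM :: cm where "ITEM = (32 ::= Rd (Ad (V 10) (V 31)) ;; 33 ::= Rd (Ad (V 11) (V 31)))"
definition ROW :: cm where "ROW = (35 ::= V 34 ;; SEARCH ;; Wr (Ad (Ad (V 17) (V 6)) (V 34)) (V 36))"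
definition TABLE :: cm where "TABLE = (For 20 6 (Wr (Ad (V 16) (V 20)) (N 1)) ;; 17 ::= V 16 ;;
 For 30 2 (31 ::= Rd (Mi (Ad (V 12) (V 2)) (Ad (V 30) (N 1))) ;; ITEM ;; For 34 6 ROW ;; 17 ::= Ad (V 17) (V 6)))"
text \<open>States are tried downwards, so the last hit is the smallest suitable start state. As the
  height is the leading digit, its height is least.\<close>

definition PICK :: cm where
 "PICK = (35 ::= Mi (V 6) (Ad (V 30) (N 1)) ;; UNPACK ;; CHECK ;; Ife (V 36) (Ife (Rd (Ad (V 17) (V 35))) (18 ::= V 35) skip) skip)"
definition PLACE :: cm where "PLACE = (17 ::= Mi (V 17) (V 6) ;; 31 ::= Rd (Ad (V 12) (V 30)) ;; ITEM ;; SEARCH ;;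
 Wr (Ad (Ad (V 13) (N 2)) (Ad (V 31) (V 31))) (V 38) ;; Wr (Ad (Ad (V 13) (N 3)) (Ad (V 31) (V 31))) (V 39) ;; 35 ::= V 37)"
text \<open>Only cells with final addresses from 128 on are copied here; the smaller addresses are
  registers and are left to the epilogue. The first address of an item is even, so both of its cells
  fall on the same side.\<close>

definition OUT :: cm where "OUT = (31 ::= Ad (N 2) (Ad (V 30) (V 30)) ;; Ife (Mi (Ad (V 31) (N 1)) (N 128))
 (Wr (Mi (V 31) (N 128)) (Rd (Ad (V 13) (V 31))) ;; Wr (Mi (Ad (V 31) (N 1)) (N 128)) (Rd (Ad (V 13) (Ad (V 31) (N 1))))) skip)"
definition S4 :: cm where "S4 = (SORT ;; TABLE ;; For 30 6 PICK ;; 35 ::= V 18 ;; For 30 2 PLACE ;; For 30 2 OUT ;; 0 ::= Ad (V 13) (N 128))"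
definition MAIN :: "nat => cm" where "MAIN K = (S1 K ;; S2 ;; S3 ;; S4)"

lemmas cm_defs = READ1_def READ_def S1_def S2_def POW_def S3_def SORT_def ITEM_def ROW_def TABLE_def PICK_def PLACE_def OUT_def S4_def MAIN_def
 SEARCH_def CHECK_def UNPACK_def LOADB_def OPT0_def OPT1_def TRY_def RANGE_def PAIR_def DIVMOD_def MULADD_def

lemma wf_MAIN: "wf (MAIN K)" by (simp add: cm_defs)

lemma loops: "loops_over {1} (S1 K)" "loops_over {2} S2" "loops_over {5, 9} S3" "loops_over {2, 3, 5, 6, 8, 9} S4" by (simp_all add: cm_defs)

lemma asgs: "asg READ = {21, 19, 23, 24, 3}" "asg POW = {23, 24, 19, 6}" "asg ITEM = {32, 33}"
 "asg SEARCH = {40, 41, 42, 43, 44, 19, 36, 45, 46, 50, 51, 52, 53, 54, 55, 56, 57, 47, 48, 49, 37, 38, 39}"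
 "asg CHECK = {36, 47, 41, 45, 46, 50, 51, 52, 53, 54, 55, 56, 57, 19, 42}" "asg OUT = {31, 19}" by (auto simp: cm_defs)

lemma Nmax_le:
 assumes "!!i. i < length rs ==> wd rs i <= k & ht rs i <= k" shows "Nmax rs <= k"
proof -
 have "fst r <= k & snd r <= k" if "r : set rs" for r using that assms unfolding in_set_conv_nth by blast
 thus ?thesis by (simp add: Nmax_def)
qed

lemma input_cells: "i < length rs ==> input_mem W rs (2 + 2 * i) = wd rs i & input_mem W rs (3 + 2 * i) = ht rs i" by (auto simp: input_mem_def)

abbreviation (input) "outp p t m == decode_packing (snd (run p t (0, m)))"

section \<open>Correctness: input, powers and sorting\<close>

locale run_main =
 fixes W :: nat and rs :: "rect list" and K :: nat
 assumes v: "valid_instance W rs" and ne: "rs ~= []"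
begin

definition n where "n = length rs"
definition NN where "NN = Nmax rs"
definition B where "B = 4 * (n * NN) + 1"
abbreviation "FX == {2, 3, 5, 6, 7, 8, 9, 10, 11, 12, 13, 14, 15, 16 :: nat}"
abbreviation "gdr == good K B (wd rs) (ht rs)"
abbreviation "pck == packed K B (wd rs) (ht rs)"
definition D where "D = 6*K+1"
definition M where "M = B ^ D"
definition A where "A = 128 * n"
abbreviation "OX j == A + 3*n + (2 + 2*j)"
abbreviation "OY j == A + 3*n + (3 + 2*j)"
definition PW where "PW = A + 5*n + 2"
definition DG where "DG = PW + D"
definition TB where "TB = DG + D"
definition os where "os = height_order rs"
definition s0 where "s0 = after (input_mem W rs)"
definition s1 where "s1 = sm (S1 K) s0"
definition s2 where "s2 = sm S2 s1"
definition s3 where "s3 = sm S3 s2"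

lemma n0: "0 < n" using ne by (simp add: n_def)
lemma B0: "0 < B" by (simp add: B_def)

text \<open>\<open>addr a\<close> is the place in the heap to which the prologue has moved the input cell \<open>a\<close>.\<close>

definition addr where "addr a = (if a < 128 then 128 * n + a - 128 else a - 128)"

lemma s0: "fst s0 1 = 128 * n" "snd s0 (A - 128) = W" "2 <= a ==> a < 2*n+2 ==> snd s0 (addr a) = input_mem W rs a"
proof -
 have i: "input_mem W rs 1 = n" "input_mem W rs 0 = W" by (simp_all add: input_mem_def n_def)
 note a = after[where m = "input_mem W rs" and n = n, OF i(1) n0]
 show "fst s0 1 = 128 * n" "snd s0 (A - 128) = W" using a i by (simp_all add: s0_def A_def)
 show "2 <= a ==> a < 2*n+2 ==> snd s0 (addr a) = input_mem W rs a" using a(3)[of a] a(4)[of a] n0 by (simp add: s0_def addr_def)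
qed

lemma s1: "snd s1 = snd s0" "fst s1 1 = 128 * n" "fst s1 2 = n" "fst s1 22 = W" "fst s1 8 = K" "fst s1 9 = D" "fst s1 10 = A" "fst s1 11 = A + n"
 "fst s1 12 = A + 2*n" "fst s1 13 = A + 3*n" "fst s1 14 = PW" "fst s1 15 = DG" "fst s1 16 = TB" "fst s1 3 = 0" "fst s1 4 = 0"
proof -
 let ?d = "DIVMOD 2 20 (V 1) (N 128) 1 21"
 define d where "d = sm ?d s0"
 have q: "fst d 2 = n" using DIVMOD[of "N 128" s0 128 "V 1" 1 2 20 21] s0 by (simp add: d_def)
 have h: "snd d = snd s0" unfolding d_def by (rule nowr_heap) (simp add: DIVMOD_def)
 have r: "fst d (Suc 0) = 128 * n" using frame[of 1 ?d s0] s0 by (simp add: DIVMOD_def d_def)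
 show "snd s1 = snd s0" "fst s1 1 = 128 * n" "fst s1 2 = n" "fst s1 22 = W" "fst s1 8 = K" "fst s1 9 = D" "fst s1 10 = A" "fst s1 11 = A + n"
 "fst s1 12 = A + 2*n" "fst s1 13 = A + 3*n" "fst s1 14 = PW" "fst s1 15 = DG" "fst s1 16 = TB" "fst s1 3 = 0" "fst s1 4 = 0"
 unfolding s1_def S1_def sm.simps(3) d_def[symmetric] using s0(2) by (simp_all add: q h r A_def D_def PW_def DG_def TB_def)
qed

lemma s2: "fst s2 2 = n" "fst s2 3 = NN" "fst s2 5 = B" "fst s2 6 = 1" "fst s2 7 = min W (n * NN)" "x : {8, 9, 10, 11, 12, 13, 14, 15, 16} ==> fst s2 x = fst s1 x"
 "i < n ==> snd s2 (A + i) = wd rs i" "i < n ==> snd s2 (A + n + i) = ht rs i"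
proof -
 define I where "I i t <-> (ALL j<i. wd rs j <= fst t 3 & ht rs j <= fst t 3 & snd t (A + j) = wd rs j & snd t (A + n + j) = ht rs j) &
 fst t 3 <= NN & (ALL y<A. snd t y = snd s0 y)" for i and t :: st
 have "I (fst s1 2) (sm (For 20 2 READ) s1)"
 proof (rule For_inv)
 show "I 0 (put 20 0 s1)" by (simp add: I_def s1)
 fix i t assume i: "i < fst s1 2" and t: "I i t" "fst t 20 = i" and fr: "!!x. x ~: asg READ ==> x ~= 20 ==> fst t x = fst s1 x"
 have i: "i < n" "i < length rs" using i s1 by (simp_all add: n_def)
 have r: "fst t 1 = 128 * n" "fst t 10 = A" "fst t 11 = A + n" using fr[of 1] fr[of 10] fr[of 11] s1 by (simp_all add: asgs)
 define a where "a = 2 + (i + i)"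
 have a: "a = 2 + 2 * i" "Suc a = 3 + 2 * i" "a < 2*n+2" "Suc a < 2*n+2" "2 <= a" "2 <= Suc a" using i by (simp_all add: a_def)
 have ad: "addr a < A" "addr (Suc a) < A" using a i n0 by (auto simp: addr_def A_def)
 have "input_mem W rs a = wd rs i" "input_mem W rs (Suc a) = ht rs i" using input_cells[OF i(2), of W] a(1,2) by metis+
 hence c: "snd t (addr a) = wd rs i" "snd t (addr (Suc a)) = ht rs i" using t(1) ad s0(3)[OF a(5,3)] s0(3)[OF a(6,4)] unfolding I_def by metis+
 \<comment> \<open>\<open>a\<close> is even, so the two cells of a rectangle are relocated together
   and one test in \<open>READ1\<close> suffices.\<close>
 have "Suc a < 128 <-> a < 128" using a(1) by presburger
 hence sa: "addr (Suc a) = Suc (addr a)" using n0 by (cases "a < 128"; simp add: addr_def; linarith)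
 define m where "m = fst t 3 + (wd rs i - fst t 3)"
 define m' where "m' = m + (ht rs i - m)"
 define t1 where "t1 = sm READ1 t"
 have t1: "fst t1 21 = addr a + 128" "snd t1 = snd t" "!!x. x ~: {21, 19} ==> fst t1 x = fst t x"
 using n0 r(1)[unfolded One_nat_def] by (auto simp: t1_def READ1_def t(2) a_def addr_def)
 have "A + n + i ~= addr (Suc a)" "A + i ~= addr (Suc a)" using ad by simp_all
 hence "fst (sm READ t) 3 = m'" "snd (sm READ t) = (snd t)(A + i := wd rs i, A + n + i := ht rs i)" "fst (sm READ t) 20 = i"
 unfolding READ_def sm.simps(3) t1_def[symmetric] using c by (simp_all add: t1 sa r t(2) m_def m'_def)
 moreover have "m' <= NN" "fst t 3 <= m'" "wd rs i <= m'" "ht rs i <= m'" using t(1) Nmax_ge[OF i(2)] by (auto simp: m_def m'_def NN_def I_def)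
 ultimately show "I (Suc i) (inc 20 (sm READ t))" using t(1) i unfolding I_def by (auto simp: less_Suc_eq intro: le_trans)
 qed (auto simp: asgs)
 hence I: "I n (sm (For 20 2 READ) s1)" using s1 by simp
 define t where "t = sm (For 20 2 READ) s1"
 have tr: "fst t x = fst s1 x" if "x ~: {20, 21, 19, 23, 24, 3}" for x unfolding t_def using that by (subst frame) (auto simp: asgs)
 have t3: "fst t 3 = NN" using I Nmax_le[of rs "fst t 3"] unfolding I_def t_def[symmetric] NN_def n_def by (meson le_antisym)
 define u where "u = sm (MULADD 4 (V 2) (V 3) 2 20) t"
 have u4: "fst u 4 = n * NN" unfolding u_def using MULADD[of "V 2" t 2 4 20 "V 3"] by (simp add: tr s1 t3)
 have ur: "fst u x = fst t x" if "x ~: {4, 20, 19}" for x unfolding u_def using that by (subst frame) (auto simp: MULADD_def)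
 have uh: "snd u = snd t" unfolding u_def by (rule nowr_heap) (simp add: MULADD_def)
 have e: "s2 = put 6 1 (put 5 B (put 7 (min W (n * NN)) u))" unfolding s2_def S2_def sm.simps(3) t_def[symmetric] u_def[symmetric]
 by (simp add: put_def ur tr s1 u4 B_def min_def fun_eq_iff)
 show "fst s2 2 = n" "fst s2 3 = NN" "fst s2 5 = B" "fst s2 6 = 1" "fst s2 7 = min W (n * NN)" unfolding e by (simp_all add: ur tr s1 t3)
 show "x : {8, 9, 10, 11, 12, 13, 14, 15, 16} ==> fst s2 x = fst s1 x" unfolding e by (auto simp: ur tr)
 show "i < n ==> snd s2 (A + i) = wd rs i" "i < n ==> snd s2 (A + n + i) = ht rs i" using I unfolding e I_def t_def[symmetric] by (simp_all add: uh)
qed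

lemma s3: "fst s3 6 = M" "x ~: {6, 19, 20, 23, 24} ==> fst s3 x = fst s2 x" "j < D ==> snd s3 (PW + j) = B ^ j" "y < PW ==> snd s3 y = snd s2 y"
proof -
 define I where "I i t <-> fst t 6 = B ^ i & (ALL j<i. snd t (PW + j) = B ^ j) & (ALL y<PW. snd t y = snd s2 y)" for i and t :: st
 have "I (fst s2 9) (sm (For 20 9 POW) s2)"
 proof (rule For_inv)
 show "I 0 (put 20 0 s2)" by (simp add: I_def s2)
 fix i t assume t: "I i t" "fst t 20 = i" and fr: "!!x. x ~: asg POW ==> x ~= 20 ==> fst t x = fst s2 x"
 have r: "fst t 5 = B" "fst t 14 = PW" using fr[of 5] fr[of 14] s2(3) s2(6)[of 14] s1 by (simp_all add: asgs)
 define t1 where "t1 = put 23 0 (fst t, (snd t)(PW + i := B ^ i))"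
 let ?m = "MULADD 23 (V 5) (V 6) 5 24"
 have t6: "fst t 6 = B ^ i" using t(1) by (simp add: I_def)
 have m: "fst (sm ?m t1) 23 = B * B ^ i" using MULADD[of "V 5" t1 5 23 24 "V 6"] by (simp add: t1_def r t6)
 have mh: "snd (sm ?m t1) = (snd t)(PW + i := B ^ i)" using nowr_heap[of ?m t1] by (simp add: MULADD_def t1_def)
 define u where "u = sm ?m t1"
 have "sm POW t = put 6 (B * B ^ i) u" unfolding POW_def sm.simps(3) using m by (simp add: u_def t1_def put_def r t(2) t6)
 thus "I (Suc i) (inc 20 (sm POW t))" using t(1) mh[folded u_def] by (auto simp: I_def less_Suc_eq)
 qed (auto simp: asgs)
 hence I: "I D s3" using s2(6)[of 9] s1 by (simp add: s3_def S3_def)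
 show "fst s3 6 = M" "j < D ==> snd s3 (PW + j) = B ^ j" "y < PW ==> snd s3 y = snd s2 y" using I by (auto simp: I_def M_def)
 show "x ~: {6, 19, 20, 23, 24} ==> fst s3 x = fst s2 x" unfolding s3_def S3_def by (subst frame) (auto simp: asgs)
qed

definition regs :: "st => bool" where
 "regs t <-> fst t 2 = n & fst t 3 = NN & fst t 5 = B & fst t 6 = M & fst t 7 = min W (n * NN) & fst t 8 = K & fst t 9 = D & fst t 10 = A &
 fst t 11 = A + n & fst t 12 = A + 2*n & fst t 13 = A + 3*n & fst t 14 = PW & fst t 15 = DG & fst t 16 = TB"
definition items_at :: "st => bool" where
 "items_at t <-> (ALL i<n. snd t (A + i) = wd rs i & snd t (A + n + i) = ht rs i) & (ALL j<D. snd t (PW + j) = B ^ j)"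

lemma regs_cong: "regs s ==> (!!x. x : FX ==> fst t x = fst s x) ==> regs t" by (simp add: regs_def)

lemma s3_ok: "regs s3" "items_at s3"
proof -
 show "regs s3" unfolding regs_def by (simp add: s3 s2 s1)
 have "A + i < PW" "A + n + i < PW" if "i < n" for i using that by (simp_all add: PW_def)
 thus "items_at s3" unfolding items_at_def by (simp add: s3 s2)
qed

lemma regs_env: "regs t ==> items_at t ==> env K B PW DG t" by (auto simp: regs_def items_at_def env_def B0 M_def D_def DG_def)

definition listed :: "nat list => st => bool" where "listed l t <-> fst t 23 = A + 2*n + length l & (ALL j<length l. snd t (A + 2*n + j) = l ! j) &
 (ALL y. y < A + 2*n | A + 3*n <= y --> snd t y = snd s3 y)"

lemma sort: "regs (sm SORT s3)" "items_at (sm SORT s3)" "j < n ==> snd (sm SORT s3) (A + 2*n + j) = os ! j"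
proof -
 define F where "F a i = filter (%i. ht rs i = NN - a) [0..<i]" for a i
 define pre where "pre a = concat (map (%a. F a n) [0..<a])" for a
 have preN: "pre NN = os" by (simp add: pre_def F_def os_def height_order_def NN_def n_def)
 \<comment> \<open>Every intermediate list is at most as long as the final one, so the writes stay
   within the \<open>n\<close> cells of the order.\<close>
 have len: "length (pre a @ F a i) <= n" if "a < NN" "i <= n" for a i
 proof -
 have "length (F a i) <= length (F a n)" using upt_add_eq_append[of 0 i "n - i"] that by (simp add: F_def)
 moreover have "length (pre a') <= length (pre NN)" if "a' <= NN" for a' using upt_add_eq_append[of 0 a' "NN - a'"] that by (simp add: pre_def)
 from this[of "Suc a"] have "length (pre a) + length (F a n) <= length os" using that(1) preN by (simp add: pre_def)
 ultimately show ?thesis using height_order(3)[OF v] by (simp add: os_def n_def)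
 qed
 let ?i = "25 ::= Rd (Ad (V 11) (V 21)) ;; Ife (Ad (Mi (V 24) (V 25)) (Mi (V 25) (V 24))) skip (Wr (V 23) (V 21) ;; 23 ::= Ad (V 23) (N 1))"
 let ?o = "24 ::= Mi (V 3) (V 20) ;; For 21 2 ?i"
 define s where "s = put 23 (A + 2*n) s3"
 have R: "fst s3 12 = A + 2*n" "fst s3 3 = NN" "fst s3 11 = A + n" "fst s3 2 = n" using s3_ok(1) by (simp_all add: regs_def)
 have "listed (pre (fst s 3)) (sm (For 20 3 ?o) s)"
 proof (rule For_inv)
 show "listed (pre 0) (put 20 0 s)" by (simp add: listed_def pre_def s_def)
 fix a t assume a: "a < fst s 3" and t: "listed (pre a) t" "fst t 20 = a" and fr: "!!x. x ~: asg ?o ==> x ~= 20 ==> fst t x = fst s x"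
 have aN: "a < NN" using a R by (simp add: s_def)
 have r: "fst t 3 = NN" "fst t 11 = A + n" "fst t 2 = n" using fr[of 3] fr[of 11] fr[of 2] R by (simp_all add: s_def)
 define u where "u = put 24 (NN - a) t"
 have "listed (pre a @ F a (fst u 2)) (sm (For 21 2 ?i) u)"
 proof (rule For_inv)
 show "listed (pre a @ F a 0) (put 21 0 u)" using t(1) by (simp add: listed_def F_def u_def)
 fix i t' assume i: "i < fst u 2" and t': "listed (pre a @ F a i) t'" "fst t' 21 = i" and fr': "!!x. x ~: asg ?i ==> x ~= 21 ==> fst t' x = fst u x"
 have iN: "i < n" using i r by (simp add: u_def)
 have r': "fst t' 11 = A + n" "fst t' 24 = NN - a" using fr'[of 11] fr'[of 24] r by (simp_all add: u_def)
 have "snd t' (A + n + i) = ht rs i" using t'(1) s3_ok(2) iN by (simp add: listed_def items_at_def)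
 hence e: "sm ?i t' = (if ht rs i = NN - a then put 23 (Suc (fst t' 23)) (put 25 (ht rs i) (fst t', (snd t')(fst t' 23 := i)))
 else put 19 0 (put 25 (ht rs i) t'))" using r' t'(2) by (auto simp: put_def)
 have l: "length (pre a @ F a i) < n" if "ht rs i = NN - a" using len[OF aN, of "Suc i"] iN that by (simp add: F_def)
 show "listed (pre a @ F a (Suc i)) (inc 21 (sm ?i t'))"
 proof (cases "ht rs i = NN - a")
 case True
 have "F a (Suc i) = F a i @ [i]" using True by (simp add: F_def)
 thus ?thesis using t'(1) l[OF True] unfolding e listed_def using True by (auto simp: nth_append less_Suc_eq)
 next
 case False
 hence "F a (Suc i) = F a i" by (simp add: F_def)
 thus ?thesis using t'(1) False unfolding e listed_def by simp
 qed
 qed auto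
 moreover have "pre a @ F a n = pre (Suc a)" by (simp add: pre_def)
 moreover have "sm ?o t = sm (For 21 2 ?i) u" using r t(2) by (simp add: u_def)
 ultimately show "listed (pre (Suc a)) (inc 20 (sm ?o t))" using r by (simp add: u_def listed_def)
 qed auto
 moreover have e: "sm SORT s3 = sm (For 20 3 ?o) s" unfolding SORT_def sm.simps(3) by (simp add: s_def R)
 ultimately have l: "listed os (sm SORT s3)" using preN R by (simp add: s_def)
 show "regs (sm SORT s3)" by (rule regs_cong[OF s3_ok(1)], rule frame) (auto simp: SORT_def)
 show "items_at (sm SORT s3)" using l s3_ok(2) by (auto simp: items_at_def listed_def PW_def)
 show "j < n ==> snd (sm SORT s3) (A + 2*n + j) = os ! j" using l height_order(3)[OF v] by (simp add: listed_def os_def n_def)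
qed

text \<open>\<open>ready t\<close>: everything below the digits is as after sorting, apart from the output buffer.\<close>

definition ready :: "st => bool" where "ready t <-> regs t & items_at t & (ALL j<n. snd t (A + 2*n + j) = os ! j)"

lemma ready_cong:
 assumes "ready s" "!!x. x : FX ==> fst t x = fst s x" "!!y. y < A + 3*n | PW <= y & y < DG ==> snd t y = snd s y" shows "ready t"
 using assms regs_cong[of s t] unfolding ready_def items_at_def DG_def by auto

lemma os: "length os = n" "set os = {..<n}" "distinct os" "sorted_wrt (%i j. ht rs j <= ht rs i) os"
 using height_order[OF v] by (simp_all add: os_def n_def)

lemma item:
 assumes "ready t" "fst t 31 < n" shows "sm ITEM t = put 33 (ht rs (fst t 31)) (put 32 (wd rs (fst t 31)) t)"
 using assms by (simp add: ITEM_def ready_def regs_def items_at_def put_def)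

abbreviation gd :: "nat => nat => bool" where "gd k == gdr (drop (n - k) os)"

text \<open>Row \<open>k\<close> of the table tells which states admit a packing of the last \<open>k\<close> items.\<close>

definition rows :: "nat => st => bool" where "rows k t <-> (ALL l<=k. ALL c<M. snd t (TB + l * M + c) ~= 0 <-> gd l c)"

lemma search_step:
 assumes rd: "ready t" and t: "fst t 35 < M" "fst t 31 < n" "fst t 32 = wd rs (fst t 31)" "fst t 33 = ht rs (fst t 31)"
 and rw: "fst t 17 = TB + l * M" "!!c. c < M ==> snd t (TB + l * M + c) ~= 0 <-> gdr xs c"
 defines "u == sm SEARCH t" shows "fst u 36 ~= 0 <-> gdr (fst t 31 # xs) (fst t 35)"
 "fst u 36 ~= 0 ==> EX b<K. opt B (fst t 32) (fst t 33) (fst t 35) b (fst u 37) (fst u 38) (fst u 39) & fst u 37 < M & gdr xs (fst u 37)"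
 "y < DG | TB <= y ==> snd u y = snd t y"
proof -
 have e: "env K B PW DG t" using rd regs_env by (simp add: ready_def)
 have c: "fst t 35 < B ^ (6*K+1)" using t(1) by (simp add: M_def D_def)
 have r: "DG + (6*K+1) <= fst t 17" using rw(1) by (simp add: TB_def D_def)
 note S = search[OF e c r, folded u_def]
 have lt: "c' < M" if "opt B w h (fst t 35) b c' x y" "b < K" for w h b c' x y using opt_less[OF that(1) c B0 that(2)] by (simp add: M_def D_def)
 show "fst u 36 ~= 0 <-> gdr (fst t 31 # xs) (fst t 35)" unfolding S(1) good.simps rw(1) using rw(2) lt t(3,4) by metis
 show "fst u 36 ~= 0 ==> EX b<K. opt B (fst t 32) (fst t 33) (fst t 35) b (fst u 37) (fst u 38) (fst u 39) & fst u 37 < M & gdr xs (fst u 37)"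
 using S(2) rw lt by metis
 show "y < DG | TB <= y ==> snd u y = snd t y" using S(3) unfolding TB_def D_def by blast
qed

end

section \<open>Correctness: table, choice of the start state and output\<close>

context run_main
begin

lemma ready_put: "ready s ==> x ~: FX ==> ready (put x k s)" by (rule ready_cong) auto

lemma drop_gd: "i < n ==> drop (n - Suc i) os = os ! (n - Suc i) # drop (n - i) os"
 using Cons_nth_drop_Suc[of "n - Suc i" os] os(1) by (simp add: Suc_diff_Suc)

lemma ready0: "ready (sm SORT s3)" using sort by (simp add: ready_def)

text \<open>Row 0 is constantly 1, and each further row results from the previous one by a search
  for every state; items enter from the end of the order.\<close>

lemma table:
 defines "t == sm TABLE (sm SORT s3)" shows "ready t" "rows n t" "fst t 17 = TB + n * M"
proof -
 let ?z = "Wr (Ad (V 16) (V 20)) (N 1)" and ?s = "sm SORT s3"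
 have R: "fst ?s 6 = M" "fst ?s 16 = TB" "fst ?s 2 = n" using ready0 by (simp_all add: ready_def regs_def)
 define I where "I i t <-> (ALL j<i. snd t (TB + j) = 1) & (ALL y<TB. snd t y = snd ?s y)" for i and t :: st
 have "I (fst ?s 6) (sm (For 20 6 ?z) ?s)"
 proof (rule For_inv)
 show "I 0 (put 20 0 ?s)" by (simp add: I_def)
 fix i t assume t: "I i t" "fst t 20 = i" and fr: "!!x. x ~: asg ?z ==> x ~= 20 ==> fst t x = fst ?s x"
 show "I (Suc i) (inc 20 (sm ?z t))" using t fr[of 16] R by (auto simp: I_def less_Suc_eq)
 qed auto
 hence I: "I M (sm (For 20 6 ?z) ?s)" using R by simp
 define u where "u = sm (17 ::= V 16) (sm (For 20 6 ?z) ?s)"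
 have ur: "fst u x = fst ?s x" if "x ~: {17, 20}" for x unfolding u_def using that frame[of x "For 20 6 ?z" ?s] by simp
 have uh: "snd u = snd (sm (For 20 6 ?z) ?s)" by (simp add: u_def)
 have u17: "fst u 17 = TB" using frame[of 16 "For 20 6 ?z" ?s] R by (simp add: u_def)
 have ru: "ready u" by (rule ready_cong[OF ready0]) (use I in "auto simp: ur uh I_def TB_def DG_def PW_def")
 have w0: "rows 0 u" using I by (simp add: rows_def uh I_def os(1))
 let ?b = "31 ::= Rd (Mi (Ad (V 12) (V 2)) (Ad (V 30) (N 1))) ;; ITEM ;; For 34 6 ROW ;; 17 ::= Ad (V 17) (V 6)"
 define J where "J i t <-> ready t & rows i t & fst t 17 = TB + i * M" for i and t :: st
 have aR: "asg ROW = {35, 40, 41, 42, 43, 44, 19, 36, 45, 46, 50, 51, 52, 53, 54, 55, 56, 57, 47, 48, 49, 37, 38, 39}" by (auto simp: ROW_def asgs)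
 have "J (fst u 2) (sm (For 30 2 ?b) u)"
 proof (rule For_inv)
 show "J 0 (put 30 0 u)" using ready_put[OF ru, of 30 0] w0 u17 by (simp add: J_def rows_def)
 fix i t assume i: "i < fst u 2" and t: "J i t" "fst t 30 = i"
 have iN: "i < n" using i ur[of 2] R by simp
 have rt: "ready t" "rows i t" "fst t 17 = TB + i * M" "fst t 2 = n" "fst t 12 = A + 2*n" "fst t 6 = M" using t(1) by (auto simp: J_def ready_def regs_def)
 define x where "x = os ! (n - Suc i)"
 have x: "x < n" using os(1,2) iN nth_mem[of "n - Suc i" os] by (auto simp: x_def)
 have ox: "snd t (A + 2*n + n - Suc i) = x"
 proof -
 have e: "A + 2*n + n - Suc i = A + 2*n + (n - Suc i)" using iN by simp
 have "n - Suc i < n" using iN by simp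
 thus ?thesis unfolding e x_def using rt(1) unfolding ready_def by blast
 qed
 define t1 where "t1 = put 33 (ht rs x) (put 32 (wd rs x) (put 31 x t))"
 have r1: "ready (put 31 x t)" by (rule ready_cong[OF rt(1)]) auto
 have e1: "sm ITEM (sm (31 ::= Rd (Mi (Ad (V 12) (V 2)) (Ad (V 30) (N 1)))) t) = t1" using item[OF r1] x ox t(2) rt by (simp add: t1_def)
 have rt1: "ready t1" by (rule ready_cong[OF rt(1)]) (auto simp: t1_def)
 define L where "L c t' <-> ready t' & rows i t' & (ALL c'<c. snd t' (TB + Suc i * M + c') ~= 0 <-> gd (Suc i) c')" for c and t' :: st
 have "L (fst t1 6) (sm (For 34 6 ROW) t1)"
 proof (rule For_inv)
 show "L 0 (put 34 0 t1)" using ready_put[OF rt1, of 34 0] rt(2) by (simp add: L_def rows_def t1_def)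
 fix c t' assume c: "c < fst t1 6" and t': "L c t'" "fst t' 34 = c" and fr: "!!x. x ~: asg ROW ==> x ~= 34 ==> fst t' x = fst t1 x"
 have cM: "c < M" using c rt by (simp add: t1_def)
 have r': "fst t' 17 = TB + i * M" "fst t' 31 = x" "fst t' 32 = wd rs x" "fst t' 33 = ht rs x" "fst t' 6 = M"
 using fr[of 17] fr[of 31] fr[of 32] fr[of 33] fr[of 6] rt by (simp_all add: aR t1_def)
 define v where "v = put 35 c t'"
 define w where "w = sm SEARCH v"
 have rv: "ready v" by (rule ready_cong[of t']) (use t' in "auto simp: v_def L_def")
 have dr: "gdr (x # drop (n - i) os) = gd (Suc i)" unfolding x_def drop_gd[OF iN] ..
 have S: "fst w 36 ~= 0 <-> gd (Suc i) c" "!!y. y < DG | TB <= y ==> snd w y = snd v y"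
 using search_step[OF rv, of i "drop (n - i) os"] r' t'(1) x cM unfolding w_def[symmetric] dr[symmetric] by (auto simp: v_def L_def rows_def)
 have wr: "fst w x = fst v x" if "x ~: asg SEARCH" for x unfolding w_def using that by (rule frame)
 have e: "sm ROW t' = (fst w, (snd w)(TB + Suc i * M + c := fst w 36))"
 unfolding ROW_def sm.simps(3) using t'(2) r' wr[of 17] wr[of 6] wr[of 34] by (simp add: v_def[symmetric] w_def[symmetric] asgs) (simp add: v_def algebra_simps)
 have far: "l * M + c' < Suc i * M + c" if "l <= i" "c' < M" for l c'
 proof -
 have "Suc l * M <= Suc i * M" using that by (intro mult_le_mono1) simp
 thus ?thesis using that unfolding mult_Suc by linarith
 qed
 have "ready (inc 34 (sm ROW t'))"
 proof (rule ready_cong[OF rv])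
 show "!!x. x : FX ==> fst (inc 34 (sm ROW t')) x = fst v x" unfolding e using wr by (auto simp: asgs)
 show "!!y. y < A + 3*n | PW <= y & y < DG ==> snd (inc 34 (sm ROW t')) y = snd v y" unfolding e using S(2) by (auto simp: TB_def DG_def PW_def)
 qed
 moreover have "rows i (inc 34 (sm ROW t'))" unfolding rows_def e
 proof (intro allI impI)
 fix l c' assume l: "l <= i" "c' < M"
 have "snd (inc 34 (fst w, (snd w)(TB + Suc i * M + c := fst w 36))) (TB + l * M + c') = snd t' (TB + l * M + c')"
 using far[OF l] S(2)[of "TB + l * M + c'"] by (simp add: v_def)
 thus "snd (inc 34 (fst w, (snd w)(TB + Suc i * M + c := fst w 36))) (TB + l * M + c') ~= 0 <-> gd l c'"
 using t'(1) l by (simp add: L_def rows_def)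
 qed
 ultimately show "L (Suc c) (inc 34 (sm ROW t'))" using t'(1) S unfolding L_def e by (auto simp: less_Suc_eq v_def)
 qed (auto simp: aR)
 hence L: "L M (sm (For 34 6 ROW) t1)" using rt by (simp add: t1_def)
 define t2 where "t2 = sm (For 34 6 ROW) t1"
 have t2r: "fst t2 17 = TB + i * M" "fst t2 6 = M" using frame[of 17 "For 34 6 ROW" t1] frame[of 6 "For 34 6 ROW" t1] rt
 by (simp_all add: t2_def aR t1_def)
 have e: "sm ?b t = put 17 (TB + Suc i * M) t2" unfolding sm.simps(3) e1 t2_def[symmetric] using t2r by (simp add: algebra_simps)
 have "rows (Suc i) t2" using L unfolding L_def t2_def[symmetric] rows_def by (metis le_Suc_eq)
 moreover have "ready (inc 30 (put 17 (TB + Suc i * M) t2))" by (rule ready_cong[of t2]) (use L in "auto simp: L_def t2_def")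
 ultimately show "J (Suc i) (inc 30 (sm ?b t))" unfolding e J_def by (simp add: rows_def)
 qed (auto simp: aR ITEM_def)
 moreover have "t = sm (For 30 2 ?b) u" unfolding t_def TABLE_def u_def by simp
 ultimately have "J n t" using ur[of 2] R by simp
 thus "ready t" "rows n t" "fst t 17 = TB + n * M" by (auto simp: J_def)
qed

definition ok :: "nat => bool" where "ok c <-> c < M & start K B (min W (n * NN)) c & gdr os c"

lemma pick:
 assumes ex: "ok c0"
 defines "t == sm (For 30 6 PICK) (sm TABLE (sm SORT s3))" shows "ready t" "rows n t" "fst t 17 = TB + n * M" "ok (fst t 18)" "fst t 18 <= c0"
proof -
 let ?s = "sm TABLE (sm SORT s3)"
 \<comment> \<open>After \<open>i\<close> rounds the states from \<open>M - i\<close> on have been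
   tried; if one of them is suitable, register 18 holds the least.\<close>
 define I where "I i t <-> ready t & rows n t & fst t 17 = TB + n * M &
 ((EX c. M <= c + i & ok c) --> ok (fst t 18) & (ALL c. M <= c + i & ok c --> fst t 18 <= c))" for i and t :: st
 have ag: "asg PICK = {35, 40, 41, 42, 43, 44, 36, 47, 45, 46, 50, 51, 52, 53, 54, 55, 56, 57, 19, 18}" by (auto simp: PICK_def asgs asg_search)
 have R: "fst ?s 6 = M" using table(1) by (simp add: ready_def regs_def)
 have "I (fst ?s 6) (sm (For 30 6 PICK) ?s)"
 proof (rule For_inv)
 show "I 0 (put 30 0 ?s)" using table ready_put[OF table(1), of 30 0] by (auto simp: I_def rows_def ok_def)
 fix i t assume i: "i < fst ?s 6" and t: "I i t" "fst t 30 = i"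
 define c where "c = M - Suc i"
 have c: "c < M" using i R by (simp add: c_def)
 have cs: "M <= d + Suc i <-> M <= d + i | d = c" for d using i R by (auto simp: c_def)
 define v where "v = put 35 c t"
 define u where "u = sm UNPACK v"
 define w where "w = sm CHECK u"
 have t1: "ready t" "rows n t" "fst t 17 = TB + n * M" using t(1) by (auto simp: I_def)
 have rv: "ready v" by (rule ready_cong[OF t1(1)]) (auto simp: v_def)
 have e: "env K B PW DG v" using rv regs_env by (simp add: ready_def)
 have vc: "fst v 35 = c" "c < B ^ (6*K+1)" using c by (simp_all add: v_def M_def D_def)
 have U: "ALL j<6*K+1. snd u (DG + j) = dig B c j" "!!y. y < DG | TB <= y ==> snd u y = snd t y"
 using unpack[OF e] vc unfolding u_def TB_def D_def by (auto simp: v_def)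
 have ur: "fst u x = fst v x" if "x ~: asg UNPACK" for x unfolding u_def using that by (rule frame)
 have wr: "fst w x = fst u x" if "x ~: asg CHECK" for x unfolding w_def using that by (rule frame)
 have rg: "fst u 8 = K" "fst u 9 = 6*K+1" "fst u 7 = min W (n * NN)" "fst u 14 = PW" "fst u 15 = DG"
 using rv ur by (simp_all add: asg_search ready_def regs_def D_def)
 have "loaded K B PW DG c u" using U e rg by (auto simp: loaded_def env_def DG_def D_def v_def)
 note C = check[OF this rg(1,2), unfolded rg(3), folded w_def]
 have keep: "fst w x = fst t x" if "x : {2, 3, 5, 6, 7, 8, 9, 10, 11, 12, 13, 14, 15, 16, 17, 18, 30}" for x
 using that wr[of x] ur[of x] by (auto simp: asgs asg_search v_def)
 have w35: "fst w 35 = c" using wr[of 35] ur[of 35] by (simp add: asgs asg_search v_def)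
 have row: "snd w (TB + n * M + c) ~= 0 <-> gdr os c" using t1(2) c U(2) by (simp add: C(2) rows_def)
 have st: "sm CHECK (sm UNPACK (sm (35 ::= Mi (V 6) (Ad (V 30) (N 1))) t)) = w"
 using t1(1) t(2) by (simp add: w_def u_def v_def c_def ready_def regs_def)
 have s18: "fst (sm PICK t) 18 = (if ok c then c else fst t 18)" "snd (sm PICK t) = snd w" "!!x. x ~: {18, 19} ==> fst (sm PICK t) x = fst w x"
 unfolding PICK_def sm.simps(3) st using C(1) row c keep[of 17] keep[of 18] w35 t1(3) by (auto simp: ok_def)
 let ?t = "inc 30 (sm PICK t)"
 have "ready ?t"
 proof (rule ready_cong[OF t1(1)])
 fix z :: nat assume "z : FX"
 hence "z ~: {18, 19}" "z ~= 30" "z : {2, 3, 5, 6, 7, 8, 9, 10, 11, 12, 13, 14, 15, 16, 17, 18, 30}" by auto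
 thus "fst ?t z = fst t z" using s18(3)[of z] keep[of z] by simp
 next
 fix y assume "y < A + 3*n | PW <= y & y < DG"
 hence "y < DG" by (auto simp: DG_def PW_def)
 thus "snd ?t y = snd t y" using U(2)[of y] by (simp add: s18(2) C(2))
 qed
 moreover have "rows n ?t" using t1(2) U(2) s18(2) C(2) by (simp add: rows_def)
 moreover have "fst ?t 17 = TB + n * M" using s18(3)[of 17] keep[of 17] t1(3) by simp
 moreover have "(EX d. M <= d + Suc i & ok d) --> ok (fst ?t 18) & (ALL d. M <= d + Suc i & ok d --> fst ?t 18 <= d)"
 proof (cases "ok c")
 case True
 have "c <= d" if "M <= d + Suc i" for d using that by (simp add: c_def)
 thus ?thesis using True s18(1) by simp
 next
 case False
 have "(M <= d + Suc i & ok d) <-> (M <= d + i & ok d)" for d using False cs[of d] by auto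
 thus ?thesis using t(1) s18(1) False by (simp add: I_def)
 qed
 ultimately show "I (Suc i) ?t" unfolding I_def by blast
 qed (auto simp: ag)
 hence I: "I M t" using R by (simp add: t_def)
 thus "ready t" "rows n t" "fst t 17 = TB + n * M" by (auto simp: I_def)
 have "M <= c0 + M" by simp
 thus "ok (fst t 18)" "fst t 18 <= c0" using I ex unfolding I_def by blast+
qed

text \<open>The state reached admits the remaining items, and the positions of the first
  \<open>i\<close> items in the buffer form a packing consistent with it.\<close>

definition placed :: "nat => nat => st => bool" where
 "placed c0 i t <-> ready t & rows n t & fst t 17 = TB + (n - i) * M & gdr (drop i os) (fst t 35) &
 (EX px py hh. pck c0 (set (take i os)) hh (fst t 35) px py & (ALL j:set (drop i os). ht rs j <= hh) &
 (ALL j:set (take i os). snd t (OX j) = px j & snd t (OY j) = py j))"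

lemma place:
 assumes s: "ready s" "rows n s" "fst s 17 = TB + n * M" "fst s 35 = c0" and c0: "ok c0" shows "placed c0 n (sm (For 30 2 PLACE) s)"
proof -
 have ag: "asg PLACE = {17, 31, 32, 33, 35} Un asg SEARCH" by (auto simp: PLACE_def asgs)
 have ms: "c < M <-> c < B ^ (6*K+1)" for c by (simp add: M_def D_def)
 have st: "start K B (min W (n * NN)) c0" "c0 < B ^ (6*K+1)" "gdr os c0" using c0 ms by (auto simp: ok_def)
 have "placed c0 (fst s 2) (sm (For 30 2 PLACE) s)"
 proof (rule For_inv)
 have "ALL j:set os. ht rs j <= NN" using os(2) Nmax_ge(2)[of _ rs] by (auto simp: n_def NN_def)
 thus "placed c0 0 (put 30 0 s)" using packed_start[OF st(1,2)] s st(3) ready_put[OF s(1), of 30 0] unfolding placed_def by (auto simp: rows_def)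
 fix i t assume i: "i < fst s 2" and t: "placed c0 i t" "fst t 30 = i"
 have iN: "i < n" using i s(1) by (simp add: ready_def regs_def)
 obtain px py hh where P: "pck c0 (set (take i os)) hh (fst t 35) px py" "ALL j:set (drop i os). ht rs j <= hh"
 "ALL j:set (take i os). snd t (OX j) = px j & snd t (OY j) = py j" using t(1) unfolding placed_def by blast
 have t1: "ready t" "rows n t" "fst t 17 = TB + (n - i) * M" "gdr (drop i os) (fst t 35)" using t(1) by (auto simp: placed_def)
 have c: "fst t 35 < M" using P(1) ms by (simp add: packed_def)
 define x where "x = os ! i"
 have x: "x < n" using os(1,2) iN nth_mem[of i os] by (auto simp: x_def)
 have dx: "drop i os = x # drop (Suc i) os" using Cons_nth_drop_Suc[of i os] iN os(1) by (simp add: x_def)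
 have tx: "take (Suc i) os = take i os @ [x]" using iN os(1) by (simp add: x_def take_Suc_conv_app_nth)
 have xn: "x ~: set (take i os)" using os(3) tx by (metis distinct_take distinct_append distinct_singleton disjoint_insert(1) list.simps(15) not_distinct_conv_prefix)
 have srt: "ht rs j <= ht rs x" if "j : set (drop (Suc i) os)" for j
 using sorted_wrt_append[of _ "take i os" "drop i os"] os(4) that dx by (metis append_take_drop_id sorted_wrt.simps(2))
 define v where "v = put 33 (ht rs x) (put 32 (wd rs x) (put 31 x (put 17 (TB + (n - Suc i) * M) t)))"
 define u where "u = sm SEARCH v"
 have rr: "TB + (n - i) * M - M = TB + (n - Suc i) * M"
 proof -
 have "n - i = Suc (n - Suc i)" using iN by simp
 thus ?thesis by simp
 qed
 have r1: "ready (put 31 x (put 17 (TB + (n - Suc i) * M) t))" by (rule ready_cong[OF t1(1)]) auto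
 have e1: "sm ITEM (sm (31 ::= Rd (Ad (V 12) (V 30))) (sm (17 ::= Mi (V 17) (V 6)) t)) = v"
 using item[OF r1] x t(2) t1 iN rr by (simp add: v_def ready_def regs_def x_def)
 have rv: "ready v" by (rule ready_cong[OF t1(1)]) (auto simp: v_def)
 have dd: "drop (n - (n - Suc i)) os = drop (Suc i) os" using iN by simp
 have vr: "fst v 35 = fst t 35" "fst v 31 = x" "fst v 32 = wd rs x" "fst v 33 = ht rs x" "fst v 17 = TB + (n - Suc i) * M" by (simp_all add: v_def)
 have rw: "snd v (TB + (n - Suc i) * M + c) ~= 0 <-> gdr (drop (Suc i) os) c" if "c < M" for c using t1(2) that dd unfolding rows_def v_def by simp
 note S = search_step[OF rv, of "n - Suc i" "drop (Suc i) os", unfolded vr, folded u_def]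
 \<comment> \<open>The remaining items can be packed from the current state, so the table makes the
   search succeed.\<close>
 have g36: "fst u 36 ~= 0" using S(1) t1(4) dx c x rw by simp
 obtain b where b: "b < K" "opt B (wd rs x) (ht rs x) (fst t 35) b (fst u 37) (fst u 38) (fst u 39)" "fst u 37 < M"
 "gdr (drop (Suc i) os) (fst u 37)" using S(2) g36 c x rw by blast
 have wx: "0 < wd rs x" using v x by (simp add: valid_instance_def n_def)
 have hx: "ht rs x <= hh" using P(2) dx by simp
 note P' = packed_step[OF st(1) P(1) B0 b(1,2) xn hx wx le_refl]
 have ur: "fst u z = fst v z" if "z ~: asg SEARCH" for z unfolding u_def using that by (rule frame)
 have r13: "fst v 13 = A + 3*n" using rv by (simp add: ready_def regs_def)
 have u13: "fst u 13 = A + 3*n" and u31: "fst u 31 = x" using ur[of 13] ur[of 31] r13 vr(2) by (simp_all add: asgs)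
 have ad: "A + 3*n + 2 + (x + x) = OX x" "A + 3*n + 3 + (x + x) = OY x" by simp_all
 have e: "sm PLACE t = put 35 (fst u 37) (fst u, (snd u)(OX x := fst u 38, OY x := fst u 39))"
 unfolding PLACE_def sm.simps(3) e1 u_def[symmetric] by (simp only: sm.simps ev.simps u13 u31 ad fst_conv snd_conv)
 have ob: "OY j < PW" if "j < n" for j using that by (simp add: PW_def)
 have un: "snd u y = snd t y" if "y < DG | TB <= y" for y using S(3) that c x rw by (simp add: v_def)
 have far: "TB + z ~= OY x" "TB + z ~= OX x" for z using ob[OF x] by (simp_all add: TB_def DG_def)
 let ?t = "inc 30 (sm PLACE t)"
 have "ready ?t"
 proof (rule ready_cong[OF rv])
 show "!!z. z : FX ==> fst ?t z = fst v z" unfolding e using ur by (auto simp: asgs)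
 fix y assume y: "y < A + 3*n | PW <= y & y < DG"
 thus "snd ?t y = snd v y" unfolding e using un[of y] ob[OF x] by (auto simp: v_def DG_def PW_def)
 qed
 moreover have "rows n ?t" using t1(2) un far unfolding e rows_def by (simp add: add.assoc)
 moreover have "fst ?t 17 = TB + (n - Suc i) * M" unfolding e using ur[of 17] vr by (simp add: asgs)
 moreover have "fst ?t 35 = fst u 37" unfolding e by simp
 moreover have "EX px py hh. pck c0 (set (take (Suc i) os)) hh (fst u 37) px py & (ALL j:set (drop (Suc i) os). ht rs j <= hh) &
 (ALL j:set (take (Suc i) os). snd ?t (OX j) = px j & snd ?t (OY j) = py j)"
 proof (intro exI conjI)
 show "pck c0 (set (take (Suc i) os)) (ht rs x) (fst u 37) (px(x := fst u 38)) (py(x := fst u 39))" using P' by (simp add: tx)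
 show "ALL j:set (drop (Suc i) os). ht rs j <= ht rs x" using srt by blast
 show "ALL j:set (take (Suc i) os). snd ?t (OX j) = (px(x := fst u 38)) j &
 snd ?t (OY j) = (py(x := fst u 39)) j"
 proof
 fix j assume j: "j : set (take (Suc i) os)"
 show "snd ?t (OX j) = (px(x := fst u 38)) j & snd ?t (OY j) = (py(x := fst u 39)) j"
 proof (cases "j = x")
 case True
 thus ?thesis unfolding e by simp
 next
 case False
 hence ji: "j : set (take i os)" using j tx by simp
 hence jn: "j < n" using os(2) set_take_subset[of i os] by auto
 have par: "2 + 2*j ~= 3 + 2*x" "3 + 2*j ~= 2 + 2*x" by presburger+
 have "OX j < DG" "OY j < DG" using ob[OF jn] by (simp_all add: DG_def)
 thus ?thesis unfolding e using un P(3) ji False par by (simp del: One_nat_def)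
 qed
 qed
 qed
 ultimately show "placed c0 (Suc i) ?t" unfolding placed_def using b(4) by simp
 qed (auto simp: ag asgs)
 thus ?thesis using s(1) by (simp add: ready_def regs_def)
qed

text \<open>The targets lie below \<open>A\<close> and the sources above it, so no source is
  overwritten.\<close>

lemma out_loop:
 assumes "ready f"
 defines "t == sm (For 30 2 OUT) f"
 shows "fst t 13 = A + 3*n" "j < n ==> k < 2 ==> 128 <= 2 + 2*j + k ==> snd t (2 + 2*j + k - 128) = snd f (A + 3*n + (2 + 2*j + k))"
 "A <= y ==> snd t y = snd f y"
proof -
 have R: "fst f 13 = A + 3*n" "fst f 2 = n" using assms by (simp_all add: ready_def regs_def)
 define I where "I i t <-> (ALL j<i. ALL k<2. 128 <= 2 + 2*j + k --> snd t (2 + 2*j + k - 128) = snd f (A + 3*n + (2 + 2*j + k))) & (ALL y>=A. snd t y = snd f y)" for i and t :: st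
 have "I (fst f 2) (sm (For 30 2 OUT) f)"
 proof (rule For_inv)
 show "I 0 (put 30 0 f)" by (simp add: I_def)
 fix i t assume i: "i < fst f 2" and t: "I i t" "fst t 30 = i" and fr: "!!x. x ~: asg OUT ==> x ~= 30 ==> fst t x = fst f x"
 have iN: "i < n" using i R by simp
 define a where "a = 2 + (i + i)"
 have aA: "Suc a - 128 < A" using iN by (simp add: a_def A_def)
 have r: "fst t 13 = A + 3*n" using fr[of 13] R by (simp add: asgs)
 have hy: "snd t (A + 3*n + z) = snd f (A + 3*n + z)" for z using t(1) by (simp add: I_def)
 have ev: "128 <= a <-> 128 <= Suc a" unfolding a_def by presburger
 show "I (Suc i) (inc 30 (sm OUT t))"
 proof (cases "128 <= a")
 case False
 hence "snd (sm OUT t) = snd t" by (simp add: OUT_def t(2) a_def)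
 moreover have "~ 128 <= 2 + 2*i + k" if "k < 2" for k using False ev that unfolding a_def by presburger
 ultimately show ?thesis using t(1) by (auto simp: I_def less_Suc_eq)
 next
 case True
 have n1: "A + 3*n + Suc a ~= a - 128" using aA by simp
 have e: "snd (sm OUT t) = (snd t)(a - 128 := snd f (A + 3*n + a), Suc a - 128 := snd f (A + 3*n + Suc a))"
 using True hy[of a] hy[of "Suc a"] n1 by (simp add: OUT_def t(2) r a_def)
 have old: "2 + 2*j + k - 128 ~= a - 128 & 2 + 2*j + k - 128 ~= Suc a - 128" if "j < i" "k < 2" "128 <= 2 + 2*j + k" for j k
 using that True unfolding a_def by presburger
 have new: "snd (sm OUT t) (2 + 2*i + k - 128) = snd f (A + 3*n + (2 + 2*i + k))" if "k < 2" for k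
 proof -
 have a: "2 + 2*i + k = a + k" "k = 0 | k = 1" using that by (auto simp: a_def)
 have "a - 128 ~= Suc a - 128" using True by simp
 thus ?thesis unfolding a(1) e using a(2) by auto
 qed
 have "snd (sm OUT t) y = snd f y" if "A <= y" for y using t(1) that aA unfolding e I_def by auto
 moreover have "snd (sm OUT t) (2 + 2*j + k - 128) = snd f (A + 3*n + (2 + 2*j + k))" if "j < i" "k < 2" "128 <= 2 + 2*j + k" for j k
 using t(1) old[OF that] that unfolding e I_def by simp
 ultimately show ?thesis using new unfolding I_def inc_simps less_Suc_eq by blast
 qed
 qed (auto simp: asgs)
 hence I: "I n t" using R by (simp add: t_def)
 show "j < n ==> k < 2 ==> 128 <= 2 + 2*j + k ==> snd t (2 + 2*j + k - 128) = snd f (A + 3*n + (2 + 2*j + k))" "A <= y ==> snd t y = snd f y"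
 using I unfolding I_def by blast+
 show "fst t 13 = A + 3*n" using frame[of 13 "For 30 2 OUT" f] R by (simp add: t_def asgs)
qed

section \<open>The whole run and its length\<close>

definition bound :: nat where "bound = 128 * n + NN + B + M + D"

lemma bd_MAIN: "bd bound (MAIN K) s0"
proof -
 have "bd bound (S1 K) s0" by (rule loops_over_bd[OF loops(1)]) (use s0(1) in "simp add: bound_def")
 moreover have "bd bound S2 s1" by (rule loops_over_bd[OF loops(2)]) (simp add: s1 bound_def)
 moreover have "bd bound S3 s2" by (rule loops_over_bd[OF loops(3)]) (use s2(6)[of 9] in "simp add: s2 s1 bound_def")
 moreover have "bd bound S4 s3"
 proof (rule loops_over_bd[OF loops(4)])
 have "K <= D" by (simp add: D_def)
 thus "ALL x:{2, 3, 5, 6, 8, 9}. fst s3 x <= bound" using s3_ok(1) by (simp add: regs_def bound_def)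
 qed
 ultimately show ?thesis unfolding MAIN_def bd.simps s1_def[symmetric] s2_def[symmetric] s3_def[symmetric] by blast
qed

theorem main_run:
 assumes ex: "ok c0"
 defines "p == program (MAIN K)" and "m == input_mem W rs"
 shows "EX t <= cost bound (MAIN K) + (1 + length prologue + length epilogue). halted p (run p t (0, m)) &
 feasible_packing W rs (outp p t m) &
 packing_height rs (outp p t m) <= dig B c0 (6*K)"
proof -
 define t1 where "t1 = sm (For 30 6 PICK) (sm TABLE (sm SORT s3))"
 define c where "c = fst t1 18"
 define t2 where "t2 = sm (For 30 2 PLACE) (put 35 c t1)"
 define t3 where "t3 = sm (For 30 2 OUT) t2"
 note pk = pick[OF ex, folded t1_def c_def]
 have "ready (put 35 c t1)" by (rule ready_cong[OF pk(1)]) auto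
 hence pl: "placed c n t2" unfolding t2_def by (rule place) (use pk in "auto simp: rows_def")
 have r2: "ready t2" using pl by (simp add: placed_def)
 obtain px py hh where P: "pck c {..<n} hh (fst t2 35) px py"
 "ALL j<n. snd t2 (OX j) = px j & snd t2 (OY j) = py j" using pl os(1,2) unfolding placed_def by auto
 note o = out_loop[OF r2, folded t3_def]
 have f: "sm (MAIN K) s0 = put 0 (A + 3*n + 128) t3"
 unfolding MAIN_def S4_def sm.simps(3) s1_def[symmetric] s2_def[symmetric] s3_def[symmetric] t1_def[symmetric]
 using o(1) by (simp add: c_def[symmetric] t2_def[symmetric] t3_def[symmetric] del: sm.simps(5))
 have n1: "m 1 ~= 0" using n0 by (simp add: m_def input_mem_def n_def)
 have bd: "bd bound (MAIN K) (after m)" using bd_MAIN by (simp add: s0_def m_def)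
 have f': "sm (MAIN K) (after m) = put 0 (A + 3*n + 128) t3" using f by (simp add: s0_def m_def)
 have r0: "128 <= fst (sm (MAIN K) (after m)) 0" unfolding f' by simp
 let ?q = "put 0 (A + 3*n + 128) t3"
 obtain t where t: "t <= cost bound (MAIN K) + (1 + length prologue + length epilogue)" "halted p (run p t (0, m))"
 and ta: "ALL a>=2. snd (run p t (0, m)) a = (if a < 128 then snd ?q (fst ?q 0 + a - 128) else snd ?q (a - 128))"
 using machine[OF wf_MAIN n1 bd r0] unfolding f' p_def[symmetric] by blast
 have t3: "snd (run p t (0, m)) a = (if a < 128 then snd t3 (A + 3*n + a) else snd t3 (a - 128))" if "2 <= a" for a
 using ta that by (simp add: add.assoc)
 have cell: "snd (run p t (0, m)) (2 + 2*j + k) = snd t2 (A + 3*n + (2 + 2*j + k))" if "j < n" "k < 2" for j k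
 using t3[of "2 + 2*j + k"] o(2)[OF that] o(3)[of "A + 3*n + (2 + 2*j + k)"] by simp
 have dec: "outp p t m j = (px j, py j)" if "j < n" for j
 using cell[OF that, of 0] cell[OF that, of 1] P(2) that by (simp add: decode_packing_def add.commute[of _ "2 * j"] eval_nat_numeral)
 have st: "start K B (min W (n * NN)) c" using pk(4) by (simp add: ok_def)
 \<comment> \<open>The height is the leading digit, so a smaller state cannot have a larger
   height.\<close>
 have top: "dig B c (6*K) <= dig B c0 (6*K)"
 proof -
 have "d div B ^ (6*K) < B" if "d < M" for d using that B0 by (simp add: M_def D_def div_less_iff_less_mult)
 hence "c div B ^ (6*K) < B" "c0 div B ^ (6*K) < B" using pk(4) ex by (auto simp: ok_def)
 thus ?thesis using div_le_mono[OF pk(5)] by (simp add: dig_def)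
 qed
 have "px i + wd rs i <= W" "py i + ht rs i <= dig B c0 (6*K)" if "i < n" for i using packed_final[OF st P(1), of i] that top by auto
 moreover have "separated (px i) (py i) (wd rs i) (ht rs i) (px j) (py j) (wd rs j) (ht rs j)" if "i < n" "j < n" "i ~= j" for i j
 using P(1) that unfolding packed_def by auto
 ultimately have "feasible_packing W rs (outp p t m)" "packing_height rs (outp p t m) <= dig B c0 (6*K)"
 unfolding feasible_iff[OF v] packing_height_le n_def[symmetric] by (simp_all add: dec)
 thus ?thesis using t(1,2) by blast
qed

text \<open>The number \<open>M = B ^ D\<close> of states dominates. Its exponent depends on the
  number of boxes alone, hence on the precision only.\<close>

lemma bound_poly: "bound + 1 <= (140 + D + 4 ^ D) * (n * NN + 2) ^ (D + 1)"
proof -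
 define X where "X = n * NN + 2"
 have NN: "0 < NN"
 proof -
 have "0 < wd rs 0" "wd rs 0 <= Nmax rs" using v ne Nmax_ge(1)[of 0 rs] by (auto simp: valid_instance_def)
 thus ?thesis by (simp add: NN_def)
 qed
 have "n * 1 <= n * NN" "1 * NN <= n * NN" using n0 NN by (intro mult_le_mono; simp)+
 hence X: "n <= X" "NN <= X" "B <= 4 * X" "1 <= X" unfolding X_def B_def by (linarith | simp)+
 have "M <= (4 * X) ^ D" unfolding M_def using X(3) by (rule power_mono) simp
 also have "... = 4 ^ D * X ^ D" by (rule power_mult_distrib)
 also have "... <= 4 ^ D * X ^ (D + 1)" using X(4) by (intro mult_le_mono2 power_increasing) auto
 finally have M: "M <= 4 ^ D * X ^ (D + 1)" .
 have p: "X * 1 <= X * X ^ D" using X(4) by (intro mult_le_mono2) simp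
 have "128 * n + NN + B + D + 1 <= 134 * X + D * X" using X mult_le_mono2[OF X(4), of D] by linarith
 also have "... <= (140 + D) * X" by (simp add: distrib_right)
 also have "... <= (140 + D) * X ^ (D + 1)" using p by (intro mult_le_mono2) simp
 finally show ?thesis using M unfolding bound_def X_def[symmetric] distrib_right by linarith
qed

end

theorem approximation_scheme:
 fixes e :: real
 assumes e: "0 < e" "e <= 1/9"
 defines "p == program (MAIN (total_boxes e))"
 shows "EX c k. ALL W rs. valid_instance W rs --> (EX t <= c * (length rs * Nmax rs + 2) ^ k. halted p (run p t (0, input_mem W rs)) &
 feasible_packing W rs (outp p t (input_mem W rs)) &
 real (packing_height rs (outp p t (input_mem W rs))) <= (4/3 + 15 * e) * real (OPT W rs))"
proof -
 define K where "K = total_boxes e"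
 define D where "D = 6 * K + 1"
 define L where "L = 1 + length prologue + length epilogue"
 obtain a k where ak: "!!P. cost P (MAIN K) <= a * (P + 1) ^ k" using cost_poly by blast
 let ?c = "a * (140 + D + 4 ^ D) ^ k + L" and ?k = "(D + 1) * k"
 have L1: "1 <= L" by (simp add: L_def)
 show ?thesis
 proof (rule exI[of _ ?c], rule exI[of _ ?k], intro allI impI)
 fix W rs assume v: "valid_instance W rs"
 let ?X = "length rs * Nmax rs + 2"
 have X: "1 <= ?X ^ ?k" by simp
 show "EX t <= ?c * ?X ^ ?k. halted p (run p t (0, input_mem W rs)) & feasible_packing W rs (outp p t (input_mem W rs)) &
 real (packing_height rs (outp p t (input_mem W rs))) <= (4/3 + 15 * e) * real (OPT W rs)"
 proof (cases "rs = []")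
 case True
 have "halted p (run p 1 (0, input_mem W rs))" unfolding p_def by (rule machine_empty[THEN conjunct1]) (simp add: True input_mem_def)
 moreover have "1 * 1 <= ?c * ?X ^ ?k" using L1 X by (intro mult_le_mono) linarith+
 moreover have "packing_height rs q = 0" "feasible_packing W rs q" for q using True by (simp_all add: packing_height_def feasible_packing_def)
 ultimately show ?thesis using e by (intro exI[of _ 1]) auto
 next
 case False
 interpret R: run_main W rs K by unfold_locales (use v False in auto)
 obtain c0 where c0: "R.ok c0" "real (dig R.B c0 (6*K)) <= (4/3 + 15 * e) * real (OPT W rs)"
 using good_start[OF v False e, folded K_def] unfolding R.ok_def R.M_def R.D_def R.B_def R.n_def R.NN_def R.os_def by blast
 obtain t where t: "t <= cost R.bound (MAIN K) + L" "halted p (run p t (0, input_mem W rs))" "feasible_packing W rs (outp p t (input_mem W rs))"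
 "packing_height rs (outp p t (input_mem W rs)) <= dig R.B c0 (6*K)" using R.main_run[OF c0(1)] unfolding p_def K_def[symmetric] L_def by blast
 have b: "R.bound + 1 <= (140 + D + 4 ^ D) * ?X ^ (D + 1)" using R.bound_poly by (simp add: R.D_def D_def R.n_def R.NN_def)
 have "cost R.bound (MAIN K) <= a * (R.bound + 1) ^ k" by (rule ak)
 also have "... <= a * ((140 + D + 4 ^ D) * ?X ^ (D + 1)) ^ k" by (intro mult_le_mono2 power_mono b) simp
 also have "... = a * (140 + D + 4 ^ D) ^ k * ?X ^ ?k" unfolding power_mult_distrib power_mult by (simp only: mult.assoc)
 finally have c1: "cost R.bound (MAIN K) <= a * (140 + D + 4 ^ D) ^ k * ?X ^ ?k" .
 have "L * 1 <= L * ?X ^ ?k" using X by (rule mult_le_mono2)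
 moreover have "?c * ?X ^ ?k = a * (140 + D + 4 ^ D) ^ k * ?X ^ ?k + L * ?X ^ ?k" by (rule distrib_right)
 ultimately have "cost R.bound (MAIN K) + L <= ?c * ?X ^ ?k" using c1 by linarith
 moreover have "real (packing_height rs (outp p t (input_mem W rs))) <= (4/3 + 15 * e) * real (OPT W rs)"
 using t(4) c0(2) by (meson of_nat_mono order_trans)
 ultimately show ?thesis using t by (meson le_trans)
 qed
 qed
qed

theorem theorem1:
  fixes \<epsilon> :: real
  assumes "\<epsilon> > 0"
  shows "\<exists>(prog :: instr list) (c :: nat) (k :: nat).
           \<forall>W rs. valid_instance W rs \<longrightarrow>
             (\<exists>t \<le> c * (length rs * Nmax rs + 2) ^ k.
                halted prog (run prog t (0, input_mem W rs)) \<and>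
                feasible_packing W rs (decode_packing (snd (run prog t (0, input_mem W rs)))) \<and>
                real (packing_height rs (decode_packing (snd (run prog t (0, input_mem W rs)))))
                  \<le> (4/3 + \<epsilon>) * real (OPT W rs))"
proof -
  \<comment> \<open>The 15 is the total of the height budget in \<open>assembly\<close>; the bound
    \<open>1/9\<close> is the one required by \<open>good_start\<close>.\<close>
  define e where "e = min (\<epsilon> / 15) (1 / 9)"
  have e: "0 < e" "e \<le> 1 / 9" "15 * e \<le> \<epsilon>" using assms by (auto simp: e_def)
  have "(4/3 + 15 * e) * real (OPT W rs) \<le> (4/3 + \<epsilon>) * real (OPT W rs)" for W rs using e(3) by (intro mult_right_mono) auto
  then show ?thesis using approximation_scheme[OF e(1,2)] by (meson order_trans)
qed

end
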